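(* Let $0<T_{max}\le+\infty$. Mild solutions of the Navier–Stokes equation and of the Navier–Stokes matrix potential equation are equivalent under the correspondence $u=-\operatorname{div}(M)$, $M=2\nabla_{sym}(-\Delta)^{-1}u$. That is, if $u=-\operatorname{div}(M)$ and $M=2\nabla_{sym}(-\Delta)^{-1}u$, then $M\in C\left([0,T_{max});\dot{\mathcal{H}}^1_{st}\cap\dot{\mathcal{H}}^2_{st}\right)$ is a mild solution of the Navier–Stokes matrix potential equation if and only if $u\in C\left([0,T_{max});\mathbf{H}^1_{df}\right)$ is a mild solution of the Navier–Stokes equation. Explicitly: (i) if $M\in C\left([0,T_{max});\dot{\mathcal{H}}^1_{st}\cap\dot{\mathcal{H}}^2_{st}\right)$ is a mild solution of the matrix potential equation, then $u:=-\operatorname{div}(M)$ is a mild solution of the Navier–Stokes equation in $C\left([0,T_{max});\mathbf{H}^1_{df}\right)$; (ii) if $u\in C\left([0,T_{max});\mathbf{H}^1_{df}\right)$ is a mild solution of the Navier–Stokes equation, then $M:=2\nabla_{sym}(-\Delta)^{-1}u$ is a mild solution of the matrix potential equation in $C\left([0,T_{max});\dot{\mathcal{H}}^1_{st}\cap\dot{\mathcal{H}}^2_{st}\right)$.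
   Context: All functions are real-valued on $\mathbb{R}^3$ (times a time interval). Operators in $x$ are Fourier multipliers with $\hat f(\xi)=\int_{\mathbb{R}^3} e^{-2\pi i x\cdot\xi}f(x)\,dx$: $\partial_j$ has symbol $2\pi i\xi_j$, $(-\Delta)^{s}$ has symbol $(4\pi^2|\xi|^2)^s$, and $e^{t\Delta}$ has symbol $e^{-4\pi^2|\xi|^2t}$. $(\nabla_{sym}u)_{ij}=\frac12(\partial_iu_j+\partial_ju_i)$; $\operatorname{div}(M)_j=\sum_i\partial_iM_{ij}$; $(u\otimes u)_{ij}=u_iu_j$. Norms: $\|f\|_{\dot H^s}^2=\int_{\mathbb{R}^3}(4\pi^2|\xi|^2)^s|\hat f(\xi)|^2\,d\xi$, and $\dot H^s$ is the corresponding homogeneous Sobolev space (closure of $C_c^\infty$); $\dot H^1\cap\dot H^2$ consists of $f\in\dot H^1$ with $\|f\|_{\dot H^2}<\infty$. $\mathbf{H}^1_{df}$ is the space of divergence free vector fields in the inhomogeneous Sobolev space $H^1(\mathbb{R}^3;\mathbb{R}^3)$. $\dot{\mathcal{H}}^s_{st}$ is the space of symmetric-matrix-valued functions of the form $\nabla_{sym}(-\Delta)^{-1/2}w$ with $w\in\dot H^s(\mathbb{R}^3;\mathbb{R}^3)$, $\nabla\cdot w=0$. $\mathcal{L}^2_{st}=\{\nabla_{sym}(-\Delta)^{-1/2}w:w\in L^2(\mathbb{R}^3;\mathbb{R}^3),\ \nabla\cdot(-\Delta)^{-1/2}w=0\}$, and $P_{st}$ is the orthogonal projection of $L^2(\mathbb{R}^3;\mathcal{S}^{3\times3})$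 (with inner product $\int\sum_{i,j}M_{ij}Q_{ij}\,dx$, where $\mathcal{S}^{3\times3}$ denotes the real symmetric matrices) onto $\mathcal{L}^2_{st}$. $P_{df}$ is the Helmholtz projection onto divergence free vector fields, with symbol $I_3-\frac{\xi\otimes\xi}{|\xi|^2}$. $M\in C([0,T_{max});\dot{\mathcal{H}}^1_{st}\cap\dot{\mathcal{H}}^2_{st})$ is a mild solution of the Navier–Stokes matrix potential equation if for all $0<t<T_{max}$, with $M^0=M(\cdot,0)$, $$M(\cdot,t)=e^{t\Delta}M^0+\int_0^te^{(t-\tau)\Delta}P_{st}\big(\operatorname{div}(M)\otimes\operatorname{div}(M)\big)(\cdot,\tau)\,d\tau.$$ $u\in C([0,T_{max});\mathbf{H}^1_{df})$ is a mild solution of the Navier–Stokes equation if for all $0<t<T_{max}$, with $u^0=u(\cdot,0)$, $$u(\cdot,t)=e^{t\Delta}u^0-\int_0^te^{(t-\tau)\Delta}P_{df}\operatorname{div}(u\otimes u)(\cdot,\tau)\,d\tau.$$ *)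

theory Defs
  imports "HOL-Analysis.Analysis"
begin

section \<open>Schwartz functions and test functions on three-dimensional space\<close>

definition partial :: "3 \<Rightarrow> (real^3 \<Rightarrow> 'b::real_normed_vector) \<Rightarrow> real^3 \<Rightarrow> 'b"
  where "partial k f x = frechet_derivative f (at x) (axis k 1)"

text \<open>Differentiability of all iterated partial derivatives is the same as being of class
  \<open>C\<^sup>\<infinity>\<close>, since differentiable functions are continuous.\<close>

definition smooth :: "(real^3 \<Rightarrow> 'b::real_normed_vector) \<Rightarrow> bool"
  where "smooth f \<longleftrightarrow> (\<forall>ks x. foldr partial ks f differentiable (at x))"

definition schwartz :: "(real^3 \<Rightarrow> complex) \<Rightarrow> bool"
  where "schwartz \<phi> \<longleftrightarrow> smooth \<phi> \<and>
    (\<forall>ks (n::nat). bounded (range (\<lambda>x. (1 + norm x) ^ n *\<^sub>R foldr partial ks \<phi> x)))"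

definition test_function :: "(real^3 \<Rightarrow> real) \<Rightarrow> bool"
  where "test_function \<phi> \<longleftrightarrow> smooth \<phi> \<and> compact (closure {x. \<phi> x \<noteq> 0})"

section \<open>Fourier transform\<close>

definition fourier :: "(real^3 \<Rightarrow> complex) \<Rightarrow> real^3 \<Rightarrow> complex"
  where "fourier \<phi> \<xi> = (LINT x|lborel. cis (- 2 * pi * (x \<bullet> \<xi>)) * \<phi> x)"

text \<open>\<open>has_ft f g\<close>: the Fourier transform of \<open>f\<close>, taken in the sense of tempered distributions,
  is the function \<open>g\<close>. This covers \<open>L\<^sup>1\<close>, \<open>L\<^sup>2\<close> and the homogeneous space of order 1 at once.
  Measurability of \<open>f\<close> and \<open>g\<close> is contained in the integrability conditions (take \<open>\<phi>\<close> Gaussian),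
  and each of \<open>f\<close>, \<open>g\<close> determines the other almost everywhere. Functions
  are identified when they agree almost everywhere; all notions below respect this.\<close>

definition has_ft :: "(real^3 \<Rightarrow> real) \<Rightarrow> (real^3 \<Rightarrow> complex) \<Rightarrow> bool"
  where "has_ft f g \<longleftrightarrow> (\<forall>\<phi>. schwartz \<phi> \<longrightarrow>
      integrable lborel (\<lambda>x. complex_of_real (f x) * \<phi> x) \<and>
      integrable lborel (\<lambda>\<xi>. g \<xi> * \<phi> \<xi>) \<and>
      (LINT x|lborel. complex_of_real (f x) * fourier \<phi> x) = (LINT \<xi>|lborel. g \<xi> * \<phi> \<xi>))"

definition ft :: "(real^3 \<Rightarrow> real) \<Rightarrow> real^3 \<Rightarrow> complex"
  where "ft f = (SOME g. has_ft f g)"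

definition vhas_ft :: "(real^3 \<Rightarrow> real^3) \<Rightarrow> (real^3 \<Rightarrow> complex^3) \<Rightarrow> bool"
  where "vhas_ft u U \<longleftrightarrow> (\<forall>j. has_ft (\<lambda>x. u x $ j) (\<lambda>\<xi>. U \<xi> $ j))"

definition vft :: "(real^3 \<Rightarrow> real^3) \<Rightarrow> real^3 \<Rightarrow> complex^3"
  where "vft u \<xi> = (\<chi> j. ft (\<lambda>x. u x $ j) \<xi>)"

definition mhas_ft :: "(real^3 \<Rightarrow> real^3^3) \<Rightarrow> (real^3 \<Rightarrow> complex^3^3) \<Rightarrow> bool"
  where "mhas_ft M G \<longleftrightarrow> (\<forall>i j. has_ft (\<lambda>x. M x $ i $ j) (\<lambda>\<xi>. G \<xi> $ i $ j))"

definition mft :: "(real^3 \<Rightarrow> real^3^3) \<Rightarrow> real^3 \<Rightarrow> complex^3^3"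
  where "mft M \<xi> = (\<chi> i j. ft (\<lambda>x. M x $ i $ j) \<xi>)"

section \<open>Fourier multipliers\<close>

text \<open>The operators act on Fourier transforms, by multiplication with their symbols. Intermediate
  results need not be tempered distributions: for \<open>u\<close> in \<open>L\<^sup>2\<close> the function
  \<open>|\<xi>|\<^sup>-\<^sup>2 vft u \<xi>\<close> may fail to be locally integrable, while \<open>\<nabla>\<^sub>s\<^sub>y\<^sub>m (-\<Delta>)\<^sup>-\<^sup>1 u\<close> is a function.
  That a function \<open>f\<close> is the result of applying a composite operator is expressed by
  \<open>has_ft f S\<close>, with \<open>S\<close> the product of the symbols with the Fourier transform.\<close>

definition deriv_symbol :: "3 \<Rightarrow> real^3 \<Rightarrow> complex"
  where "deriv_symbol j \<xi> = 2 * complex_of_real pi * \<i> * complex_of_real (\<xi> $ j)"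

definition laplace_pow :: "real \<Rightarrow> (real^3 \<Rightarrow> 'v::real_vector) \<Rightarrow> real^3 \<Rightarrow> 'v"
  where "laplace_pow s G \<xi> = ((4 * pi\<^sup>2 * (norm \<xi>)\<^sup>2) powr s) *\<^sub>R G \<xi>"

definition heat :: "real \<Rightarrow> (real^3 \<Rightarrow> 'v::real_vector) \<Rightarrow> real^3 \<Rightarrow> 'v"
  where "heat t G \<xi> = exp (- 4 * pi\<^sup>2 * (norm \<xi>)\<^sup>2 * t) *\<^sub>R G \<xi>"

definition vdiv :: "(real^3 \<Rightarrow> complex^3) \<Rightarrow> real^3 \<Rightarrow> complex"
  where "vdiv U \<xi> = (\<Sum>j\<in>UNIV. deriv_symbol j \<xi> * U \<xi> $ j)"

definition mdiv :: "(real^3 \<Rightarrow> complex^3^3) \<Rightarrow> real^3 \<Rightarrow> complex^3"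
  where "mdiv G \<xi> = (\<chi> j. \<Sum>i\<in>UNIV. deriv_symbol i \<xi> * G \<xi> $ i $ j)"

definition sym_grad :: "(real^3 \<Rightarrow> complex^3) \<Rightarrow> real^3 \<Rightarrow> complex^3^3"
  where "sym_grad U \<xi> =
    (\<chi> i j. (deriv_symbol i \<xi> * U \<xi> $ j + deriv_symbol j \<xi> * U \<xi> $ i) / 2)"

definition helmholtz :: "(real^3 \<Rightarrow> complex^3) \<Rightarrow> real^3 \<Rightarrow> complex^3"
  where "helmholtz U \<xi> = (\<chi> i. \<Sum>j\<in>UNIV.
    complex_of_real ((if i = j then 1 else 0) - \<xi> $ i * \<xi> $ j / (norm \<xi>)\<^sup>2) * U \<xi> $ j)"

section \<open>Function spaces\<close>

definition l2_sq :: "(real^3 \<Rightarrow> real) \<Rightarrow> ennreal"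
  where "l2_sq f = (\<integral>\<^sup>+ x. ennreal ((f x)\<^sup>2) \<partial>lborel)"

definition L2 :: "(real^3 \<Rightarrow> real) set"
  where "L2 = {f. f \<in> borel_measurable lborel \<and> l2_sq f < \<infinity>}"

definition hdot_sq :: "real \<Rightarrow> (real^3 \<Rightarrow> real) \<Rightarrow> ennreal"
  where "hdot_sq s f = (if \<exists>g. has_ft f g
     then \<integral>\<^sup>+ \<xi>. ennreal ((4 * pi\<^sup>2 * (norm \<xi>)\<^sup>2) powr s * (cmod (ft f \<xi>))\<^sup>2) \<partial>lborel
     else \<infinity>)"

text \<open>The closure of the test functions. Membership forces \<open>f\<close> to have a Fourier transform that is
  a function, because \<open>hdot_sq\<close> is infinite otherwise; so nonzero constants are excluded.\<close>

definition Hdot :: "real \<Rightarrow> (real^3 \<Rightarrow> real) set"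
  where "Hdot s = {f. \<exists>\<phi>::nat \<Rightarrow> real^3 \<Rightarrow> real. (\<forall>n. test_function (\<phi> n)) \<and>
     (\<lambda>n. hdot_sq s (\<lambda>x. f x - \<phi> n x)) \<longlonglongrightarrow> 0}"

definition mhdot_sq :: "real \<Rightarrow> (real^3 \<Rightarrow> real^3^3) \<Rightarrow> ennreal"
  where "mhdot_sq s M = (\<Sum>i\<in>UNIV. \<Sum>j\<in>UNIV. hdot_sq s (\<lambda>x. M x $ i $ j))"

definition vh1_sq :: "(real^3 \<Rightarrow> real^3) \<Rightarrow> ennreal"
  where "vh1_sq u = (\<Sum>j\<in>UNIV. l2_sq (\<lambda>x. u x $ j) + hdot_sq 1 (\<lambda>x. u x $ j))"

definition H1_df :: "(real^3 \<Rightarrow> real^3) set"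
  where "H1_df = {u. (\<forall>j. (\<lambda>x. u x $ j) \<in> L2) \<and> vh1_sq u < \<infinity> \<and>
     (AE \<xi> in lborel. vdiv (vft u) \<xi> = 0)}"

definition symmetric_valued :: "(real^3 \<Rightarrow> real^3^3) \<Rightarrow> bool"
  where "symmetric_valued M \<longleftrightarrow> (AE x in lborel. transpose (M x) = M x)"

definition Hdot_st :: "real \<Rightarrow> (real^3 \<Rightarrow> real^3^3) set"
  where "Hdot_st s = {M. symmetric_valued M \<and>
     (\<exists>w. (\<forall>j. (\<lambda>x. w x $ j) \<in> Hdot s) \<and> (AE \<xi> in lborel. vdiv (vft w) \<xi> = 0) \<and>
          mhas_ft M (sym_grad (laplace_pow (- 1/2) (vft w))))}"

text \<open>The intersection of the spaces of orders 1 and 2 is read as the elements of the former with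
  finite norm of order 2; the order-2 norm alone does not define a complete space of functions in
  dimension three.\<close>

definition Hdot12_st :: "(real^3 \<Rightarrow> real^3^3) set"
  where "Hdot12_st = {M \<in> Hdot_st 1. mhdot_sq 2 M < \<infinity>}"

definition L2_sym :: "(real^3 \<Rightarrow> real^3^3) set"
  where "L2_sym = {M. symmetric_valued M \<and> (\<forall>i j. (\<lambda>x. M x $ i $ j) \<in> L2)}"

definition L2_st :: "(real^3 \<Rightarrow> real^3^3) set"
  where "L2_st = {M \<in> L2_sym.
     \<exists>w. (\<forall>j. (\<lambda>x. w x $ j) \<in> L2) \<and>
         (AE \<xi> in lborel. vdiv (laplace_pow (- 1/2) (vft w)) \<xi> = 0) \<and>
         mhas_ft M (sym_grad (laplace_pow (- 1/2) (vft w)))}"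

text \<open>Orthogonal projection of \<open>L2_sym\<close> onto \<open>L2_st\<close>; the inner product of \<open>real^3^3\<close> is
  the sum of the products of the entries.\<close>

definition P_st :: "(real^3 \<Rightarrow> real^3^3) \<Rightarrow> real^3 \<Rightarrow> real^3^3"
  where "P_st Q = (SOME N. N \<in> L2_st \<and>
     (\<forall>R\<in>L2_st. (LINT x|lborel. (Q x - N x) \<bullet> R x) = 0))"

section \<open>Mild solutions\<close>

definition time_interval :: "ereal \<Rightarrow> real set"
  where "time_interval T = {t. 0 \<le> t \<and> ereal t < T}"

definition C_H1_df :: "ereal \<Rightarrow> (real \<Rightarrow> real^3 \<Rightarrow> real^3) set"
  where "C_H1_df T = {u. \<forall>t\<in>time_interval T. u t \<in> H1_df \<and>
     ((\<lambda>r. vh1_sq (\<lambda>x. u r x - u t x)) \<longlongrightarrow> 0) (at t within time_interval T)}"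

definition C_Hdot12_st :: "ereal \<Rightarrow> (real \<Rightarrow> real^3 \<Rightarrow> real^3^3) set"
  where "C_Hdot12_st T = {M. \<forall>t\<in>time_interval T. M t \<in> Hdot12_st \<and>
     ((\<lambda>r. mhdot_sq 1 (\<lambda>x. M r x - M t x)) \<longlongrightarrow> 0) (at t within time_interval T) \<and>
     ((\<lambda>r. mhdot_sq 2 (\<lambda>x. M r x - M t x)) \<longlongrightarrow> 0) (at t within time_interval T)}"

text \<open>\<open>has_time_integral F t I\<close>: \<open>I\<close> is the integral of \<open>F \<tau>\<close> over \<open>0 \<le> \<tau> \<le> t\<close>, as an
  integral with values in the tempered distributions, i.e. paired with every Schwartz function.
  Here \<open>F \<tau>\<close> and \<open>I\<close> are Fourier transforms; as the Fourier transform is a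
  bijection of the Schwartz space, pairing on the Fourier side is no restriction.\<close>

definition has_time_integral ::
    "(real \<Rightarrow> real^3 \<Rightarrow> complex) \<Rightarrow> real \<Rightarrow> (real^3 \<Rightarrow> complex) \<Rightarrow> bool"
  where "has_time_integral F t I \<longleftrightarrow> (\<forall>\<phi>. schwartz \<phi> \<longrightarrow>
     (\<forall>\<tau>\<in>{0..t}. integrable lborel (\<lambda>\<xi>. F \<tau> \<xi> * \<phi> \<xi>)) \<and>
     integrable lborel (\<lambda>\<xi>. I \<xi> * \<phi> \<xi>) \<and>
     set_integrable lborel {0..t} (\<lambda>\<tau>. LINT \<xi>|lborel. F \<tau> \<xi> * \<phi> \<xi>) \<and>
     (LINT \<tau>:{0..t}|lborel. (LINT \<xi>|lborel. F \<tau> \<xi> * \<phi> \<xi>)) = (LINT \<xi>|lborel. I \<xi> * \<phi> \<xi>))"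

definition tensor_sq :: "(real^3 \<Rightarrow> real^3) \<Rightarrow> real^3 \<Rightarrow> real^3^3"
  where "tensor_sq v x = (\<chi> i j. v x $ i * v x $ j)"

definition div_fun :: "(real^3 \<Rightarrow> real^3^3) \<Rightarrow> real^3 \<Rightarrow> real^3"
  where "div_fun M = (SOME v. vhas_ft v (mdiv (mft M)))"

definition mild_NS :: "ereal \<Rightarrow> (real \<Rightarrow> real^3 \<Rightarrow> real^3) \<Rightarrow> bool"
  where "mild_NS T u \<longleftrightarrow> u \<in> C_H1_df T \<and>
    (\<forall>t. 0 < t \<and> ereal t < T \<longrightarrow>
      (\<exists>I :: real^3 \<Rightarrow> complex^3.
        (\<forall>j. has_time_integral
           (\<lambda>\<tau> \<xi>. heat (t - \<tau>) (helmholtz (mdiv (mft (tensor_sq (u \<tau>))))) \<xi> $ j) t (\<lambda>\<xi>. I \<xi> $ j)) \<and>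
        vhas_ft (u t) (\<lambda>\<xi>. heat t (vft (u 0)) \<xi> - I \<xi>)))"

definition mild_potential :: "ereal \<Rightarrow> (real \<Rightarrow> real^3 \<Rightarrow> real^3^3) \<Rightarrow> bool"
  where "mild_potential T M \<longleftrightarrow> M \<in> C_Hdot12_st T \<and>
    (\<forall>t. 0 < t \<and> ereal t < T \<longrightarrow>
      (\<exists>I :: real^3 \<Rightarrow> complex^3^3.
        (\<forall>i j. has_time_integral
           (\<lambda>\<tau> \<xi>. heat (t - \<tau>) (mft (P_st (tensor_sq (div_fun (M \<tau>))))) \<xi> $ i $ j) t
           (\<lambda>\<xi>. I \<xi> $ i $ j)) \<and>
        mhas_ft (M t) (\<lambda>\<xi>. heat t (mft (M 0)) \<xi> + I \<xi>)))"

section \<open>The correspondence\<close>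

text \<open>\<open>u = - div M\<close>\<close>

definition is_velocity_of :: "(real^3 \<Rightarrow> real^3) \<Rightarrow> (real^3 \<Rightarrow> real^3^3) \<Rightarrow> bool"
  where "is_velocity_of u M \<longleftrightarrow> (\<exists>G. mhas_ft M G) \<and> vhas_ft u (\<lambda>\<xi>. - mdiv (mft M) \<xi>)"

text \<open>\<open>M = 2 \<nabla>\<^sub>s\<^sub>y\<^sub>m (-\<Delta>)\<^sup>-\<^sup>1 u\<close>\<close>

definition is_potential_of :: "(real^3 \<Rightarrow> real^3^3) \<Rightarrow> (real^3 \<Rightarrow> real^3) \<Rightarrow> bool"
  where "is_potential_of M u \<longleftrightarrow>
    (\<exists>U. vhas_ft u U) \<and> mhas_ft M (\<lambda>\<xi>. 2 *\<^sub>R sym_grad (laplace_pow (- 1) (vft u)) \<xi>)"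

end

theory Submission
  imports Defs "HOL-Probability.Probability" "HOL-Real_Asymp.Real_Asymp"
begin

text \<open>The correspondence is an identity between Fourier multipliers: with \<open>e = \<xi> / |\<xi>|\<close>, the projection
  onto strain matrices acts on symmetric \<open>Q\<close> as \<open>e \<otimes> v + v \<otimes> e\<close>, where \<open>v\<close> is the part of \<open>Q e\<close>
  orthogonal to \<open>e\<close>, so that \<open>div P\<^sub>s\<^sub>t Q = P\<^sub>d\<^sub>f div Q\<close> and
  \<open>P\<^sub>s\<^sub>t Q = - 2 \<nabla>\<^sub>s\<^sub>y\<^sub>m (-\<Delta>)\<^sup>-\<^sup>1 P\<^sub>d\<^sub>f div Q\<close>. The quadratic term makes sense because products of
  \<open>H\<^sup>1\<close> functions are in \<open>L\<^sup>2\<close>. Applying \<open>- div\<close> to the equation for \<open>M\<close> amounts to testing it with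
  the Schwartz functions \<open>2 \<pi> i \<xi>\<^sub>j \<phi>\<close>. In the other direction one has to divide by \<open>|\<xi>|\<^sup>2\<close>; the time integral is
  first identified on test functions of the form \<open>|\<xi>|\<^sup>2 \<psi>\<close> and then extended by dominated
  convergence, using that \<open>u\<close> is bounded in \<open>H\<^sup>1\<close> on compact time intervals.\<close>

section \<open>Smooth and Schwartz functions\<close>

text \<open>Every notion is tested against Schwartz functions and fixed only up to null sets, and
  \<open>ft\<close>, \<open>P_st\<close> and \<open>div_fun\<close> are arbitrary choices. Each of
  them has to be pinned down almost everywhere first: transforms by testing, the projection by
  comparing two candidates. This requires inversion, Plancherel and density of test functions in
  weighted L2 spaces on R^3.

  The obstacle sits at frequency zero. The transform of a potential has the size of that of
  \<open>u\<close> divided by |xi|. It need not be square integrable, yet it is tempered because 1 /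
  |xi|^2 is integrable near the origin of R^3. The division by |xi|^2 cannot be moved to the test
  function, as \<open>\<phi>\<close> / |xi|^2 is not Schwartz, and the velocity time integral is
  known only through its pairings. Passing to general \<open>\<phi>\<close> involves two limits. In
  the integrand an L2 bound on the projected quadratic term, uniform in time, is enough. For the
  candidate time integral no direct bound is at hand; the equation expresses it as the transform of
  \<open>M t\<close> minus the heat flow of that of \<open>M 0\<close>, and both are
  tempered.\<close>

text \<open>A class closed under all \<open>partial k\<close> contains every iterated derivative of
  its members. Smoothness thus never needs a formula for higher derivatives, only an invariant
  class.\<close>

lemma smooth_coinduct:
  assumes "F f"
    and diff: "\<And>g x. F g \<Longrightarrow> g differentiable (at x)"
    and part: "\<And>g k. F g \<Longrightarrow> F (partial k g)"
  shows "smooth f"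
proof -
  have "F (foldr partial ks f)" for ks
    by (induction ks) (auto intro: assms)
  then show ?thesis unfolding smooth_def using diff by blast
qed

text \<open>The decay half of \<open>schwartz\<close> for a single function; the derivatives are
  supplied by coinduction over an invariant class.\<close>

definition rapid :: "(real^3 \<Rightarrow> 'b::real_normed_vector) \<Rightarrow> bool"
  where "rapid f \<longleftrightarrow> (\<forall>n::nat. bounded (range (\<lambda>x. (1 + norm x) ^ n *\<^sub>R f x)))"

lemma rapid_iff: "rapid f \<longleftrightarrow> (\<forall>n::nat. \<exists>C. \<forall>x. (1 + norm x) ^ n * norm (f x) \<le> C)"
  unfolding rapid_def bounded_iff by simp

lemma schwartz_iff: "schwartz f \<longleftrightarrow> smooth f \<and> (\<forall>ks. rapid (foldr partial ks f))"
  unfolding schwartz_def rapid_def by blast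

lemma schwartz_coinduct:
  assumes "F f"
    and diff: "\<And>g x. F g \<Longrightarrow> g differentiable (at x)"
    and part: "\<And>g k. F g \<Longrightarrow> F (partial k g)"
    and rap: "\<And>g. F g \<Longrightarrow> rapid g"
  shows "schwartz f"
proof -
  have "F (foldr partial ks f)" for ks
    by (induction ks) (auto intro: assms)
  moreover have "smooth f" by (rule smooth_coinduct[of F]) (fact assms)+
  ultimately show ?thesis unfolding schwartz_iff using rap by blast
qed

lemma smooth_differentiable: "smooth f \<Longrightarrow> f differentiable (at x)"
  unfolding smooth_def by (metis foldr_Nil id_apply)

lemma smooth_partial: "smooth f \<Longrightarrow> smooth (partial k f)"
  unfolding smooth_def
proof (intro allI)
  fix ks x assume "\<forall>ks x. foldr partial ks f differentiable at x"
  \<comment> \<open>\<open>foldr\<close> applies the last entry of the list first, so appending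
    \<open>k\<close> makes \<open>partial k\<close> the innermost derivative.\<close>
  then have "foldr partial (ks @ [k]) f differentiable at x" by blast
  then show "foldr partial ks (partial k f) differentiable at x" by simp
qed

lemma schwartz_partial:
  assumes "schwartz f" shows "schwartz (partial k f)"
proof -
  have "rapid (foldr partial ks (partial k f))" for ks
  proof -
    have "rapid (foldr partial (ks @ [k]) f)" using assms schwartz_iff by blast
    then show ?thesis by simp
  qed
  then show ?thesis using assms smooth_partial unfolding schwartz_iff by blast
qed

lemma schwartz_rapid: "schwartz f \<Longrightarrow> rapid f"
  unfolding schwartz_iff by (metis foldr_Nil id_apply)

lemma schwartz_smooth: "schwartz f \<Longrightarrow> smooth f"
  unfolding schwartz_iff by simp

lemma schwartz_differentiable: "schwartz f \<Longrightarrow> f differentiable (at x)"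
  using schwartz_smooth smooth_differentiable by blast

lemma smooth_continuous: "smooth f \<Longrightarrow> continuous_on A f"
  by (meson continuous_at_imp_continuous_on differentiable_imp_continuous_within smooth_differentiable)

lemma partial_eq: "(f has_derivative f') (at x) \<Longrightarrow> partial k f x = f' (axis k 1)"
  unfolding partial_def using frechet_derivative_at by metis

lemma has_derivative_frechet: "f differentiable (at x) \<Longrightarrow> (f has_derivative frechet_derivative f (at x)) (at x)"
  by (simp add: frechet_derivative_works)

lemma partial_const [simp]: "partial k (\<lambda>x. c) = (\<lambda>x. 0)"
  by (rule ext, rule partial_eq[where f'="\<lambda>_. 0"]) simp

lemma partial_add:
  assumes "\<And>x. f differentiable (at x)" "\<And>x. g differentiable (at x)"
  shows "partial k (\<lambda>x. f x + g x) = (\<lambda>x. partial k f x + partial k g x)"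
  by (rule ext, rule partial_eq[THEN trans],
      rule has_derivative_add[OF has_derivative_frechet[OF assms(1)] has_derivative_frechet[OF assms(2)]])
    (simp add: partial_def)

lemma partial_mult:
  fixes f g :: "real^3 \<Rightarrow> 'b::real_normed_algebra"
  assumes "\<And>x. f differentiable (at x)" "\<And>x. g differentiable (at x)"
  shows "partial k (\<lambda>x. f x * g x) = (\<lambda>x. f x * partial k g x + partial k f x * g x)"
  by (rule ext, rule partial_eq[THEN trans],
      rule has_derivative_mult[OF has_derivative_frechet[OF assms(1)] has_derivative_frechet[OF assms(2)]])
    (simp add: partial_def)

lemma partial_linear:
  assumes "\<And>x. f differentiable (at x)" "bounded_linear h"
  shows "partial k (\<lambda>x. h (f x)) = (\<lambda>x. h (partial k f x))"
  by (rule ext, rule partial_eq[THEN trans],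
      rule bounded_linear.has_derivative[OF assms(2) has_derivative_frechet[OF assms(1)]])
    (simp add: partial_def)

lemma partial_affine:
  fixes c :: real
  assumes "\<And>x. f differentiable (at x)"
  shows "partial k (\<lambda>x. f (c *\<^sub>R x + b)) = (\<lambda>x. c *\<^sub>R partial k f (c *\<^sub>R x + b))"
proof
  fix x
  have "((\<lambda>x. c *\<^sub>R x + b) has_derivative (\<lambda>h. c *\<^sub>R h)) (at x)"
    by (auto intro!: derivative_eq_intros)
  then have "(f \<circ> (\<lambda>x. c *\<^sub>R x + b) has_derivative frechet_derivative f (at (c *\<^sub>R x + b)) \<circ> (\<lambda>h. c *\<^sub>R h)) (at x)"
    by (rule diff_chain_at) (rule has_derivative_frechet[OF assms])
  from partial_eq[OF this, of k]
  show "partial k (\<lambda>x. f (c *\<^sub>R x + b)) x = c *\<^sub>R partial k f (c *\<^sub>R x + b)"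
    using linear_frechet_derivative[OF assms] by (simp add: o_def partial_def linear_scale)
qed

lemma partial_coord:
  "partial k (\<lambda>x. c *\<^sub>R (x $ j)) = (\<lambda>x. if j = k then c else 0)"
proof
  fix x
  have "((\<lambda>x::real^3. c *\<^sub>R (x $ j)) has_derivative (\<lambda>h. c *\<^sub>R (h $ j))) (at x)"
    by (intro has_derivative_scaleR_right bounded_linear_imp_has_derivative bounded_linear_vec_nth)
  from partial_eq[OF this] show "partial k (\<lambda>x. c *\<^sub>R (x $ j)) x = (if j = k then c else 0)"
    by (simp add: axis_def)
qed

section \<open>Rapidly decreasing functions\<close>

lemma rapid_add: "rapid f \<Longrightarrow> rapid g \<Longrightarrow> rapid (\<lambda>x. f x + g x)"
  unfolding rapid_def scaleR_add_right by (intro allI bounded_plus_comp) auto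

lemma rapid_linear:
  assumes "rapid f" "bounded_linear h" shows "rapid (\<lambda>x. h (f x))"
  unfolding rapid_def
proof
  fix n
  have "bounded (h ` range (\<lambda>x. (1 + norm x) ^ n *\<^sub>R f x))"
    using assms(1) unfolding rapid_def by (intro bounded_linear_image[OF _ assms(2)]) blast
  then show "bounded (range (\<lambda>x. (1 + norm x) ^ n *\<^sub>R h (f x)))"
    by (simp add: image_image linear_scale[OF bounded_linear.linear[OF assms(2)]])
qed

lemma rapid_mult:
  fixes f g :: "real^3 \<Rightarrow> 'b::real_normed_algebra"
  assumes "rapid f" "bounded (range g)" shows "rapid (\<lambda>x. f x * g x)"
  unfolding rapid_iff
proof
  fix n
  obtain C where C: "\<And>x. (1 + norm x) ^ n * norm (f x) \<le> C" using assms(1) rapid_iff by metis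
  obtain D where D: "\<And>x. norm (g x) \<le> D" using assms(2) unfolding bounded_iff by auto
  have C0: "0 \<le> C" by (rule order_trans[OF _ C[of 0]]) simp
  have "(1 + norm x) ^ n * norm (f x * g x) \<le> C * D" for x
  proof -
    have "(1 + norm x) ^ n * norm (f x * g x) \<le> ((1 + norm x) ^ n * norm (f x)) * norm (g x)"
      by (simp add: mult.assoc mult_left_mono norm_mult_ineq)
    also have "\<dots> \<le> C * D" by (intro mult_mono C D C0) simp
    finally show ?thesis .
  qed
  then show "\<exists>C. \<forall>x. (1 + norm x) ^ n * norm (f x * g x) \<le> C" by blast
qed

lemma rapid_bounded: "rapid f \<Longrightarrow> bounded (range f)"
  unfolding rapid_def by (drule spec[of _ 0]) simp

lemma rapid_coord:
  assumes "rapid f" shows "rapid (\<lambda>x. (x $ j) *\<^sub>R f x)"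
  unfolding rapid_iff
proof
  fix n
  obtain C where C: "\<And>x. (1 + norm x) ^ Suc n * norm (f x) \<le> C" using assms(1) rapid_iff by metis
  have "(1 + norm x) ^ n * norm ((x $ j) *\<^sub>R f x) \<le> C" for x
  proof -
    have "(1 + norm x) ^ n * norm ((x $ j) *\<^sub>R f x) \<le> (1 + norm x) ^ n * ((1 + norm x) * norm (f x))"
      by (intro mult_left_mono) (auto intro!: mult_right_mono simp: component_le_norm_cart add_increasing)
    also have "\<dots> \<le> C" using C[of x] by (simp add: mult_ac)
    finally show ?thesis .
  qed
  then show "\<exists>C. \<forall>x. (1 + norm x) ^ n * norm ((x $ j) *\<^sub>R f x) \<le> C" by blast
qed

lemma rapid_affine:
  fixes c :: real
  assumes "rapid f" "c \<noteq> 0" shows "rapid (\<lambda>x. f (c *\<^sub>R x + b))"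
  unfolding rapid_iff
proof
  fix n
  obtain C where C: "\<And>x. (1 + norm x) ^ n * norm (f x) \<le> C" using assms(1) rapid_iff by metis
  \<comment> \<open>Chosen so that 1 + |x| \<le> D (1 + |c x + b|): the first summand absorbs the 1,
    the second bounds |x| by (|c x + b| + |b|) / |c|.\<close>
  define D where "D = (1 + norm b) + (1 + norm b) / \<bar>c\<bar>"
  have le: "1 + norm x \<le> D * (1 + norm (c *\<^sub>R x + b))" for x
  proof -
    have "norm (c *\<^sub>R x) \<le> norm (c *\<^sub>R x + b) + norm b"
      by (metis add_diff_cancel_right' norm_triangle_ineq4)
    then have "norm x \<le> (norm (c *\<^sub>R x + b) + norm b) / \<bar>c\<bar>"
      using assms(2) by (simp add: field_simps)
    also have "\<dots> \<le> (1 + norm b) * (1 + norm (c *\<^sub>R x + b)) / \<bar>c\<bar>"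
    proof (intro divide_right_mono)
      have "norm b \<le> norm b * (1 + norm (c *\<^sub>R x + b))" by (simp add: mult_le_cancel_left1)
      then show "norm (c *\<^sub>R x + b) + norm b \<le> (1 + norm b) * (1 + norm (c *\<^sub>R x + b))"
        by (simp add: distrib_right)
    qed simp
    finally have "1 + norm x \<le> 1 + (1 + norm b) / \<bar>c\<bar> * (1 + norm (c *\<^sub>R x + b))" by simp
    moreover have "1 \<le> (1 + norm b) * (1 + norm (c *\<^sub>R x + b))"
      by (rule mult_ge1_I) simp_all
    ultimately show ?thesis
      unfolding D_def distrib_right[of "1 + norm b" "(1 + norm b) / \<bar>c\<bar>"] by linarith
  qed
  have "(1 + norm x) ^ n * norm (f (c *\<^sub>R x + b)) \<le> D ^ n * C" for x
  proof -
    have "D \<ge> 0" unfolding D_def by simp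
    have "(1 + norm x) ^ n * norm (f (c *\<^sub>R x + b)) \<le> (D * (1 + norm (c *\<^sub>R x + b))) ^ n * norm (f (c *\<^sub>R x + b))"
      by (intro mult_right_mono power_mono le) auto
    also have "\<dots> \<le> D ^ n * C"
      using C[of "c *\<^sub>R x + b"] \<open>D \<ge> 0\<close> by (simp add: power_mult_distrib mult.assoc mult_left_mono)
    finally show ?thesis .
  qed
  then show "\<exists>C. \<forall>x. (1 + norm x) ^ n * norm (f (c *\<^sub>R x + b)) \<le> C" by blast
qed

lemma differentiable_bounded_linear:
  "f differentiable (at x) \<Longrightarrow> bounded_linear h \<Longrightarrow> (\<lambda>x. h (f x)) differentiable (at x)"
  unfolding differentiable_def using bounded_linear.has_derivative by blast

lemma differentiable_affine:
  fixes c :: real and f :: "real^3 \<Rightarrow> 'b::real_normed_vector"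
  assumes "\<And>x. f differentiable (at x)"
  shows "(\<lambda>x. f (c *\<^sub>R x + b)) differentiable (at x)"
  by (rule differentiable_compose[of f]) (auto intro!: assms derivative_intros)

section \<open>Closure properties of the Schwartz space\<close>

lemma schwartz_zero: "schwartz (\<lambda>x. 0)"
  by (rule schwartz_coinduct[of "\<lambda>f. f = (\<lambda>x. 0)"]) (auto simp: rapid_def)

lemma schwartz_add:
  assumes "schwartz f" "schwartz g" shows "schwartz (\<lambda>x. f x + g x)"
proof (rule schwartz_coinduct[of "\<lambda>h. \<exists>f g. schwartz f \<and> schwartz g \<and> h = (\<lambda>x. f x + g x)"])
  show "\<exists>f' g'. schwartz f' \<and> schwartz g' \<and> (\<lambda>x. f x + g x) = (\<lambda>x. f' x + g' x)"
    using assms by blast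
next
  fix h k assume "\<exists>f g. schwartz f \<and> schwartz g \<and> h = (\<lambda>x. f x + g x)"
  then obtain f g where fg: "schwartz f" "schwartz g" "h = (\<lambda>x. f x + g x)" by blast
  then have "partial k h = (\<lambda>x. partial k f x + partial k g x)"
    using partial_add schwartz_differentiable by blast
  then show "\<exists>f g. schwartz f \<and> schwartz g \<and> partial k h = (\<lambda>x. f x + g x)"
    using fg schwartz_partial by blast
qed (auto intro: schwartz_differentiable schwartz_rapid rapid_add differentiable_add)

lemma schwartz_linear:
  assumes "schwartz f" "bounded_linear h" shows "schwartz (\<lambda>x. h (f x))"
proof (rule schwartz_coinduct[of "\<lambda>u. \<exists>f. schwartz f \<and> u = (\<lambda>x. h (f x))"])
  show "\<exists>f'. schwartz f' \<and> (\<lambda>x. h (f x)) = (\<lambda>x. h (f' x))"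
    using assms by blast
next
  fix u k assume "\<exists>f. schwartz f \<and> u = (\<lambda>x. h (f x))"
  then show "\<exists>f. schwartz f \<and> partial k u = (\<lambda>x. h (f x))"
    using partial_linear[OF _ assms(2)] schwartz_differentiable schwartz_partial by metis
qed (use assms schwartz_differentiable schwartz_rapid rapid_linear differentiable_bounded_linear in blast)+

lemma schwartz_cmul: "schwartz f \<Longrightarrow> schwartz (\<lambda>x. c * f x)"
  using schwartz_linear[OF _ bounded_linear_mult_right] .

lemma schwartz_cnj: "schwartz f \<Longrightarrow> schwartz (\<lambda>x. cnj (f x))"
  using schwartz_linear[OF _ bounded_linear_cnj] .

lemma schwartz_diff: "schwartz f \<Longrightarrow> schwartz g \<Longrightarrow> schwartz (\<lambda>x. f x - g x)"
  using schwartz_add[OF _ schwartz_cmul[of g "-1"]] by simp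

lemma schwartz_sum: "(\<And>i. i \<in> I \<Longrightarrow> schwartz (f i)) \<Longrightarrow> schwartz (\<lambda>x. \<Sum>i\<in>I. f i x)"
  by (induction I rule: infinite_finite_induct) (auto simp: schwartz_zero schwartz_add)

lemma schwartz_affine:
  fixes c :: real
  assumes "schwartz f" "c \<noteq> 0" shows "schwartz (\<lambda>x. f (c *\<^sub>R x + b))"
proof (rule schwartz_coinduct[of "\<lambda>u. \<exists>f. schwartz f \<and> u = (\<lambda>x. f (c *\<^sub>R x + b))"])
  show "\<exists>f'. schwartz f' \<and> (\<lambda>x. f (c *\<^sub>R x + b)) = (\<lambda>x. f' (c *\<^sub>R x + b))"
    using assms by blast
next
  fix u k assume "\<exists>f. schwartz f \<and> u = (\<lambda>x. f (c *\<^sub>R x + b))"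
  then obtain f where f: "schwartz f" "u = (\<lambda>x. f (c *\<^sub>R x + b))" by blast
  \<comment> \<open>The factor \<open>c\<close> of the chain rule is absorbed into the Schwartz
    function, so that the derivative has the shape of the invariant class again.\<close>
  have "partial k u = (\<lambda>x. (\<lambda>y. complex_of_real c * partial k f y) (c *\<^sub>R x + b))"
    unfolding f(2) by (subst partial_affine) (auto simp: f(1) schwartz_differentiable scaleR_conv_of_real)
  then show "\<exists>f. schwartz f \<and> partial k u = (\<lambda>x. f (c *\<^sub>R x + b))"
    using schwartz_cmul[OF schwartz_partial[OF f(1)]] by blast
qed (use schwartz_differentiable schwartz_rapid rapid_affine[OF _ assms(2)] differentiable_affine in blast)+

text \<open>By the Leibniz rule products alone are not stable under \<open>partial\<close>, while
  finite sums of products are. This is the invariant class for both smooth and Schwartz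
  products.\<close>

inductive sums_of_products :: "(real^3 \<Rightarrow> 'b::real_normed_algebra) set \<Rightarrow> (real^3 \<Rightarrow> 'b) \<Rightarrow> bool"
  for S where
    product: "f \<in> S \<Longrightarrow> g \<in> S \<Longrightarrow> sums_of_products S (\<lambda>x. f x * g x)"
  | plus: "sums_of_products S f \<Longrightarrow> sums_of_products S g \<Longrightarrow> sums_of_products S (\<lambda>x. f x + g x)"

lemma sums_of_products_differentiable:
  assumes "sums_of_products S f" "\<And>f x. f \<in> S \<Longrightarrow> f differentiable (at x)"
  shows "f differentiable (at x)"
  using assms(1)
proof (induction arbitrary: x)
  case (product f g)
  then show ?case using assms(2) by (simp add: differentiable_mult)
qed simp

lemma sums_of_products_partial:
  assumes "sums_of_products S f" "\<And>f x. f \<in> S \<Longrightarrow> f differentiable (at x)" "\<And>f. f \<in> S \<Longrightarrow> partial k f \<in> S"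
  shows "sums_of_products S (partial k f)"
  using assms(1)
proof (induction)
  case (product f g)
  then show ?case using assms(2,3) by (simp add: partial_mult sums_of_products.intros)
next
  case (plus f g)
  then show ?case using sums_of_products_differentiable[OF _ assms(2)]
    by (simp add: partial_add sums_of_products.intros)
qed

lemma smooth_mult:
  fixes f g :: "real^3 \<Rightarrow> 'b::real_normed_algebra"
  assumes "smooth f" "smooth g" shows "smooth (\<lambda>x. f x * g x)"
  by (rule smooth_coinduct[of "sums_of_products (Collect smooth)"])
    (use assms in \<open>auto intro: sums_of_products.intros smooth_differentiable smooth_partial
      sums_of_products_differentiable sums_of_products_partial\<close>)

lemma schwartz_mult:
  assumes "schwartz f" "schwartz g" shows "schwartz (\<lambda>x. f x * g x)"
proof (rule schwartz_coinduct[of "sums_of_products (Collect schwartz)"])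
  fix h :: "real^3 \<Rightarrow> complex"
  assume "sums_of_products (Collect schwartz) h"
  then show "rapid h"
    by induction (auto intro: rapid_mult rapid_add rapid_bounded schwartz_rapid)
qed (use assms in \<open>auto intro: sums_of_products.intros schwartz_differentiable schwartz_partial
      sums_of_products_differentiable sums_of_products_partial\<close>)

lemma smooth_linear:
  assumes "smooth f" "bounded_linear h" shows "smooth (\<lambda>x. h (f x))"
proof (rule smooth_coinduct[of "\<lambda>u. \<exists>f. smooth f \<and> u = (\<lambda>x. h (f x))"])
  fix u k assume "\<exists>f. smooth f \<and> u = (\<lambda>x. h (f x))"
  then show "\<exists>f. smooth f \<and> partial k u = (\<lambda>x. h (f x))"
    using partial_linear[OF _ assms(2)] smooth_differentiable smooth_partial by metis
qed (use assms smooth_differentiable differentiable_bounded_linear in blast)+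

lemma smooth_add:
  assumes "smooth f" "smooth g" shows "smooth (\<lambda>x. f x + g x)"
proof (rule smooth_coinduct[of "\<lambda>h. \<exists>f g. smooth f \<and> smooth g \<and> h = (\<lambda>x. f x + g x)"])
  fix h k assume "\<exists>f g. smooth f \<and> smooth g \<and> h = (\<lambda>x. f x + g x)"
  then obtain f g where fg: "smooth f" "smooth g" "h = (\<lambda>x. f x + g x)" by blast
  then have "partial k h = (\<lambda>x. partial k f x + partial k g x)"
    using partial_add smooth_differentiable by blast
  then show "\<exists>f g. smooth f \<and> smooth g \<and> partial k h = (\<lambda>x. f x + g x)"
    using fg smooth_partial by blast
qed (use assms in \<open>auto intro: smooth_differentiable differentiable_add\<close>)

lemma smooth_const: "smooth (\<lambda>x. c)"
  by (rule smooth_coinduct[of "\<lambda>f. \<exists>c. f = (\<lambda>x. c)"]) auto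

text \<open>Differentiating \<open>x $ j\<close> times \<open>f\<close> leaves the undifferentiated
  \<open>f\<close> as an extra term. The invariant class therefore carries a Schwartz summand
  \<open>g\<close> that collects these remainders.\<close>

lemma schwartz_coord:
  assumes "schwartz f" shows "schwartz (\<lambda>x. complex_of_real (x $ j) * f x)"
proof (rule schwartz_coinduct[of "\<lambda>h. \<exists>f g. schwartz f \<and> schwartz g \<and> h = (\<lambda>x. complex_of_real (x $ j) * f x + g x)"])
  show "\<exists>f' g. schwartz f' \<and> schwartz g \<and> (\<lambda>x. complex_of_real (x $ j) * f x) = (\<lambda>x. complex_of_real (x $ j) * f' x + g x)"
    by (intro exI[of _ f] exI[of _ "\<lambda>x. 0"] conjI assms schwartz_zero) simp
next
  fix h x assume "\<exists>f g. schwartz f \<and> schwartz g \<and> h = (\<lambda>x. complex_of_real (x $ j) * f x + g x)"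
  then obtain f g where f: "schwartz f" "schwartz g" "h = (\<lambda>x. complex_of_real (x $ j) * f x + g x)" by blast
  have d: "(\<lambda>x. complex_of_real (x $ j)) differentiable (at x)" for x :: "real^3"
    by (rule differentiable_bounded_linear[OF _ bounded_linear_of_real])
      (simp add: bounded_linear_vec_nth bounded_linear_imp_differentiable)
  have pc: "partial k (\<lambda>x. complex_of_real (x $ j)) = (\<lambda>x. if j = k then 1 else 0)" for k
  proof -
    have "partial k (\<lambda>x. complex_of_real (x $ j)) = (\<lambda>x. complex_of_real (partial k (\<lambda>x. 1 *\<^sub>R (x $ j)) x))"
      by (subst partial_linear[OF _ bounded_linear_of_real, symmetric])
        (simp_all add: bounded_linear_vec_nth bounded_linear_imp_differentiable)
    then show ?thesis unfolding partial_coord by auto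
  qed
  show "h differentiable (at x)"
    unfolding f(3) by (intro differentiable_add differentiable_mult d schwartz_differentiable f)
  have "rapid (\<lambda>x. (x $ j) *\<^sub>R f x)" using f(1) by (simp add: rapid_coord schwartz_rapid)
  then show "rapid h"
    unfolding f(3) by (intro rapid_add[OF _ schwartz_rapid[OF f(2)]]) (simp add: scaleR_conv_of_real)
  fix k
  have "partial k h = (\<lambda>x. complex_of_real (x $ j) * partial k f x + ((if j = k then 1 else 0) * f x + partial k g x))"
    unfolding f(3)
    by (subst partial_add partial_mult, (intro differentiable_mult d schwartz_differentiable f)+)+
      (auto simp: pc)
  then show "\<exists>f g. schwartz f \<and> schwartz g \<and> partial k h = (\<lambda>x. complex_of_real (x $ j) * f x + g x)"
    by (intro exI[of _ "partial k f"] exI[of _ "\<lambda>x. (if j = k then 1 else 0) * f x + partial k g x"] conjI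
        schwartz_partial schwartz_add schwartz_cmul f)
qed

section \<open>The Gaussian\<close>

text \<open>Polynomials times the Gaussian, described by closure rules only: a derivative of the
  Gaussian is a coordinate times it, so the class is invariant under \<open>partial\<close>.\<close>

inductive poly_gaussian :: "(real^3 \<Rightarrow> complex) \<Rightarrow> bool" where
    gauss: "poly_gaussian (\<lambda>x. complex_of_real (exp (- (norm x)\<^sup>2)))"
  | coord: "poly_gaussian f \<Longrightarrow> poly_gaussian (\<lambda>x. (x $ j) *\<^sub>R f x)"
  | plus: "poly_gaussian f \<Longrightarrow> poly_gaussian g \<Longrightarrow> poly_gaussian (\<lambda>x. f x + g x)"
  | scal: "poly_gaussian f \<Longrightarrow> poly_gaussian (\<lambda>x. (c::real) *\<^sub>R f x)"

lemma has_derivative_gauss: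
  "((\<lambda>x::real^3. complex_of_real (exp (- (norm x)\<^sup>2))) has_derivative
     (\<lambda>h. complex_of_real (- 2 * (x \<bullet> h) * exp (- (norm x)\<^sup>2)))) (at x)"
proof -
  have "((\<lambda>x::real^3. exp (- (x \<bullet> x))) has_derivative (\<lambda>h. - 2 * (x \<bullet> h) * exp (- (x \<bullet> x)))) (at x)"
    by (auto intro!: derivative_eq_intros simp: inner_commute)
  from bounded_linear.has_derivative[OF bounded_linear_of_real this]
  show ?thesis by (simp add: power2_norm_eq_inner)
qed

lemma poly_gaussian_differentiable: "poly_gaussian f \<Longrightarrow> f differentiable (at x)"
proof (induction arbitrary: x rule: poly_gaussian.induct)
  case gauss
  show ?case using has_derivative_gauss differentiable_def by blast
next
  case (coord f j)
  then show ?case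
    by (intro differentiable_scaleR) (auto simp: bounded_linear_vec_nth bounded_linear_imp_differentiable)
next
  case (plus f g) show ?case by (intro differentiable_add plus.IH)
next
  case (scal f c) show ?case by (rule differentiable_bounded_linear[OF scal.IH bounded_linear_scaleR_right])
qed

lemma poly_gaussian_partial: "poly_gaussian f \<Longrightarrow> poly_gaussian (partial k f)"
proof (induction rule: poly_gaussian.induct)
  case gauss
  have "partial k (\<lambda>x. complex_of_real (exp (- (norm x)\<^sup>2))) = (\<lambda>x. (-2) *\<^sub>R (x $ k) *\<^sub>R complex_of_real (exp (- (norm x)\<^sup>2)))"
    by (rule ext, subst partial_eq[OF has_derivative_gauss]) (simp add: inner_axis scaleR_conv_of_real)
  then show ?case by (simp only:) (intro poly_gaussian.intros)
next
  case (coord f j)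
  have "partial k (\<lambda>x. (x $ j) *\<^sub>R f x) = (\<lambda>x. (x $ j) *\<^sub>R partial k f x + (if j = k then 1 else 0) *\<^sub>R f x)"
  proof
    fix x
    have "((\<lambda>x. (x $ j) *\<^sub>R f x) has_derivative (\<lambda>h. (x $ j) *\<^sub>R frechet_derivative f (at x) h + (h $ j) *\<^sub>R f x)) (at x)"
      by (rule has_derivative_scaleR) (auto intro!: has_derivative_frechet poly_gaussian_differentiable coord bounded_linear_imp_has_derivative bounded_linear_vec_nth)
    from partial_eq[OF this]
    show "partial k (\<lambda>x. (x $ j) *\<^sub>R f x) x = (x $ j) *\<^sub>R partial k f x + (if j = k then 1 else 0) *\<^sub>R f x"
      by (simp add: partial_def axis_def)
  qed
  then show ?case by (simp only:) (intro poly_gaussian.intros coord)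
next
  case (plus f g)
  then show ?case
    by (subst partial_add) (auto intro: poly_gaussian_differentiable poly_gaussian.intros)
next
  case (scal f c)
  then show ?case
    by (subst partial_linear[OF _ bounded_linear_scaleR_right]) (auto intro: poly_gaussian_differentiable poly_gaussian.intros)
qed

lemma rapid_gauss: "rapid (\<lambda>x. complex_of_real (exp (- (norm x)\<^sup>2)))"
  unfolding rapid_iff
proof
  fix n :: nat
  have "((\<lambda>r::real. (1 + r) ^ n * exp (- r\<^sup>2)) \<longlongrightarrow> 0) at_top"
    by real_asymp
  then have "\<forall>\<^sub>F r::real in at_top. (1 + r) ^ n * exp (- r\<^sup>2) < 1"
    by (rule order_tendstoD) simp
  then obtain R :: real where R: "\<And>r. r \<ge> R \<Longrightarrow> (1 + r) ^ n * exp (- r\<^sup>2) < 1"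
    unfolding eventually_at_top_linorder by blast
  have "(1 + norm x) ^ n * norm (complex_of_real (exp (- (norm x)\<^sup>2))) \<le> max 1 ((1 + \<bar>R\<bar>) ^ n)" for x :: "real^3"
  proof (cases "norm x \<ge> R")
    case True
    then have "(1 + norm x) ^ n * norm (complex_of_real (exp (- (norm x)\<^sup>2))) \<le> 1"
      using R[of "norm x"] by simp
    then show ?thesis by linarith
  next
    case False
    have "(1 + norm x) ^ n * norm (complex_of_real (exp (- (norm x)\<^sup>2))) \<le> (1 + \<bar>R\<bar>) ^ n * 1"
      using False by (intro mult_mono power_mono) auto
    then show ?thesis by linarith
  qed
  then show "\<exists>C. \<forall>x::real^3. (1 + norm x) ^ n * norm (complex_of_real (exp (- (norm x)\<^sup>2))) \<le> C" by blast
qed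

lemma schwartz_gauss: "schwartz (\<lambda>x. complex_of_real (exp (- (norm x)\<^sup>2)))"
proof (rule schwartz_coinduct[of poly_gaussian])
  fix g assume "poly_gaussian g"
  then show "rapid g"
    by induction (auto intro: rapid_gauss rapid_coord rapid_add rapid_linear[OF _ bounded_linear_scaleR_right])
qed (auto intro: poly_gaussian.intros poly_gaussian_differentiable poly_gaussian_partial)


section \<open>Smooth functions of bounded support\<close>

text \<open>Off the closed support the function vanishes on an open set, hence so does its
  derivative. Bounded support is thereby an invariant of differentiation.\<close>

lemma partial_support: "{x. partial k f x \<noteq> 0} \<subseteq> closure {x. f x \<noteq> 0}"
proof
  fix x assume x: "x \<in> {x. partial k f x \<noteq> 0}"
  show "x \<in> closure {x. f x \<noteq> 0}"
  proof (rule ccontr)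
    assume "x \<notin> closure {x. f x \<noteq> 0}"
    then have xin: "x \<in> - closure {x. f x \<noteq> 0}" by simp
    have "(f has_derivative (\<lambda>h. 0)) (at x)"
    proof (rule has_derivative_transform_within_open[OF _ _ xin])
      show "((\<lambda>x. 0) has_derivative (\<lambda>h. 0)) (at x)" by simp
      show "open (- closure {x. f x \<noteq> 0})" by (rule open_Compl[OF closed_closure])
      show "0 = f y" if "y \<in> - closure {x. f x \<noteq> 0}" for y
        using that closure_subset[of "{x. f x \<noteq> 0}"] by auto
    qed
    from partial_eq[OF this] show False using x by simp
  qed
qed

lemma schwartz_bounded_support:
  assumes "smooth f" "bounded {x. f x \<noteq> 0}" shows "schwartz f"
proof (rule schwartz_coinduct[of "\<lambda>f. smooth f \<and> bounded {x. f x \<noteq> 0}"])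
  fix g :: "real^3 \<Rightarrow> complex" assume g: "smooth g \<and> bounded {x. g x \<noteq> 0}"
  show "g differentiable (at x)" for x using g smooth_differentiable by blast
  show "smooth (partial k g) \<and> bounded {x. partial k g x \<noteq> 0}" for k
    using g smooth_partial bounded_subset[OF bounded_closure partial_support] by blast
  show "rapid g" unfolding rapid_def
  proof
    fix n
    let ?h = "\<lambda>x. (1 + norm x) ^ n *\<^sub>R g x" and ?K = "closure {x. g x \<noteq> 0}"
    have "compact (?h ` ?K)"
      using g by (intro compact_continuous_image continuous_intros smooth_continuous) auto
    moreover have "range ?h \<subseteq> insert 0 (?h ` ?K)"
      using closure_subset[of "{x. g x \<noteq> 0}"] by auto
    ultimately show "bounded (range ?h)"
      by (meson bounded_insert bounded_subset compact_imp_bounded)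
  qed
qed (use assms in auto)

lemma test_function_iff: "test_function \<phi> \<longleftrightarrow> smooth \<phi> \<and> bounded {x. \<phi> x \<noteq> 0}"
  unfolding test_function_def by simp

lemma test_function_schwartz:
  assumes "test_function \<phi>" shows "schwartz (\<lambda>x. complex_of_real (\<phi> x))"
  using assms smooth_linear[OF _ bounded_linear_of_real]
  by (intro schwartz_bounded_support) (auto simp: test_function_iff)

text \<open>The powers of 1/s are built in because differentiating exp (-1/s) produces them; the
  functions with all \<open>m\<close> together span a space closed under differentiation.\<close>

definition bump_core :: "nat \<Rightarrow> real \<Rightarrow> real"
  where "bump_core m s = (if 0 < s then exp (- inverse s) * inverse s ^ m else 0)"

lemma bump_core_tendsto_0: "(bump_core m \<longlongrightarrow> 0) (at 0)"
proof (rule filterlim_split_at)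
  show "(bump_core m \<longlongrightarrow> 0) (at_left 0)"
    by (rule tendsto_eventually) (auto simp: bump_core_def eventually_at_filter)
  have "((\<lambda>s::real. inverse s ^ m / exp (inverse s)) \<longlongrightarrow> 0) (at_right 0)"
    by (rule filterlim_compose[OF tendsto_power_div_exp_0 filterlim_inverse_at_top_right])
  moreover have "\<forall>\<^sub>F s in at_right 0. inverse s ^ m / exp (inverse s) = bump_core m s"
    by (auto simp: bump_core_def exp_minus field_simps eventually_at_filter)
  ultimately show "(bump_core m \<longlongrightarrow> 0) (at_right 0)"
    using tendsto_cong by fastforce
qed

lemma bump_core_has_derivative:
  "(bump_core m has_real_derivative (bump_core (m + 2) s - real m * bump_core (m + 1) s)) (at s)"
proof -
  consider "s > 0" | "s < 0" | "s = 0" by linarith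
  then show ?thesis
  proof cases
    case 1
    have inv: "(inverse has_real_derivative - (inverse s * inverse s)) (at s)"
      using DERIV_inverse[of s UNIV] 1 by (simp add: power2_eq_square)
    have D: "((\<lambda>s. exp (- inverse s) * inverse s ^ m) has_real_derivative
        exp (- inverse s) * (- (- (inverse s * inverse s))) * inverse s ^ m +
        (real m * (- (inverse s * inverse s) * inverse s ^ (m - Suc 0))) * exp (- inverse s)) (at s)"
      by (rule DERIV_mult[OF DERIV_fun_exp[OF DERIV_minus[OF inv]] DERIV_power[OF inv]])
    have "real m * (inverse s * inverse s * inverse s ^ (m - Suc 0)) = real m * inverse s ^ (m + 1)"
      by (cases m) auto
    then have "((\<lambda>s. exp (- inverse s) * inverse s ^ m) has_real_derivative
        (bump_core (m + 2) s - real m * bump_core (m + 1) s)) (at s)"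
      by (intro DERIV_cong[OF D]) (use 1 in \<open>cases m; auto simp: bump_core_def algebra_simps\<close>)
    then show ?thesis
      by (rule has_field_derivative_transform_within_open[where S="{0<..}"]) (use 1 in \<open>auto simp: bump_core_def\<close>)
  next
    case 2
    have "((\<lambda>s. 0) has_real_derivative 0) (at s)" by simp
    then have "(bump_core m has_real_derivative 0) (at s)"
      by (rule has_field_derivative_transform_within_open[where S="{..<0}"]) (use 2 in \<open>auto simp: bump_core_def\<close>)
    then show ?thesis using 2 by (simp add: bump_core_def)
  next
    case 3
    \<comment> \<open>At the junction the difference quotient is the next function of the family,
      whose limit at 0 is already known.\<close>
    have "(\<lambda>h. (bump_core m (0 + h) - bump_core m 0) / h) = bump_core (Suc m)"
      by (auto simp: bump_core_def field_simps)
    then have "(bump_core m has_real_derivative 0) (at 0)"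
      unfolding DERIV_def using bump_core_tendsto_0 by simp
    then show ?thesis using 3 by (simp add: bump_core_def)
  qed
qed

inductive bump_span :: "real \<Rightarrow> real \<Rightarrow> 3 \<Rightarrow> (real^3 \<Rightarrow> real) \<Rightarrow> bool" for c a k where
    core: "bump_span c a k (\<lambda>x. bump_core m (c * x $ k + a))"
  | plus: "bump_span c a k f \<Longrightarrow> bump_span c a k g \<Longrightarrow> bump_span c a k (\<lambda>x. f x + g x)"
  | scal: "bump_span c a k f \<Longrightarrow> bump_span c a k (\<lambda>x. d *\<^sub>R f x)"

lemma has_derivative_bump_core:
  "((\<lambda>x::real^3. bump_core m (c * x $ k + a)) has_derivative
     (\<lambda>h. (bump_core (m + 2) (c * x $ k + a) - real m * bump_core (m + 1) (c * x $ k + a)) * (c * h $ k))) (at x)"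
proof -
  have "((\<lambda>x::real^3. c * x $ k + a) has_derivative (\<lambda>h. c * h $ k)) (at x)"
    by (intro has_derivative_add_const has_derivative_mult_right bounded_linear_imp_has_derivative bounded_linear_vec_nth)
  from diff_chain_at[OF this bump_core_has_derivative[unfolded has_field_derivative_def]]
  show ?thesis by (simp add: o_def)
qed

lemma bump_span_differentiable: "bump_span c a k f \<Longrightarrow> f differentiable (at x)"
proof (induction arbitrary: x rule: bump_span.induct)
  case (core m) show ?case using has_derivative_bump_core differentiable_def by blast
next
  case (plus f g) show ?case by (intro differentiable_add plus.IH)
next
  case (scal f d) show ?case by (rule differentiable_bounded_linear[OF scal.IH bounded_linear_scaleR_right])
qed

lemma bump_span_partial: "bump_span c a k f \<Longrightarrow> bump_span c a k (partial j f)"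
proof (induction rule: bump_span.induct)
  case (core m)
  have "partial j (\<lambda>x. bump_core m (c * x $ k + a)) =
     (\<lambda>x. (if j = k then c else 0) *\<^sub>R (bump_core (m + 2) (c * x $ k + a) + (- real m) *\<^sub>R bump_core (m + 1) (c * x $ k + a)))"
    by (rule ext, subst partial_eq[OF has_derivative_bump_core]) (auto simp: axis_def)
  then show ?case by (simp only:) (intro bump_span.intros)
next
  case (plus f g)
  then show ?case
    by (subst partial_add) (auto intro: bump_span_differentiable bump_span.intros)
next
  case (scal f d)
  then show ?case
    by (subst partial_linear[OF _ bounded_linear_scaleR_right]) (auto intro: bump_span_differentiable bump_span.intros simp del: real_scaleR_def)
qed

lemma smooth_bump_core: "smooth (\<lambda>x. bump_core m (c * x $ k + a))"
  by (rule smooth_coinduct[of "bump_span c a k"])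
    (auto intro: bump_span.intros bump_span_differentiable bump_span_partial)

lemma smooth_prod:
  fixes f :: "'i \<Rightarrow> real^3 \<Rightarrow> 'b::{real_normed_algebra, comm_ring_1}"
  shows "(\<And>i. i \<in> I \<Longrightarrow> smooth (f i)) \<Longrightarrow> smooth (\<lambda>x. \<Prod>i\<in>I. f i x)"
  by (induction I rule: infinite_finite_induct) (auto simp: smooth_const smooth_mult)

text \<open>One smooth one-sided cutoff for each face of the box. The parameter \<open>c\<close>
  steepens the cutoffs: as it grows all factors tend to 1 inside the box, while for
  \<open>c > 0\<close> the product is exactly 0 outside, so indicators of boxes are bounded limits
  of test functions.\<close>

definition box_bump :: "real \<Rightarrow> real^3 \<Rightarrow> real^3 \<Rightarrow> real^3 \<Rightarrow> real"
  where "box_bump c a b x = (\<Prod>k\<in>UNIV. bump_core 0 (c * x $ k + - (c * a $ k)) * bump_core 0 ((- c) * x $ k + c * b $ k))"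

lemma smooth_box_bump: "smooth (box_bump c a b)"
  unfolding box_bump_def[abs_def] by (intro smooth_prod smooth_mult smooth_bump_core)

lemma bump_core_bounds: "0 \<le> bump_core 0 s" "bump_core 0 s \<le> 1"
  by (auto simp: bump_core_def)

lemma box_bump_bounds: "0 \<le> box_bump c a b x" "box_bump c a b x \<le> 1"
  unfolding box_bump_def
  by (auto intro!: prod_nonneg prod_le_1 mult_nonneg_nonneg mult_le_one simp: bump_core_bounds)

lemma mem_box_cart_open: "x \<in> box a b \<longleftrightarrow> (\<forall>k. a $ k < x $ k \<and> x $ k < b $ k)" for x :: "real^'n"
  by (simp add: mem_box_cart)

lemma box_bump_outside:
  assumes "c > 0" "x \<notin> box a b" shows "box_bump c a b x = 0"
proof -
  obtain k where "\<not> (a $ k < x $ k \<and> x $ k < b $ k)" using assms mem_box_cart_open by blast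
  then have "bump_core 0 (c * x $ k + - (c * a $ k)) * bump_core 0 ((- c) * x $ k + c * b $ k) = 0"
    using assms(1) by (auto simp: bump_core_def)
  then show ?thesis unfolding box_bump_def by (intro prod_zero) auto
qed

lemma bump_core_at_top: "(bump_core 0 \<longlongrightarrow> 1) at_top"
proof -
  have "((\<lambda>s::real. exp (- inverse s)) \<longlongrightarrow> 1) at_top" by real_asymp
  moreover have "\<forall>\<^sub>F s in at_top. exp (- inverse s) = bump_core 0 s"
    using eventually_gt_at_top[of 0] by eventually_elim (simp add: bump_core_def)
  ultimately show ?thesis using tendsto_cong by fastforce
qed

lemma box_bump_tendsto:
  "(\<lambda>n. box_bump (real (Suc n)) a b x) \<longlonglongrightarrow> indicator (box a b) x"
proof (cases "x \<in> box a b")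
  case True
  have lim: "(\<lambda>n. bump_core 0 (real (Suc n) * d)) \<longlonglongrightarrow> 1" if "d > 0" for d
    by (rule filterlim_compose[OF bump_core_at_top])
      (rule filterlim_at_top_mult_tendsto_pos[OF tendsto_const that] filterlim_compose[OF filterlim_real_sequentially filterlim_Suc]
        | simp only: mult.commute[of _ d] filterlim_tendsto_pos_mult_at_top[OF tendsto_const that])+
  have "(\<lambda>n. \<Prod>k\<in>UNIV. bump_core 0 (real (Suc n) * (x $ k - a $ k)) * bump_core 0 (real (Suc n) * (b $ k - x $ k)))
      \<longlonglongrightarrow> (\<Prod>k\<in>(UNIV::3 set). 1 * 1)"
    using True by (intro tendsto_prod tendsto_mult lim) (auto simp: mem_box_cart_open)
  moreover have "box_bump (real (Suc n)) a b x = (\<Prod>k\<in>UNIV. bump_core 0 (real (Suc n) * (x $ k - a $ k)) * bump_core 0 (real (Suc n) * (b $ k - x $ k)))" for n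
    unfolding box_bump_def by (intro prod.cong arg_cong2[where f="(*)"] arg_cong[where f="bump_core 0"]) (simp_all add: algebra_simps)
  ultimately show ?thesis using True by simp
next
  case False
  then show ?thesis by (simp add: box_bump_outside)
qed

lemma box_bump_test_function: "c > 0 \<Longrightarrow> test_function (box_bump c a b)"
  unfolding test_function_iff
  by (intro conjI smooth_box_bump bounded_subset[OF bounded_box[of a b]]) (use box_bump_outside in blast)

section \<open>Integration on three-dimensional space\<close>

lemma prod_Basis_cart: "(\<Prod>b\<in>(Basis :: (real^3) set). F b) = (\<Prod>k\<in>UNIV. F (axis k 1))"
proof -
  have 1: "(Basis :: (real^3) set) = range (\<lambda>k. axis k 1)" by (auto simp: Basis_vec_def)
  have 2: "inj (\<lambda>k::3. axis k (1::real))" by (auto simp: inj_on_def axis_eq_axis)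
  show ?thesis unfolding 1 by (subst prod.reindex[OF 2]) simp
qed

lemma nn_integral_prod_cart:
  fixes f :: "3 \<Rightarrow> real \<Rightarrow> ennreal"
  assumes "\<And>k. f k \<in> borel_measurable borel"
  shows "(\<integral>\<^sup>+x. (\<Prod>k\<in>UNIV. f k (x $ k)) \<partial>(lborel :: (real^3) measure)) = (\<Prod>k\<in>UNIV. \<integral>\<^sup>+x. f k x \<partial>lborel)"
proof -
  \<comment> \<open>The product formula is indexed by basis vectors. \<open>SOME\<close> recovers
    the coordinate, without ambiguity since \<open>axis k 1\<close> determines
    \<open>k\<close>.\<close>
  define g where "g b = f (SOME k. b = axis k 1)" for b :: "real^3"
  have g: "g (axis k 1) = f k" for k
    unfolding g_def by (rule arg_cong[where f=f]) (auto simp: axis_eq_axis)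
  show ?thesis
    using nn_integral_lborel_prod[of g] assms unfolding prod_Basis_cart g
    by (simp add: g_def inner_axis)
qed

lemma integral_prod_cart:
  fixes f :: "3 \<Rightarrow> real \<Rightarrow> complex"
  assumes f: "\<And>k. integrable lborel (f k)"
  shows "(LINT x|(lborel :: (real^3) measure). (\<Prod>k\<in>UNIV. f k (x $ k))) = (\<Prod>k\<in>UNIV. LINT x|lborel. f k x)"
proof -
  define g where "g b = f (SOME k. b = axis k 1)" for b :: "real^3"
  have g: "g (axis k 1) = f k" for k
    unfolding g_def by (rule arg_cong[where f=f]) (auto simp: axis_eq_axis)
  have gi: "integrable lborel (g b)" for b unfolding g_def by (rule f)
  have [measurable]: "f k \<in> borel_measurable borel" for k using borel_measurable_integrable[OF f] by simp
  interpret product_sigma_finite "\<lambda>b::real^3. lborel :: real measure" ..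
  have meas[measurable]: "(\<lambda>x. \<Sum>b\<in>Basis. x b *\<^sub>R b) \<in> (\<Pi>\<^sub>M b\<in>(Basis :: (real^3) set). lborel) \<rightarrow>\<^sub>M borel"
    by (intro borel_measurable_sum borel_measurable_scaleR measurable_const)
      (auto intro!: measurable_compose[OF measurable_component_singleton])
  have "(LINT x|(lborel :: (real^3) measure). (\<Prod>k\<in>UNIV. f k (x $ k)))
    = (LINT x|(\<Pi>\<^sub>M b\<in>(Basis :: (real^3) set). lborel). (\<Prod>k\<in>UNIV. f k ((\<Sum>b\<in>Basis. x b *\<^sub>R b) $ k)))"
    by (subst lborel_eq, subst integral_distr) (auto)
  also have "\<dots> = (LINT x|(\<Pi>\<^sub>M b\<in>(Basis :: (real^3) set). lborel). (\<Prod>b\<in>Basis. g b (x b)))"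
  proof (intro Bochner_Integration.integral_cong refl)
    fix x :: "real^3 \<Rightarrow> real"
    have "(\<Sum>b\<in>Basis. x b *\<^sub>R b) $ k = x (axis k 1)" for k
    proof -
      have "(\<Sum>b\<in>Basis. x b *\<^sub>R b) $ k = (\<Sum>b\<in>Basis. x b *\<^sub>R b) \<bullet> axis k 1"
        by (simp add: inner_axis)
      also have "\<dots> = x (axis k 1)"
        by (rule inner_sum_left_Basis) (auto simp: axis_in_Basis_iff)
      finally show ?thesis .
    qed
    then show "(\<Prod>k\<in>UNIV. f k ((\<Sum>b\<in>Basis. x b *\<^sub>R b) $ k)) = (\<Prod>b\<in>Basis. g b (x b))"
      by (simp add: prod_Basis_cart g)
  qed
  also have "\<dots> = (\<Prod>b\<in>Basis. LINT x|lborel. g b x)"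
    by (rule product_integral_prod) (auto intro: gi)
  also have "\<dots> = (\<Prod>k\<in>UNIV. LINT x|lborel. f k x)"
    by (simp add: prod_Basis_cart g)
  finally show ?thesis .
qed

lemma abs_cube: "\<bar>c\<bar> * (c * c) = \<bar>c\<bar> ^ 3" for c :: real
  by (metis abs_mult_self_eq power3_eq_cube mult.commute)

section \<open>Affine substitutions\<close>

lemma nn_integral_affine:
  fixes f :: "real^3 \<Rightarrow> ennreal"
  assumes [measurable]: "f \<in> borel_measurable borel" and c: "c \<noteq> 0"
  shows "(\<integral>\<^sup>+x. f x \<partial>lborel) = ennreal (\<bar>c\<bar> ^ 3) * (\<integral>\<^sup>+x. f (c *\<^sub>R x + t) \<partial>lborel)"
  by (subst lborel_affine[OF c, of t])
    (simp add: nn_integral_density nn_integral_distr nn_integral_cmult add.commute abs_cube)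

lemma integrable_affine:
  fixes f :: "real^3 \<Rightarrow> 'b::{banach, second_countable_topology}"
  assumes f: "integrable lborel f" and c: "c \<noteq> 0"
  shows "integrable lborel (\<lambda>x. f (c *\<^sub>R x + t))"
proof -
  have [measurable]: "f \<in> borel_measurable borel" using f by (auto dest: borel_measurable_integrable)
  have "ennreal (\<bar>c\<bar> ^ 3) * (\<integral>\<^sup>+x. ennreal (norm (f (c *\<^sub>R x + t))) \<partial>lborel) < \<infinity>"
    using f nn_integral_affine[of "\<lambda>x. ennreal (norm (f x))", OF _ c, of t]
    by (simp add: integrable_iff_bounded)
  then have "(\<integral>\<^sup>+x. ennreal (norm (f (c *\<^sub>R x + t))) \<partial>lborel) < \<infinity>"
    using c by (auto simp: ennreal_mult_less_top)
  then show ?thesis by (simp add: integrable_iff_bounded)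
qed

lemma integral_affine:
  fixes f :: "real^3 \<Rightarrow> 'b::{banach, second_countable_topology}"
  assumes [measurable]: "f \<in> borel_measurable borel" and c: "c \<noteq> 0"
  shows "(LINT x|lborel. f x) = (\<bar>c\<bar> ^ 3) *\<^sub>R (LINT x|lborel. f (c *\<^sub>R x + t))"
  by (subst lborel_affine[OF c, of t])
    (simp add: integral_density integral_distr add.commute abs_cube)

lemma AE_affine:
  assumes "AE x in lborel. P x" and c: "(c::real) \<noteq> 0"
  shows "AE x in lborel. P (c *\<^sub>R x + (t::real^3))"
proof -
  obtain N where N: "N \<in> sets lborel" "emeasure lborel N = 0" "{x. \<not> P x} \<subseteq> N"
    using assms(1) by (auto elim!: AE_E)
  have [measurable]: "N \<in> sets borel" using N by simp
  have "ennreal (\<bar>c\<bar> ^ 3) * (\<integral>\<^sup>+x. indicator N (c *\<^sub>R x + t) \<partial>lborel) = 0"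
    using nn_integral_affine[of "indicator N", OF _ c, of t] N by simp
  then have "(\<integral>\<^sup>+x. indicator N (c *\<^sub>R x + t) \<partial>lborel) = 0" using c by simp
  then have "AE x in lborel. indicator N (c *\<^sub>R x + t) = (0::ennreal)"
    by (subst (asm) nn_integral_0_iff_AE) auto
  then show ?thesis by (rule eventually_mono) (use N(3) in \<open>auto simp: indicator_def split: if_splits\<close>)
qed

section \<open>Integrability from decay\<close>

lemma nn_integral_inverse_square_real: "(\<integral>\<^sup>+s. ennreal (1 / (1 + s\<^sup>2)) \<partial>(lborel :: real measure)) < \<infinity>"
  using integrable_inverse_1_plus_square
  by (simp add: set_integrable_def integrable_iff_bounded inverse_eq_divide)

text \<open>Since 1 + x_k^2 \<le> (1 + |x|)^2, the weight is at most a product of three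
  one-dimensional weights 1 / (1 + s^2), each integrable. The exponent 6 is twice the
  dimension.\<close>

lemma nn_integral_weight6: "(\<integral>\<^sup>+x. ennreal (1 / (1 + norm x) ^ 6) \<partial>(lborel :: (real^3) measure)) < \<infinity>"
proof -
  have "1 / (1 + norm x) ^ 6 \<le> (\<Prod>k\<in>UNIV. 1 / (1 + (x $ k)\<^sup>2))" for x :: "real^3"
  proof -
    have "(\<Prod>k\<in>(UNIV::3 set). 1 + (x $ k)\<^sup>2) \<le> (\<Prod>k\<in>(UNIV::3 set). (1 + norm x)\<^sup>2)"
    proof (intro prod_mono conjI)
      fix k :: 3
      have "(x $ k)\<^sup>2 \<le> (norm x)\<^sup>2"
        using power_mono[OF component_le_norm_cart[of x k], of 2] by simp
      then show "1 + (x $ k)\<^sup>2 \<le> (1 + norm x)\<^sup>2"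
        by (simp add: power2_sum add_increasing2)
    qed simp
    also have "\<dots> = (1 + norm x) ^ 6" by (simp flip: power_mult)
    finally show ?thesis
      unfolding prod_dividef prod.neutral_const
      by (intro divide_left_mono mult_pos_pos prod_pos zero_less_power add_pos_nonneg) auto
  qed
  then have "(\<integral>\<^sup>+x. ennreal (1 / (1 + norm x) ^ 6) \<partial>(lborel :: (real^3) measure))
      \<le> (\<integral>\<^sup>+x. (\<Prod>k\<in>UNIV. ennreal (1 / (1 + (x $ k)\<^sup>2))) \<partial>(lborel :: (real^3) measure))"
    by (intro nn_integral_mono) (subst prod_ennreal, auto intro!: ennreal_leI)
  also have "\<dots> = (\<Prod>k\<in>(UNIV::3 set). \<integral>\<^sup>+s. ennreal (1 / (1 + s\<^sup>2)) \<partial>lborel)"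
    by (rule nn_integral_prod_cart) simp
  also have "\<dots> < \<infinity>"
    using nn_integral_inverse_square_real by (simp add: less_top[symmetric] power_eq_top_ennreal)
  finally show ?thesis .
qed

lemma integrable_weight6: "integrable lborel (\<lambda>x::real^3. C / (1 + norm x) ^ 6)"
proof -
  have "integrable lborel (\<lambda>x::real^3. 1 / (1 + norm x) ^ 6)"
    using nn_integral_weight6 by (simp add: integrable_iff_bounded)
  from integrable_mult_right[OF this, of C] show ?thesis by simp
qed

lemma rapid_bound:
  assumes "rapid f" obtains C where "\<And>x. norm (f x) \<le> C / (1 + norm x) ^ n" "C \<ge> 0"
proof -
  obtain C where C: "\<And>x. (1 + norm x) ^ n * norm (f x) \<le> C" using assms rapid_iff by metis
  have "norm (f x) \<le> C / (1 + norm x) ^ n" for x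
    using C[of x] by (simp add: field_simps add_pos_nonneg)
  moreover have "C \<ge> 0" by (rule order_trans[OF _ C[of 0]]) simp
  ultimately show ?thesis using that by blast
qed

lemma rapid_integrable:
  fixes f :: "real^3 \<Rightarrow> 'b::{banach, second_countable_topology}"
  assumes "rapid f" and [measurable]: "f \<in> borel_measurable borel" shows "integrable lborel f"
proof -
  obtain C where C: "\<And>x. norm (f x) \<le> C / (1 + norm x) ^ 6" "C \<ge> 0" using rapid_bound[OF assms(1)] by blast
  show ?thesis
    by (rule Bochner_Integration.integrable_bound[OF integrable_weight6[of C]]) (auto simp: C)
qed

lemma schwartz_continuous: "schwartz f \<Longrightarrow> continuous_on A f"
  using schwartz_smooth smooth_continuous by blast

lemma schwartz_measurable [measurable_dest]: "schwartz f \<Longrightarrow> f \<in> borel_measurable borel"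
  by (rule borel_measurable_continuous_onI, rule schwartz_continuous)

lemma schwartz_integrable: "schwartz f \<Longrightarrow> integrable lborel f"
  by (intro rapid_integrable schwartz_rapid) (simp_all add: schwartz_measurable)

lemma schwartz_bounded: assumes "schwartz f" obtains C where "\<And>x. norm (f x) \<le> C" "C \<ge> 0"
  using rapid_bound[OF schwartz_rapid[OF assms], of 0] by auto

text \<open>The integral of a difference quotient vanishes by translation invariance.\<close>

lemma integral_partial_eq_0:
  fixes f :: "real^3 \<Rightarrow> complex"
  assumes int: "integrable lborel f" and diff: "\<And>x. f differentiable (at x)"
    and bound: "\<And>x. norm (partial k f x) \<le> C / (1 + norm x) ^ 6"
  shows "(LINT x|lborel. partial k f x) = 0"
proof -
  have [measurable]: "f \<in> borel_measurable borel" using int by (auto dest: borel_measurable_integrable)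
  define h where "h n = 1 / real (Suc n)" for n
  define e :: "real^3" where "e = axis k 1"
  define D where "D n x = (f (x + h n *\<^sub>R e) - f x) /\<^sub>R h n" for n x
  have C0: "C \<ge> 0" using order_trans[OF norm_ge_zero bound[of 0]] by simp
  have h: "0 < h n" "h n \<le> 1" for n by (auto simp: h_def)
  have der: "((\<lambda>t. f (x + t *\<^sub>R e)) has_vector_derivative partial k f (x + t *\<^sub>R e)) (at t within S)" for x t S
  proof -
    have "((\<lambda>t. x + t *\<^sub>R e) has_derivative (\<lambda>s. s *\<^sub>R e)) (at t)"
      by (auto intro!: derivative_eq_intros)
    from diff_chain_at[OF this has_derivative_frechet[OF diff]]
    have "((\<lambda>t. f (x + t *\<^sub>R e)) has_derivative (\<lambda>s. s *\<^sub>R partial k f (x + t *\<^sub>R e))) (at t)"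
      using linear_frechet_derivative[OF diff]
      by (simp add: o_def partial_def linear_scale e_def)
    then show ?thesis unfolding has_vector_derivative_def by (rule has_derivative_at_withinI)
  qed
  have lim: "(\<lambda>n. D n x) \<longlonglongrightarrow> partial k f x" for x
  proof -
    have "((\<lambda>t. norm ((f (x + t *\<^sub>R e) - f x - t *\<^sub>R partial k f x) /\<^sub>R \<bar>t\<bar>)) \<longlongrightarrow> 0) (at 0)"
      using der[of x 0 UNIV] by (intro tendsto_norm_zero) (simp add: has_vector_derivative_def has_derivative_def)
    moreover have "norm ((f (x + t *\<^sub>R e) - f x - t *\<^sub>R partial k f x) /\<^sub>R \<bar>t\<bar>) =
        norm ((f (x + t *\<^sub>R e) - f x) /\<^sub>R t - partial k f x)" if "t \<noteq> 0" for t
    proof -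
      have "(f (x + t *\<^sub>R e) - f x) /\<^sub>R t - partial k f x = (f (x + t *\<^sub>R e) - f x - t *\<^sub>R partial k f x) /\<^sub>R t"
        using that by (simp add: scaleR_diff_right)
      then show ?thesis by simp
    qed
    ultimately have "((\<lambda>t. norm ((f (x + t *\<^sub>R e) - f x) /\<^sub>R t - partial k f x)) \<longlongrightarrow> 0) (at 0)"
      by (auto elim!: Lim_transform_eventually simp: eventually_at_filter)
    then have "((\<lambda>t. (f (x + t *\<^sub>R e) - f x) /\<^sub>R t) \<longlongrightarrow> partial k f x) (at 0)"
      by (rule Lim_null[THEN iffD2, OF tendsto_norm_zero_cancel])
    moreover have "filterlim h (at 0) sequentially"
      unfolding h_def filterlim_at using LIMSEQ_inverse_real_of_nat by (auto simp: inverse_eq_divide)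
    ultimately show ?thesis unfolding D_def using filterlim_compose by fastforce
  qed
  \<comment> \<open>Mean value inequality along a segment of length at most 1. Its points y satisfy
    1 + |x| \<le> 2 (1 + |y|), and 64 is the sixth power of this 2.\<close>
  have bd: "norm (D n x) \<le> 64 * C / (1 + norm x) ^ 6" for n x
  proof -
    have "norm (f (x + h n *\<^sub>R e) - f (x + 0 *\<^sub>R e)) \<le> (64 * C / (1 + norm x) ^ 6) * norm (h n - 0)"
    proof (rule differentiable_bound[of "{0..1}" "\<lambda>t. f (x + t *\<^sub>R e)"])
      fix t :: real assume t: "t \<in> {0..1}"
      show "((\<lambda>t. f (x + t *\<^sub>R e)) has_derivative (\<lambda>s. s *\<^sub>R partial k f (x + t *\<^sub>R e))) (at t within {0..1})"
        using der unfolding has_vector_derivative_def by blast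
      let ?y = "x + t *\<^sub>R e"
      have "norm x \<le> norm ?y + norm (t *\<^sub>R e)"
        by (metis add_diff_cancel_right' norm_triangle_ineq4)
      then have "1 + norm x \<le> 2 * (1 + norm ?y)"
        using t norm_ge_zero[of ?y] by (simp add: e_def del: norm_ge_zero)
      then have "(1 + norm x) ^ 6 \<le> (2 * (1 + norm ?y)) ^ 6"
        by (intro power_mono) auto
      then have le: "(1 + norm x) ^ 6 \<le> 64 * (1 + norm ?y) ^ 6" unfolding power_mult_distrib by simp
      have pos: "0 < (1 + norm z) ^ 6" for z :: "real^3" by (intro zero_less_power add_pos_nonneg) auto
      have "C / (1 + norm ?y) ^ 6 = 64 * C / (64 * (1 + norm ?y) ^ 6)" by simp
      also have "\<dots> \<le> 64 * C / (1 + norm x) ^ 6"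
        using C0 le pos by (intro divide_left_mono mult_pos_pos) auto
      finally have "C / (1 + norm ?y) ^ 6 \<le> 64 * C / (1 + norm x) ^ 6" .
      then have le2: "norm (partial k f ?y) \<le> 64 * C / (1 + norm x) ^ 6" using bound order_trans by blast
      show "onorm (\<lambda>s. s *\<^sub>R partial k f ?y) \<le> 64 * C / (1 + norm x) ^ 6"
      proof (intro onorm_bound)
        fix s :: real
        from le2 show "norm (s *\<^sub>R partial k f ?y) \<le> 64 * C / (1 + norm x) ^ 6 * norm s"
          unfolding norm_scaleR real_norm_def mult.commute[of "\<bar>s\<bar>"] by (rule mult_right_mono) simp
      qed (use C0 in simp)
    qed (use h in \<open>auto intro: less_imp_le\<close>)
    then show ?thesis using h[of n] unfolding D_def norm_scaleR by (simp add: field_simps)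
  qed
  have "(LINT x|lborel. D n x) = 0" for n
  proof -
    have i: "integrable lborel (\<lambda>x. f (x + h n *\<^sub>R e))" using integrable_affine[OF int, of 1] by simp
    have "(LINT x|lborel. f (x + h n *\<^sub>R e)) = (LINT x|lborel. f x)"
      using integral_affine[of f 1 "h n *\<^sub>R e"] by simp
    then show ?thesis unfolding D_def by (simp add: i int Bochner_Integration.integral_diff)
  qed
  moreover have "(\<lambda>n. LINT x|lborel. D n x) \<longlonglongrightarrow> (LINT x|lborel. partial k f x)"
  proof (rule integral_dominated_convergence[where w="\<lambda>x. 64 * C / (1 + norm x) ^ 6"])
    show "D n \<in> borel_measurable lborel" for n unfolding D_def by measurable
    then show "partial k f \<in> borel_measurable lborel"
      by (rule borel_measurable_LIMSEQ_metric) (rule lim)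
  qed (auto intro: integrable_weight6 lim bd)
  ultimately show ?thesis by (simp add: LIMSEQ_const_iff)
qed

section \<open>The Fourier transform on Schwartz functions\<close>

lemma continuous_cis [continuous_intros]: "continuous_on A f \<Longrightarrow> continuous_on A (\<lambda>x. cis (f x))"
  unfolding cis_conv_exp by (intro continuous_intros)

lemma measurable_cis [measurable]: "cis \<in> borel_measurable borel"
  by (intro borel_measurable_continuous_onI continuous_intros)

lemma has_derivative_cis_inner:
  fixes \<xi> :: "real^3"
  shows "((\<lambda>x. cis (c * (x \<bullet> \<xi>))) has_derivative (\<lambda>h. cis (c * (x \<bullet> \<xi>)) * (\<i> * complex_of_real (c * (h \<bullet> \<xi>))))) (at x)"
proof -
  have bl: "bounded_linear (\<lambda>x. \<i> * complex_of_real (c * (x \<bullet> \<xi>)))"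
    by (intro bounded_linear_const_mult bounded_linear_compose[OF bounded_linear_of_real] bounded_linear_inner_left)
  have "(exp has_derivative (*) (exp (\<i> * complex_of_real (c * (x \<bullet> \<xi>))))) (at (\<i> * complex_of_real (c * (x \<bullet> \<xi>))))"
    using DERIV_exp unfolding has_field_derivative_def .
  from diff_chain_at[OF bounded_linear_imp_has_derivative[OF bl] this]
  show ?thesis by (simp add: o_def cis_conv_exp)
qed

lemma partial_cis:
  fixes \<xi> :: "real^3"
  shows "partial k (\<lambda>x. cis (- 2 * pi * (x \<bullet> \<xi>))) = (\<lambda>x. - deriv_symbol k \<xi> * cis (- 2 * pi * (x \<bullet> \<xi>)))"
  by (rule ext, subst partial_eq[OF has_derivative_cis_inner])
    (simp add: deriv_symbol_def inner_axis' mult_ac)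

lemma differentiable_cis_inner: "(\<lambda>x::real^3. cis (c * (x \<bullet> \<xi>))) differentiable (at x)"
  using has_derivative_cis_inner differentiable_def by blast

lemma integrable_cis_mult:
  fixes f :: "real^3 \<Rightarrow> complex"
  assumes "integrable lborel f"
  shows "integrable lborel (\<lambda>x. cis (c * (x \<bullet> \<xi>)) * f x)"
proof (rule Bochner_Integration.integrable_bound[OF assms])
  show "(\<lambda>x. cis (c * (x \<bullet> \<xi>)) * f x) \<in> borel_measurable lborel"
    using borel_measurable_integrable[OF assms] by measurable
qed (auto simp: norm_mult)

lemma fourier_norm_le:
  assumes "integrable lborel f" shows "norm (fourier f \<xi>) \<le> (LINT x|lborel. norm (f x))"
  unfolding fourier_def by (rule order_trans[OF integral_norm_bound]) (simp add: norm_mult)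

lemma fourier_cmul: "fourier (\<lambda>x. c * f x) \<xi> = c * fourier f \<xi>"
  unfolding fourier_def by (simp add: mult.left_commute)

lemma fourier_diff:
  assumes "integrable lborel f" "integrable lborel g"
  shows "fourier (\<lambda>x. f x - g x) \<xi> = fourier f \<xi> - fourier g \<xi>"
  unfolding fourier_def right_diff_distrib
  by (rule Bochner_Integration.integral_diff) (use assms integrable_cis_mult in blast)+

text \<open>Integration by parts in a single stroke: the exponential times \<open>?g\<close> is the
  partial derivative of the exponential times \<open>\<phi>\<close>, so its integral vanishes, and
  this integral is the difference of the two sides.\<close>

lemma fourier_partial:
  assumes "schwartz \<phi>"
  shows "fourier (partial k \<phi>) \<xi> = deriv_symbol k \<xi> * fourier \<phi> \<xi>"
proof -
  let ?e = "\<lambda>x. cis (- 2 * pi * (x \<bullet> \<xi>))"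
  let ?g = "\<lambda>x. partial k \<phi> x - deriv_symbol k \<xi> * \<phi> x"
  have sg: "schwartz ?g" by (intro schwartz_diff schwartz_partial schwartz_cmul assms)
  have p: "partial k (\<lambda>x. ?e x * \<phi> x) = (\<lambda>x. ?e x * ?g x)"
    unfolding partial_mult[OF differentiable_cis_inner schwartz_differentiable[OF assms]] partial_cis
    by (rule ext) (simp add: algebra_simps)
  obtain C where C: "\<And>x. norm (?g x) \<le> C / (1 + norm x) ^ 6" using rapid_bound[OF schwartz_rapid[OF sg]] by blast
  have "(LINT x|lborel. partial k (\<lambda>x. ?e x * \<phi> x) x) = 0"
  proof (rule integral_partial_eq_0)
    show "integrable lborel (\<lambda>x. ?e x * \<phi> x)"
      by (intro integrable_cis_mult schwartz_integrable assms)
    show "(\<lambda>x. ?e x * \<phi> x) differentiable at x" for x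
      by (intro differentiable_mult differentiable_cis_inner schwartz_differentiable assms)
    show "norm (partial k (\<lambda>x. ?e x * \<phi> x) x) \<le> C / (1 + norm x) ^ 6" for x
      unfolding p using C[of x] by (simp add: norm_mult)
  qed
  then have "fourier ?g \<xi> = 0" unfolding p fourier_def .
  then show ?thesis
    by (subst (asm) fourier_diff)
      (auto simp: fourier_cmul intro!: schwartz_integrable schwartz_cmul schwartz_partial assms)
qed

lemma cis_approx: "norm (cis a - 1 - \<i> * complex_of_real a) \<le> a\<^sup>2"
proof -
  have "norm (cis a - 1 - \<i> * complex_of_real a) \<le> \<bar>a\<bar> ^ 2 / 2"
    using iexp_approx1[of a 1] by (simp add: cis_conv_exp diff_diff_eq numeral_2_eq_2)
  also have "\<dots> \<le> a\<^sup>2" by simp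
  finally show ?thesis .
qed

text \<open>The total derivative is estimated at once with a quadratic remainder, because
  \<open>smooth\<close> asks for differentiability and the existence of partial derivatives would
  not yield it.\<close>

lemma has_derivative_fourier:
  assumes "schwartz \<phi>"
  shows "(fourier \<phi> has_derivative
    (\<lambda>h. \<Sum>k\<in>UNIV. (h $ k) *\<^sub>R fourier (\<lambda>x. (- 2 * pi * \<i>) * (complex_of_real (x $ k) * \<phi> x)) \<xi>)) (at \<xi>)"
    (is "(_ has_derivative ?D) _")
proof -
  \<comment> \<open>Two of the eight powers of decay pay for the factor |x|^2 in the Taylor
    remainder of \<open>cis\<close>; the other six form the integrable weight.\<close>
  obtain C where C: "\<And>x. norm (\<phi> x) \<le> C / (1 + norm x) ^ 8" "C \<ge> 0" using rapid_bound[OF schwartz_rapid[OF assms]] by blast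
  let ?w = "\<lambda>x::real^3. (4 * pi\<^sup>2 * C) / (1 + norm x) ^ 6"
  define K where "K = (LINT x|lborel. ?w x)"
  have bound: "norm (fourier \<phi> (\<xi> + h) - fourier \<phi> \<xi> - ?D h) \<le> K * (norm h)\<^sup>2" for h
  proof -
    let ?s = "\<lambda>k x. (- 2 * pi * \<i>) * (complex_of_real (x $ k) * \<phi> x)"
    let ?e = "\<lambda>x. cis (- 2 * pi * (x \<bullet> \<xi>))"
    let ?r = "\<lambda>x. cis (- 2 * pi * (x \<bullet> h)) - 1 - \<i> * complex_of_real (- 2 * pi * (x \<bullet> h))"
    have s: "schwartz (?s k)" for k by (intro schwartz_cmul schwartz_coord assms)
    have i1: "integrable lborel (\<lambda>x. cis (- 2 * pi * (x \<bullet> (\<xi> + h))) * \<phi> x)"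
      "integrable lborel (\<lambda>x. ?e x * \<phi> x)" "\<And>k. integrable lborel (\<lambda>x. ?e x * ?s k x)"
      by (intro integrable_cis_mult schwartz_integrable assms s)+
    have iS: "integrable lborel (\<lambda>x. \<Sum>k\<in>UNIV. (h $ k) *\<^sub>R (?e x * ?s k x))"
      by (intro Bochner_Integration.integrable_sum integrable_scaleR_right i1(3))
    have "fourier \<phi> (\<xi> + h) - fourier \<phi> \<xi> - ?D h =
       (LINT x|lborel. cis (- 2 * pi * (x \<bullet> (\<xi> + h))) * \<phi> x) - (LINT x|lborel. ?e x * \<phi> x)
        - (LINT x|lborel. (\<Sum>k\<in>UNIV. (h $ k) *\<^sub>R (?e x * ?s k x)))"
      unfolding fourier_def by (subst Bochner_Integration.integral_sum) (use i1(3) in auto)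
    also have "\<dots> = (LINT x|lborel. cis (- 2 * pi * (x \<bullet> (\<xi> + h))) * \<phi> x - ?e x * \<phi> x
        - (\<Sum>k\<in>UNIV. (h $ k) *\<^sub>R (?e x * ?s k x)))"
      by (subst Bochner_Integration.integral_diff[OF Bochner_Integration.integrable_diff[OF i1(1,2)] iS],
          subst Bochner_Integration.integral_diff[OF i1(1,2)]) (rule refl)
    also have "\<dots> = (LINT x|lborel. ?e x * (\<phi> x * ?r x))"
    proof (intro Bochner_Integration.integral_cong refl)
      fix x :: "real^3"
      have 1: "cis (- 2 * pi * (x \<bullet> (\<xi> + h))) = ?e x * cis (- 2 * pi * (x \<bullet> h))"
        by (simp add: cis_mult inner_add_right algebra_simps)
      have 2: "(\<Sum>k\<in>UNIV. (h $ k) *\<^sub>R (?e x * ?s k x)) = ?e x * \<phi> x * (\<i> * complex_of_real (- 2 * pi * (x \<bullet> h)))"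
        by (simp add: inner_vec_def sum_distrib_left sum_distrib_right scaleR_conv_of_real mult_ac sum_negf[symmetric])
      show "cis (- 2 * pi * (x \<bullet> (\<xi> + h))) * \<phi> x - ?e x * \<phi> x
        - (\<Sum>k\<in>UNIV. (h $ k) *\<^sub>R (?e x * ?s k x)) = ?e x * (\<phi> x * ?r x)"
        unfolding 1 2 by (simp only: right_diff_distrib mult_1_right mult.assoc mult.commute[of "\<phi> x" "cis _"])
    qed
    finally have eq: "fourier \<phi> (\<xi> + h) - fourier \<phi> \<xi> - ?D h = (LINT x|lborel. ?e x * (\<phi> x * ?r x))" .
    have pw: "norm (?e x * (\<phi> x * ?r x)) \<le> ?w x * (norm h)\<^sup>2" for x
    proof -
      have "norm (?r x) \<le> (- 2 * pi * (x \<bullet> h))\<^sup>2" by (rule cis_approx)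
      also have "\<dots> = 4 * pi\<^sup>2 * (x \<bullet> h)\<^sup>2" by (simp add: power_mult_distrib)
      also have "(x \<bullet> h)\<^sup>2 \<le> (norm x)\<^sup>2 * (norm h)\<^sup>2"
        by (metis Cauchy_Schwarz_ineq power2_norm_eq_inner)
      also have "(norm x)\<^sup>2 * (norm h)\<^sup>2 \<le> (1 + norm x)\<^sup>2 * (norm h)\<^sup>2"
        by (intro mult_right_mono power_mono) auto
      finally have r: "norm (?r x) \<le> 4 * pi\<^sup>2 * ((1 + norm x)\<^sup>2 * (norm h)\<^sup>2)" by simp
      have "norm (?e x * (\<phi> x * ?r x)) = norm (\<phi> x) * norm (?r x)" by (simp add: norm_mult)
      also have "\<dots> \<le> C / (1 + norm x) ^ 8 * (4 * pi\<^sup>2 * ((1 + norm x)\<^sup>2 * (norm h)\<^sup>2))"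
        by (intro mult_mono C r) (use C(2) in \<open>auto intro: divide_nonneg_nonneg\<close>)
      also have "(1 + norm x) ^ 8 = (1 + norm x) ^ 6 * (1 + norm x)\<^sup>2" by (simp flip: power_add)
      also have "C / ((1 + norm x) ^ 6 * (1 + norm x)\<^sup>2) * (4 * pi\<^sup>2 * ((1 + norm x)\<^sup>2 * (norm h)\<^sup>2)) = ?w x * (norm h)\<^sup>2"
        using norm_ge_zero[of x] by (simp add: field_simps add_nonneg_eq_0_iff)
      finally show ?thesis .
    qed
    have "norm (LINT x|lborel. ?e x * (\<phi> x * ?r x)) \<le> (LINT x|lborel. ?w x * (norm h)\<^sup>2)"
      by (intro Bochner_Integration.integral_norm_bound_integral integrable_mult_left integrable_weight6 pw
        Bochner_Integration.integrable_bound[OF integrable_mult_left[OF integrable_weight6[of "4 * pi\<^sup>2 * C"], of "(norm h)\<^sup>2"]])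
        (use schwartz_measurable[OF assms] pw C(2) in \<open>auto intro!: order_trans[OF pw] AE_I2 mult_right_mono divide_nonneg_nonneg simp: abs_mult\<close>)
    also have "\<dots> = K * (norm h)\<^sup>2" unfolding K_def by (rule integral_mult_left_zero)
    finally show ?thesis unfolding eq .
  qed
  have "((\<lambda>y. norm (fourier \<phi> y - fourier \<phi> \<xi> - ?D (y - \<xi>)) / norm (y - \<xi>)) \<longlongrightarrow> 0) (at \<xi>)"
  proof (rule Lim_null_comparison)
    show "\<forall>\<^sub>F y in at \<xi>. norm (norm (fourier \<phi> y - fourier \<phi> \<xi> - ?D (y - \<xi>)) / norm (y - \<xi>)) \<le> K * norm (y - \<xi>)"
      unfolding eventually_at_filter
      by (rule always_eventually, rule allI)
        (use bound[of "y - \<xi>" for y] in \<open>simp add: divide_simps power2_eq_square mult.assoc\<close>)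
    have "((\<lambda>y. K * norm (y - \<xi>)) \<longlongrightarrow> K * norm (\<xi> - \<xi>)) (at \<xi>)" by (intro tendsto_intros)
    then show "((\<lambda>y. K * norm (y - \<xi>)) \<longlongrightarrow> 0) (at \<xi>)" by simp
  qed
  moreover have "bounded_linear ?D"
    by (intro bounded_linear_sum bounded_linear_scaleR_left[THEN bounded_linear_compose] bounded_linear_vec_nth)
  ultimately show ?thesis unfolding has_derivative_iff_norm by simp
qed

lemma partial_fourier:
  assumes "schwartz \<phi>"
  shows "partial k (fourier \<phi>) = fourier (\<lambda>x. (- 2 * pi * \<i>) * (complex_of_real (x $ k) * \<phi> x))"
  by (rule ext, subst partial_eq[OF has_derivative_fourier[OF assms]])
    (simp add: axis_def if_distrib[of "\<lambda>c. c *\<^sub>R _"] cong: if_cong)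

text \<open>Each further factor 1 + |xi| is traded for one derivative of \<open>\<phi>\<close>, as
  |xi_k| is at most the modulus of \<open>deriv_symbol k\<close>. The induction starts from the L1
  bound and has to range over all Schwartz functions.\<close>

lemma rapid_fourier:
  assumes "schwartz \<phi>" shows "rapid (fourier \<phi>)"
proof -
  have "\<exists>C. \<forall>\<xi>. (1 + norm \<xi>) ^ n * norm (fourier \<phi> \<xi>) \<le> C" for n
    using assms
  proof (induction n arbitrary: \<phi>)
    case 0
    then show ?case using fourier_norm_le[OF schwartz_integrable] by auto
  next
    case (Suc n)
    obtain C where C: "\<And>\<xi>. (1 + norm \<xi>) ^ n * norm (fourier \<phi> \<xi>) \<le> C" using Suc by blast
    have "\<forall>k. \<exists>D. \<forall>\<xi>. (1 + norm \<xi>) ^ n * norm (fourier (partial k \<phi>) \<xi>) \<le> D"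
      using Suc.IH schwartz_partial[OF Suc.prems] by blast
    then obtain D where D: "\<And>k \<xi>. (1 + norm \<xi>) ^ n * norm (fourier (partial k \<phi>) \<xi>) \<le> D k" by metis
    have "(1 + norm \<xi>) ^ Suc n * norm (fourier \<phi> \<xi>) \<le> C + (\<Sum>k\<in>UNIV. D k)" for \<xi>
    proof -
      have "(1 + norm \<xi>) * norm (fourier \<phi> \<xi>) \<le> (1 + (\<Sum>k\<in>UNIV. \<bar>\<xi> $ k\<bar>)) * norm (fourier \<phi> \<xi>)"
        by (intro mult_right_mono) (auto simp: norm_le_l1_cart)
      also have "\<dots> = norm (fourier \<phi> \<xi>) + (\<Sum>k\<in>UNIV. \<bar>\<xi> $ k\<bar> * norm (fourier \<phi> \<xi>))"
        by (simp add: distrib_right sum_distrib_right)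
      also have "\<dots> \<le> norm (fourier \<phi> \<xi>) + (\<Sum>k\<in>UNIV. norm (fourier (partial k \<phi>) \<xi>))"
      proof (intro add_left_mono sum_mono)
        fix k
        have "1 * \<bar>\<xi> $ k\<bar> \<le> 2 * pi * \<bar>\<xi> $ k\<bar>" using pi_gt3 by (intro mult_right_mono) auto
        then have "\<bar>\<xi> $ k\<bar> * norm (fourier \<phi> \<xi>) \<le> (2 * pi * \<bar>\<xi> $ k\<bar>) * norm (fourier \<phi> \<xi>)"
          by (intro mult_right_mono) auto
        also have "\<dots> = norm (fourier (partial k \<phi>) \<xi>)"
          unfolding fourier_partial[OF Suc.prems] by (simp add: norm_mult deriv_symbol_def)
        finally show "\<bar>\<xi> $ k\<bar> * norm (fourier \<phi> \<xi>) \<le> norm (fourier (partial k \<phi>) \<xi>)" .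
      qed
      finally have "(1 + norm \<xi>) ^ n * ((1 + norm \<xi>) * norm (fourier \<phi> \<xi>)) \<le>
          (1 + norm \<xi>) ^ n * (norm (fourier \<phi> \<xi>) + (\<Sum>k\<in>UNIV. norm (fourier (partial k \<phi>) \<xi>)))"
        by (intro mult_left_mono) auto
      also have "\<dots> \<le> C + (\<Sum>k\<in>UNIV. D k)"
        unfolding distrib_left sum_distrib_left by (intro add_mono sum_mono C D)
      finally show ?thesis by (simp add: mult_ac)
    qed
    then show ?case by blast
  qed
  then show ?thesis unfolding rapid_iff by blast
qed

lemma schwartz_fourier: assumes "schwartz \<phi>" shows "schwartz (fourier \<phi>)"
proof (rule schwartz_coinduct[of "\<lambda>g. \<exists>\<phi>. schwartz \<phi> \<and> g = fourier \<phi>"])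
  fix g k assume "\<exists>\<phi>. schwartz \<phi> \<and> g = fourier \<phi>"
  then obtain \<phi> where "schwartz \<phi>" "g = fourier \<phi>" by blast
  then show "\<exists>\<phi>. schwartz \<phi> \<and> partial k g = fourier \<phi>"
    using partial_fourier schwartz_cmul[OF schwartz_coord] by blast
qed (use assms rapid_fourier has_derivative_fourier differentiable_def in blast)+

section \<open>Multiplication formula, Gaussians and inversion\<close>

text \<open>Fubini and the symmetry of the kernel in its two variables. This is the identity that
  \<open>has_ft\<close> extends to tempered functions.\<close>

lemma fourier_transfer:
  assumes f: "integrable lborel f" and g: "integrable lborel g"
  shows "(LINT x|lborel. f x * fourier g x) = (LINT x|lborel. fourier f x * g x)"
proof -
  have [measurable]: "f \<in> borel_measurable borel" "g \<in> borel_measurable borel"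
    using f g by (auto dest: borel_measurable_integrable)
  let ?F = "\<lambda>x y. f x * (cis (- 2 * pi * (y \<bullet> x)) * g y)"
  have i: "integrable (lborel \<Otimes>\<^sub>M lborel) (\<lambda>(x, y). ?F x y)"
  proof (rule lborel_pair.Fubini_integrable)
    show "(\<lambda>(x, y). ?F x y) \<in> borel_measurable (lborel \<Otimes>\<^sub>M lborel)" by measurable
    show "integrable lborel (\<lambda>x. LINT y|lborel. norm (case (x, y) of (x, y) \<Rightarrow> ?F x y))"
      using f by (simp add: norm_mult)
    show "AE x in lborel. integrable lborel (\<lambda>y. case (x, y) of (x, y) \<Rightarrow> ?F x y)"
      unfolding prod.case by (intro AE_I2 integrable_mult_right integrable_cis_mult g)
  qed
  have "(LINT x|lborel. f x * fourier g x) = (LINT x|lborel. LINT y|lborel. ?F x y)"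
    unfolding fourier_def by simp
  also have "\<dots> = (LINT y|lborel. LINT x|lborel. ?F x y)"
    using lborel_pair.Fubini_integral[OF i] by simp
  also have "\<dots> = (LINT y|lborel. LINT x|lborel. (cis (- 2 * pi * (x \<bullet> y)) * f x) * g y)"
    by (intro Bochner_Integration.integral_cong refl) (simp add: inner_commute mult_ac)
  also have "\<dots> = (LINT x|lborel. fourier f x * g x)"
    unfolding fourier_def by simp
  finally show ?thesis .
qed

lemma fourier_gauss_real:
  "(LINT s|lborel. cis (- 2 * pi * (s * t)) * complex_of_real (exp (- pi * s\<^sup>2))) = complex_of_real (exp (- pi * t\<^sup>2))"
proof -
  \<comment> \<open>Scaling by \<open>c\<close> carries the standard normal density to exp (- pi
    s^2): the Jacobian cancels the normalisation, and the known characteristic function becomes the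
    transform.\<close>
  define c where "c = sqrt (2 * pi)"
  have c: "c > 0" "c\<^sup>2 = 2 * pi" by (auto simp: c_def)
  have "complex_of_real (exp (- ((- c * t)\<^sup>2) / 2)) = char std_normal_distribution (- c * t)"
    by (simp add: char_std_normal_distribution)
  also have "\<dots> = (LINT x|lborel. std_normal_density x *\<^sub>R cis (- c * t * x))"
    unfolding char_def by (subst integral_density) (auto simp: normal_density_nonneg cis_conv_exp)
  also have "\<dots> = c *\<^sub>R (LINT s|lborel. std_normal_density (0 + c * s) *\<^sub>R cis (- c * t * (0 + c * s)))"
    using lborel_integral_real_affine[of c "\<lambda>x. std_normal_density x *\<^sub>R cis (- c * t * x)" 0] c by simp
  also have "\<dots> = (LINT s|lborel. c *\<^sub>R (std_normal_density (0 + c * s) *\<^sub>R cis (- c * t * (0 + c * s))))"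
    by (rule integral_scaleR_right[symmetric])
  also have "\<dots> = (LINT s|lborel. cis (- 2 * pi * (s * t)) * complex_of_real (exp (- pi * s\<^sup>2)))"
  proof (intro Bochner_Integration.integral_cong refl)
    fix s
    have "c * std_normal_density (c * s) = exp (- pi * s\<^sup>2)"
      using c unfolding std_normal_density_def by (simp add: power_mult_distrib c_def[symmetric] )
    moreover have "- c * t * (0 + c * s) = - 2 * pi * (s * t)"
      using c(2) by (simp add: power2_eq_square algebra_simps)
    ultimately show "c *\<^sub>R (std_normal_density (0 + c * s) *\<^sub>R cis (- c * t * (0 + c * s))) =
       cis (- 2 * pi * (s * t)) * complex_of_real (exp (- pi * s\<^sup>2))"
      by (simp only: add_0 scaleR_scaleR) (simp only: scaleR_conv_of_real mult.commute)
  qed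
  finally show ?thesis using c(2) by (simp add: power_mult_distrib)
qed

lemma integrable_gauss_real: "integrable lborel (\<lambda>s::real. exp (- pi * s\<^sup>2))"
proof -
  have "integrable lborel (\<lambda>s. std_normal_density (0 + sqrt (2 * pi) * s))"
    by (rule lborel_integrable_real_affine[of std_normal_density]) auto
  from integrable_mult_right[OF this, of "sqrt (2 * pi)"]
  have "integrable lborel (\<lambda>s. sqrt (2 * pi) * std_normal_density (0 + sqrt (2 * pi) * s))" .
  moreover have "sqrt (2 * pi) * std_normal_density (0 + sqrt (2 * pi) * s) = exp (- pi * s\<^sup>2)" for s
    unfolding std_normal_density_def by (simp add: power_mult_distrib)
  ultimately show ?thesis by (simp only:)
qed

lemma cis_sum: "cis (sum f A) = (\<Prod>i\<in>A. cis (f i))"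
  by (induction A rule: infinite_finite_induct) (auto simp: cis_mult[symmetric])

lemma norm2_cart: "(norm (x :: real^3))\<^sup>2 = (\<Sum>k\<in>UNIV. (x $ k)\<^sup>2)"
  unfolding power2_norm_eq_inner inner_vec_def by (simp add: power2_eq_square)

lemma fourier_gauss:
  "fourier (\<lambda>x. complex_of_real (exp (- pi * (norm x)\<^sup>2))) \<eta> = complex_of_real (exp (- pi * (norm \<eta>)\<^sup>2))"
proof -
  let ?f = "\<lambda>k s. cis (- 2 * pi * (s * \<eta> $ k)) * complex_of_real (exp (- pi * s\<^sup>2))"
  have e: "complex_of_real (exp (- pi * (norm x)\<^sup>2)) = (\<Prod>k\<in>UNIV. complex_of_real (exp (- pi * (x $ k)\<^sup>2)))" for x :: "real^3"
    unfolding norm2_cart sum_distrib_left by (simp add: exp_sum)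
  have "fourier (\<lambda>x. complex_of_real (exp (- pi * (norm x)\<^sup>2))) \<eta> = (LINT x|lborel. (\<Prod>k\<in>UNIV. ?f k (x $ k)))"
    unfolding fourier_def e inner_vec_def sum_distrib_left cis_sum by (simp add: prod.distrib)
  also have "\<dots> = (\<Prod>k\<in>UNIV. LINT s|lborel. ?f k s)"
  proof (rule integral_prod_cart)
    fix k
    show "integrable lborel (?f k)"
      by (rule Bochner_Integration.integrable_bound[OF integrable_gauss_real]) (auto simp: norm_mult)
  qed
  also have "\<dots> = complex_of_real (exp (- pi * (norm \<eta>)\<^sup>2))"
    unfolding fourier_gauss_real e ..
  finally show ?thesis .
qed

lemma integrable_gauss:
  assumes "c > 0" shows "integrable lborel (\<lambda>x::real^3. complex_of_real (exp (- pi * (norm (c *\<^sub>R x))\<^sup>2)))"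
proof -
  have "integrable lborel (\<lambda>x::real^3. complex_of_real (exp (- (norm ((sqrt pi * c) *\<^sub>R x + 0))\<^sup>2)))"
    using integrable_affine[OF schwartz_integrable[OF schwartz_gauss], of "sqrt pi * c" 0] assms by auto
  then show ?thesis by (simp add: power_mult_distrib mult.assoc)
qed

text \<open>Gaussian summation. The inversion integral is damped by a Gaussian of width 1 /
  \<open>h n\<close>; the multiplication formula turns it into an average of \<open>\<phi>\<close>
  around \<open>x\<close> at scale \<open>h n\<close>. As \<open>h n\<close> tends to 0, dominated
  convergence removes the damping on one side and concentrates the average on the other.\<close>

lemma fourier_fourier:
  assumes "schwartz \<phi>" shows "fourier (fourier \<phi>) (- x) = \<phi> x"
proof -
  define h where "h n = inverse (real (Suc n))" for n
  have h: "h n > 0" for n by (simp add: h_def)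
  have h0: "h \<longlonglongrightarrow> 0" unfolding h_def by (rule LIMSEQ_inverse_real_of_nat)
  let ?G = "\<lambda>x::real^3. complex_of_real (exp (- pi * (norm x)\<^sup>2))"
  have Gi: "integrable lborel (\<lambda>x. ?G x)" using integrable_gauss[of 1] by simp
  obtain B where B: "\<And>x. norm (\<phi> x) \<le> B" using schwartz_bounded[OF assms] by blast
  have [measurable]: "\<phi> \<in> borel_measurable borel" "fourier \<phi> \<in> borel_measurable borel"
    using assms schwartz_fourier schwartz_measurable by blast+
  have eq: "(LINT \<xi>|lborel. fourier \<phi> \<xi> * (cis (2 * pi * (\<xi> \<bullet> x)) * ?G (h n *\<^sub>R \<xi>)))
     = (LINT z|lborel. \<phi> (h n *\<^sub>R z + x) * ?G z)" for n
  proof -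
    let ?m = "\<lambda>\<xi>. cis (2 * pi * (\<xi> \<bullet> x)) * ?G (h n *\<^sub>R \<xi>)"
    have mi: "integrable lborel ?m" by (intro integrable_cis_mult integrable_gauss h)
    \<comment> \<open>The transform of the damped exponential is a Gaussian centred at
      \<open>x\<close> of width \<open>h n\<close>. The factor \<open>h n\<close> to the power -3 is
      undone below by the substitution y = h z + x.\<close>
    have m: "fourier ?m (h n *\<^sub>R z + x) = inverse (h n ^ 3) *\<^sub>R ?G z" for z
    proof -
      have "fourier ?G z = (h n ^ 3) *\<^sub>R (LINT \<xi>|lborel. cis (- 2 * pi * ((h n *\<^sub>R \<xi>) \<bullet> z)) * ?G (h n *\<^sub>R \<xi>))"
        unfolding fourier_def using integral_affine[of "\<lambda>\<xi>. cis (- 2 * pi * (\<xi> \<bullet> z)) * ?G \<xi>" "h n" 0] h[of n] by simp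
      moreover have "cis (- 2 * pi * ((h n *\<^sub>R \<xi>) \<bullet> z)) * ?G (h n *\<^sub>R \<xi>) = cis (- 2 * pi * (\<xi> \<bullet> (h n *\<^sub>R z + x))) * ?m \<xi>" for \<xi>
        by (simp add: cis_mult inner_add_right algebra_simps)
      ultimately have "?G z = (h n ^ 3) *\<^sub>R fourier ?m (h n *\<^sub>R z + x)"
        unfolding fourier_gauss fourier_def by (simp add: mult.assoc)
      then show ?thesis using h[of n] by simp
    qed
    have "(LINT \<xi>|lborel. fourier \<phi> \<xi> * ?m \<xi>) = (LINT y|lborel. \<phi> y * fourier ?m y)"
      by (rule fourier_transfer[symmetric]) (rule schwartz_integrable[OF assms], rule mi)
    also have "\<dots> = (h n ^ 3) *\<^sub>R (LINT z|lborel. \<phi> (h n *\<^sub>R z + x) * fourier ?m (h n *\<^sub>R z + x))"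
    proof -
      have "(\<lambda>y. fourier ?m y) \<in> borel_measurable borel"
        unfolding fourier_def using borel_measurable_integrable[OF mi] by measurable
      then show ?thesis
        using integral_affine[of "\<lambda>y. \<phi> y * fourier ?m y" "h n" x] h[of n] by simp
    qed
    also have "\<dots> = (LINT z|lborel. \<phi> (h n *\<^sub>R z + x) * ?G z)"
      unfolding m using h[of n] by (simp add: mult_scaleR_right)
    finally show ?thesis .
  qed
  have lim1: "(\<lambda>n. LINT \<xi>|lborel. fourier \<phi> \<xi> * (cis (2 * pi * (\<xi> \<bullet> x)) * ?G (h n *\<^sub>R \<xi>)))
     \<longlonglongrightarrow> (LINT \<xi>|lborel. fourier \<phi> \<xi> * (cis (2 * pi * (\<xi> \<bullet> x)) * ?G (0 *\<^sub>R \<xi>)))"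
  proof (rule integral_dominated_convergence[where w="\<lambda>\<xi>. norm (fourier \<phi> \<xi>)"])
    show "integrable lborel (\<lambda>\<xi>. norm (fourier \<phi> \<xi>))"
      by (intro integrable_norm schwartz_integrable schwartz_fourier assms)
    show "AE \<xi> in lborel. (\<lambda>n. fourier \<phi> \<xi> * (cis (2 * pi * (\<xi> \<bullet> x)) * ?G (h n *\<^sub>R \<xi>)))
        \<longlonglongrightarrow> fourier \<phi> \<xi> * (cis (2 * pi * (\<xi> \<bullet> x)) * ?G (0 *\<^sub>R \<xi>))"
      by (intro AE_I2 tendsto_intros h0)
    show "AE \<xi> in lborel. norm (fourier \<phi> \<xi> * (cis (2 * pi * (\<xi> \<bullet> x)) * ?G (h n *\<^sub>R \<xi>))) \<le> norm (fourier \<phi> \<xi>)" for n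
      by (auto simp: norm_mult mult_left_le)
  qed measurable
  have lim2: "(\<lambda>n. LINT z|lborel. \<phi> (h n *\<^sub>R z + x) * ?G z) \<longlonglongrightarrow> (LINT z|lborel. \<phi> (0 *\<^sub>R z + x) * ?G z)"
  proof (rule integral_dominated_convergence[where w="\<lambda>z. B * norm (?G z)"])
    show "integrable lborel (\<lambda>z. B * norm (?G z))" using Gi by (intro integrable_mult_right integrable_norm)
    have "isCont \<phi> (0 *\<^sub>R z + x)" for z
      using schwartz_differentiable[OF assms] differentiable_imp_continuous_within by blast
    then show "AE z in lborel. (\<lambda>n. \<phi> (h n *\<^sub>R z + x) * ?G z) \<longlonglongrightarrow> \<phi> (0 *\<^sub>R z + x) * ?G z"
      by (intro AE_I2 tendsto_mult tendsto_const isCont_tendsto_compose[of _ \<phi>] tendsto_intros h0)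
    show "AE z in lborel. norm (\<phi> (h n *\<^sub>R z + x) * ?G z) \<le> B * norm (?G z)" for n
      by (auto simp: norm_mult intro!: AE_I2 mult_right_mono B)
  qed measurable
  have G1: "(LINT z|lborel. ?G z) = 1"
    using fourier_gauss[of 0] by (simp add: fourier_def)
  have "(LINT \<xi>|lborel. fourier \<phi> \<xi> * (cis (2 * pi * (\<xi> \<bullet> x)) * ?G (0 *\<^sub>R \<xi>))) = (LINT z|lborel. \<phi> (0 *\<^sub>R z + x) * ?G z)"
    using LIMSEQ_unique[OF lim1[unfolded eq] lim2] .
  also have "\<dots> = \<phi> x" using G1 by simp
  finally show ?thesis by (simp add: fourier_def mult.commute)
qed

lemma fourier_reflect:
  assumes [measurable]: "f \<in> borel_measurable borel"
  shows "fourier (\<lambda>x. f (- x)) \<xi> = fourier f (- \<xi>)"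
  unfolding fourier_def
  using integral_affine[of "\<lambda>x. cis (- 2 * pi * (x \<bullet> - \<xi>)) * f x" "-1" 0] by simp

lemma schwartz_reflect: "schwartz f \<Longrightarrow> schwartz (\<lambda>x. f (- x))"
  using schwartz_affine[of f "-1" 0] by simp

lemma schwartz_translate: "schwartz f \<Longrightarrow> schwartz (\<lambda>x. f (x + b))"
  using schwartz_affine[of f 1 b] by simp

lemma fourier_surj:
  assumes "schwartz \<psi>" obtains \<phi> where "schwartz \<phi>" "fourier \<phi> = \<psi>"
proof
  show "schwartz (\<lambda>x. fourier \<psi> (- x))" by (intro schwartz_reflect schwartz_fourier assms)
  show "fourier (\<lambda>x. fourier \<psi> (- x)) = \<psi>"
    by (rule ext) (simp add: fourier_reflect schwartz_measurable schwartz_fourier assms fourier_fourier[OF assms])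
qed

lemma fourier_cnj: "fourier (\<lambda>x. cnj (f x)) \<xi> = cnj (fourier f (- \<xi>))"
  unfolding fourier_def by (simp add: cis_cnj flip: Bochner_Integration.integral_cnj)

text \<open>The multiplication formula paired with the conjugate of the transform, whose own
  transform is the conjugate of \<open>\<phi>\<close> by inversion.\<close>

lemma plancherel_schwartz:
  assumes "schwartz \<phi>"
  shows "(LINT \<xi>|lborel. (norm (fourier \<phi> \<xi>))\<^sup>2) = (LINT x|lborel. (norm (\<phi> x))\<^sup>2)"
proof -
  let ?\<psi> = "\<lambda>\<xi>. cnj (fourier \<phi> \<xi>)"
  have sF: "schwartz (fourier \<phi>)" using schwartz_fourier assms by blast
  have "fourier ?\<psi> x = cnj (\<phi> x)" for x
    unfolding fourier_cnj using fourier_fourier[OF assms] by simp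
  then have "(LINT x|lborel. \<phi> x * cnj (\<phi> x)) = (LINT x|lborel. fourier \<phi> x * ?\<psi> x)"
    using fourier_transfer[of \<phi> ?\<psi>] schwartz_integrable[OF assms] schwartz_integrable[OF schwartz_cnj[OF sF]] by simp
  then have "complex_of_real (LINT x|lborel. (norm (\<phi> x))\<^sup>2) = complex_of_real (LINT x|lborel. (norm (fourier \<phi> x))\<^sup>2)"
    by (simp only: complex_norm_square[symmetric] integral_complex_of_real)
  then show ?thesis by (simp only: of_real_eq_iff)
qed

section \<open>Square-integrable functions\<close>

text \<open>Induction over the sigma-algebra generated by boxes. Keeping the approximants between 0
  and 1 and zero off the fixed box lets complements and unions be imitated by products of test
  functions. The measure is general because Lebesgue measure, |f| dx and the weight |xi|^2 are all
  needed.\<close>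

lemma approx_indicator:
  fixes M :: "(real^3) measure"
  assumes sets: "sets M = sets borel" and fin: "emeasure M (box a b) < \<infinity>"
    and A: "A \<in> sets borel" and e: "(e::real) > 0"
  shows "\<exists>\<psi>. test_function \<psi> \<and> (\<forall>x. 0 \<le> \<psi> x \<and> \<psi> x \<le> 1) \<and> (\<forall>x. x \<notin> box a b \<longrightarrow> \<psi> x = 0) \<and>
    (\<integral>\<^sup>+x. ennreal \<bar>indicator (A \<inter> box a b) x - \<psi> x\<bar> \<partial>M) < ennreal e"
    (is "?P A e")
proof -
  note [measurable_cong] = sets
  have tf_meas: "test_function \<psi> \<Longrightarrow> \<psi> \<in> borel_measurable borel" for \<psi>
    unfolding test_function_iff using borel_measurable_continuous_onI smooth_continuous by blast
  have box: "?P (box c d) e" if e: "e > 0" for c d and e :: real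
  proof -
    obtain c' d' where cd: "box c d \<inter> box a b = box c' d'" using box_Int_box by blast
    let ?\<psi> = "\<lambda>n. box_bump (real (Suc n)) c' d'"
    have sub: "box c' d' \<subseteq> box a b" using cd by auto
    have [measurable]: "?\<psi> n \<in> borel_measurable M" for n
      using tf_meas[OF box_bump_test_function[of "real (Suc n)"]] by simp
    have "(\<lambda>n. \<integral>\<^sup>+x. ennreal \<bar>indicator (box c' d') x - ?\<psi> n x\<bar> \<partial>M) \<longlonglongrightarrow> (\<integral>\<^sup>+x. 0 \<partial>M)"
    proof (rule nn_integral_dominated_convergence[where w="\<lambda>x. indicator (box a b) x"])
      show "AE x in M. ennreal \<bar>indicator (box c' d') x - ?\<psi> n x\<bar> \<le> indicator (box a b) x" for n
        using box_bump_bounds[of "real (Suc n)" c' d'] box_bump_outside[of "real (Suc n)" _ c' d'] sub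
        by (intro AE_I2) (auto simp: indicator_def abs_le_iff)
      show "(\<integral>\<^sup>+x. indicator (box a b) x \<partial>M) < \<infinity>" using fin by (simp add: sets)
      show "AE x in M. (\<lambda>n. ennreal \<bar>indicator (box c' d') x - ?\<psi> n x\<bar>) \<longlonglongrightarrow> 0"
      proof (intro AE_I2)
        fix x
        have "(\<lambda>n. ennreal \<bar>indicator (box c' d') x - ?\<psi> n x\<bar>) \<longlonglongrightarrow> ennreal \<bar>indicator (box c' d') x - indicator (box c' d') x\<bar>"
          by (intro tendsto_intros box_bump_tendsto)
        then show "(\<lambda>n. ennreal \<bar>indicator (box c' d') x - ?\<psi> n x\<bar>) \<longlonglongrightarrow> 0" by simp
      qed
    qed measurable
    then have "\<forall>\<^sub>F n in sequentially. (\<integral>\<^sup>+x. ennreal \<bar>indicator (box c' d') x - ?\<psi> n x\<bar> \<partial>M) < ennreal e"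
      by (rule order_tendstoD) (use e in simp)
    then obtain n where "(\<integral>\<^sup>+x. ennreal \<bar>indicator (box c' d') x - ?\<psi> n x\<bar> \<partial>M) < ennreal e"
      by (auto simp: eventually_sequentially)
    then show ?thesis
      unfolding cd using box_bump_bounds subsetD[OF sub]
      by (intro exI[of _ "?\<psi> n"] conjI allI impI box_bump_test_function box_bump_outside) auto
  qed
  have combine: "?P A e" if meas: "A \<in> sets borel" and e: "e > 0" and
      \<psi>: "test_function \<psi>" "\<And>x. 0 \<le> \<psi> x \<and> \<psi> x \<le> 1" "\<And>x. x \<notin> box a b \<Longrightarrow> \<psi> x = 0" and
      f: "f \<in> borel_measurable M" "(\<integral>\<^sup>+x. ennreal (f x) \<partial>M) < ennreal (e / 2)" "\<And>x. f x \<ge> 0" and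
      g: "g \<in> borel_measurable M" "(\<integral>\<^sup>+x. ennreal (g x) \<partial>M) < ennreal (e / 2)" "\<And>x. g x \<ge> 0" and
      le: "\<And>x. \<bar>indicator (A \<inter> box a b) x - \<psi> x\<bar> \<le> f x + g x"
    for A and e :: real and \<psi> and f g :: "real^3 \<Rightarrow> real"
  proof -
    have "(\<integral>\<^sup>+x. ennreal \<bar>indicator (A \<inter> box a b) x - \<psi> x\<bar> \<partial>M) \<le> (\<integral>\<^sup>+x. ennreal (f x) + ennreal (g x) \<partial>M)"
      using le f(3) g(3) by (intro nn_integral_mono) (simp flip: ennreal_plus)
    also have "\<dots> = (\<integral>\<^sup>+x. ennreal (f x) \<partial>M) + (\<integral>\<^sup>+x. ennreal (g x) \<partial>M)"
      using f(1) g(1) by (intro nn_integral_add) auto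
    also have "\<dots> < ennreal (e / 2) + ennreal (e / 2)" using f(2) g(2) by (rule add_strict_mono)
    also have "\<dots> = ennreal e" using e by (simp flip: ennreal_plus)
    finally show ?thesis using \<psi> by blast
  qed
  have union: "?P (A \<union> B) e" if meas: "A \<in> sets borel" "B \<in> sets borel" and e: "e > 0"
    and IH: "\<And>e. e > 0 \<Longrightarrow> ?P A e" "\<And>e. e > 0 \<Longrightarrow> ?P B e" for A B and e :: real
  proof -
    from IH(1)[of "e / 2"] e obtain \<psi> where \<psi>: "test_function \<psi>" "\<And>x. 0 \<le> \<psi> x \<and> \<psi> x \<le> 1" "\<And>x. x \<notin> box a b \<Longrightarrow> \<psi> x = 0"
      "(\<integral>\<^sup>+x. ennreal \<bar>indicator (A \<inter> box a b) x - \<psi> x\<bar> \<partial>M) < ennreal (e / 2)" by auto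
    from IH(2)[of "e / 2"] e obtain \<eta> where \<eta>: "test_function \<eta>" "\<And>x. 0 \<le> \<eta> x \<and> \<eta> x \<le> 1" "\<And>x. x \<notin> box a b \<Longrightarrow> \<eta> x = 0"
      "(\<integral>\<^sup>+x. ennreal \<bar>indicator (B \<inter> box a b) x - \<eta> x\<bar> \<partial>M) < ennreal (e / 2)" by auto
    have [measurable]: "\<psi> \<in> borel_measurable M" "\<eta> \<in> borel_measurable M" "A \<in> sets M" "B \<in> sets M"
      using tf_meas \<psi>(1) \<eta>(1) meas sets by (simp_all)
    \<comment> \<open>The smooth counterpart of a union, 1 - (1 - \<open>\<psi>\<close>)(1 -
      \<open>\<eta>\<close>); a plain sum would exceed 1 on the overlap.\<close>
    let ?\<theta> = "\<lambda>x. \<psi> x + \<eta> x + (- 1) * (\<psi> x * \<eta> x)"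
    show ?thesis
    proof (rule combine[where \<psi>="?\<theta>" and f="\<lambda>x. \<bar>indicator (A \<inter> box a b) x - \<psi> x\<bar>" and g="\<lambda>x. \<bar>indicator (B \<inter> box a b) x - \<eta> x\<bar>"])
      have "smooth ?\<theta>" using \<psi>(1) \<eta>(1) unfolding test_function_iff by (intro smooth_add smooth_mult smooth_const) auto
      moreover have "bounded {x. ?\<theta> x \<noteq> 0}"
        by (rule bounded_subset[OF bounded_box[of a b]], rule subsetI, rule ccontr) (simp add: \<psi>(3) \<eta>(3))
      ultimately show "test_function ?\<theta>" unfolding test_function_iff by blast
      have *: "?\<theta> x = 1 - (1 - \<psi> x) * (1 - \<eta> x)" for x by (simp add: algebra_simps)
      show "0 \<le> ?\<theta> x \<and> ?\<theta> x \<le> 1" for x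
        unfolding * using \<psi>(2)[of x] \<eta>(2)[of x] by (auto intro: mult_le_one)
      show "?\<theta> x = 0" if "x \<notin> box a b" for x using \<psi>(3) \<eta>(3) that by simp
      show "\<bar>indicator ((A \<union> B) \<inter> box a b) x - ?\<theta> x\<bar> \<le> \<bar>indicator (A \<inter> box a b) x - \<psi> x\<bar> + \<bar>indicator (B \<inter> box a b) x - \<eta> x\<bar>" for x
      proof -
        have p: "0 \<le> \<psi> x" "\<psi> x \<le> 1" "0 \<le> \<eta> x" "\<eta> x \<le> 1" using \<psi>(2) \<eta>(2) by auto
        have q: "(1 - \<psi> x) * (1 - \<eta> x) \<le> 1 - \<psi> x" "(1 - \<psi> x) * (1 - \<eta> x) \<le> 1 - \<eta> x" "0 \<le> (1 - \<psi> x) * (1 - \<eta> x)"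
          using p mult_left_le[of "1 - \<eta> x" "1 - \<psi> x"] mult_left_le[of "1 - \<psi> x" "1 - \<eta> x"] by (auto simp: mult.commute)
        have r: "0 \<le> \<psi> x * \<eta> x" using p by simp
        consider "x \<notin> box a b" | "x \<in> box a b" "x \<in> A" | "x \<in> box a b" "x \<in> B" | "x \<in> box a b" "x \<notin> A" "x \<notin> B" by blast
        then show ?thesis
        proof cases
          case 1 then show ?thesis using \<psi>(3) \<eta>(3) by simp
        next
          case 2 then show ?thesis unfolding * using p q by simp
        next
          case 3 then show ?thesis unfolding * using p q by simp
        next
          case 4 then show ?thesis using p r unfolding * using q by (simp add: algebra_simps)
        qed
      qed
    qed (use e meas \<psi> \<eta> in auto)
  qed
  have "A \<in> sigma_sets UNIV (range (\<lambda>(a, b). box a b))"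
    using A unfolding borel_eq_box by (simp add: sets_measure_of)
  then have "A \<in> sets borel \<and> (\<forall>e>0. ?P A e)"
  proof (induction rule: sigma_sets.induct)
    case (Basic A)
    then show ?case using box by auto
  next
    case Empty
    have "test_function (\<lambda>x. 0)" unfolding test_function_iff by (simp add: smooth_const)
    then show ?case by (auto intro!: exI[of _ "\<lambda>x. 0"])
  next
    case (Compl A)
    then have meas: "A \<in> sets borel" by blast
    have "?P (UNIV - A) e" if e: "e > 0" for e :: real
    proof -
      from Compl e obtain \<psi> where \<psi>: "test_function \<psi>" "\<And>x. 0 \<le> \<psi> x \<and> \<psi> x \<le> 1" "\<And>x. x \<notin> box a b \<Longrightarrow> \<psi> x = 0"
        "(\<integral>\<^sup>+x. ennreal \<bar>indicator (A \<inter> box a b) x - \<psi> x\<bar> \<partial>M) < ennreal (e / 2)" by (meson half_gt_zero)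
      from box[of "e / 2" a b] e obtain \<eta> where \<eta>: "test_function \<eta>" "\<And>x. 0 \<le> \<eta> x \<and> \<eta> x \<le> 1" "\<And>x. x \<notin> box a b \<Longrightarrow> \<eta> x = 0"
        "(\<integral>\<^sup>+x. ennreal \<bar>indicator (box a b) x - \<eta> x\<bar> \<partial>M) < ennreal (e / 2)" by auto
      have [measurable]: "\<psi> \<in> borel_measurable M" "\<eta> \<in> borel_measurable M" "A \<in> sets M"
        using tf_meas \<psi>(1) \<eta>(1) meas sets by (simp_all)
      \<comment> \<open>The complement is taken relative to the box. The constant 1 is not a test
        function, so \<open>\<eta>\<close>, an approximation of the indicator of the box, stands in
        for it.\<close>
      let ?\<theta> = "\<lambda>x. \<eta> x * (1 + (- 1) * \<psi> x)"
      show ?thesis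
      proof (rule combine[where \<psi>="?\<theta>" and f="\<lambda>x. \<bar>indicator (A \<inter> box a b) x - \<psi> x\<bar>" and g="\<lambda>x. \<bar>indicator (box a b) x - \<eta> x\<bar>"])
        have "smooth ?\<theta>" using \<psi>(1) \<eta>(1) unfolding test_function_iff by (intro smooth_add smooth_mult smooth_const) auto
        moreover have "bounded {x. ?\<theta> x \<noteq> 0}"
          by (rule bounded_subset[OF bounded_box[of a b]], rule subsetI, rule ccontr) (simp add: \<psi>(3) \<eta>(3))
        ultimately show "test_function ?\<theta>" unfolding test_function_iff by blast
        show "0 \<le> ?\<theta> x \<and> ?\<theta> x \<le> 1" for x
          using \<psi>(2)[of x] \<eta>(2)[of x] by (auto intro: mult_le_one)
        show "?\<theta> x = 0" if "x \<notin> box a b" for x using \<eta>(3) that by simp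
        show "\<bar>indicator ((UNIV - A) \<inter> box a b) x - ?\<theta> x\<bar> \<le> \<bar>indicator (A \<inter> box a b) x - \<psi> x\<bar> + \<bar>indicator (box a b) x - \<eta> x\<bar>" for x
        proof -
          have p: "0 \<le> \<psi> x" "\<psi> x \<le> 1" "0 \<le> \<eta> x" "\<eta> x \<le> 1" using \<psi>(2) \<eta>(2) by auto
          have q: "\<eta> x * (1 - \<psi> x) \<le> 1 - \<psi> x" "0 \<le> \<eta> x * (1 - \<psi> x)" "(1 - \<eta> x) * \<psi> x \<ge> 0"
            using p mult_right_mono[of "\<eta> x" 1 "1 - \<psi> x"] by auto
          consider "x \<notin> box a b" | "x \<in> box a b" "x \<in> A" | "x \<in> box a b" "x \<notin> A" by blast
          then show ?thesis
          proof cases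
            case 1 then show ?thesis using \<psi>(3) \<eta>(3) by simp
          next
            case 2 then show ?thesis using p q by simp
          next
            case 3 
            have "1 - \<eta> x * (1 - \<psi> x) \<le> \<psi> x + (1 - \<eta> x)" using q(3) by (simp add: algebra_simps)
            then show ?thesis using 3 p q by simp
          qed
        qed
      qed (use e meas \<psi> \<eta> in auto)
    qed
    then show ?case using meas by auto
  next
    case (Union F)
    define S where "S n = (\<Union>i<n. F i)" for n :: nat
    have measF: "F i \<in> sets borel" for i using Union by blast
    then have measS: "S n \<in> sets borel" for n unfolding S_def by auto
    have PS: "\<forall>e>0. ?P (S n) e" for n
    proof (induction n)
      case 0
      have "test_function (\<lambda>x. 0)" unfolding test_function_iff by (simp add: smooth_const)
      then show ?case by (auto simp: S_def intro!: exI[of _ "\<lambda>x. 0"])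
    next
      case (Suc n)
      have "S (Suc n) = S n \<union> F n" unfolding S_def by (auto simp: less_Suc_eq)
      have PF: "\<forall>e>0. ?P (F n) e" using Union by blast
      show ?case unfolding \<open>S (Suc n) = S n \<union> F n\<close>
        by (intro allI impI union[OF measS measF _ Suc.IH[rule_format] PF[rule_format]])
    qed
    have "?P (\<Union>i. F i) e" if e: "e > 0" for e :: real
    proof -
      \<comment> \<open>The part of the countable union missed by the first \<open>n\<close> sets.
        Its mass in the box tends to 0 by dominated convergence, as the box has finite
        measure.\<close>
      let ?d = "\<lambda>n x. indicator (((\<Union>i. F i) - S n) \<inter> box a b) x :: real"
      have [measurable]: "S n \<in> sets M" "F n \<in> sets M" for n using measS measF sets by auto
      have "(\<lambda>n. \<integral>\<^sup>+x. ennreal (?d n x) \<partial>M) \<longlonglongrightarrow> (\<integral>\<^sup>+x. 0 \<partial>M)"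
      proof (rule nn_integral_dominated_convergence[where w="\<lambda>x. indicator (box a b) x"])
        show "(\<integral>\<^sup>+x. indicator (box a b) x \<partial>M) < \<infinity>" using fin by (simp add: sets)
        show "AE x in M. (\<lambda>n. ennreal (?d n x)) \<longlonglongrightarrow> 0"
        proof (intro AE_I2 tendsto_eventually)
          fix x
          show "\<forall>\<^sub>F n in sequentially. ennreal (?d n x) = 0"
          proof (cases "x \<in> (\<Union>i. F i)")
            case True
            then obtain i where "x \<in> F i" by blast
            then have "x \<in> S n" if "n \<ge> Suc i" for n using that unfolding S_def by force
            then show ?thesis unfolding eventually_sequentially by (intro exI[of _ "Suc i"]) auto
          qed simp
        qed
      qed (auto simp: indicator_def)
      then have "\<forall>\<^sub>F n in sequentially. (\<integral>\<^sup>+x. ennreal (?d n x) \<partial>M) < ennreal (e / 2)"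
        by (rule order_tendstoD) (use e in simp)
      then obtain n where n: "(\<integral>\<^sup>+x. ennreal (?d n x) \<partial>M) < ennreal (e / 2)"
        by (auto simp: eventually_sequentially)
      from PS[of n] e obtain \<psi> where \<psi>: "test_function \<psi>" "\<And>x. 0 \<le> \<psi> x \<and> \<psi> x \<le> 1" "\<And>x. x \<notin> box a b \<Longrightarrow> \<psi> x = 0"
        "(\<integral>\<^sup>+x. ennreal \<bar>indicator (S n \<inter> box a b) x - \<psi> x\<bar> \<partial>M) < ennreal (e / 2)" by (meson half_gt_zero)
      have [measurable]: "\<psi> \<in> borel_measurable M" using tf_meas \<psi>(1) by simp
      show ?thesis
      proof (rule combine[where \<psi>=\<psi> and f="?d n" and g="\<lambda>x. \<bar>indicator (S n \<inter> box a b) x - \<psi> x\<bar>"])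
        have "S n \<subseteq> (\<Union>i. F i)" unfolding S_def by auto
        then show "\<bar>indicator ((\<Union>i. F i) \<inter> box a b) x - \<psi> x\<bar> \<le> ?d n x + \<bar>indicator (S n \<inter> box a b) x - \<psi> x\<bar>" for x
          using \<psi>(2)[of x] by (auto simp: indicator_def)
      qed (use e measF \<psi> n in auto)
    qed
    then show ?case using measF by auto
  qed
  then show ?thesis using e by blast
qed

section \<open>The squared L2 norm\<close>

text \<open>The measure is a parameter so that the homogeneous and the inhomogeneous Sobolev norms
  become instances on the Fourier side, with weighted measures.\<close>

definition sqint :: "'a measure \<Rightarrow> ('a \<Rightarrow> 'b::real_normed_vector) \<Rightarrow> ennreal"
  where "sqint M f = (\<integral>\<^sup>+x. ennreal ((norm (f x))\<^sup>2) \<partial>M)"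

lemma sum_sq_le: "((a::real) + b)\<^sup>2 \<le> 2 * a\<^sup>2 + 2 * b\<^sup>2"
  using sum_squares_bound[of a b] by (simp add: power2_sum)

text \<open>The triangle inequality in squared form. The loss of a factor 2 is harmless and square
  roots of extended reals are avoided.\<close>

lemma sqint_add_le:
  fixes f g :: "'a \<Rightarrow> 'b::{real_normed_vector, second_countable_topology}"
  assumes [measurable]: "f \<in> borel_measurable M" "g \<in> borel_measurable M"
  shows "sqint M (\<lambda>x. f x + g x) \<le> 2 * sqint M f + 2 * sqint M g"
proof -
  have "sqint M (\<lambda>x. f x + g x) \<le> (\<integral>\<^sup>+x. 2 * ennreal ((norm (f x))\<^sup>2) + 2 * ennreal ((norm (g x))\<^sup>2) \<partial>M)"
    unfolding sqint_def
  proof (intro nn_integral_mono)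
    fix x
    have "(norm (f x + g x))\<^sup>2 \<le> (norm (f x) + norm (g x))\<^sup>2" by (intro power_mono norm_triangle_ineq) simp
    also have "\<dots> \<le> 2 * (norm (f x))\<^sup>2 + 2 * (norm (g x))\<^sup>2" by (rule sum_sq_le)
    finally have "ennreal ((norm (f x + g x))\<^sup>2) \<le> ennreal (2 * (norm (f x))\<^sup>2 + 2 * (norm (g x))\<^sup>2)"
      by (rule ennreal_leI)
    then show "ennreal ((norm (f x + g x))\<^sup>2) \<le> 2 * ennreal ((norm (f x))\<^sup>2) + 2 * ennreal ((norm (g x))\<^sup>2)"
      by (simp add: ennreal_plus ennreal_mult')
  qed
  also have "\<dots> = 2 * sqint M f + 2 * sqint M g"
    unfolding sqint_def by (simp add: nn_integral_add nn_integral_cmult)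
  finally show ?thesis .
qed

lemma sqint_uminus: "sqint M (\<lambda>x. - f x) = sqint M f"
  by (simp add: sqint_def)

lemma sqint_diff_le:
  fixes f g :: "'a \<Rightarrow> 'b::{real_normed_vector, second_countable_topology}"
  assumes [measurable]: "f \<in> borel_measurable M" "g \<in> borel_measurable M"
  shows "sqint M (\<lambda>x. f x - g x) \<le> 2 * sqint M f + 2 * sqint M g"
  using sqint_add_le[of f M "\<lambda>x. - g x"] by (simp add: sqint_uminus)

lemma sqint_commute: "sqint M (\<lambda>x. f x - g x) = sqint M (\<lambda>x. g x - f x)"
  by (simp add: sqint_def norm_minus_commute)

lemma sqint_triangle:
  fixes f g :: "'a \<Rightarrow> 'b::{real_normed_vector, second_countable_topology}"
  assumes [measurable]: "f \<in> borel_measurable M" "g \<in> borel_measurable M" "h \<in> borel_measurable M"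
  shows "sqint M (\<lambda>x. f x - h x) \<le> 2 * sqint M (\<lambda>x. f x - g x) + 2 * sqint M (\<lambda>x. g x - h x)"
  using sqint_add_le[of "\<lambda>x. f x - g x" M "\<lambda>x. g x - h x"] by simp

lemma sqint_cong_AE: "AE x in M. norm (f x) = norm (g x) \<Longrightarrow> sqint M f = sqint M g"
  unfolding sqint_def by (rule nn_integral_cong_AE) auto

lemma sqint_cmult:
  fixes f :: "'a \<Rightarrow> complex"
  assumes [measurable]: "f \<in> borel_measurable M"
  shows "sqint M (\<lambda>x. c * f x) = ennreal ((norm c)\<^sup>2) * sqint M f"
  unfolding sqint_def by (simp add: norm_mult power_mult_distrib ennreal_mult nn_integral_cmult)

lemma ennreal_two_less_top: "a < \<top> \<Longrightarrow> b < \<top> \<Longrightarrow> 2 * a + 2 * b < (\<top>::ennreal)"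
  by (simp add: ennreal_mult_less_top)

lemma sqint_add_finite:
  fixes f g :: "'a \<Rightarrow> 'b::{real_normed_vector, second_countable_topology}"
  assumes "f \<in> borel_measurable M" "g \<in> borel_measurable M" "sqint M f < \<infinity>" "sqint M g < \<infinity>"
  shows "sqint M (\<lambda>x. f x + g x) < \<infinity>" "sqint M (\<lambda>x. f x - g x) < \<infinity>"
  using assms(3,4) ennreal_two_less_top unfolding infinity_ennreal_def
  by (blast intro: order.strict_trans1[OF sqint_add_le[OF assms(1,2)]] order.strict_trans1[OF sqint_diff_le[OF assms(1,2)]])+

lemma nn_integral_mult_sqint:
  fixes f g :: "'a \<Rightarrow> 'b::{real_normed_algebra, second_countable_topology}"
  assumes [measurable]: "f \<in> borel_measurable M" "g \<in> borel_measurable M"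
  shows "(\<integral>\<^sup>+x. ennreal (norm (f x) * norm (g x)) \<partial>M)\<^sup>2 \<le> sqint M f * sqint M g"
  using Cauchy_Schwarz_nn_integral[of "\<lambda>x. ennreal (norm (f x))" M "\<lambda>x. ennreal (norm (g x))"]
  by (simp add: sqint_def ennreal_mult ennreal_power)

lemma integrable_mult_sqint:
  fixes f g :: "'a \<Rightarrow> complex"
  assumes [measurable]: "f \<in> borel_measurable M" "g \<in> borel_measurable M"
    and fin: "sqint M f < \<infinity>" "sqint M g < \<infinity>"
  shows "integrable M (\<lambda>x. f x * g x)"
    and "ennreal (norm (LINT x|M. f x * g x))^2 \<le> sqint M f * sqint M g"
proof -
  have "(\<integral>\<^sup>+x. ennreal (norm (f x * g x)) \<partial>M)\<^sup>2 \<le> sqint M f * sqint M g"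
    using nn_integral_mult_sqint[OF assms(1,2)] by (simp add: norm_mult)
  moreover have "\<dots> < \<top>" using fin by (simp add: ennreal_mult_less_top)
  ultimately have *: "(\<integral>\<^sup>+x. ennreal (norm (f x * g x)) \<partial>M) < \<infinity>"
    by (metis infinity_ennreal_def less_top order.strict_trans1 power_eq_top_ennreal zero_neq_numeral)
  then show i: "integrable M (\<lambda>x. f x * g x)"
    by (simp add: integrable_iff_bounded)
  have "ennreal (norm (LINT x|M. f x * g x))^2 \<le> (\<integral>\<^sup>+x. ennreal (norm (f x * g x)) \<partial>M)\<^sup>2"
    by (intro power_mono integral_norm_bound_ennreal i) simp
  then show "ennreal (norm (LINT x|M. f x * g x))^2 \<le> sqint M f * sqint M g"
    using \<open>(\<integral>\<^sup>+x. ennreal (norm (f x * g x)) \<partial>M)\<^sup>2 \<le> sqint M f * sqint M g\<close> by order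
qed

lemma tendsto_integral_sqint:
  fixes f :: "nat \<Rightarrow> 'a \<Rightarrow> complex"
  assumes [measurable]: "\<And>n. f n \<in> borel_measurable M" "f0 \<in> borel_measurable M" "g \<in> borel_measurable M"
    and fin: "sqint M f0 < \<infinity>" "sqint M g < \<infinity>"
    and lim: "(\<lambda>n. sqint M (\<lambda>x. f n x - f0 x)) \<longlonglongrightarrow> 0"
  shows "(\<lambda>n. LINT x|M. f n x * g x) \<longlonglongrightarrow> (LINT x|M. f0 x * g x)"
proof -
  \<comment> \<open>Distance below 1 holds only eventually; from there on \<open>f n\<close> differs
    from \<open>f0\<close> by a square-integrable function, which makes the products
    integrable.\<close>
  have "\<forall>\<^sub>F n in sequentially. sqint M (\<lambda>x. f n x - f0 x) < 1"
    by (rule order_tendstoD[OF lim]) simp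
  then have ev: "\<forall>\<^sub>F n in sequentially. ennreal (norm ((LINT x|M. f n x * g x) - (LINT x|M. f0 x * g x)))^2
      \<le> sqint M (\<lambda>x. f n x - f0 x) * sqint M g"
  proof eventually_elim
    case (elim n)
    then have fd: "sqint M (\<lambda>x. f n x - f0 x) < \<infinity>" by (rule order.strict_trans) simp
    then have "integrable M (\<lambda>x. (f n x - f0 x) * g x)" by (intro integrable_mult_sqint fin) auto
    moreover have i0: "integrable M (\<lambda>x. f0 x * g x)" by (intro integrable_mult_sqint fin) auto
    ultimately have "integrable M (\<lambda>x. (f n x - f0 x) * g x + f0 x * g x)" by (rule Bochner_Integration.integrable_add)
    then have "integrable M (\<lambda>x. f n x * g x)" by (simp add: algebra_simps)
    then have "(LINT x|M. f n x * g x) - (LINT x|M. f0 x * g x) = (LINT x|M. (f n x - f0 x) * g x)"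
      using i0 by (simp add: left_diff_distrib)
    then show ?case using integrable_mult_sqint(2)[OF _ _ fd fin(2)] by simp
  qed
  have "(\<lambda>n. sqint M (\<lambda>x. f n x - f0 x) * sqint M g) \<longlonglongrightarrow> 0 * sqint M g"
    using ennreal_tendsto_cmult[OF _ lim, of "sqint M g"] fin by (simp add: mult.commute)
  then have "(\<lambda>n. ennreal (norm ((LINT x|M. f n x * g x) - (LINT x|M. f0 x * g x)))^2) \<longlonglongrightarrow> 0"
    by (intro tendsto_sandwich[OF _ ev tendsto_const]) (auto)
  then have "(\<lambda>n. ennreal ((norm ((LINT x|M. f n x * g x) - (LINT x|M. f0 x * g x)))^2)) \<longlonglongrightarrow> ennreal 0"
    by (simp add: ennreal_power)
  then have "(\<lambda>n. (norm ((LINT x|M. f n x * g x) - (LINT x|M. f0 x * g x)))^2) \<longlonglongrightarrow> 0"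
    by (subst (asm) tendsto_ennreal_iff) auto
  from tendsto_real_sqrt[OF this] have "(\<lambda>n. norm ((LINT x|M. f n x * g x) - (LINT x|M. f0 x * g x))) \<longlonglongrightarrow> 0" by simp
  then show ?thesis by (rule Lim_null[THEN iffD2, OF tendsto_norm_zero_cancel])
qed

section \<open>Density of compactly supported smooth functions\<close>

definition ccsmooth :: "(real^3 \<Rightarrow> complex) \<Rightarrow> bool"
  where "ccsmooth \<psi> \<longleftrightarrow> smooth \<psi> \<and> bounded {x. \<psi> x \<noteq> 0}"

lemma ccsmooth_schwartz: "ccsmooth \<psi> \<Longrightarrow> schwartz \<psi>"
  unfolding ccsmooth_def using schwartz_bounded_support by blast

lemma ccsmooth_add: "ccsmooth f \<Longrightarrow> ccsmooth g \<Longrightarrow> ccsmooth (\<lambda>x. f x + g x)"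
  unfolding ccsmooth_def
  by (auto intro: smooth_add bounded_subset[of "{x. f x \<noteq> 0} \<union> {x. g x \<noteq> 0}"])

lemma ccsmooth_cmul: "ccsmooth f \<Longrightarrow> ccsmooth (\<lambda>x. c * f x)"
  unfolding ccsmooth_def
  by (auto intro: smooth_mult smooth_const bounded_subset[of "{x. f x \<noteq> 0}"])

lemma ccsmooth_zero: "ccsmooth (\<lambda>x. 0)"
  by (simp add: ccsmooth_def smooth_const)

lemma ccsmooth_test: "test_function \<psi> \<Longrightarrow> ccsmooth (\<lambda>x. complex_of_real (\<psi> x))"
  unfolding ccsmooth_def test_function_iff using smooth_linear[OF _ bounded_linear_of_real] by auto

text \<open>Simple functions cut off to growing boxes reduce the claim to indicators. There L1
  approximation suffices: the difference of an indicator and a function with values between 0 and 1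
  is at most 1 in modulus, so its square is at most its modulus.\<close>

lemma ccsmooth_dense:
  fixes M :: "(real^3) measure" and g :: "real^3 \<Rightarrow> complex"
  assumes sets: "sets M = sets borel" and fin: "\<And>a b. emeasure M (box a b) < \<infinity>"
    and g: "g \<in> borel_measurable borel" "sqint M g < \<infinity>" and e: "(e::real) > 0"
  shows "\<exists>\<psi>. ccsmooth \<psi> \<and> sqint M (\<lambda>x. g x - \<psi> x) < ennreal e"
proof -
  note [measurable_cong] = sets
  have cm: "ccsmooth \<psi> \<Longrightarrow> \<psi> \<in> borel_measurable M" for \<psi>
    using schwartz_measurable[OF ccsmooth_schwartz] by simp
  define D where "D g \<longleftrightarrow> g \<in> borel_measurable M \<and> (\<forall>e>0. \<exists>\<psi>. ccsmooth \<psi> \<and> sqint M (\<lambda>x. g x - \<psi> x) < ennreal e)" for g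
  have four: "2 * ennreal (e / 4) + 2 * ennreal (e / 4) = ennreal e" if "e > 0" for e
  proof -
    have "2 * ennreal (e / 4) = ennreal (e / 2)" using ennreal_mult'[of 2 "e / 4"] by simp
    then show ?thesis using that by (simp flip: ennreal_plus)
  qed
  have strict: "2 * x + 2 * y < ennreal e" if "x < ennreal (e / 4)" "y < ennreal (e / 4)" "e > 0" for x y e
    unfolding four[OF that(3), symmetric] using that
    by (intro add_strict_mono ennreal_mult_strict_left_mono) auto
  have D_add: "D (\<lambda>x. f x + h x)" if Df: "D f" and Dh: "D h" for f h
    unfolding D_def
  proof (intro conjI allI impI)
    have [measurable]: "f \<in> borel_measurable M" "h \<in> borel_measurable M" using Df Dh D_def by auto
    show "(\<lambda>x. f x + h x) \<in> borel_measurable M" by measurable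
    fix e :: real assume e: "e > 0"
    obtain \<psi> where \<psi>: "ccsmooth \<psi>" "sqint M (\<lambda>x. f x - \<psi> x) < ennreal (e / 4)"
      using Df e unfolding D_def by (meson zero_less_divide_iff zero_less_numeral)
    obtain \<eta> where \<eta>: "ccsmooth \<eta>" "sqint M (\<lambda>x. h x - \<eta> x) < ennreal (e / 4)"
      using Dh e unfolding D_def by (meson zero_less_divide_iff zero_less_numeral)
    note [measurable] = cm[OF \<psi>(1)] cm[OF \<eta>(1)]
    have "sqint M (\<lambda>x. f x + h x - (\<psi> x + \<eta> x)) = sqint M (\<lambda>x. (f x - \<psi> x) + (h x - \<eta> x))"
      by (simp add: algebra_simps)
    also have "\<dots> \<le> 2 * sqint M (\<lambda>x. f x - \<psi> x) + 2 * sqint M (\<lambda>x. h x - \<eta> x)"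
      by (rule sqint_add_le) measurable
    also have "\<dots> < ennreal e" using strict \<psi>(2) \<eta>(2) e by blast
    finally show "\<exists>\<psi>. ccsmooth \<psi> \<and> sqint M (\<lambda>x. f x + h x - \<psi> x) < ennreal e"
      using ccsmooth_add[OF \<psi>(1) \<eta>(1)] by blast
  qed
  have D_zero: "D (\<lambda>x. 0)" unfolding D_def using ccsmooth_zero by (auto simp: sqint_def intro!: exI[of _ "\<lambda>x. 0"])
  have D_sum: "D (\<lambda>x. \<Sum>y\<in>Y. f y x)" if "\<And>y. y \<in> Y \<Longrightarrow> D (f y)" for f and Y :: "complex set"
    using that by (induction Y rule: infinite_finite_induct) (auto intro: D_zero D_add)
  have D_ind: "D (\<lambda>x. c * indicator (A \<inter> box a b) x)" if A: "A \<in> sets borel" for A a b c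
    unfolding D_def
  proof (intro conjI allI impI)
    have [measurable]: "A \<in> sets M" using A sets by simp
    show "(\<lambda>x. c * indicator (A \<inter> box a b) x) \<in> borel_measurable M" by measurable
    fix e :: real assume e: "e > 0"
    \<comment> \<open>The tolerance for the indicator compensates the factor |c|^2; the added 1
      covers \<open>c = 0\<close> and makes the final inequality strict.\<close>
    define d where "d = e / ((norm c)\<^sup>2 + 1)"
    have cp: "(norm c)\<^sup>2 + 1 > 0" by (simp add: add_nonneg_pos)
    have d: "d > 0" using e cp unfolding d_def by simp
    obtain \<psi> where \<psi>: "test_function \<psi>" "\<And>x. 0 \<le> \<psi> x \<and> \<psi> x \<le> 1"
      "(\<integral>\<^sup>+x. ennreal \<bar>indicator (A \<inter> box a b) x - \<psi> x\<bar> \<partial>M) < ennreal d"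
      using approx_indicator[OF sets fin A d, of a b] by auto
    note cc = ccsmooth_test[OF \<psi>(1)]
    have [measurable]: "(\<lambda>x. complex_of_real (\<psi> x)) \<in> borel_measurable M" using cm[OF cc] .
    have "sqint M (\<lambda>x. c * indicator (A \<inter> box a b) x - c * complex_of_real (\<psi> x))
       = ennreal ((norm c)\<^sup>2) * sqint M (\<lambda>x. indicator (A \<inter> box a b) x - complex_of_real (\<psi> x))"
      unfolding right_diff_distrib[symmetric] by (rule sqint_cmult) measurable
    also have "sqint M (\<lambda>x. indicator (A \<inter> box a b) x - complex_of_real (\<psi> x))
        \<le> (\<integral>\<^sup>+x. ennreal \<bar>indicator (A \<inter> box a b) x - \<psi> x\<bar> \<partial>M)"
      unfolding sqint_def
    proof (intro nn_integral_mono ennreal_leI)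
      fix x
      have "norm (indicator (A \<inter> box a b) x - complex_of_real (\<psi> x)) = \<bar>indicator (A \<inter> box a b) x - \<psi> x\<bar>"
        by (metis norm_of_real of_real_diff of_real_indicator)
      moreover have "\<bar>indicator (A \<inter> box a b) x - \<psi> x\<bar> \<le> 1" using \<psi>(2)[of x] by (auto simp: indicator_def)
      ultimately show "(norm (indicator (A \<inter> box a b) x - complex_of_real (\<psi> x)))\<^sup>2 \<le> \<bar>indicator (A \<inter> box a b) x - \<psi> x\<bar>"
        using power_decreasing[of 1 2 "\<bar>indicator (A \<inter> box a b) x - \<psi> x\<bar>"] by simp
    qed
    also have "ennreal ((norm c)\<^sup>2) * (\<integral>\<^sup>+x. ennreal \<bar>indicator (A \<inter> box a b) x - \<psi> x\<bar> \<partial>M) \<le> ennreal ((norm c)\<^sup>2) * ennreal d"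
      using \<psi>(3) by (intro mult_left_mono) auto
    also have "\<dots> = ennreal ((norm c)\<^sup>2 * d)" by (simp add: ennreal_mult')
    also have "\<dots> < ennreal e"
      using e cp by (intro ennreal_lessI) (auto simp: d_def field_simps)
    finally show "\<exists>\<psi>. ccsmooth \<psi> \<and> sqint M (\<lambda>x. c * indicator (A \<inter> box a b) x - \<psi> x) < ennreal e"
      using ccsmooth_cmul[OF cc] by (auto simp: mult_left_mono)
  qed
  obtain F where F: "\<And>i. simple_function borel (F i)" "\<And>x. (\<lambda>i. F i x) \<longlonglongrightarrow> g x"
      "\<And>i x. norm (F i x) \<le> 2 * norm (g x)"
    using borel_measurable_implies_sequence_metric[OF g(1), of 0] by (auto simp: dist_norm)
  define B :: "nat \<Rightarrow> (real^3) set" where "B n = box (\<chi> k. - real n) (\<chi> k. real n)" for n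
  have Bx: "\<forall>\<^sub>F n in sequentially. x \<in> B n" for x
  proof -
    obtain N :: nat where N: "norm x < real N" using reals_Archimedean2 by blast
    have "x \<in> B n" if "n \<ge> N" for n
    proof -
      have "\<bar>x $ k\<bar> < real n" for k
        using component_le_norm_cart[of x k] N that by linarith
      then show ?thesis by (auto simp: B_def mem_box_cart abs_less_iff minus_less_iff)
    qed
    then show ?thesis unfolding eventually_sequentially by blast
  qed
  define G where "G n x = F n x * indicator (B n) x" for n x
  have DG: "D (G n)" for n
  proof -
    have "G n = (\<lambda>x. \<Sum>y\<in>range (F n). y * indicator (F n -` {y} \<inter> B n) x)"
    proof
      fix x
      have "finite (range (F n))" using simple_functionD(1)[OF F(1)] by simp
      then have "(\<Sum>y\<in>range (F n). y * indicator (F n -` {y} \<inter> B n) x) = (\<Sum>y\<in>{F n x}. y * indicator (F n -` {y} \<inter> B n) x)"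
        by (intro sum.mono_neutral_right) auto
      then show "G n x = (\<Sum>y\<in>range (F n). y * indicator (F n -` {y} \<inter> B n) x)"
        by (simp add: G_def indicator_def)
    qed
    moreover have "F n -` {y} \<in> sets borel" for y
      using simple_functionD(2)[OF F(1), of n "{y}"] by simp
    ultimately show ?thesis unfolding B_def by (simp only:) (intro D_sum D_ind)
  qed
  have [measurable]: "g \<in> borel_measurable M" using g(1) by simp
  have [measurable]: "G n \<in> borel_measurable M" for n using DG D_def by blast
  \<comment> \<open>The majorant has factor 9 = (1 + 2)^2, since the truncated simple functions are
    bounded by twice \<open>g\<close>.\<close>
  have "(\<lambda>n. sqint M (\<lambda>x. g x - G n x)) \<longlonglongrightarrow> (\<integral>\<^sup>+x. 0 \<partial>M)"
    unfolding sqint_def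
  proof (rule nn_integral_dominated_convergence[where w="\<lambda>x. 9 * ennreal ((norm (g x))\<^sup>2)"])
    show "AE x in M. ennreal ((norm (g x - G n x))\<^sup>2) \<le> 9 * ennreal ((norm (g x))\<^sup>2)" for n
    proof (intro AE_I2)
      fix x
      have "norm (G n x) \<le> 2 * norm (g x)" using F(3)[of n x] by (auto simp: G_def indicator_def)
      then have "norm (g x - G n x) \<le> 3 * norm (g x)" using norm_triangle_ineq4[of "g x" "G n x"] by linarith
      then have "(norm (g x - G n x))\<^sup>2 \<le> (3 * norm (g x))\<^sup>2" by (intro power_mono) auto
      then have "ennreal ((norm (g x - G n x))\<^sup>2) \<le> ennreal (9 * (norm (g x))\<^sup>2)"
        by (intro ennreal_leI) (simp add: power_mult_distrib)
      then show "ennreal ((norm (g x - G n x))\<^sup>2) \<le> 9 * ennreal ((norm (g x))\<^sup>2)" by (simp add: ennreal_mult')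
    qed
    show "(\<integral>\<^sup>+x. 9 * ennreal ((norm (g x))\<^sup>2) \<partial>M) < \<infinity>"
      using g(2) by (simp add: nn_integral_cmult sqint_def ennreal_mult_less_top)
    show "AE x in M. (\<lambda>n. ennreal ((norm (g x - G n x))\<^sup>2)) \<longlonglongrightarrow> 0"
    proof (intro AE_I2)
      fix x
      have "\<forall>\<^sub>F n in sequentially. F n x = G n x" using Bx[of x] by eventually_elim (simp add: G_def)
      then have "(\<lambda>n. G n x) \<longlonglongrightarrow> g x" using F(2) by (rule Lim_transform_eventually[rotated])
      then have "(\<lambda>n. ennreal ((norm (g x - G n x))\<^sup>2)) \<longlonglongrightarrow> ennreal ((norm (g x - g x))\<^sup>2)"
        by (intro tendsto_intros)
      then show "(\<lambda>n. ennreal ((norm (g x - G n x))\<^sup>2)) \<longlonglongrightarrow> 0" by simp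
    qed
  qed measurable
  then have "\<forall>\<^sub>F n in sequentially. sqint M (\<lambda>x. g x - G n x) < ennreal (e / 4)"
    by (rule order_tendstoD) (use e in simp)
  then obtain n where n: "sqint M (\<lambda>x. g x - G n x) < ennreal (e / 4)" by (auto simp: eventually_sequentially)
  obtain \<psi> where \<psi>: "ccsmooth \<psi>" "sqint M (\<lambda>x. G n x - \<psi> x) < ennreal (e / 4)"
    using DG[of n] e unfolding D_def by (meson zero_less_divide_iff zero_less_numeral)
  note [measurable] = cm[OF \<psi>(1)]
  have "sqint M (\<lambda>x. g x - \<psi> x) \<le> 2 * sqint M (\<lambda>x. g x - G n x) + 2 * sqint M (\<lambda>x. G n x - \<psi> x)"
    by (rule sqint_triangle) measurable
  also have "\<dots> < ennreal e" using strict n \<psi>(2) e by blast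
  finally show ?thesis using \<psi>(1) by blast
qed

text \<open>Riesz-Fischer for a geometrically fast sequence. The squared increments are of order
  4^(-n), so they stay summable after multiplication by 2^n; almost everywhere the increments then
  decay like 2^(-n/2) and the sequence converges. Fatou's lemma transfers the rate to the
  limit.\<close>

lemma sqint_complete:
  fixes f :: "nat \<Rightarrow> 'a \<Rightarrow> complex"
  assumes [measurable]: "\<And>n. f n \<in> borel_measurable M"
    and cauchy: "\<And>n m. n \<le> m \<Longrightarrow> sqint M (\<lambda>x. f m x - f n x) \<le> ennreal ((1/4) ^ n)"
  obtains g where "g \<in> borel_measurable M" "\<And>n. sqint M (\<lambda>x. g x - f n x) \<le> ennreal ((1/4) ^ n)"
proof
  define g where "g x = lim (\<lambda>n. f n x)" for x
  define d where "d n x = norm (f (Suc n) x - f n x)" for n x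
  have [measurable]: "d n \<in> borel_measurable M" for n unfolding d_def by measurable
  show gm[measurable]: "g \<in> borel_measurable M" unfolding g_def by measurable
  have "(\<integral>\<^sup>+x. (\<Sum>n. ennreal (2 ^ n * (d n x)\<^sup>2)) \<partial>M) = (\<Sum>n. \<integral>\<^sup>+x. ennreal (2 ^ n * (d n x)\<^sup>2) \<partial>M)"
    by (rule nn_integral_suminf) measurable
  also have "\<dots> = (\<Sum>n. ennreal (2 ^ n) * sqint M (\<lambda>x. f (Suc n) x - f n x))"
    unfolding sqint_def d_def by (simp add: ennreal_mult nn_integral_cmult)
  also have "\<dots> \<le> (\<Sum>n. ennreal ((1/2) ^ n))"
  proof (rule suminf_le)
    fix n
    have "ennreal (2 ^ n) * sqint M (\<lambda>x. f (Suc n) x - f n x) \<le> ennreal (2 ^ n) * ennreal ((1/4) ^ n)"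
      by (intro mult_left_mono cauchy) auto
    also have "\<dots> = ennreal ((2 * (1/4)) ^ n)" unfolding power_mult_distrib by (simp add: ennreal_mult)
    also have "2 * (1/4) = (1/2 :: real)" by simp
    finally show "ennreal (2 ^ n) * sqint M (\<lambda>x. f (Suc n) x - f n x) \<le> ennreal ((1/2) ^ n)" .
  qed auto
  also have "\<dots> = ennreal (\<Sum>n. (1/2) ^ n)" by (intro suminf_ennreal2 summable_geometric) auto
  also have "\<dots> < \<infinity>" by simp
  finally have "(\<integral>\<^sup>+x. (\<Sum>n. ennreal (2 ^ n * (d n x)\<^sup>2)) \<partial>M) < \<infinity>" .
  then have "AE x in M. (\<Sum>n. ennreal (2 ^ n * (d n x)\<^sup>2)) \<noteq> \<infinity>"
    by (intro nn_integral_noteq_infinite) auto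
  then have conv: "AE x in M. (\<lambda>n. f n x) \<longlonglongrightarrow> g x"
  proof eventually_elim
    case (elim x)
    define S where "S = enn2real (\<Sum>n. ennreal (2 ^ n * (d n x)\<^sup>2))"
    have le: "d n x \<le> sqrt S * (1 / sqrt 2) ^ n" for n
    proof -
      have "(\<Sum>n\<in>{n}. ennreal (2 ^ n * (d n x)\<^sup>2)) \<le> (\<Sum>n. ennreal (2 ^ n * (d n x)\<^sup>2))"
        by (rule sum_le_suminf) auto
      then have "ennreal (2 ^ n * (d n x)\<^sup>2) \<le> (\<Sum>n. ennreal (2 ^ n * (d n x)\<^sup>2))" by simp
      also have "\<dots> = ennreal S" unfolding S_def using elim by (simp add: less_top)
      finally have "2 ^ n * (d n x)\<^sup>2 \<le> S" by (subst (asm) ennreal_le_iff) (auto simp: S_def)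
      then have "sqrt (2 ^ n * (d n x)\<^sup>2) \<le> sqrt S" by simp
      then have "sqrt 2 ^ n * d n x \<le> sqrt S" by (simp add: real_sqrt_mult real_sqrt_power d_def)
      then show ?thesis by (simp add: power_divide field_simps)
    qed
    have "summable (\<lambda>n. f (Suc n) x - f n x)"
    proof (rule summable_comparison_test'[where g="\<lambda>n. sqrt S * (1 / sqrt 2) ^ n"])
      show "summable (\<lambda>n. sqrt S * (1 / sqrt 2) ^ n)" by (intro summable_mult summable_geometric) auto
      show "norm (f (Suc n) x - f n x) \<le> sqrt S * (1 / sqrt 2) ^ n" if "n \<ge> 0" for n
        using le[of n] by (simp add: d_def)
    qed
    then have "convergent (\<lambda>n. \<Sum>k<n. f (Suc k) x - f k x)" by (simp add: summable_iff_convergent)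
    then have "convergent (\<lambda>n. f n x - f 0 x)" by (simp add: sum_lessThan_telescope[of "\<lambda>k. f k x"])
    then have "convergent (\<lambda>n. (f n x - f 0 x) + f 0 x)" by (intro convergent_add convergent_const)
    then show ?case unfolding g_def by (simp add: convergent_LIMSEQ_iff)
  qed
  show "sqint M (\<lambda>x. g x - f n x) \<le> ennreal ((1/4) ^ n)" for n
  proof -
    have "sqint M (\<lambda>x. g x - f n x) = (\<integral>\<^sup>+x. liminf (\<lambda>m. ennreal ((norm (f m x - f n x))\<^sup>2)) \<partial>M)"
      unfolding sqint_def
    proof (rule nn_integral_cong_AE)
      show "AE x in M. ennreal ((norm (g x - f n x))\<^sup>2) = liminf (\<lambda>m. ennreal ((norm (f m x - f n x))\<^sup>2))"
        using conv
      proof eventually_elim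
        case (elim x)
        then have "(\<lambda>m. ennreal ((norm (f m x - f n x))\<^sup>2)) \<longlonglongrightarrow> ennreal ((norm (g x - f n x))\<^sup>2)"
          by (intro tendsto_intros)
        then show ?case by (rule lim_imp_Liminf[OF sequentially_bot, symmetric])
      qed
    qed
    also have "\<dots> \<le> liminf (\<lambda>m. \<integral>\<^sup>+x. ennreal ((norm (f m x - f n x))\<^sup>2) \<partial>M)"
      by (rule nn_integral_liminf) measurable
    also have "\<dots> \<le> ennreal ((1/4) ^ n)"
      by (intro Liminf_le) (auto simp: eventually_sequentially sqint_def[symmetric] intro!: exI[of _ n] cauchy)
    finally show ?thesis .
  qed
qed

section \<open>The Fourier transform of tempered functions\<close>

text \<open>The complex-valued counterpart of \<open>has_ft\<close>: modulation and inversion lead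
  out of the real-valued functions.\<close>

definition cft :: "(real^3 \<Rightarrow> complex) \<Rightarrow> (real^3 \<Rightarrow> complex) \<Rightarrow> bool"
  where "cft f g \<longleftrightarrow> (\<forall>\<phi>. schwartz \<phi> \<longrightarrow>
      integrable lborel (\<lambda>x. f x * \<phi> x) \<and> integrable lborel (\<lambda>\<xi>. g \<xi> * \<phi> \<xi>) \<and>
      (LINT x|lborel. f x * fourier \<phi> x) = (LINT \<xi>|lborel. g \<xi> * \<phi> \<xi>))"

lemma has_ft_cft: "has_ft f g \<longleftrightarrow> cft (\<lambda>x. complex_of_real (f x)) g"
  unfolding has_ft_def cft_def ..

lemma cftD:
  assumes "cft f g" "schwartz \<phi>"
  shows "integrable lborel (\<lambda>x. f x * \<phi> x)" "integrable lborel (\<lambda>\<xi>. g \<xi> * \<phi> \<xi>)"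
    "(LINT x|lborel. f x * fourier \<phi> x) = (LINT \<xi>|lborel. g \<xi> * \<phi> \<xi>)"
  using assms unfolding cft_def by blast+

lemma measurable_schwartz_integrable:
  assumes "\<And>\<phi>. schwartz \<phi> \<Longrightarrow> integrable lborel (\<lambda>x. f x * \<phi> x)"
  shows "f \<in> borel_measurable borel"
proof -
  have "(\<lambda>x. f x * complex_of_real (exp (- (norm x)\<^sup>2))) \<in> borel_measurable borel"
    using borel_measurable_integrable[OF assms[OF schwartz_gauss]] by simp
  then have "(\<lambda>x. (f x * complex_of_real (exp (- (norm x)\<^sup>2))) / complex_of_real (exp (- (norm x)\<^sup>2))) \<in> borel_measurable borel"
    by measurable
  then show ?thesis by (simp del: of_real_exp)
qed

lemma cft_measurable:
  assumes "cft f g" shows "f \<in> borel_measurable borel" "g \<in> borel_measurable borel"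
  using measurable_schwartz_integrable cftD[OF assms] by blast+

section \<open>Uniqueness of transforms\<close>

text \<open>The fundamental lemma of the calculus of variations. Indicators are approximated in L1
  of the measure |f| dx, so the approximation error is exactly the error in the integral against
  \<open>f\<close>, even though \<open>f\<close> need not be bounded.\<close>

lemma schwartz_null_on_box:
  assumes f: "\<And>\<phi>. schwartz \<phi> \<Longrightarrow> integrable lborel (\<lambda>x. f x * \<phi> x)"
    and zero: "\<And>\<phi>. schwartz \<phi> \<Longrightarrow> (LINT x|lborel. f x * \<phi> x) = 0"
  shows "AE x in lborel. indicator (box a b) x *\<^sub>R f x = 0"
proof (rule sigma_finite_measure.density_zero[OF sigma_finite_lborel])
  have [measurable]: "f \<in> borel_measurable borel" using measurable_schwartz_integrable[OF f] .
  obtain R where R: "\<And>x. x \<in> box a b \<Longrightarrow> norm x \<le> R"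
    using bounded_box[of a b] unfolding bounded_iff by blast
  \<comment> \<open>On the box the Gaussian is at least exp (- R^2), so pairing with it controls the
    integral of |f| there.\<close>
  show int: "integrable lborel (\<lambda>x. indicator (box a b) x *\<^sub>R f x)"
  proof (rule Bochner_Integration.integrable_bound)
    show "integrable lborel (\<lambda>x. exp (R\<^sup>2) * norm (f x * complex_of_real (exp (- (norm x)\<^sup>2))))"
      by (intro integrable_mult_right integrable_norm f schwartz_gauss)
    show "AE x in lborel. norm (indicator (box a b) x *\<^sub>R f x) \<le> norm (exp (R\<^sup>2) * norm (f x * complex_of_real (exp (- (norm x)\<^sup>2))))"
    proof (intro AE_I2)
      fix x
      show "norm (indicator (box a b) x *\<^sub>R f x) \<le> norm (exp (R\<^sup>2) * norm (f x * complex_of_real (exp (- (norm x)\<^sup>2))))"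
      proof (cases "x \<in> box a b")
        case True
        have "(norm x)\<^sup>2 \<le> R\<^sup>2" using R[OF True] by (intro power_mono) auto
        then have "1 \<le> exp (R\<^sup>2) * exp (- (norm x)\<^sup>2)" by (simp flip: exp_add)
        then have "1 * norm (f x) \<le> exp (R\<^sup>2) * exp (- (norm x)\<^sup>2) * norm (f x)" by (intro mult_right_mono) auto
        then show ?thesis using True by (simp add: norm_mult mult_ac del: of_real_exp)
      qed simp
    qed
  qed measurable
  fix A :: "(real^3) set" assume "A \<in> sets lborel"
  then have A[measurable]: "A \<in> sets borel" by simp
  let ?M = "density lborel (\<lambda>x. ennreal (norm (f x)))"
  have fin: "emeasure ?M (box a b) < \<infinity>"
    using int by (simp add: emeasure_density integrable_iff_bounded ennreal_mult' ennreal_indicator mult.commute)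
  let ?I = "LINT x:A|lborel. indicator (box a b) x *\<^sub>R f x"
  have "norm ?I \<le> e" if e: "e > 0" for e
  proof -
    obtain \<psi> where \<psi>: "test_function \<psi>"
      "(\<integral>\<^sup>+x. ennreal \<bar>indicator (A \<inter> box a b) x - \<psi> x\<bar> \<partial>?M) < ennreal e"
      using approx_indicator[OF _ fin A e] by auto
    note sp = test_function_schwartz[OF \<psi>(1)]
    have [measurable]: "(\<lambda>x. complex_of_real (\<psi> x)) \<in> borel_measurable borel" using sp by (rule schwartz_measurable)
    have "(\<lambda>x. Re (complex_of_real (\<psi> x))) \<in> borel_measurable borel" by measurable
    then have [measurable]: "\<psi> \<in> borel_measurable borel" by simp
    have i1: "integrable lborel (\<lambda>x. indicator A x *\<^sub>R indicator (box a b) x *\<^sub>R f x)"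
      using integrable_mult_indicator[OF _ int, of A] by simp
    have "?I = (LINT x|lborel. indicator A x *\<^sub>R indicator (box a b) x *\<^sub>R f x) - (LINT x|lborel. f x * complex_of_real (\<psi> x))"
      unfolding zero[OF sp] set_lebesgue_integral_def by simp
    also have "\<dots> = (LINT x|lborel. indicator A x *\<^sub>R indicator (box a b) x *\<^sub>R f x - f x * complex_of_real (\<psi> x))"
      by (rule Bochner_Integration.integral_diff[symmetric]) (use i1 f[OF sp] in auto)
    also have "\<dots> = (LINT x|lborel. (indicator (A \<inter> box a b) x - \<psi> x) *\<^sub>R f x)"
      by (intro Bochner_Integration.integral_cong refl) (simp add: indicator_inter_arith scaleR_conv_of_real algebra_simps)
    finally have eq: "?I = (LINT x|lborel. (indicator (A \<inter> box a b) x - \<psi> x) *\<^sub>R f x)" .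
    have "ennreal (norm ?I) \<le> (\<integral>\<^sup>+x. ennreal (norm ((indicator (A \<inter> box a b) x - \<psi> x) *\<^sub>R f x)) \<partial>lborel)"
      unfolding eq
    proof (cases "integrable lborel (\<lambda>x. (indicator (A \<inter> box a b) x - \<psi> x) *\<^sub>R f x)")
      case True then show "ennreal (norm (LINT x|lborel. (indicator (A \<inter> box a b) x - \<psi> x) *\<^sub>R f x)) \<le> (\<integral>\<^sup>+x. ennreal (norm ((indicator (A \<inter> box a b) x - \<psi> x) *\<^sub>R f x)) \<partial>lborel)"
        by (rule integral_norm_bound_ennreal)
    qed (simp add: not_integrable_integral_eq)
    also have "\<dots> = (\<integral>\<^sup>+x. ennreal \<bar>indicator (A \<inter> box a b) x - \<psi> x\<bar> \<partial>?M)"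
      by (subst nn_integral_density) (auto simp: ennreal_mult mult.commute)
    also have "\<dots> \<le> ennreal e" using \<psi>(2) by (rule less_imp_le)
    finally show ?thesis using e by simp
  qed
  then have "norm ?I \<le> 0" by (rule field_le_epsilon) simp
  then show "?I = 0" by simp
qed

lemma schwartz_null:
  assumes f: "\<And>\<phi>. schwartz \<phi> \<Longrightarrow> integrable lborel (\<lambda>x. f x * \<phi> x)"
    and zero: "\<And>\<phi>. schwartz \<phi> \<Longrightarrow> (LINT x|lborel. f x * \<phi> x) = 0"
  shows "AE x in lborel. f x = 0"
proof -
  have "AE x in lborel. \<forall>n::nat. indicator (box (\<chi> k. - real n) (\<chi> k. real n)) x *\<^sub>R f x = 0"
    using schwartz_null_on_box[OF assms] by (subst AE_all_countable) blast
  then show ?thesis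
  proof eventually_elim
    case (elim x)
    obtain n :: nat where n: "norm x < real n" using reals_Archimedean2 by blast
    have "\<bar>x $ k\<bar> < real n" for k using component_le_norm_cart[of x k] n by linarith
    then have "x \<in> box (\<chi> k. - real n) (\<chi> k. real n)" by (auto simp: mem_box_cart abs_less_iff minus_less_iff)
    then show ?case using elim[rule_format, of n] by simp
  qed
qed

lemma cft_unique_right:
  assumes "cft f g" "cft f g'" shows "AE \<xi> in lborel. g \<xi> = g' \<xi>"
proof -
  have "AE \<xi> in lborel. g \<xi> - g' \<xi> = 0"
  proof (rule schwartz_null)
    fix \<phi> :: "real^3 \<Rightarrow> complex" assume \<phi>: "schwartz \<phi>"
    note 1 = cftD[OF assms(1) \<phi>] and 2 = cftD[OF assms(2) \<phi>]
    show "integrable lborel (\<lambda>\<xi>. (g \<xi> - g' \<xi>) * \<phi> \<xi>)" using 1(2) 2(2) by (simp add: left_diff_distrib)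
    show "(LINT \<xi>|lborel. (g \<xi> - g' \<xi>) * \<phi> \<xi>) = 0" using 1 2 by (simp add: left_diff_distrib)
  qed
  then show ?thesis by simp
qed

text \<open>Every Schwartz function is the transform of one, so pairings with transforms already
  determine \<open>f\<close>.\<close>

lemma cft_unique_left:
  assumes "cft f g" "cft f' g" shows "AE x in lborel. f x = f' x"
proof -
  have "AE x in lborel. f x - f' x = 0"
  proof (rule schwartz_null)
    fix \<phi> :: "real^3 \<Rightarrow> complex" assume \<phi>: "schwartz \<phi>"
    show "integrable lborel (\<lambda>x. (f x - f' x) * \<phi> x)"
      using cftD(1)[OF assms(1) \<phi>] cftD(1)[OF assms(2) \<phi>] by (simp add: left_diff_distrib)
    obtain \<psi> where \<psi>: "schwartz \<psi>" "fourier \<psi> = \<phi>" using fourier_surj[OF \<phi>] .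
    show "(LINT x|lborel. (f x - f' x) * \<phi> x) = 0"
      using cftD[OF assms(1) \<psi>(1)] cftD[OF assms(2) \<psi>(1)] cftD(1)[OF assms(1) \<phi>] cftD(1)[OF assms(2) \<phi>] \<psi>(2)
      by (simp add: left_diff_distrib)
  qed
  then show ?thesis by simp
qed

lemma cft_cong_AE:
  assumes "cft f g" "AE x in lborel. f x = f' x" "AE x in lborel. g x = g' x"
    and m: "f' \<in> borel_measurable borel" "g' \<in> borel_measurable borel"
  shows "cft f' g'"
  unfolding cft_def
proof (intro allI impI conjI)
  fix \<phi> :: "real^3 \<Rightarrow> complex" assume \<phi>: "schwartz \<phi>"
  note [measurable] = m cft_measurable[OF assms(1)] schwartz_measurable[OF \<phi>] schwartz_measurable[OF schwartz_fourier[OF \<phi>]]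
  have e1: "AE x in lborel. f x * \<phi> x = f' x * \<phi> x" "AE x in lborel. f x * fourier \<phi> x = f' x * fourier \<phi> x"
    using assms(2) by (auto elim!: eventually_mono)
  have e2: "AE x in lborel. g x * \<phi> x = g' x * \<phi> x"
    using assms(3) by (auto elim!: eventually_mono)
  show "integrable lborel (\<lambda>x. f' x * \<phi> x)"
    using integrable_cong_AE_imp[OF cftD(1)[OF assms(1) \<phi>] _ e1(1)] by simp
  show "integrable lborel (\<lambda>x. g' x * \<phi> x)"
    using integrable_cong_AE_imp[OF cftD(2)[OF assms(1) \<phi>] _ e2(1)] by simp
  have "(LINT x|lborel. f x * fourier \<phi> x) = (LINT x|lborel. f' x * fourier \<phi> x)"
    by (rule integral_cong_AE) (use e1 in auto)
  moreover have "(LINT x|lborel. g x * \<phi> x) = (LINT x|lborel. g' x * \<phi> x)"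
    by (rule integral_cong_AE) (use e2 in auto)
  ultimately show "(LINT x|lborel. f' x * fourier \<phi> x) = (LINT x|lborel. g' x * \<phi> x)"
    using cftD(3)[OF assms(1) \<phi>] by simp
qed

section \<open>Operations on transforms\<close>

lemma cft_add:
  assumes "cft f g" "cft f' g'" shows "cft (\<lambda>x. f x + f' x) (\<lambda>\<xi>. g \<xi> + g' \<xi>)"
  unfolding cft_def
proof (intro allI impI)
  fix \<phi> :: "real^3 \<Rightarrow> complex" assume \<phi>: "schwartz \<phi>"
  show "integrable lborel (\<lambda>x. (f x + f' x) * \<phi> x) \<and> integrable lborel (\<lambda>\<xi>. (g \<xi> + g' \<xi>) * \<phi> \<xi>) \<and>
    (LINT x|lborel. (f x + f' x) * fourier \<phi> x) = (LINT \<xi>|lborel. (g \<xi> + g' \<xi>) * \<phi> \<xi>)"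
    using cftD[OF assms(1) \<phi>] cftD[OF assms(2) \<phi>] cftD(1)[OF assms(1) schwartz_fourier[OF \<phi>]] cftD(1)[OF assms(2) schwartz_fourier[OF \<phi>]]
    by (simp add: distrib_right)
qed

lemma cft_cmul:
  assumes "cft f g" shows "cft (\<lambda>x. c * f x) (\<lambda>\<xi>. c * g \<xi>)"
  unfolding cft_def using cftD[OF assms] by (auto simp: mult.assoc)

lemma cft_diff:
  assumes "cft f g" "cft f' g'" shows "cft (\<lambda>x. f x - f' x) (\<lambda>\<xi>. g \<xi> - g' \<xi>)"
  using cft_add[OF assms(1) cft_cmul[OF assms(2), of "-1"]] by simp

lemma cft_integrable:
  assumes f: "integrable lborel f" shows "cft f (fourier f)"
  unfolding cft_def
proof (intro allI impI conjI)
  have [measurable]: "f \<in> borel_measurable borel" using borel_measurable_integrable[OF f] by simp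
  have [measurable]: "fourier f \<in> borel_measurable borel" unfolding fourier_def[abs_def] by measurable
  fix \<phi> :: "real^3 \<Rightarrow> complex" assume \<phi>: "schwartz \<phi>"
  note [measurable] = schwartz_measurable[OF \<phi>]
  obtain C where C: "\<And>x. norm (\<phi> x) \<le> C" using schwartz_bounded[OF \<phi>] by blast
  show "integrable lborel (\<lambda>x. f x * \<phi> x)"
    by (rule Bochner_Integration.integrable_bound[OF integrable_mult_right[OF f, of "complex_of_real C"]])
      (auto intro!: AE_I2 mult_right_mono order_trans[OF C] simp: norm_mult mult.commute[of _ "\<phi> _"])
  show "integrable lborel (\<lambda>x. fourier f x * \<phi> x)"
    by (rule Bochner_Integration.integrable_bound[OF integrable_mult_right[OF schwartz_integrable[OF \<phi>], of "complex_of_real (LINT x|lborel. norm (f x))"]])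
      (auto intro!: AE_I2 mult_right_mono fourier_norm_le f simp: norm_mult)
  show "(LINT x|lborel. f x * fourier \<phi> x) = (LINT x|lborel. fourier f x * \<phi> x)"
    by (rule fourier_transfer[OF f schwartz_integrable[OF \<phi>]])
qed

lemma cft_schwartz: "schwartz f \<Longrightarrow> cft f (fourier f)"
  by (intro cft_integrable schwartz_integrable)

lemma integral_reflect: 
  fixes f :: "real^3 \<Rightarrow> complex"
  assumes "f \<in> borel_measurable borel"
  shows "(LINT x|lborel. f (- x)) = (LINT x|lborel. f x)"
  using integral_affine[OF assms, of "-1" 0] by simp

lemma integrable_reflect:
  fixes f :: "real^3 \<Rightarrow> complex"
  shows "integrable lborel f \<Longrightarrow> integrable lborel (\<lambda>x. f (- x))"
  using integrable_affine[of f "-1" 0] by simp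

lemma AE_reflect: "AE x in lborel. P x \<Longrightarrow> AE x in lborel. P (- (x::real^3))"
  using AE_affine[of P "-1" 0] by simp

text \<open>Inversion expressed by pairings. It converts every existence result for transforms into
  one for inverse transforms.\<close>

lemma cft_dual:
  assumes "cft g h" shows "cft (\<lambda>x. h (- x)) g"
  unfolding cft_def
proof (intro allI impI conjI)
  fix \<phi> :: "real^3 \<Rightarrow> complex" assume \<phi>: "schwartz \<phi>"
  note [measurable] = cft_measurable[OF assms] schwartz_measurable[OF schwartz_fourier[OF \<phi>]]
  have s: "schwartz (\<lambda>x. fourier \<phi> (- x))" by (intro schwartz_reflect schwartz_fourier \<phi>)
  show "integrable lborel (\<lambda>x. h (- x) * \<phi> x)"
    using integrable_reflect[OF cftD(2)[OF assms schwartz_reflect[OF \<phi>]]] by simp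
  show "integrable lborel (\<lambda>\<xi>. g \<xi> * \<phi> \<xi>)" using cftD(1)[OF assms \<phi>] .
  have "(LINT x|lborel. h (- x) * fourier \<phi> x) = (LINT x|lborel. h x * fourier \<phi> (- x))"
    using integral_reflect[of "\<lambda>x. h x * fourier \<phi> (- x)"] by simp
  also have "\<dots> = (LINT x|lborel. g x * fourier (\<lambda>x. fourier \<phi> (- x)) x)"
    using cftD(3)[OF assms s] by simp
  also have "\<dots> = (LINT x|lborel. g x * \<phi> x)"
    by (simp add: fourier_reflect schwartz_measurable[OF schwartz_fourier[OF \<phi>]] fourier_fourier[OF \<phi>])
  finally show "(LINT x|lborel. h (- x) * fourier \<phi> x) = (LINT \<xi>|lborel. g \<xi> * \<phi> \<xi>)" .
qed

lemma measurable_cnj [measurable]: "cnj \<in> borel_measurable borel"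
  by (intro borel_measurable_continuous_onI continuous_intros)

lemma cft_cnj:
  assumes "cft f g" shows "cft (\<lambda>x. cnj (f x)) (\<lambda>\<xi>. cnj (g (- \<xi>)))"
  unfolding cft_def
proof (intro allI impI conjI)
  fix \<phi> :: "real^3 \<Rightarrow> complex" assume \<phi>: "schwartz \<phi>"
  note [measurable] = cft_measurable[OF assms] schwartz_measurable[OF \<phi>]
  have s: "schwartz (\<lambda>x. cnj (\<phi> x))" "schwartz (\<lambda>x. cnj (\<phi> (- x)))" by (intro schwartz_cnj schwartz_reflect \<phi>)+
  show "integrable lborel (\<lambda>x. cnj (f x) * \<phi> x)"
    using integrable_cnj[OF cftD(1)[OF assms s(1)]] by simp
  show "integrable lborel (\<lambda>x. cnj (g (- x)) * \<phi> x)"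
    using integrable_cnj[OF integrable_reflect[OF cftD(2)[OF assms s(2)]]] by simp
  have "(LINT x|lborel. cnj (f x) * fourier \<phi> x) = cnj (LINT x|lborel. f x * fourier (\<lambda>x. cnj (\<phi> (- x))) x)"
    by (subst Bochner_Integration.integral_cnj[symmetric]) (simp add: fourier_cnj fourier_reflect)
  also have "\<dots> = cnj (LINT x|lborel. g x * cnj (\<phi> (- x)))" using cftD(3)[OF assms s(2)] by simp
  also have "\<dots> = (LINT x|lborel. cnj (g x) * \<phi> (- x))"
    by (subst Bochner_Integration.integral_cnj[symmetric]) simp
  also have "\<dots> = (LINT x|lborel. cnj (g (- x)) * \<phi> x)"
    using integral_reflect[of "\<lambda>x. cnj (g x) * \<phi> (- x)"] by simp
  finally show "(LINT x|lborel. cnj (f x) * fourier \<phi> x) = (LINT x|lborel. cnj (g (- x)) * \<phi> x)" .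
qed

text \<open>Modulation becomes a shift in frequency. Combined with \<open>parseval\<close> this
  gives the convolution formula for the transform of a product.\<close>

lemma cft_modulate:
  assumes "cft f g" shows "cft (\<lambda>x. cis (- 2 * pi * (x \<bullet> a)) * f x) (\<lambda>\<xi>. g (\<xi> + a))"
  unfolding cft_def
proof (intro allI impI conjI)
  fix \<phi> :: "real^3 \<Rightarrow> complex" assume \<phi>: "schwartz \<phi>"
  note [measurable] = cft_measurable[OF assms] schwartz_measurable[OF \<phi>]
  have s: "schwartz (\<lambda>x. \<phi> (x - a))" using schwartz_translate[OF \<phi>, of "-a"] by simp
  note [measurable] = schwartz_measurable[OF s]
  show "integrable lborel (\<lambda>x. cis (- 2 * pi * (x \<bullet> a)) * f x * \<phi> x)"
    using integrable_cis_mult[OF cftD(1)[OF assms \<phi>], of "- 2 * pi" a] by (simp add: mult.assoc)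
  show "integrable lborel (\<lambda>x. g (x + a) * \<phi> x)"
    using integrable_affine[OF cftD(2)[OF assms s], of 1 a] by simp
  have tr: "fourier (\<lambda>x. \<phi> (x - a)) x = cis (- 2 * pi * (x \<bullet> a)) * fourier \<phi> x" for x
  proof -
    have "fourier (\<lambda>x. \<phi> (x - a)) x = (LINT y|lborel. cis (- 2 * pi * ((y + a) \<bullet> x)) * \<phi> y)"
      unfolding fourier_def using integral_affine[of "\<lambda>y. cis (- 2 * pi * (y \<bullet> x)) * \<phi> (y - a)" 1 a] by simp
    also have "\<dots> = (LINT y|lborel. cis (- 2 * pi * (x \<bullet> a)) * (cis (- 2 * pi * (y \<bullet> x)) * \<phi> y))"
    proof (intro Bochner_Integration.integral_cong refl)
      fix y
      have "cis (- 2 * pi * ((y + a) \<bullet> x)) = cis (- 2 * pi * (x \<bullet> a)) * cis (- 2 * pi * (y \<bullet> x))"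
        by (simp add: cis_mult inner_add_left inner_commute[of a x] algebra_simps)
      then show "cis (- 2 * pi * ((y + a) \<bullet> x)) * \<phi> y = cis (- 2 * pi * (x \<bullet> a)) * (cis (- 2 * pi * (y \<bullet> x)) * \<phi> y)"
        by (simp only: mult.assoc)
    qed
    finally show ?thesis unfolding fourier_def by simp
  qed
  have "(LINT x|lborel. cis (- 2 * pi * (x \<bullet> a)) * f x * fourier \<phi> x) = (LINT x|lborel. f x * fourier (\<lambda>x. \<phi> (x - a)) x)"
    unfolding tr by (simp add: mult_ac)
  also have "\<dots> = (LINT x|lborel. g x * \<phi> (x - a))" using cftD(3)[OF assms s] .
  also have "\<dots> = (LINT x|lborel. g (x + a) * \<phi> x)"
    using integral_affine[of "\<lambda>x. g x * \<phi> (x - a)" 1 a] by simp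
  finally show "(LINT x|lborel. cis (- 2 * pi * (x \<bullet> a)) * f x * fourier \<phi> x) = (LINT x|lborel. g (x + a) * \<phi> x)" .
qed

section \<open>L2 theory: Plancherel and Parseval\<close>

lemma schwartz_sqint:
  assumes "schwartz \<phi>" shows "sqint lborel \<phi> < \<infinity>"
proof -
  have "integrable lborel (\<lambda>x. \<phi> x * cnj (\<phi> x))"
    by (intro schwartz_integrable schwartz_mult schwartz_cnj assms)
  then show ?thesis
    unfolding integrable_iff_bounded sqint_def by (simp add: norm_mult power2_eq_square)
qed

lemma sqint_fourier_schwartz:
  assumes "schwartz \<phi>" shows "sqint lborel (fourier \<phi>) = sqint lborel \<phi>"
proof -
  have i: "integrable lborel (\<lambda>x. (norm (\<phi> x))\<^sup>2)" if "schwartz \<phi>" for \<phi>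
    using schwartz_sqint[OF that] schwartz_measurable[OF that] by (simp add: sqint_def integrable_iff_bounded)
  show ?thesis
    unfolding sqint_def using plancherel_schwartz[OF assms] i[OF assms] i[OF schwartz_fourier[OF assms]]
    by (simp add: nn_integral_eq_integral)
qed

text \<open>Extension by density: transforms of Schwartz approximants are Cauchy by Plancherel. The
  approximating sequence is part of the conclusion because \<open>parseval\<close> passes to the
  limit along it on both sides.\<close>

lemma cft_L2_exists:
  assumes f: "f \<in> borel_measurable borel" "sqint lborel f < \<infinity>"
  obtains g \<psi> where "cft f g" "sqint lborel g < \<infinity>" "\<And>n::nat. schwartz (\<psi> n)"
    "(\<lambda>n. sqint lborel (\<lambda>x. \<psi> n x - f x)) \<longlonglongrightarrow> 0"
    "(\<lambda>n. sqint lborel (\<lambda>x. fourier (\<psi> n) x - g x)) \<longlonglongrightarrow> 0"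
proof -
  \<comment> \<open>With the exponent \<open>Suc n\<close>, the factors 2 + 2 of the squared
    triangle inequality produce exactly the rate (1/4)^n demanded by
    \<open>sqint_complete\<close>.\<close>
  have "\<exists>\<psi>. ccsmooth \<psi> \<and> sqint lborel (\<lambda>x. f x - \<psi> x) < ennreal ((1/4) ^ Suc n)" for n
    by (rule ccsmooth_dense) (use f emeasure_lborel_box_finite in \<open>auto simp: less_top[symmetric] simp del: emeasure_lborel_box_eq\<close>)
  then obtain \<psi> where \<psi>: "\<And>n. ccsmooth (\<psi> n)" "\<And>n. sqint lborel (\<lambda>x. f x - \<psi> n x) < ennreal ((1/4) ^ Suc n)"
    by metis
  have s: "schwartz (\<psi> n)" for n using \<psi>(1) ccsmooth_schwartz by blast
  note [measurable] = schwartz_measurable[OF s] schwartz_measurable[OF schwartz_fourier[OF s]] f(1)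
  have cau: "sqint lborel (\<lambda>x. fourier (\<psi> m) x - fourier (\<psi> n) x) \<le> ennreal ((1/4) ^ n)" if "n \<le> m" for n m
  proof -
    have "fourier (\<lambda>x. \<psi> m x - \<psi> n x) = (\<lambda>x. fourier (\<psi> m) x - fourier (\<psi> n) x)"
      by (rule ext) (simp add: fourier_diff schwartz_integrable s)
    then have "sqint lborel (\<lambda>x. fourier (\<psi> m) x - fourier (\<psi> n) x) = sqint lborel (\<lambda>x. \<psi> m x - \<psi> n x)"
      using sqint_fourier_schwartz[OF schwartz_diff[OF s s], of m n] by simp
    also have "\<dots> \<le> 2 * sqint lborel (\<lambda>x. \<psi> m x - f x) + 2 * sqint lborel (\<lambda>x. f x - \<psi> n x)"
      by (rule sqint_triangle) measurable
    also have "\<dots> \<le> 2 * ennreal ((1/4) ^ Suc n) + 2 * ennreal ((1/4) ^ Suc n)"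
    proof (intro add_mono mult_left_mono)
      have "sqint lborel (\<lambda>x. \<psi> m x - f x) \<le> ennreal ((1/4) ^ Suc m)"
        using \<psi>(2)[of m] by (simp add: sqint_commute[of _ "\<psi> m"])
      also have "\<dots> \<le> ennreal ((1/4) ^ Suc n)" using that by (intro ennreal_leI power_decreasing) auto
      finally show "sqint lborel (\<lambda>x. \<psi> m x - f x) \<le> ennreal ((1/4) ^ Suc n)" .
    qed (use \<psi>(2)[of n] in auto)
    also have "\<dots> = ennreal ((1/4) ^ n)"
    proof -
      have "2 * ennreal ((1/4) ^ Suc n) = ennreal ((1/4) ^ n / 2)" using ennreal_mult'[of 2 "(1/4) ^ Suc n"] by simp
      then show ?thesis by (simp flip: ennreal_plus)
    qed
    finally show ?thesis .
  qed
  obtain g where g[measurable]: "g \<in> borel_measurable lborel" and gl: "\<And>n. sqint lborel (\<lambda>x. g x - fourier (\<psi> n) x) \<le> ennreal ((1/4) ^ n)"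
    using sqint_complete[of "\<lambda>n. fourier (\<psi> n)" lborel, OF _ cau] by auto
  have lim0: "(\<lambda>n. ennreal ((1/4) ^ n)) \<longlonglongrightarrow> 0" "(\<lambda>n. ennreal ((1/4) ^ Suc n)) \<longlonglongrightarrow> 0"
    using tendsto_ennrealI[OF LIMSEQ_realpow_zero[of "1/4"]] LIMSEQ_Suc[OF tendsto_ennrealI[OF LIMSEQ_realpow_zero[of "1/4"]]] by auto
  have lim1: "(\<lambda>n. sqint lborel (\<lambda>x. \<psi> n x - f x)) \<longlonglongrightarrow> 0"
    by (rule tendsto_sandwich[OF _ _ tendsto_const lim0(2)]) (use \<psi>(2) in \<open>auto simp: sqint_commute[of _ "\<psi> _"] less_imp_le\<close>)
  have lim2: "(\<lambda>n. sqint lborel (\<lambda>x. fourier (\<psi> n) x - g x)) \<longlonglongrightarrow> 0"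
    by (rule tendsto_sandwich[OF _ _ tendsto_const lim0(1)]) (use gl in \<open>auto simp: sqint_commute[of _ "fourier (\<psi> _)"]\<close>)
  have gfin: "sqint lborel g < \<infinity>"
  proof -
    have "sqint lborel (\<lambda>x. (g x - fourier (\<psi> 0) x) + fourier (\<psi> 0) x) < \<infinity>"
    proof (rule sqint_add_finite(1))
      show "sqint lborel (\<lambda>x. g x - fourier (\<psi> 0) x) < \<infinity>" using gl[of 0] by (simp add: order.strict_trans1)
      show "sqint lborel (fourier (\<psi> 0)) < \<infinity>" by (intro schwartz_sqint schwartz_fourier s)
    qed measurable
    then show ?thesis by simp
  qed
  have "cft f g"
    unfolding cft_def
  proof (intro allI impI conjI)
    fix \<phi> :: "real^3 \<Rightarrow> complex" assume \<phi>: "schwartz \<phi>"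
    note [measurable] = schwartz_measurable[OF \<phi>] schwartz_measurable[OF schwartz_fourier[OF \<phi>]]
    show "integrable lborel (\<lambda>x. f x * \<phi> x)" by (intro integrable_mult_sqint f(2) schwartz_sqint \<phi>) measurable
    show "integrable lborel (\<lambda>x. g x * \<phi> x)" by (intro integrable_mult_sqint gfin schwartz_sqint \<phi>) measurable
    have "(\<lambda>n. LINT x|lborel. \<psi> n x * fourier \<phi> x) \<longlonglongrightarrow> (LINT x|lborel. f x * fourier \<phi> x)"
      by (intro tendsto_integral_sqint f(2) schwartz_sqint schwartz_fourier \<phi> lim1) measurable
    moreover have "(\<lambda>n. LINT x|lborel. fourier (\<psi> n) x * \<phi> x) \<longlonglongrightarrow> (LINT x|lborel. g x * \<phi> x)"
      by (intro tendsto_integral_sqint gfin schwartz_sqint \<phi> lim2) measurable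
    moreover have "(LINT x|lborel. \<psi> n x * fourier \<phi> x) = (LINT x|lborel. fourier (\<psi> n) x * \<phi> x)" for n
      by (rule fourier_transfer) (intro schwartz_integrable s \<phi>)+
    ultimately show "(LINT x|lborel. f x * fourier \<phi> x) = (LINT x|lborel. g x * \<phi> x)"
      using LIMSEQ_unique by auto
  qed
  then show ?thesis using that gfin s lim1 lim2 by blast
qed

lemma sqint_reflect:
  fixes f :: "real^3 \<Rightarrow> complex"
  assumes [measurable]: "f \<in> borel_measurable borel" shows "sqint lborel (\<lambda>x. f (- x)) = sqint lborel f"
  unfolding sqint_def using nn_integral_affine[of "\<lambda>x. ennreal ((norm (f x))\<^sup>2)" "-1" 0] by simp

text \<open>The form is bilinear, without conjugation, hence the reflected argument of
  \<open>k\<close>. Only \<open>h\<close> is approximated: for Schwartz \<open>h\<close> the formula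
  is the defining pairing of \<open>f\<close> with its transform.\<close>

lemma parseval:
  assumes fg: "cft f g" and hk: "cft h k" and fin: "sqint lborel f < \<infinity>" "sqint lborel h < \<infinity>"
  shows "(LINT x|lborel. f x * h x) = (LINT \<xi>|lborel. g \<xi> * k (- \<xi>))"
proof -
  note [measurable] = cft_measurable[OF fg] cft_measurable[OF hk]
  obtain g' where g': "cft f g'" "sqint lborel g' < \<infinity>" using cft_L2_exists[OF _ fin(1)] by auto
  have gfin: "sqint lborel g < \<infinity>"
    using cft_unique_right[OF fg g'(1)] g'(2) by (subst sqint_cong_AE[of g g']) (auto elim!: eventually_mono)
  obtain k' \<psi> where k': "cft h k'" "sqint lborel k' < \<infinity>" "\<And>n::nat. schwartz (\<psi> n)"
    "(\<lambda>n. sqint lborel (\<lambda>x. \<psi> n x - h x)) \<longlonglongrightarrow> 0"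
    "(\<lambda>n. sqint lborel (\<lambda>x. fourier (\<psi> n) x - k' x)) \<longlonglongrightarrow> 0"
    using cft_L2_exists[OF _ fin(2)] by auto
  have kk: "AE \<xi> in lborel. k' (- \<xi>) = k (- \<xi>)" using AE_reflect[OF cft_unique_right[OF k'(1) hk]] .
  note [measurable] = schwartz_measurable[OF k'(3)] schwartz_measurable[OF schwartz_fourier[OF k'(3)]] cft_measurable[OF k'(1)]
  have "(\<lambda>n. LINT x|lborel. \<psi> n x * f x) \<longlonglongrightarrow> (LINT x|lborel. h x * f x)"
    by (intro tendsto_integral_sqint fin k'(4)) measurable
  moreover have "(\<lambda>n. LINT x|lborel. fourier (\<psi> n) (- x) * g x) \<longlonglongrightarrow> (LINT x|lborel. k' (- x) * g x)"
  proof (rule tendsto_integral_sqint)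
    show "(\<lambda>n. sqint lborel (\<lambda>x. fourier (\<psi> n) (- x) - k' (- x))) \<longlonglongrightarrow> 0"
      using k'(5) sqint_reflect[of "\<lambda>x. fourier (\<psi> _) x - k' x"] by simp
    show "sqint lborel (\<lambda>x. k' (- x)) < \<infinity>" using k'(2) sqint_reflect[of k'] by simp
  qed (use gfin in measurable)
  moreover have "(LINT x|lborel. \<psi> n x * f x) = (LINT x|lborel. fourier (\<psi> n) (- x) * g x)" for n
  proof -
    have s: "schwartz (\<lambda>x. fourier (\<psi> n) (- x))" by (intro schwartz_reflect schwartz_fourier k'(3))
    have "fourier (\<lambda>x. fourier (\<psi> n) (- x)) = \<psi> n"
      by (rule ext) (simp add: fourier_reflect fourier_fourier k'(3))
    then show ?thesis using cftD(3)[OF fg s] by (simp add: mult.commute)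
  qed
  ultimately have "(LINT x|lborel. h x * f x) = (LINT x|lborel. k' (- x) * g x)"
    using LIMSEQ_unique by auto
  also have "\<dots> = (LINT x|lborel. k (- x) * g x)"
    by (rule integral_cong_AE) (use kk in \<open>auto elim!: eventually_mono\<close>)
  finally show ?thesis by (simp add: mult.commute)
qed

lemma integral_norm_square_sqint:
  fixes f :: "'a \<Rightarrow> complex"
  assumes [measurable]: "f \<in> borel_measurable M" and "sqint M f < \<infinity>"
  shows "ennreal (Re (LINT x|M. f x * cnj (f x))) = sqint M f"
proof -
  have i: "integrable M (\<lambda>x. (norm (f x))\<^sup>2)" using assms by (simp add: sqint_def integrable_iff_bounded)
  have "(LINT x|M. f x * cnj (f x)) = complex_of_real (LINT x|M. (norm (f x))\<^sup>2)"
    by (simp only: complex_norm_square[symmetric] integral_complex_of_real)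
  then show ?thesis unfolding sqint_def using i by (simp add: nn_integral_eq_integral)
qed

lemma cft_sqint_finite:
  assumes "cft f g" "sqint lborel f < \<infinity>" shows "sqint lborel g < \<infinity>"
proof -
  note [measurable] = cft_measurable[OF assms(1)]
  obtain g' where g': "cft f g'" "sqint lborel g' < \<infinity>" using cft_L2_exists[OF _ assms(2)] by auto
  then show ?thesis
    using cft_unique_right[OF assms(1) g'(1)] by (subst sqint_cong_AE[of g g']) (auto elim!: eventually_mono)
qed

lemma cft_sqint:
  assumes "cft f g" "sqint lborel f < \<infinity>" shows "sqint lborel g = sqint lborel f"
proof -
  note [measurable] = cft_measurable[OF assms(1)]
  have "sqint lborel (\<lambda>x. cnj (f x)) < \<infinity>" using assms(2) by (simp add: sqint_def)
  from parseval[OF assms(1) cft_cnj[OF assms(1)] assms(2) this]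
  have "(LINT x|lborel. f x * cnj (f x)) = (LINT \<xi>|lborel. g \<xi> * cnj (g \<xi>))" by simp
  then show ?thesis
    using integral_norm_square_sqint[of f lborel] integral_norm_square_sqint[of g lborel] assms cft_sqint_finite[OF assms] by simp
qed

lemma cft_L2_inverse_exists:
  assumes "g \<in> borel_measurable borel" "sqint lborel g < \<infinity>"
  obtains f where "cft f g" "sqint lborel f < \<infinity>"
proof -
  obtain h where h: "cft g h" "sqint lborel h < \<infinity>" using cft_L2_exists[OF assms] by auto
  then show ?thesis
    using that[OF cft_dual[OF h(1)]] sqint_reflect[OF cft_measurable(2)[OF h(1)]] by simp
qed

text \<open>Square integrability of \<open>f\<close> is a consequence: by uniqueness
  \<open>f\<close> agrees almost everywhere with the L2 inverse transform of
  \<open>g\<close>.\<close>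

lemma cft_sqint_inverse:
  assumes "cft f g" "sqint lborel g < \<infinity>" shows "sqint lborel f = sqint lborel g"
proof -
  obtain f' where f': "cft f' g" "sqint lborel f' < \<infinity>"
    using cft_L2_inverse_exists[OF cft_measurable(2)[OF assms(1)] assms(2)] .
  have "sqint lborel f = sqint lborel f'"
    using cft_unique_left[OF assms(1) f'(1)] by (intro sqint_cong_AE) (auto elim!: eventually_mono)
  then show ?thesis using cft_sqint[OF f'] by simp
qed

lemma cft_inverse_integrable:
  assumes "integrable lborel g" shows "\<exists>f. cft f g"
  using cft_dual[OF cft_integrable[OF assms]] by blast

text \<open>The symmetry characterising transforms of real functions. Every multiplier in use has to
  preserve it, so that a real field can be recovered from its symbol.\<close>

definition hermitian :: "(real^3 \<Rightarrow> complex) \<Rightarrow> bool"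
  where "hermitian g \<longleftrightarrow> (AE \<xi> in lborel. g (- \<xi>) = cnj (g \<xi>))"

lemma has_ft_hermitian: assumes "has_ft f g" shows "hermitian g"
proof -
  have c: "cft (\<lambda>x. complex_of_real (f x)) g" using assms has_ft_cft by blast
  have "AE \<xi> in lborel. cnj (g (- \<xi>)) = g \<xi>"
    using cft_unique_right[OF _ c, of "\<lambda>\<xi>. cnj (g (- \<xi>))"] cft_cnj[OF c] by simp
  then show ?thesis unfolding hermitian_def by (auto elim!: eventually_mono) (metis complex_cnj_cnj)
qed

lemma has_ft_of_hermitian:
  assumes "cft f g" "hermitian g" shows "has_ft (\<lambda>x. Re (f x)) g"
proof -
  note [measurable] = cft_measurable[OF assms(1)]
  have "cft (\<lambda>x. 1/2 * (f x + cnj (f x))) (\<lambda>\<xi>. 1/2 * (g \<xi> + cnj (g (- \<xi>))))"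
    by (intro cft_cmul cft_add cft_cnj assms)
  then have "cft (\<lambda>x. complex_of_real (Re (f x))) g"
  proof (rule cft_cong_AE)
    show "AE x in lborel. 1/2 * (f x + cnj (f x)) = complex_of_real (Re (f x))"
      by (simp add: complex_add_cnj)
    show "AE \<xi> in lborel. 1/2 * (g \<xi> + cnj (g (- \<xi>))) = g \<xi>"
      using assms(2) unfolding hermitian_def by (auto elim!: eventually_mono)
  qed measurable
  then show ?thesis unfolding has_ft_cft .
qed

section \<open>Singular weights, products and density\<close>

text \<open>Finds the dyadic shell of a radius. Summing over such shells replaces polar coordinates
  in the two weight integrals that follow.\<close>

lemma dyadic_scale:
  assumes "0 < r" "r \<le> (1::real)" obtains k where "(1/2) ^ Suc k < r" "r \<le> (1/2) ^ k"
proof -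
  define n where "n = (LEAST n. (1/2) ^ n < r)"
  obtain m where "(1/2) ^ m < r" using real_arch_pow_inv[OF assms(1), of "1/2"] by auto
  then have n: "(1/2) ^ n < r" unfolding n_def by (rule LeastI)
  then have "n \<noteq> 0" using assms(2) by (intro notI) simp
  then obtain k where k: "n = Suc k" by (cases n) auto
  have "\<not> (1/2) ^ k < r" using not_less_Least[of k "\<lambda>n. (1/2) ^ n < r"] k unfolding n_def by auto
  then show ?thesis using that[of k] n k by auto
qed

lemma cball_borel [measurable]: "cball (a::real^3) r \<in> sets borel"
  by simp

lemma norm_borel [measurable]: "norm \<in> borel_measurable (borel :: (real^3) measure)"
  by (intro borel_measurable_continuous_onI continuous_intros)

definition ball_volume3 :: ennreal where "ball_volume3 = emeasure lborel (cball (0 :: real^3) 1)"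

lemma ball_volume3_finite: "ball_volume3 < \<top>"
  unfolding ball_volume3_def using emeasure_bounded_finite[of "cball 0 1 :: (real^3) set"] by simp

lemma emeasure_cball_scale:
  assumes "r > 0" shows "emeasure lborel (cball (0 :: real^3) r) = ennreal (r ^ 3) * ball_volume3"
proof -
  have "emeasure lborel (cball (0 :: real^3) r) = (\<integral>\<^sup>+x. indicator (cball 0 r) x \<partial>(lborel :: (real^3) measure))" by simp
  also have "\<dots> = ennreal (r ^ 3) * (\<integral>\<^sup>+x. indicator (cball 0 r) (r *\<^sub>R x + 0) \<partial>(lborel :: (real^3) measure))"
    using nn_integral_affine[of "indicator (cball 0 r)" r 0, OF borel_measurable_indicator[OF cball_borel]] assms by simp
  also have "(\<integral>\<^sup>+x. indicator (cball 0 r) (r *\<^sub>R x + 0) \<partial>(lborel :: (real^3) measure)) = (\<integral>\<^sup>+x. indicator (cball 0 1) x \<partial>(lborel :: (real^3) measure))"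
    using assms by (intro nn_integral_cong) (auto simp: indicator_def mult_le_cancel_left1)
  finally show ?thesis by (simp add: ball_volume3_def)
qed

lemma suminf_geometric_ennreal:
  assumes "c < \<top>" "0 \<le> a" shows "(\<Sum>k. ennreal (a * (1/2) ^ k) * c) < \<top>"
proof -
  have "(\<Sum>k. ennreal (a * (1/2) ^ k) * c) = (\<Sum>k. ennreal (a * (1/2) ^ k)) * c"
    by (rule ennreal_suminf_multc)
  also have "(\<Sum>k. ennreal (a * (1/2) ^ k)) = ennreal (\<Sum>k. a * (1/2) ^ k)"
    using assms(2) by (intro suminf_ennreal2 summable_mult summable_geometric) auto
  finally show ?thesis using assms(1) by (simp add: ennreal_mult_less_top)
qed

text \<open>On the shell 2^(-k-1) < |xi| \<le> 2^(-k) the integrand is at most 4^(k+1), while the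
  enclosing ball has volume proportional to 8^(-k). The ratio 4/8 makes the series geometric; here
  the dimension three is decisive.\<close>

lemma nn_integral_inverse_square_ball:
  "(\<integral>\<^sup>+\<xi>. ennreal (1 / (norm \<xi>)\<^sup>2) * indicator (cball 0 1) \<xi> \<partial>(lborel :: (real^3) measure)) < \<infinity>"
proof -
  let ?t = "\<lambda>k \<xi>. ennreal (4 ^ Suc k) * indicator (cball (0::real^3) ((1/2) ^ k)) \<xi>"
  have "ennreal (1 / (norm \<xi>)\<^sup>2) * indicator (cball 0 1) \<xi> \<le> (\<Sum>k. ?t k \<xi>)" for \<xi> :: "real^3"
  proof (cases "\<xi> \<noteq> 0 \<and> norm \<xi> \<le> 1")
    case True
    then obtain k where k: "(1/2) ^ Suc k < norm \<xi>" "norm \<xi> \<le> (1/2) ^ k" using dyadic_scale[of "norm \<xi>"] by auto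
    have "((1/2) ^ Suc k)\<^sup>2 \<le> (norm \<xi>)\<^sup>2" using k(1) by (intro power_mono) auto
    moreover have "((1/2::real) ^ Suc k)\<^sup>2 = 1 / 4 ^ Suc k"
      by (simp only: power_commutes power_mult[symmetric] power_divide) (simp add: power_mult power_mult_distrib[symmetric] mult.commute[of _ 2])
    ultimately have "1 / (norm \<xi>)\<^sup>2 \<le> 4 ^ Suc k" using True by (simp add: field_simps)
    then have "ennreal (1 / (norm \<xi>)\<^sup>2) * indicator (cball 0 1) \<xi> \<le> (\<Sum>k\<in>{k}. ?t k \<xi>)"
      using True k(2) by (simp add: ennreal_leI)
    also have "\<dots> \<le> (\<Sum>k. ?t k \<xi>)" by (rule sum_le_suminf) auto
    finally show ?thesis .
  next
    case False
    then have "ennreal (1 / (norm \<xi>)\<^sup>2) * indicator (cball 0 1) \<xi> = 0" by (cases "\<xi> = 0") simp_all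
    then show ?thesis by (simp only: zero_le)
  qed
  then have "(\<integral>\<^sup>+\<xi>. ennreal (1 / (norm \<xi>)\<^sup>2) * indicator (cball 0 1) \<xi> \<partial>(lborel :: (real^3) measure))
     \<le> (\<integral>\<^sup>+\<xi>. (\<Sum>k. ?t k \<xi>) \<partial>lborel)" by (intro nn_integral_mono)
  also have "\<dots> = (\<Sum>k. \<integral>\<^sup>+\<xi>. ?t k \<xi> \<partial>lborel)" by (rule nn_integral_suminf) measurable
  also have "\<dots> = (\<Sum>k. ennreal (4 * (1/2) ^ k) * ball_volume3)"
  proof (rule suminf_cong)
    fix k
    have "(\<integral>\<^sup>+\<xi>. ?t k \<xi> \<partial>lborel) = ennreal (4 ^ Suc k) * (ennreal (((1/2) ^ k) ^ 3) * ball_volume3)"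
      by (simp add: nn_integral_cmult emeasure_cball_scale del: power_Suc)
    also have "\<dots> = ennreal (4 ^ Suc k * ((1/2) ^ k) ^ 3) * ball_volume3"
      by (simp add: ennreal_mult mult.assoc)
    also have "4 ^ Suc k * ((1/2) ^ k) ^ 3 = (4::real) * (4 * (1/2) ^ 3) ^ k"
      unfolding power_mult_distrib by (simp add: power_mult[symmetric] mult.commute)
    finally show "(\<integral>\<^sup>+\<xi>. ?t k \<xi> \<partial>lborel) = ennreal (4 * (1/2) ^ k) * ball_volume3" by (simp add: power3_eq_cube)
  qed
  also have "\<dots> < \<infinity>"
    unfolding infinity_ennreal_def by (rule suminf_geometric_ennreal[OF ball_volume3_finite]) simp
  finally show ?thesis .
qed

text \<open>For 2^k \<le> |xi| < 2^(k+1) the integrand is at most 16^(-k) and the enclosing ball has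
  volume proportional to 8^(k+1). Decay of order four beats dimension three, again with ratio
  1/2.\<close>

lemma nn_integral_weight4:
  "(\<integral>\<^sup>+\<xi>. ennreal (1 / (1 + 4 * pi\<^sup>2 * (norm \<xi>)\<^sup>2)\<^sup>2) \<partial>(lborel :: (real^3) measure)) < \<infinity>"
proof -
  let ?t = "\<lambda>k \<xi>. ennreal ((1/16) ^ k) * indicator (cball (0::real^3) (2 ^ Suc k)) \<xi>"
  have "ennreal (1 / (1 + 4 * pi\<^sup>2 * (norm \<xi>)\<^sup>2)\<^sup>2) \<le> indicator (cball 0 1) \<xi> + (\<Sum>k. ?t k \<xi>)" for \<xi> :: "real^3"
  proof (cases "norm \<xi> \<le> 1")
    case True
    have "1 \<le> (1 + 4 * pi\<^sup>2 * (norm \<xi>)\<^sup>2)\<^sup>2" by (rule one_le_power) simp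
    then have "1 / (1 + 4 * pi\<^sup>2 * (norm \<xi>)\<^sup>2)\<^sup>2 \<le> 1 / 1" 
      using add_pos_nonneg[of 1 "4 * pi\<^sup>2 * (norm \<xi>)\<^sup>2"] by (intro divide_left_mono) auto
    then have "ennreal (1 / (1 + 4 * pi\<^sup>2 * (norm \<xi>)\<^sup>2)\<^sup>2) \<le> indicator (cball 0 1) \<xi>"
      using True ennreal_leI by fastforce
    then show ?thesis by (rule order_trans) simp
  next
    case False
    define r where "r = norm \<xi>"
    have r: "r > 1" using False r_def by simp
    obtain k where k: "(1/2) ^ Suc k < 1 / r" "1 / r \<le> (1/2) ^ k"
      using dyadic_scale[of "1 / r"] r by auto
    have k1: "r < 2 ^ Suc k" using k(1) r by (simp add: field_simps)
    have k2: "2 ^ k \<le> r" using k(2) r by (simp add: field_simps)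
    have "(16::real) ^ k = ((2 ^ k)\<^sup>2)\<^sup>2" by (simp add: power_mult[symmetric] mult.commute[of k] power_mult)
    also have "\<dots> \<le> (r\<^sup>2)\<^sup>2" using k2 by (intro power_mono) auto
    also have "\<dots> \<le> (1 + 4 * pi\<^sup>2 * r\<^sup>2)\<^sup>2"
    proof (intro power_mono)
      have "1 * r\<^sup>2 \<le> (4 * pi\<^sup>2) * r\<^sup>2"
      proof (intro mult_right_mono)
        have "1 \<le> pi" using pi_gt3 by simp
        then have "1 \<le> pi\<^sup>2" by (rule one_le_power)
        then show "1 \<le> 4 * pi\<^sup>2" by simp
      qed simp
      then show "r\<^sup>2 \<le> 1 + 4 * pi\<^sup>2 * r\<^sup>2" by simp
    qed simp
    finally have "1 / (1 + 4 * pi\<^sup>2 * r\<^sup>2)\<^sup>2 \<le> (1/16) ^ k"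
      using frac_le[of 1 1 "16 ^ k" "(1 + 4 * pi\<^sup>2 * r\<^sup>2)\<^sup>2"] by (simp add: power_one_over)
    then have "ennreal (1 / (1 + 4 * pi\<^sup>2 * (norm \<xi>)\<^sup>2)\<^sup>2) \<le> (\<Sum>k\<in>{k}. ?t k \<xi>)"
      using k1 unfolding r_def by (simp add: ennreal_leI)
    also have "\<dots> \<le> (\<Sum>k. ?t k \<xi>)" by (rule sum_le_suminf) auto
    finally show ?thesis by (rule order_trans) simp
  qed
  then have "(\<integral>\<^sup>+\<xi>. ennreal (1 / (1 + 4 * pi\<^sup>2 * (norm \<xi>)\<^sup>2)\<^sup>2) \<partial>(lborel :: (real^3) measure))
     \<le> (\<integral>\<^sup>+\<xi>. indicator (cball 0 1) \<xi> + (\<Sum>k. ?t k \<xi>) \<partial>lborel)" by (intro nn_integral_mono)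
  also have "\<dots> = ball_volume3 + (\<Sum>k. \<integral>\<^sup>+\<xi>. ?t k \<xi> \<partial>lborel)"
    by (subst nn_integral_add, measurable, subst nn_integral_suminf) (auto simp: ball_volume3_def)
  also have "(\<Sum>k. \<integral>\<^sup>+\<xi>. ?t k \<xi> \<partial>lborel) = (\<Sum>k. ennreal (8 * (1/2) ^ k) * ball_volume3)"
  proof (rule suminf_cong)
    fix k
    have "(\<integral>\<^sup>+\<xi>. ?t k \<xi> \<partial>lborel) = ennreal ((1/16) ^ k) * (ennreal ((2 ^ Suc k) ^ 3) * ball_volume3)"
      by (simp add: nn_integral_cmult emeasure_cball_scale del: power_Suc)
    also have "\<dots> = ennreal ((1/16) ^ k * (2 ^ Suc k) ^ 3) * ball_volume3"
      by (simp add: ennreal_mult mult.assoc)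
    also have "(1/16) ^ k * (2 ^ Suc k) ^ 3 = (8::real) * ((1/16) * 2 ^ 3) ^ k"
    proof -
      have "((2::real) ^ k) ^ 3 = (2 ^ 3) ^ k" by (simp only: power_mult[symmetric] mult.commute)
      moreover have "((2::real) ^ Suc k) ^ 3 = 8 * (2 ^ k) ^ 3" by (simp add: power_mult_distrib)
      ultimately show ?thesis by (simp only: power_mult_distrib mult.left_commute)
    qed
    finally show "(\<integral>\<^sup>+\<xi>. ?t k \<xi> \<partial>lborel) = ennreal (8 * (1/2) ^ k) * ball_volume3" by (simp add: power3_eq_cube)
  qed
  also have "ball_volume3 + \<dots> < \<infinity>"
    unfolding infinity_ennreal_def ennreal_add_less_top
    by (intro conjI ball_volume3_finite suminf_geometric_ennreal) simp
  finally show ?thesis .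
qed

text \<open>Multipliers of order \<open>-1\<close> are integrable near the origin and square integrable away from it.\<close>

lemma cft_order_minus_one_exists:
  fixes G :: "real^3 \<Rightarrow> complex"
  assumes G: "G \<in> borel_measurable borel" "sqint lborel G < \<infinity>"
    and g[measurable]: "g \<in> borel_measurable borel"
    and le: "AE \<xi> in lborel. norm (g \<xi>) \<le> C * norm (G \<xi>) / norm (\<xi>::real^3)"
  shows "\<exists>f. cft f g"
proof -
  note [measurable] = G(1)
  let ?B = "cball (0::real^3) 1"
  let ?w = "\<lambda>\<xi>. complex_of_real (indicator ?B \<xi> / norm \<xi>)"
  have wfin: "sqint lborel ?w < \<infinity>"
  proof -
    have "sqint lborel ?w = (\<integral>\<^sup>+\<xi>. ennreal (1 / (norm \<xi>)\<^sup>2) * indicator ?B \<xi> \<partial>lborel)"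
      unfolding sqint_def by (intro nn_integral_cong) (auto simp: indicator_def power_divide norm_divide)
    then show ?thesis using nn_integral_inverse_square_ball by simp
  qed
  have [measurable]: "?w \<in> borel_measurable borel" by measurable
  have "integrable lborel (\<lambda>\<xi>. complex_of_real C * (G \<xi> * ?w \<xi>))"
    by (intro integrable_mult_right integrable_mult_sqint G(2) wfin) measurable
  then have "integrable lborel (\<lambda>\<xi>. indicator ?B \<xi> *\<^sub>R g \<xi>)"
  proof (rule Bochner_Integration.integrable_bound)
    show "AE \<xi> in lborel. norm (indicator ?B \<xi> *\<^sub>R g \<xi>) \<le> norm (complex_of_real C * (G \<xi> * ?w \<xi>))"
      using le
    proof eventually_elim
      case (elim \<xi>)
      then have "norm (g \<xi>) \<le> norm (C * norm (G \<xi>) / norm \<xi>)" by (metis abs_ge_self order_trans real_norm_def)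
      then show ?case by (auto simp: indicator_def norm_mult norm_divide abs_mult)
    qed
  qed measurable
  then obtain f1 where f1: "cft f1 (\<lambda>\<xi>. indicator ?B \<xi> *\<^sub>R g \<xi>)" using cft_inverse_integrable by blast
  have "sqint lborel (\<lambda>\<xi>. indicator (- ?B) \<xi> *\<^sub>R g \<xi>) \<le> sqint lborel (\<lambda>\<xi>. complex_of_real C * G \<xi>)"
    unfolding sqint_def
  proof (intro nn_integral_mono_AE)
    show "AE \<xi> in lborel. ennreal ((norm (indicator (- ?B) \<xi> *\<^sub>R g \<xi>))\<^sup>2) \<le> ennreal ((norm (complex_of_real C * G \<xi>))\<^sup>2)"
      using le
    proof eventually_elim
      case (elim \<xi>)
      show ?case
      proof (intro ennreal_leI power_mono)
        show "norm (indicator (- ?B) \<xi> *\<^sub>R g \<xi>) \<le> norm (complex_of_real C * G \<xi>)"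
        proof (cases "\<xi> \<in> ?B")
          case False
          then have "norm \<xi> > 1" by simp
          have "norm (g \<xi>) \<le> \<bar>C\<bar> * norm (G \<xi>) / norm \<xi>"
            using elim by (rule order_trans) (intro divide_right_mono mult_right_mono, auto)
          also have "\<dots> \<le> \<bar>C\<bar> * norm (G \<xi>)"
            using \<open>norm \<xi> > 1\<close> divide_left_mono[of 1 "norm \<xi>" "\<bar>C\<bar> * norm (G \<xi>)"] by (cases "\<xi> = 0") simp_all
          finally show ?thesis using False by (simp add: norm_mult)
        qed simp
      qed simp
    qed
  qed
  also have "\<dots> < \<infinity>" using G(2) by (simp add: sqint_cmult ennreal_mult_less_top)
  finally obtain f2 where f2: "cft f2 (\<lambda>\<xi>. indicator (- ?B) \<xi> *\<^sub>R g \<xi>)"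
    using cft_L2_inverse_exists[of "\<lambda>\<xi>. indicator (- ?B) \<xi> *\<^sub>R g \<xi>"] by auto
  have "(\<lambda>\<xi>. indicator ?B \<xi> *\<^sub>R g \<xi> + indicator (- ?B) \<xi> *\<^sub>R g \<xi>) = g"
    by (auto simp: indicator_def fun_eq_iff)
  then show ?thesis using cft_add[OF f1 f2] by auto
qed

section \<open>Products of H1 functions\<close>

definition h1_sq :: "(real^3 \<Rightarrow> complex) \<Rightarrow> ennreal"
  where "h1_sq g = (\<integral>\<^sup>+\<xi>. ennreal ((1 + 4 * pi\<^sup>2 * (norm \<xi>)\<^sup>2) * (norm (g \<xi>))\<^sup>2) \<partial>lborel)"

definition product_const :: ennreal
  where "product_const = (\<integral>\<^sup>+\<xi>. ennreal (1 / (1 + 4 * pi\<^sup>2 * (norm \<xi>)\<^sup>2)\<^sup>2) \<partial>(lborel :: (real^3) measure))"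

lemma product_const_finite: "product_const < \<top>"
  using nn_integral_weight4 unfolding product_const_def by simp

text \<open>On the Fourier side the product is a convolution; distributing the weight
  \<open>1 + 4 \<pi>\<^sup>2 |\<xi>|\<^sup>2\<close> over both factors and using Cauchy--Schwarz replaces the
  Sobolev embedding of \<open>H\<^sup>1\<close> into \<open>L\<^sup>4\<close>.\<close>

lemma product_L2:
  assumes fg: "cft f g" and hk: "cft h k" and fin: "sqint lborel f < \<infinity>" "sqint lborel h < \<infinity>"
  shows "cft (\<lambda>x. f x * h x) (fourier (\<lambda>x. f x * h x))"
    and "sqint lborel (fourier (\<lambda>x. f x * h x)) \<le> product_const * (h1_sq g * h1_sq k)"
proof -
  note [measurable] = cft_measurable[OF fg] cft_measurable[OF hk]
  show "cft (\<lambda>x. f x * h x) (fourier (\<lambda>x. f x * h x))"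
    by (intro cft_integrable integrable_mult_sqint fin) measurable
  let ?s = "\<lambda>\<xi>::real^3. 1 + 4 * pi\<^sup>2 * (norm \<xi>)\<^sup>2"
  let ?a = "\<lambda>g \<xi>. sqrt (?s \<xi>) * norm (g \<xi> :: complex)"
  have sp: "?s \<xi> > 0" for \<xi> by (simp add: add_pos_nonneg)
  \<comment> \<open>Parseval against the modulated second factor gives the convolution at every
    single frequency, not merely almost everywhere.\<close>
  have conv: "fourier (\<lambda>x. f x * h x) \<xi> = (LINT \<eta>|lborel. g \<eta> * k (- \<eta> + \<xi>))" for \<xi>
  proof -
    have "sqint lborel (\<lambda>x. cis (- 2 * pi * (x \<bullet> \<xi>)) * h x) < \<infinity>" using fin(2) by (simp add: sqint_def norm_mult)
    from parseval[OF fg cft_modulate[OF hk] fin(1) this]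
    show ?thesis by (simp add: fourier_def mult_ac)
  qed
  have pw: "ennreal ((norm (fourier (\<lambda>x. f x * h x) \<xi>))\<^sup>2) \<le>
      (\<integral>\<^sup>+\<eta>. ennreal (?s \<eta> * (norm (g \<eta>))\<^sup>2) * ennreal (?s (\<xi> - \<eta>) * (norm (k (\<xi> - \<eta>)))\<^sup>2) \<partial>lborel) * product_const" for \<xi>
  proof -
    let ?A = "\<lambda>\<eta>. ennreal (?a g \<eta> * ?a k (\<xi> - \<eta>))"
    let ?B = "\<lambda>\<eta>. ennreal (1 / (sqrt (?s \<eta>) * sqrt (?s (\<xi> - \<eta>))))"
    have "ennreal (norm (fourier (\<lambda>x. f x * h x) \<xi>)) \<le> (\<integral>\<^sup>+\<eta>. ennreal (norm (g \<eta> * k (- \<eta> + \<xi>))) \<partial>lborel)"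
      unfolding conv
      by (cases "integrable lborel (\<lambda>\<eta>. g \<eta> * k (- \<eta> + \<xi>))")
        (auto intro: integral_norm_bound_ennreal simp: not_integrable_integral_eq)
    also have "\<dots> = (\<integral>\<^sup>+\<eta>. ?A \<eta> * ?B \<eta> \<partial>lborel)"
    proof (intro nn_integral_cong)
      fix \<eta>
      have "sqrt (?s \<eta>) > 0" "sqrt (?s (\<xi> - \<eta>)) > 0" using sp by auto
      then have "norm (g \<eta> * k (- \<eta> + \<xi>)) = ?a g \<eta> * ?a k (\<xi> - \<eta>) * (1 / (sqrt (?s \<eta>) * sqrt (?s (\<xi> - \<eta>))))"
        by (simp add: norm_mult)
      then show "ennreal (norm (g \<eta> * k (- \<eta> + \<xi>))) = ?A \<eta> * ?B \<eta>"
        by (simp only:) (rule ennreal_mult', simp)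
    qed
    finally have "(ennreal (norm (fourier (\<lambda>x. f x * h x) \<xi>)))\<^sup>2 \<le> (\<integral>\<^sup>+\<eta>. ?A \<eta> * ?B \<eta> \<partial>lborel)\<^sup>2"
      by (intro power_mono) auto
    also have "\<dots> \<le> (\<integral>\<^sup>+\<eta>. (?A \<eta>)\<^sup>2 \<partial>lborel) * (\<integral>\<^sup>+\<eta>. (?B \<eta>)\<^sup>2 \<partial>lborel)"
      by (rule Cauchy_Schwarz_nn_integral) measurable
    also have "(\<integral>\<^sup>+\<eta>. (?A \<eta>)\<^sup>2 \<partial>lborel) = (\<integral>\<^sup>+\<eta>. ennreal (?s \<eta> * (norm (g \<eta>))\<^sup>2) * ennreal (?s (\<xi> - \<eta>) * (norm (k (\<xi> - \<eta>)))\<^sup>2) \<partial>lborel)"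
    proof (intro nn_integral_cong)
      fix \<eta>
      have "(?A \<eta>)\<^sup>2 = ennreal ((?a g \<eta> * ?a k (\<xi> - \<eta>))\<^sup>2)" by (rule ennreal_power) simp
      also have "(?a g \<eta> * ?a k (\<xi> - \<eta>))\<^sup>2 = (?s \<eta> * (norm (g \<eta>))\<^sup>2) * (?s (\<xi> - \<eta>) * (norm (k (\<xi> - \<eta>)))\<^sup>2)"
        using sp[of \<eta>] sp[of "\<xi> - \<eta>"] by (simp add: power_mult_distrib)
      finally show "(?A \<eta>)\<^sup>2 = ennreal (?s \<eta> * (norm (g \<eta>))\<^sup>2) * ennreal (?s (\<xi> - \<eta>) * (norm (k (\<xi> - \<eta>)))\<^sup>2)"
        using sp[of \<eta>] sp[of "\<xi> - \<eta>"] by (simp add: ennreal_mult)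
    qed
    \<comment> \<open>The inequality a b \<le> (a^2 + b^2) / 2 separates the two weights. Reflection
      and translation make the resulting integrals equal, so the two halves add up to
      \<open>product_const\<close> for every frequency.\<close>
    also have "(\<integral>\<^sup>+\<eta>. (?B \<eta>)\<^sup>2 \<partial>lborel) \<le> (\<integral>\<^sup>+\<eta>. ennreal (1 / (?s \<eta>)\<^sup>2 / 2) + ennreal (1 / (?s (\<xi> - \<eta>))\<^sup>2 / 2) \<partial>lborel)"
    proof (intro nn_integral_mono)
      fix \<eta>
      have "(?B \<eta>)\<^sup>2 = ennreal ((1 / (sqrt (?s \<eta>) * sqrt (?s (\<xi> - \<eta>))))\<^sup>2)" by (rule ennreal_power) simp
      also have "(1 / (sqrt (?s \<eta>) * sqrt (?s (\<xi> - \<eta>))))\<^sup>2 = (1 / ?s \<eta>) * (1 / ?s (\<xi> - \<eta>))"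
        using sp[of \<eta>] sp[of "\<xi> - \<eta>"] by (simp add: power_mult_distrib power_divide)
      also have "(1 / ?s \<eta>) * (1 / ?s (\<xi> - \<eta>)) \<le> 1 / (?s \<eta>)\<^sup>2 / 2 + 1 / (?s (\<xi> - \<eta>))\<^sup>2 / 2"
        using sum_squares_bound[of "1 / ?s \<eta>" "1 / ?s (\<xi> - \<eta>)"] by (simp add: power_divide)
      finally show "(?B \<eta>)\<^sup>2 \<le> ennreal (1 / (?s \<eta>)\<^sup>2 / 2) + ennreal (1 / (?s (\<xi> - \<eta>))\<^sup>2 / 2)"
        by (simp add: ennreal_leI flip: ennreal_plus)
    qed
    also have "\<dots> = (\<integral>\<^sup>+\<eta>. ennreal (1 / (?s \<eta>)\<^sup>2 / 2) \<partial>lborel) + (\<integral>\<^sup>+\<eta>. ennreal (1 / (?s (\<xi> - \<eta>))\<^sup>2 / 2) \<partial>lborel)"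
      by (rule nn_integral_add) measurable
    also have "(\<integral>\<^sup>+\<eta>. ennreal (1 / (?s (\<xi> - \<eta>))\<^sup>2 / 2) \<partial>lborel) = (\<integral>\<^sup>+\<eta>. ennreal (1 / (?s \<eta>)\<^sup>2 / 2) \<partial>lborel)"
      using nn_integral_affine[of "\<lambda>\<eta>. ennreal (1 / (?s \<eta>)\<^sup>2 / 2)" "-1" \<xi>] by (simp add: add.commute[of _ \<xi>])
    also have "(\<integral>\<^sup>+\<eta>. ennreal (1 / (?s \<eta>)\<^sup>2 / 2) \<partial>lborel) + (\<integral>\<^sup>+\<eta>. ennreal (1 / (?s \<eta>)\<^sup>2 / 2) \<partial>lborel) = product_const"
      unfolding product_const_def
      by (subst nn_integral_add[symmetric]) (auto intro!: nn_integral_cong simp flip: ennreal_plus)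
    finally show ?thesis by (simp add: ennreal_power mult_left_mono)
  qed
  have "sqint lborel (fourier (\<lambda>x. f x * h x)) \<le> (\<integral>\<^sup>+\<xi>. (\<integral>\<^sup>+\<eta>. ennreal (?s \<eta> * (norm (g \<eta>))\<^sup>2) * ennreal (?s (\<xi> - \<eta>) * (norm (k (\<xi> - \<eta>)))\<^sup>2) \<partial>lborel) * product_const \<partial>lborel)"
    unfolding sqint_def by (intro nn_integral_mono pw)
  also have "\<dots> = (\<integral>\<^sup>+\<xi>. (\<integral>\<^sup>+\<eta>. ennreal (?s \<eta> * (norm (g \<eta>))\<^sup>2) * ennreal (?s (\<xi> - \<eta>) * (norm (k (\<xi> - \<eta>)))\<^sup>2) \<partial>lborel) \<partial>lborel) * product_const"
    by (rule nn_integral_multc) measurable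
  also have "(\<integral>\<^sup>+\<xi>. (\<integral>\<^sup>+\<eta>. ennreal (?s \<eta> * (norm (g \<eta>))\<^sup>2) * ennreal (?s (\<xi> - \<eta>) * (norm (k (\<xi> - \<eta>)))\<^sup>2) \<partial>lborel) \<partial>lborel)
     = (\<integral>\<^sup>+\<eta>. (\<integral>\<^sup>+\<xi>. ennreal (?s \<eta> * (norm (g \<eta>))\<^sup>2) * ennreal (?s (\<xi> - \<eta>) * (norm (k (\<xi> - \<eta>)))\<^sup>2) \<partial>lborel) \<partial>lborel)"
    by (rule lborel_pair.Fubini') measurable
  also have "\<dots> = (\<integral>\<^sup>+\<eta>. ennreal (?s \<eta> * (norm (g \<eta>))\<^sup>2) * h1_sq k \<partial>lborel)"
  proof (intro nn_integral_cong)
    fix \<eta>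
    have "(\<integral>\<^sup>+\<xi>. ennreal (?s (\<xi> - \<eta>) * (norm (k (\<xi> - \<eta>)))\<^sup>2) \<partial>lborel) = h1_sq k"
      unfolding h1_sq_def using nn_integral_affine[of "\<lambda>\<xi>. ennreal (?s \<xi> * (norm (k \<xi>))\<^sup>2)" 1 "- \<eta>"] by simp
    then show "(\<integral>\<^sup>+\<xi>. ennreal (?s \<eta> * (norm (g \<eta>))\<^sup>2) * ennreal (?s (\<xi> - \<eta>) * (norm (k (\<xi> - \<eta>)))\<^sup>2) \<partial>lborel) = ennreal (?s \<eta> * (norm (g \<eta>))\<^sup>2) * h1_sq k"
      by (subst nn_integral_cmult) auto
  qed
  also have "\<dots> = h1_sq g * h1_sq k" unfolding h1_sq_def[of g] by (rule nn_integral_multc) measurable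
  finally show "sqint lborel (fourier (\<lambda>x. f x * h x)) \<le> product_const * (h1_sq g * h1_sq k)" by (simp add: mult.commute)
qed

section \<open>The chosen transform and the Sobolev norms\<close>

lemma ft_AE_eq: "has_ft f g \<Longrightarrow> AE \<xi> in lborel. ft f \<xi> = g \<xi>"
  unfolding ft_def has_ft_cft by (rule cft_unique_right[OF someI[of "\<lambda>g. cft (\<lambda>x. complex_of_real (f x)) g" g]])

lemma has_ft_ft: "has_ft f g \<Longrightarrow> has_ft f (ft f)"
  unfolding ft_def by (rule someI[of "has_ft f" g])

lemma has_ft_measurable:
  assumes "has_ft f g" shows "f \<in> borel_measurable borel" "g \<in> borel_measurable borel"
proof -
  have c: "cft (\<lambda>x. complex_of_real (f x)) g" using assms has_ft_cft by blast
  have "(\<lambda>x. Re (complex_of_real (f x))) \<in> borel_measurable borel"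
    by (rule measurable_compose[OF cft_measurable(1)[OF c]]) measurable
  then show "f \<in> borel_measurable borel" by simp
  show "g \<in> borel_measurable borel" using cft_measurable(2)[OF c] .
qed

lemma hdot_sq_eq:
  assumes "has_ft f g"
  shows "hdot_sq s f = (\<integral>\<^sup>+\<xi>. ennreal ((4 * pi\<^sup>2 * (norm \<xi>)\<^sup>2) powr s * (cmod (g \<xi>))\<^sup>2) \<partial>lborel)"
proof -
  have "hdot_sq s f = (\<integral>\<^sup>+\<xi>. ennreal ((4 * pi\<^sup>2 * (norm \<xi>)\<^sup>2) powr s * (cmod (ft f \<xi>))\<^sup>2) \<partial>lborel)"
    unfolding hdot_sq_def using assms by auto
  also have "\<dots> = (\<integral>\<^sup>+\<xi>. ennreal ((4 * pi\<^sup>2 * (norm \<xi>)\<^sup>2) powr s * (cmod (g \<xi>))\<^sup>2) \<partial>lborel)"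
    by (rule nn_integral_cong_AE) (use ft_AE_eq[OF assms] in \<open>auto elim!: eventually_mono\<close>)
  finally show ?thesis .
qed

lemma has_ft_add: "has_ft f g \<Longrightarrow> has_ft f' g' \<Longrightarrow> has_ft (\<lambda>x. f x + f' x) (\<lambda>\<xi>. g \<xi> + g' \<xi>)"
  unfolding has_ft_cft using cft_add by fastforce

lemma has_ft_diff: "has_ft f g \<Longrightarrow> has_ft f' g' \<Longrightarrow> has_ft (\<lambda>x. f x - f' x) (\<lambda>\<xi>. g \<xi> - g' \<xi>)"
  unfolding has_ft_cft using cft_diff by fastforce

lemma has_ft_unique: "has_ft f g \<Longrightarrow> has_ft f g' \<Longrightarrow> AE \<xi> in lborel. g \<xi> = g' \<xi>"
  unfolding has_ft_cft by (rule cft_unique_right)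

lemma has_ft_unique_left:
  assumes "has_ft f g" "has_ft f' g" shows "AE x in lborel. f x = f' x"
  using cft_unique_left[OF assms[unfolded has_ft_cft]] by simp

lemma has_ft_cong_AE:
  assumes "has_ft f g" "AE \<xi> in lborel. g \<xi> = g' \<xi>" "g' \<in> borel_measurable borel"
  shows "has_ft f g'"
proof -
  have c: "cft (\<lambda>x. complex_of_real (f x)) g" using assms(1) has_ft_cft by blast
  show ?thesis unfolding has_ft_cft
    by (rule cft_cong_AE[OF c _ assms(2) cft_measurable(1)[OF c] assms(3)]) simp
qed

lemma has_ft_cong_AE_left:
  assumes "has_ft f g" "AE x in lborel. f x = f' x" "f' \<in> borel_measurable borel"
  shows "has_ft f' g"
proof -
  have c: "cft (\<lambda>x. complex_of_real (f x)) g" using assms(1) has_ft_cft by blast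
  show ?thesis unfolding has_ft_cft
    by (rule cft_cong_AE[OF c _ _ _ cft_measurable(2)[OF c]]) (use assms(2,3) in \<open>auto elim!: eventually_mono\<close>)
qed

text \<open>Under this weight the homogeneous norm of order 1 is an ordinary L2 norm of the
  transform, so the general density result applies to it.\<close>

definition h1dot_measure :: "(real^3) measure"
  where "h1dot_measure = density lborel (\<lambda>\<xi>. ennreal (4 * pi\<^sup>2 * (norm \<xi>)\<^sup>2))"

lemma sets_h1dot_measure [measurable_cong]: "sets h1dot_measure = sets borel"
  by (simp add: h1dot_measure_def)

lemma sqint_h1dot:
  fixes g :: "real^3 \<Rightarrow> complex"
  assumes [measurable]: "g \<in> borel_measurable borel"
  shows "sqint h1dot_measure g = (\<integral>\<^sup>+\<xi>. ennreal (4 * pi\<^sup>2 * (norm \<xi>)\<^sup>2 * (norm (g \<xi>))\<^sup>2) \<partial>lborel)"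
  unfolding sqint_def h1dot_measure_def by (subst nn_integral_density) (auto simp: ennreal_mult')

lemma hdot_sq_1: "has_ft f g \<Longrightarrow> hdot_sq 1 f = sqint h1dot_measure g"
  by (subst sqint_h1dot) (auto simp: hdot_sq_eq has_ft_measurable)

lemma h1dot_measure_box: "emeasure h1dot_measure (box a b) < \<infinity>"
proof -
  obtain R where R: "\<And>x. x \<in> box a b \<Longrightarrow> norm x \<le> R"
    using bounded_box[of a b] unfolding bounded_iff by blast
  have "emeasure h1dot_measure (box a b) = (\<integral>\<^sup>+\<xi>. ennreal (4 * pi\<^sup>2 * (norm \<xi>)\<^sup>2) * indicator (box a b) \<xi> \<partial>lborel)"
    unfolding h1dot_measure_def by (rule emeasure_density) auto
  also have "\<dots> \<le> (\<integral>\<^sup>+\<xi>. ennreal (4 * pi\<^sup>2 * R\<^sup>2) * indicator (box a b) \<xi> \<partial>lborel)"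
    by (intro nn_integral_mono) (auto simp: indicator_def intro!: ennreal_leI mult_left_mono power_mono R)
  also have "\<dots> = ennreal (4 * pi\<^sup>2 * R\<^sup>2) * emeasure lborel (box a b)" by (simp add: nn_integral_cmult del: emeasure_lborel_box_eq)
  also have "\<dots> < \<infinity>" using emeasure_lborel_box_finite[of a b] by (simp add: ennreal_mult_less_top del: emeasure_lborel_box_eq)
  finally show ?thesis .
qed

text \<open>Plancherel applied to each derivative. It moves the cutoff argument to physical space,
  where derivatives of a product are explicit.\<close>

lemma sqint_h1dot_fourier:
  assumes "schwartz \<phi>"
  shows "sqint h1dot_measure (fourier \<phi>) = (\<Sum>k\<in>UNIV. sqint lborel (partial k \<phi>))"
proof -
  note [measurable] = schwartz_measurable[OF schwartz_fourier[OF assms]]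
  have "sqint h1dot_measure (fourier \<phi>) = (\<integral>\<^sup>+\<xi>. ennreal (4 * pi\<^sup>2 * (norm \<xi>)\<^sup>2 * (norm (fourier \<phi> \<xi>))\<^sup>2) \<partial>lborel)"
    by (rule sqint_h1dot) measurable
  also have "\<dots> = (\<integral>\<^sup>+\<xi>. (\<Sum>k\<in>UNIV. ennreal ((norm (fourier (partial k \<phi>) \<xi>))\<^sup>2)) \<partial>lborel)"
  proof (intro nn_integral_cong)
    fix \<xi> :: "real^3"
    have "4 * pi\<^sup>2 * (norm \<xi>)\<^sup>2 * (norm (fourier \<phi> \<xi>))\<^sup>2 = (\<Sum>k\<in>UNIV. (norm (fourier (partial k \<phi>) \<xi>))\<^sup>2)"
      unfolding fourier_partial[OF assms] norm2_cart
      by (simp add: norm_mult deriv_symbol_def power_mult_distrib sum_distrib_left sum_distrib_right)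
    then show "ennreal (4 * pi\<^sup>2 * (norm \<xi>)\<^sup>2 * (norm (fourier \<phi> \<xi>))\<^sup>2) = (\<Sum>k\<in>UNIV. ennreal ((norm (fourier (partial k \<phi>) \<xi>))\<^sup>2))"
      by (simp add: sum_ennreal)
  qed
  also have "\<dots> = (\<Sum>k\<in>UNIV. sqint lborel (fourier (partial k \<phi>)))"
    unfolding sqint_def
    by (rule nn_integral_sum) (use schwartz_measurable[OF schwartz_fourier[OF schwartz_partial[OF assms]]] in measurable)
  finally show ?thesis by (simp add: sqint_fourier_schwartz schwartz_partial assms)
qed

lemma cutoff_exists:
  obtains \<theta> :: "real^3 \<Rightarrow> complex" where "ccsmooth \<theta>" "\<theta> 0 = 1"
proof -
  let ?b = "box_bump 1 (\<chi> k. -1) (\<chi> k. 1)"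
  have pos: "?b 0 > 0" unfolding box_bump_def by (intro prod_pos) (auto simp: bump_core_def)
  show ?thesis
  proof (rule that[of "\<lambda>x. complex_of_real (inverse (?b 0)) * complex_of_real (?b x)"])
    show "ccsmooth (\<lambda>x. complex_of_real (inverse (?b 0)) * complex_of_real (?b x))"
      by (intro ccsmooth_cmul ccsmooth_test box_bump_test_function) simp
  qed (use pos in simp)
qed

text \<open>Multiplication by \<open>\<theta>\<close> (h x) with \<open>\<theta> 0 = 1\<close>. The
  gradient of the error consists of the gradient of \<open>\<phi>\<close> times 1 -
  \<open>\<theta>\<close> (h x), and of \<open>\<phi>\<close> times a gradient carrying the factor
  h. Both tend to 0 pointwise under a square-integrable majorant.\<close>

lemma cutoff_convergence:
  assumes \<phi>: "schwartz \<phi>" and e: "(e::real) > 0"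
  shows "\<exists>\<psi>. ccsmooth \<psi> \<and> sqint h1dot_measure (\<lambda>\<xi>. fourier \<phi> \<xi> - fourier \<psi> \<xi>) < ennreal e"
proof -
  obtain \<theta> where \<theta>: "ccsmooth \<theta>" "\<theta> 0 = 1" using cutoff_exists .
  have s\<theta>: "schwartz \<theta>" using \<theta>(1) ccsmooth_schwartz by blast
  obtain B where B: "\<And>x. norm (\<theta> x) \<le> B" using schwartz_bounded[OF s\<theta>] by blast
  have "\<forall>k. \<exists>D. \<forall>x. norm (partial k \<theta> x) \<le> D" using schwartz_bounded[OF schwartz_partial[OF s\<theta>]] by metis
  then obtain D where D: "\<And>k x. norm (partial k \<theta> x) \<le> D k" by metis
  have B0: "B \<ge> 0" "D k \<ge> 0" for k using order_trans[OF norm_ge_zero B[of 0]] order_trans[OF norm_ge_zero D[of k 0]] by auto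
  define h where "h n = inverse (real (Suc n))" for n
  have h: "h n > 0" "h n \<le> 1" for n by (auto simp: h_def divide_simps)
  have h0: "h \<longlonglongrightarrow> 0" unfolding h_def by (rule LIMSEQ_inverse_real_of_nat)
  define \<psi> where "\<psi> n x = \<phi> x * \<theta> (h n *\<^sub>R x)" for n x
  have st: "schwartz (\<lambda>x. \<theta> (h n *\<^sub>R x))" for n using schwartz_affine[OF s\<theta>, of "h n" 0] h(1)[of n] by simp
  have s\<psi>: "schwartz (\<psi> n)" for n unfolding \<psi>_def by (intro schwartz_mult \<phi> st)
  have cc: "ccsmooth (\<psi> n)" for n
  proof -
    have "{x. \<psi> n x \<noteq> 0} \<subseteq> (\<lambda>y. inverse (h n) *\<^sub>R y) ` {y. \<theta> y \<noteq> 0}"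
    proof
      fix x assume "x \<in> {x. \<psi> n x \<noteq> 0}"
      then have "\<theta> (h n *\<^sub>R x) \<noteq> 0" by (auto simp: \<psi>_def)
      moreover have "x = inverse (h n) *\<^sub>R (h n *\<^sub>R x)" using h(1)[of n] by simp
      ultimately show "x \<in> (\<lambda>y. inverse (h n) *\<^sub>R y) ` {y. \<theta> y \<noteq> 0}" by blast
    qed
    moreover have "bounded ((\<lambda>y. inverse (h n) *\<^sub>R y) ` {y. \<theta> y \<noteq> 0})"
      using \<theta>(1) unfolding ccsmooth_def by (intro bounded_scaling) blast
    ultimately show ?thesis unfolding ccsmooth_def using schwartz_smooth[OF s\<psi>] bounded_subset by blast
  qed
  have part: "partial k (\<lambda>x. \<phi> x - \<psi> n x) x = partial k \<phi> x * (1 - \<theta> (h n *\<^sub>R x)) - \<phi> x * (h n *\<^sub>R partial k \<theta> (h n *\<^sub>R x))" for k n x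
  proof -
    have "partial k (\<lambda>x. \<phi> x - \<psi> n x) = (\<lambda>x. partial k \<phi> x + (-1) * partial k (\<psi> n) x)"
    proof -
      have "partial k (\<lambda>x. \<phi> x + (-1) * \<psi> n x) = (\<lambda>x. partial k \<phi> x + partial k (\<lambda>x. (-1) * \<psi> n x) x)"
        by (rule partial_add) (intro schwartz_differentiable \<phi> schwartz_cmul s\<psi>)+
      also have "partial k (\<lambda>x. (-1) * \<psi> n x) = (\<lambda>x. (-1) * partial k (\<psi> n) x)"
        by (rule partial_linear[OF _ bounded_linear_mult_right]) (intro schwartz_differentiable s\<psi>)
      finally show ?thesis by simp
    qed
    moreover have "partial k (\<psi> n) = (\<lambda>x. \<phi> x * partial k (\<lambda>x. \<theta> (h n *\<^sub>R x)) x + partial k \<phi> x * \<theta> (h n *\<^sub>R x))"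
      unfolding \<psi>_def by (rule partial_mult) (intro schwartz_differentiable \<phi> st)+
    moreover have "partial k (\<lambda>x. \<theta> (h n *\<^sub>R x)) = (\<lambda>x. h n *\<^sub>R partial k \<theta> (h n *\<^sub>R x))"
      using partial_affine[where f=\<theta> and k=k and c="h n" and b=0] schwartz_differentiable[OF s\<theta>] by simp
    ultimately show ?thesis by (simp add: algebra_simps)
  qed
  have lim: "(\<lambda>n. sqint lborel (partial k (\<lambda>x. \<phi> x - \<psi> n x))) \<longlonglongrightarrow> (\<integral>\<^sup>+x. 0 \<partial>(lborel :: (real^3) measure))" for k
    unfolding sqint_def
  proof (rule nn_integral_dominated_convergence[where w="\<lambda>x. ennreal (((1 + B) * norm (partial k \<phi> x) + D k * norm (\<phi> x))\<^sup>2)"])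
    note [measurable] = schwartz_measurable[OF \<phi>] schwartz_measurable[OF schwartz_partial[OF \<phi>]]
      schwartz_measurable[OF schwartz_partial[OF schwartz_diff[OF \<phi> s\<psi>]]]
    show "(\<lambda>x. ennreal ((norm (partial k (\<lambda>x. \<phi> x - \<psi> n x) x))\<^sup>2)) \<in> borel_measurable lborel" for n by measurable
    show "(\<lambda>x. ennreal (((1 + B) * norm (partial k \<phi> x) + D k * norm (\<phi> x))\<^sup>2)) \<in> borel_measurable lborel" by measurable
    show "AE x in lborel. ennreal ((norm (partial k (\<lambda>x. \<phi> x - \<psi> n x) x))\<^sup>2) \<le> ennreal (((1 + B) * norm (partial k \<phi> x) + D k * norm (\<phi> x))\<^sup>2)" for n
    proof (intro AE_I2 ennreal_leI power_mono)
      fix x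
      have "norm (1 - \<theta> (h n *\<^sub>R x)) \<le> 1 + B" using norm_triangle_ineq4[of 1 "\<theta> (h n *\<^sub>R x)"] B[of "h n *\<^sub>R x"] by simp
      then have "norm (partial k \<phi> x * (1 - \<theta> (h n *\<^sub>R x))) \<le> (1 + B) * norm (partial k \<phi> x)"
        unfolding norm_mult mult.commute[of "norm (partial k \<phi> x)"] by (rule mult_right_mono) simp
      moreover have "h n * norm (partial k \<theta> (h n *\<^sub>R x)) \<le> 1 * D k" using h[of n] B0 by (intro mult_mono D) auto
      then have "norm (\<phi> x * (h n *\<^sub>R partial k \<theta> (h n *\<^sub>R x))) \<le> D k * norm (\<phi> x)"
        using h[of n] mult_left_mono[of "h n * norm (partial k \<theta> (h n *\<^sub>R x))" "D k" "norm (\<phi> x)"]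
        by (simp add: norm_mult mult_ac)
      ultimately show "norm (partial k (\<lambda>x. \<phi> x - \<psi> n x) x) \<le> (1 + B) * norm (partial k \<phi> x) + D k * norm (\<phi> x)"
        unfolding part by (intro order_trans[OF norm_triangle_ineq4] add_mono)
    qed simp
    have "sqint lborel (\<lambda>x. complex_of_real (1 + B) * partial k \<phi> x) < \<infinity>" "sqint lborel (\<lambda>x. complex_of_real (D k) * \<phi> x) < \<infinity>"
      by (intro schwartz_sqint schwartz_cmul schwartz_partial \<phi>)+
    then have f: "2 * sqint lborel (\<lambda>x. complex_of_real (1 + B) * partial k \<phi> x) + 2 * sqint lborel (\<lambda>x. complex_of_real (D k) * \<phi> x) < \<infinity>"
      using ennreal_two_less_top by simp
    have "(\<integral>\<^sup>+x. ennreal (((1 + B) * norm (partial k \<phi> x) + D k * norm (\<phi> x))\<^sup>2) \<partial>lborel)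
      \<le> (\<integral>\<^sup>+x. 2 * ennreal ((norm (complex_of_real (1 + B) * partial k \<phi> x))\<^sup>2) + 2 * ennreal ((norm (complex_of_real (D k) * \<phi> x))\<^sup>2) \<partial>lborel)"
    proof (intro nn_integral_mono)
      fix x
      have "norm (complex_of_real (1 + B) * partial k \<phi> x) = (1 + B) * norm (partial k \<phi> x)" "norm (complex_of_real (D k) * \<phi> x) = D k * norm (\<phi> x)"
        using B0(1) B0(2)[of k] by (simp_all add: norm_mult del: of_real_add)
      then show "ennreal (((1 + B) * norm (partial k \<phi> x) + D k * norm (\<phi> x))\<^sup>2) \<le> 2 * ennreal ((norm (complex_of_real (1 + B) * partial k \<phi> x))\<^sup>2) + 2 * ennreal ((norm (complex_of_real (D k) * \<phi> x))\<^sup>2)"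
        using ennreal_leI[OF sum_sq_le[of "(1 + B) * norm (partial k \<phi> x)" "D k * norm (\<phi> x)"]]
        by (simp add: ennreal_plus ennreal_mult')
    qed
    also have "\<dots> = 2 * sqint lborel (\<lambda>x. complex_of_real (1 + B) * partial k \<phi> x) + 2 * sqint lborel (\<lambda>x. complex_of_real (D k) * \<phi> x)"
      unfolding sqint_def by (simp add: nn_integral_add nn_integral_cmult)
    finally show "(\<integral>\<^sup>+x. ennreal (((1 + B) * norm (partial k \<phi> x) + D k * norm (\<phi> x))\<^sup>2) \<partial>lborel) < \<infinity>"
      using f by (rule order.strict_trans1)
    show "AE x in lborel. (\<lambda>n. ennreal ((norm (partial k (\<lambda>x. \<phi> x - \<psi> n x) x))\<^sup>2)) \<longlonglongrightarrow> 0"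
    proof (intro AE_I2)
      fix x
      have c: "isCont f (0 *\<^sub>R x)" if "schwartz f" for f using schwartz_differentiable[OF that] differentiable_imp_continuous_within by blast
      have "(\<lambda>n. ennreal ((norm (partial k (\<lambda>x. \<phi> x - \<psi> n x) x))\<^sup>2)) \<longlonglongrightarrow>
        ennreal ((norm (partial k \<phi> x * (1 - \<theta> (0 *\<^sub>R x)) - \<phi> x * (0 *\<^sub>R partial k \<theta> (0 *\<^sub>R x))))\<^sup>2)"
        unfolding part
        by (intro tendsto_ennrealI tendsto_power tendsto_norm tendsto_diff tendsto_mult tendsto_const tendsto_scaleR h0
            isCont_tendsto_compose[OF c[OF s\<theta>]] isCont_tendsto_compose[OF c[OF schwartz_partial[OF s\<theta>]]])
      then show "(\<lambda>n. ennreal ((norm (partial k (\<lambda>x. \<phi> x - \<psi> n x) x))\<^sup>2)) \<longlonglongrightarrow> 0" using \<theta>(2) by simp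
    qed
  qed simp
  have eq: "sqint h1dot_measure (\<lambda>\<xi>. fourier \<phi> \<xi> - fourier (\<psi> n) \<xi>) = (\<Sum>k\<in>UNIV. sqint lborel (partial k (\<lambda>x. \<phi> x - \<psi> n x)))" for n
  proof -
    have "(\<lambda>\<xi>. fourier \<phi> \<xi> - fourier (\<psi> n) \<xi>) = fourier (\<lambda>x. \<phi> x - \<psi> n x)"
      by (rule ext) (simp add: fourier_diff schwartz_integrable \<phi> s\<psi>)
    then show ?thesis using sqint_h1dot_fourier[OF schwartz_diff[OF \<phi> s\<psi>]] by simp
  qed
  have "(\<lambda>n. \<Sum>k\<in>UNIV. sqint lborel (partial k (\<lambda>x. \<phi> x - \<psi> n x))) \<longlonglongrightarrow> (\<Sum>k\<in>(UNIV::3 set). 0)"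
    using lim by (intro tendsto_sum) simp
  then have "(\<lambda>n. sqint h1dot_measure (\<lambda>\<xi>. fourier \<phi> \<xi> - fourier (\<psi> n) \<xi>)) \<longlonglongrightarrow> 0" by (simp add: eq)
  then have "\<forall>\<^sub>F n in sequentially. sqint h1dot_measure (\<lambda>\<xi>. fourier \<phi> \<xi> - fourier (\<psi> n) \<xi>) < ennreal e"
    by (rule order_tendstoD) (use e in simp)
  then show ?thesis using cc by (auto simp: eventually_sequentially)
qed

lemma sqint_h1dot_reflect:
  fixes f :: "real^3 \<Rightarrow> complex"
  assumes [measurable]: "f \<in> borel_measurable borel"
  shows "sqint h1dot_measure (\<lambda>\<xi>. f (- \<xi>)) = sqint h1dot_measure f"
  using nn_integral_affine[of "\<lambda>\<xi>. ennreal (4 * pi\<^sup>2 * (norm \<xi>)\<^sup>2 * (norm (f \<xi>))\<^sup>2)" "-1" 0]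
  by (simp add: sqint_h1dot)

text \<open>Approximation in two stages. In frequency, the transform is approximated in the weighted
  L2 space by a smooth function of bounded support. This function is the transform of a Schwartz
  function, which is then cut off in physical space. Taking real parts yields a real test
  function.\<close>

lemma Hdot_1_I:
  assumes fg: "has_ft f g" and fin: "hdot_sq 1 f < \<infinity>"
  shows "f \<in> Hdot 1"
proof -
  note [measurable] = has_ft_measurable[OF fg]
  have gfin: "sqint h1dot_measure g < \<infinity>" using fin hdot_sq_1[OF fg] by simp
  have "\<exists>\<phi>. test_function \<phi> \<and> hdot_sq 1 (\<lambda>x. f x - \<phi> x) \<le> ennreal e" if e: "e > 0" for e :: real
  proof -
    obtain \<psi> where \<psi>: "ccsmooth \<psi>" "sqint h1dot_measure (\<lambda>\<xi>. g \<xi> - \<psi> \<xi>) < ennreal (e / 4)"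
      using ccsmooth_dense[OF sets_h1dot_measure h1dot_measure_box _ gfin, of "e / 4"] e by auto
    obtain \<phi> where \<phi>: "schwartz \<phi>" "fourier \<phi> = \<psi>" using fourier_surj[OF ccsmooth_schwartz[OF \<psi>(1)]] .
    obtain \<eta> where \<eta>: "ccsmooth \<eta>" "sqint h1dot_measure (\<lambda>\<xi>. \<psi> \<xi> - fourier \<eta> \<xi>) < ennreal (e / 4)"
      using cutoff_convergence[OF \<phi>(1), of "e / 4"] e \<phi>(2) by auto
    have s\<eta>: "schwartz \<eta>" using \<eta>(1) ccsmooth_schwartz by blast
    note [measurable] = schwartz_measurable[OF ccsmooth_schwartz[OF \<psi>(1)]] schwartz_measurable[OF schwartz_fourier[OF s\<eta>]]
    let ?d = "\<lambda>\<xi>. g \<xi> - fourier \<eta> \<xi>"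
    have d: "sqint h1dot_measure ?d \<le> ennreal e"
    proof -
      have "sqint h1dot_measure ?d \<le> 2 * sqint h1dot_measure (\<lambda>\<xi>. g \<xi> - \<psi> \<xi>) + 2 * sqint h1dot_measure (\<lambda>\<xi>. \<psi> \<xi> - fourier \<eta> \<xi>)"
        by (rule sqint_triangle) measurable
      also have "\<dots> \<le> 2 * ennreal (e / 4) + 2 * ennreal (e / 4)"
        using \<psi>(2) \<eta>(2) by (intro add_mono mult_left_mono) auto
      also have "2 * ennreal (e / 4) = ennreal (e / 2)" using ennreal_mult'[of 2 "e / 4"] by simp
      also have "ennreal (e / 2) + ennreal (e / 2) = ennreal e" using e by (simp flip: ennreal_plus)
      finally show ?thesis .
    qed
    let ?\<phi> = "\<lambda>x. Re (\<eta> x)"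
    have test: "test_function ?\<phi>"
      unfolding test_function_iff
    proof
      show "smooth ?\<phi>" using smooth_linear[OF _ bounded_linear_Re] \<eta>(1) ccsmooth_def by blast
      show "bounded {x. ?\<phi> x \<noteq> 0}"
        by (rule bounded_subset[of "{x. \<eta> x \<noteq> 0}"]) (use \<eta>(1) in \<open>auto simp: ccsmooth_def\<close>)
    qed
    \<comment> \<open>The transform of the real part of \<open>\<eta>\<close>, namely the hermitian
      part of that of \<open>\<eta>\<close>. As \<open>g\<close> is hermitian, the new error is an
      average of the old one and its reflected conjugate, which have equal norms: the factors 2
      (1/4) + 2 (1/4) add up to 1.\<close>
    let ?G = "\<lambda>\<xi>. 1/2 * (fourier \<eta> \<xi> + cnj (fourier \<eta> (- \<xi>)))"
    have "cft (\<lambda>x. 1/2 * (\<eta> x + cnj (\<eta> x))) ?G"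
      by (intro cft_cmul cft_add cft_cnj cft_schwartz s\<eta>)
    then have ftG: "has_ft ?\<phi> ?G" unfolding has_ft_cft by (simp add: complex_add_cnj)
    have "hdot_sq 1 (\<lambda>x. f x - ?\<phi> x) = sqint h1dot_measure (\<lambda>\<xi>. g \<xi> - ?G \<xi>)"
      by (rule hdot_sq_1[OF has_ft_diff[OF fg ftG]])
    also have "\<dots> = sqint h1dot_measure (\<lambda>\<xi>. 1/2 * ?d \<xi> + 1/2 * cnj (?d (- \<xi>)))"
    proof (rule sqint_cong_AE)
      have "AE \<xi> in lborel. g (- \<xi>) = cnj (g \<xi>)" using has_ft_hermitian[OF fg] unfolding hermitian_def .
      then have "AE \<xi> in lborel. norm (g \<xi> - ?G \<xi>) = norm (1/2 * ?d \<xi> + 1/2 * cnj (?d (- \<xi>)))"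
      proof eventually_elim
        case (elim \<xi>)
        have "g \<xi> - ?G \<xi> = 1/2 * ?d \<xi> + 1/2 * cnj (?d (- \<xi>))" using elim by (simp add: field_simps)
        then show ?case by simp
      qed
      then show "AE \<xi> in h1dot_measure. norm (g \<xi> - ?G \<xi>) = norm (1/2 * ?d \<xi> + 1/2 * cnj (?d (- \<xi>)))"
        unfolding h1dot_measure_def by (subst AE_density) (auto elim!: eventually_mono)
    qed
    also have "\<dots> \<le> 2 * sqint h1dot_measure (\<lambda>\<xi>. 1/2 * ?d \<xi>) + 2 * sqint h1dot_measure (\<lambda>\<xi>. 1/2 * cnj (?d (- \<xi>)))"
      by (rule sqint_add_le) measurable
    also have "sqint h1dot_measure (\<lambda>\<xi>. 1/2 * cnj (?d (- \<xi>))) = sqint h1dot_measure (\<lambda>\<xi>. 1/2 * ?d (- \<xi>))"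
      by (intro sqint_cong_AE AE_I2) (simp add: norm_mult flip: complex_cnj_diff)
    also have "\<dots> = sqint h1dot_measure (\<lambda>\<xi>. 1/2 * ?d \<xi>)"
      by (rule sqint_h1dot_reflect[of "\<lambda>\<xi>. 1/2 * ?d \<xi>"]) measurable
    also have "sqint h1dot_measure (\<lambda>\<xi>. 1/2 * ?d \<xi>) = ennreal (1/4) * sqint h1dot_measure ?d"
      by (subst sqint_cmult) (auto simp: power2_eq_square)
    also have "2 * (ennreal (1/4) * sqint h1dot_measure ?d) + 2 * (ennreal (1/4) * sqint h1dot_measure ?d) \<le>
       2 * (ennreal (1/4) * ennreal e) + 2 * (ennreal (1/4) * ennreal e)"
      by (intro add_mono mult_left_mono d) auto
    also have "2 * (ennreal (1/4) * ennreal e) = ennreal (e / 2)"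
      using e ennreal_mult'[of 2 "1/4 * e"] ennreal_mult'[of "1/4" e] by simp
    also have "ennreal (e / 2) + ennreal (e / 2) = ennreal e" using e by (simp flip: ennreal_plus)
    finally show ?thesis using test by blast
  qed
  then have "\<exists>\<phi>. test_function \<phi> \<and> hdot_sq 1 (\<lambda>x. f x - \<phi> x) \<le> ennreal (inverse (real (Suc n)))" for n
    by simp
  then obtain \<phi> where \<phi>: "\<And>n. test_function (\<phi> n)" "\<And>n. hdot_sq 1 (\<lambda>x. f x - \<phi> n x) \<le> ennreal (inverse (real (Suc n)))" by metis
  have lim: "(\<lambda>n. ennreal (inverse (real (Suc n)))) \<longlonglongrightarrow> 0"
    using tendsto_ennrealI[OF LIMSEQ_inverse_real_of_nat] by simp
  have "(\<lambda>n. hdot_sq 1 (\<lambda>x. f x - \<phi> n x)) \<longlonglongrightarrow> 0"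
    by (rule tendsto_sandwich[OF _ _ tendsto_const lim]) (use \<phi>(2) in auto)
  then show ?thesis unfolding Hdot_def using \<phi>(1) by blast
qed

text \<open>One test function at finite distance is enough: adding it back preserves both the
  existence of a transform and the finiteness of the norm.\<close>

lemma Hdot_1_D:
  assumes "f \<in> Hdot 1" obtains g where "has_ft f g" "hdot_sq 1 f < \<infinity>"
proof -
  obtain \<phi> where \<phi>: "\<And>n::nat. test_function (\<phi> n)" "(\<lambda>n. hdot_sq 1 (\<lambda>x. f x - \<phi> n x)) \<longlonglongrightarrow> 0"
    using assms unfolding Hdot_def by blast
  have "\<forall>\<^sub>F n in sequentially. hdot_sq 1 (\<lambda>x. f x - \<phi> n x) < \<infinity>"
    by (rule order_tendstoD[OF \<phi>(2)]) simp
  then obtain n where n: "hdot_sq 1 (\<lambda>x. f x - \<phi> n x) < \<infinity>" by (auto simp: eventually_sequentially)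
  then obtain d where d: "has_ft (\<lambda>x. f x - \<phi> n x) d" unfolding hdot_sq_def by (auto split: if_splits)
  have s: "schwartz (\<lambda>x. complex_of_real (\<phi> n x))" using test_function_schwartz[OF \<phi>(1)] .
  let ?F = "fourier (\<lambda>x. complex_of_real (\<phi> n x))"
  have p: "has_ft (\<phi> n) ?F" unfolding has_ft_cft by (rule cft_schwartz[OF s])
  have g: "has_ft f (\<lambda>\<xi>. d \<xi> + ?F \<xi>)" using has_ft_add[OF d p] by simp
  note [measurable] = has_ft_measurable[OF d] has_ft_measurable[OF p]
  have "hdot_sq 1 f = sqint h1dot_measure (\<lambda>\<xi>. d \<xi> + ?F \<xi>)" by (rule hdot_sq_1[OF g])
  also have "\<dots> < \<infinity>"
  proof (rule sqint_add_finite(1))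
    show "sqint h1dot_measure d < \<infinity>" using n hdot_sq_1[OF d] by simp
    show "sqint h1dot_measure ?F < \<infinity>"
      unfolding sqint_h1dot_fourier[OF s] using schwartz_sqint[OF schwartz_partial[OF s]] by (simp add: less_top[symmetric])
  qed measurable
  finally show ?thesis using that g by blast
qed

section \<open>Symbol calculus\<close>

definition lap :: "real^3 \<Rightarrow> real" where "lap \<xi> = 4 * pi\<^sup>2 * (norm \<xi>)\<^sup>2"

lemma lap_nonneg [simp]: "0 \<le> lap \<xi>"
  by (simp add: lap_def)

lemma lap_pos: "\<xi> \<noteq> 0 \<Longrightarrow> 0 < lap \<xi>"
  by (simp add: lap_def)

lemma lap_minus [simp]: "lap (- \<xi>) = lap \<xi>"
  by (simp add: lap_def)

lemma lap_borel [measurable]: "lap \<in> borel_measurable borel"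
  unfolding lap_def[abs_def] by measurable

lemma sqrt_lap: "sqrt (lap \<xi>) = 2 * pi * norm \<xi>"
  by (simp add: lap_def real_sqrt_mult)

lemma AE_nonzero: "AE \<xi> in lborel. (\<xi> :: real^3) \<noteq> 0"
  by (rule AE_lborel_singleton)

lemma nth_borel [measurable]: "(\<lambda>\<xi>::real^3. \<xi> $ j) \<in> borel_measurable borel"
  by (intro borel_measurable_continuous_onI continuous_intros)

lemma deriv_symbol_borel [measurable]: "deriv_symbol j \<in> borel_measurable borel"
  unfolding deriv_symbol_def[abs_def] by measurable

lemma deriv_symbol_minus: "deriv_symbol j (- \<xi>) = - deriv_symbol j \<xi>"
  by (simp add: deriv_symbol_def)

lemma cnj_deriv_symbol: "cnj (deriv_symbol j \<xi>) = - deriv_symbol j \<xi>"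
  by (simp add: deriv_symbol_def)

lemma deriv_symbol_mult: "deriv_symbol i \<xi> * deriv_symbol j \<xi> = - complex_of_real (4 * pi\<^sup>2 * (\<xi> $ i * \<xi> $ j))"
  by (simp add: deriv_symbol_def power2_eq_square mult_ac)

lemma sum_deriv_symbol_square: "(\<Sum>j\<in>UNIV. deriv_symbol j \<xi> * deriv_symbol j \<xi>) = - complex_of_real (lap \<xi>)"
  unfolding deriv_symbol_mult lap_def norm2_cart
  by (simp add: sum_negf sum_distrib_left power2_eq_square)

lemma norm_deriv_symbol_le: "norm (deriv_symbol j \<xi>) \<le> sqrt (lap \<xi>)"
  unfolding sqrt_lap by (simp add: deriv_symbol_def norm_mult component_le_norm_cart mult_left_mono)

lemma laplace_pow_minus_one: "laplace_pow (- 1) U \<xi> = (1 / lap \<xi>) *\<^sub>R U \<xi>"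
  unfolding laplace_pow_def lap_def by (simp add: powr_minus inverse_eq_divide)

lemma laplace_pow_minus_half: "laplace_pow (- 1/2) U \<xi> = (1 / sqrt (lap \<xi>)) *\<^sub>R U \<xi>"
proof -
  \<comment> \<open>This includes the origin, where both sides have the default value 0.\<close>
  have "lap \<xi> powr (- 1/2) = 1 / sqrt (lap \<xi>)"
    using powr_minus[of "lap \<xi>" "1/2"] by (simp add: powr_half_sqrt inverse_eq_divide)
  then show ?thesis unfolding laplace_pow_def lap_def by simp
qed

lemma sym_grad_nth: "sym_grad U \<xi> $ i $ j = (deriv_symbol i \<xi> * U \<xi> $ j + deriv_symbol j \<xi> * U \<xi> $ i) / 2"
  by (simp add: sym_grad_def)

lemma mdiv_nth: "mdiv G \<xi> $ j = (\<Sum>i\<in>UNIV. deriv_symbol i \<xi> * G \<xi> $ i $ j)"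
  by (simp add: mdiv_def)

text \<open>The projection in the form I + grad (-Delta)^(-1) div; the plus sign comes from the
  product of two imaginary symbols.\<close>

lemma helmholtz_nth:
  assumes "\<xi> \<noteq> 0"
  shows "helmholtz U \<xi> $ i = U \<xi> $ i + deriv_symbol i \<xi> * vdiv U \<xi> / complex_of_real (lap \<xi>)"
proof -
  have "complex_of_real (\<xi> $ i * \<xi> $ j / (norm \<xi>)\<^sup>2) = - (deriv_symbol i \<xi> * deriv_symbol j \<xi> / complex_of_real (lap \<xi>))" for j
    unfolding deriv_symbol_mult lap_def using assms by (simp add: field_simps)
  then have e: "complex_of_real ((if i = j then 1 else 0) - \<xi> $ i * \<xi> $ j / (norm \<xi>)\<^sup>2) * U \<xi> $ j =
     (if i = j then U \<xi> $ j else 0) + deriv_symbol i \<xi> * (deriv_symbol j \<xi> * U \<xi> $ j) / complex_of_real (lap \<xi>)" for j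
    unfolding of_real_diff by (simp add: left_diff_distrib distrib_right mult.assoc)
  show ?thesis
    unfolding helmholtz_def vec_lambda_beta e vdiv_def by (simp add: sum.distrib sum_distrib_left sum_divide_distrib)
qed

lemma vdiv_helmholtz:
  assumes "\<xi> \<noteq> 0" shows "vdiv (helmholtz U) \<xi> = 0"
proof -
  have "vdiv (helmholtz U) \<xi> = vdiv U \<xi> + (\<Sum>j\<in>UNIV. deriv_symbol j \<xi> * deriv_symbol j \<xi>) * vdiv U \<xi> / complex_of_real (lap \<xi>)"
    unfolding vdiv_def[of "helmholtz U"] helmholtz_nth[OF assms] distrib_left sum.distrib
    by (simp add: vdiv_def sum_distrib_right sum_divide_distrib mult.assoc)
  also have "\<dots> = 0" unfolding sum_deriv_symbol_square using lap_pos[OF assms] by simp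
  finally show ?thesis .
qed

lemma mdiv_sym_grad:
  "mdiv (sym_grad U) \<xi> $ j = (deriv_symbol j \<xi> * vdiv U \<xi> - complex_of_real (lap \<xi>) * U \<xi> $ j) / 2"
proof -
  have "mdiv (sym_grad U) \<xi> $ j = ((\<Sum>i\<in>UNIV. deriv_symbol i \<xi> * deriv_symbol i \<xi>) * U \<xi> $ j + deriv_symbol j \<xi> * vdiv U \<xi>) / 2"
    unfolding mdiv_nth sym_grad_nth vdiv_def
    by (simp add: sum_distrib_left sum_distrib_right sum.distrib[symmetric] sum_divide_distrib distrib_left mult_ac)
  then show ?thesis unfolding sum_deriv_symbol_square by simp
qed

lemma vdiv_scale: "vdiv (\<lambda>\<xi>. c \<xi> *\<^sub>R U \<xi>) \<xi> = c \<xi> *\<^sub>R vdiv U \<xi>"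
  by (simp add: vdiv_def scaleR_right.sum mult_scaleR_right)

lemma sym_grad_scale: "sym_grad (\<lambda>\<xi>. c \<xi> *\<^sub>R U \<xi>) \<xi> = c \<xi> *\<^sub>R sym_grad U \<xi>"
  by (simp only: vec_eq_iff sym_grad_nth vector_scaleR_component) (simp add: scaleR_conv_of_real algebra_simps)

lemma mdiv_scale: "mdiv (\<lambda>\<xi>. c \<xi> *\<^sub>R G \<xi>) \<xi> = c \<xi> *\<^sub>R mdiv G \<xi>"
  by (simp add: mdiv_def vec_eq_iff scaleR_right.sum mult_scaleR_right)

lemma vdiv_laplace_pow: "vdiv (laplace_pow s U) \<xi> = ((4 * pi\<^sup>2 * (norm \<xi>)\<^sup>2) powr s) *\<^sub>R vdiv U \<xi>"
  unfolding laplace_pow_def[abs_def] by (rule vdiv_scale)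

lemma sym_grad_laplace_pow: "sym_grad (laplace_pow s U) \<xi> = ((4 * pi\<^sup>2 * (norm \<xi>)\<^sup>2) powr s) *\<^sub>R sym_grad U \<xi>"
  unfolding laplace_pow_def[abs_def] by (rule sym_grad_scale)

lemma sym_grad_minus_one: "sym_grad (laplace_pow (- 1) U) \<xi> = (1 / lap \<xi>) *\<^sub>R sym_grad U \<xi>"
proof -
  have "laplace_pow (- 1) U = (\<lambda>\<xi>. (1 / lap \<xi>) *\<^sub>R U \<xi>)" by (rule ext) (rule laplace_pow_minus_one)
  then show ?thesis by (simp only: sym_grad_scale)
qed

lemma sym_grad_minus_half: "sym_grad (laplace_pow (- 1/2) U) \<xi> = (1 / sqrt (lap \<xi>)) *\<^sub>R sym_grad U \<xi>"
proof -
  have "laplace_pow (- 1/2) U = (\<lambda>\<xi>. (1 / sqrt (lap \<xi>)) *\<^sub>R U \<xi>)" by (rule ext) (rule laplace_pow_minus_half)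
  then show ?thesis by (simp only: sym_grad_scale)
qed

lemma mdiv_potential:
  assumes "\<xi> \<noteq> 0" "vdiv U \<xi> = 0"
  shows "mdiv (\<lambda>\<xi>. 2 *\<^sub>R sym_grad (laplace_pow (- 1) U) \<xi>) \<xi> = - U \<xi>"
proof -
  have "(\<lambda>\<xi>. 2 *\<^sub>R sym_grad (laplace_pow (- 1) U) \<xi>) = (\<lambda>\<xi>. (2 / lap \<xi>) *\<^sub>R sym_grad U \<xi>)"
    by (simp add: sym_grad_minus_one)
  then have e: "mdiv (\<lambda>\<xi>. 2 *\<^sub>R sym_grad (laplace_pow (- 1) U) \<xi>) \<xi> = (2 / lap \<xi>) *\<^sub>R mdiv (sym_grad U) \<xi>"
    by (simp only: mdiv_scale)
  show ?thesis
    unfolding e vec_eq_iff vector_scaleR_component mdiv_sym_grad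
    using lap_pos[OF assms(1)] assms(2) by (simp add: scaleR_conv_of_real)
qed

text \<open>The symbol of the orthogonal projection onto strain matrices: with \<open>e = \<xi> / |\<xi>|\<close> it sends a
  symmetric \<open>Q\<close> to \<open>e \<otimes> v + v \<otimes> e\<close>, where \<open>v\<close> is the part of \<open>Q e\<close> orthogonal to \<open>e\<close>.\<close>

definition st_symbol :: "(real^3 \<Rightarrow> complex^3^3) \<Rightarrow> real^3 \<Rightarrow> complex^3^3"
  where "st_symbol G \<xi> = (- 2 / lap \<xi>) *\<^sub>R sym_grad (helmholtz (mdiv G)) \<xi>"

lemma mdiv_st_symbol:
  assumes "\<xi> \<noteq> 0" shows "mdiv (st_symbol G) \<xi> = helmholtz (mdiv G) \<xi>"
proof -
  have e: "mdiv (st_symbol G) \<xi> = (- 2 / lap \<xi>) *\<^sub>R mdiv (sym_grad (helmholtz (mdiv G))) \<xi>"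
    unfolding st_symbol_def[abs_def] by (rule mdiv_scale)
  show ?thesis
    unfolding e vec_eq_iff vector_scaleR_component mdiv_sym_grad
    using lap_pos[OF assms] vdiv_helmholtz[OF assms] by (simp add: scaleR_conv_of_real)
qed

lemma st_symbol_sym: "st_symbol G \<xi> $ i $ j = st_symbol G \<xi> $ j $ i"
  by (simp add: st_symbol_def sym_grad_nth add.commute)

section \<open>Size of the symbols\<close>

lemma norm_mdiv_le: "norm (mdiv G \<xi> $ j) \<le> sqrt (lap \<xi>) * (\<Sum>i\<in>UNIV. norm (G \<xi> $ i $ j))"
proof -
  have "norm (mdiv G \<xi> $ j) \<le> (\<Sum>i\<in>UNIV. sqrt (lap \<xi>) * norm (G \<xi> $ i $ j))"
    unfolding mdiv_nth
    by (rule sum_norm_le) (simp add: norm_mult norm_deriv_symbol_le mult_right_mono)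
  then show ?thesis by (simp add: sum_distrib_left)
qed

lemma norm_helmholtz_le: "norm (helmholtz U \<xi> $ i) \<le> 2 * (\<Sum>j\<in>UNIV. norm (U \<xi> $ j))"
proof -
  have "norm (helmholtz U \<xi> $ i) \<le> (\<Sum>j\<in>UNIV. 2 * norm (U \<xi> $ j))"
    unfolding helmholtz_def vec_lambda_beta
  proof (rule sum_norm_le)
    fix j
    have "\<bar>\<xi> $ i * \<xi> $ j\<bar> \<le> (norm \<xi>)\<^sup>2"
      unfolding abs_mult power2_eq_square by (intro mult_mono component_le_norm_cart) auto
    then have "\<bar>\<xi> $ i * \<xi> $ j / (norm \<xi>)\<^sup>2\<bar> \<le> 1"
      by (cases "\<xi> = 0") (simp_all add: divide_le_eq)
    moreover have "\<bar>(if i = j then 1 else 0) - a\<bar> \<le> 2" if "\<bar>a\<bar> \<le> 1" for a :: real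
      using that by (auto simp: abs_le_iff)
    ultimately have "\<bar>(if i = j then 1 else 0) - \<xi> $ i * \<xi> $ j / (norm \<xi>)\<^sup>2\<bar> \<le> 2" by blast
    then show "norm (complex_of_real ((if i = j then 1 else 0) - \<xi> $ i * \<xi> $ j / (norm \<xi>)\<^sup>2) * U \<xi> $ j) \<le> 2 * norm (U \<xi> $ j)"
      unfolding norm_mult norm_of_real by (rule mult_right_mono) simp
  qed
  then show ?thesis by (simp add: sum_distrib_left)
qed

lemma norm_sym_grad_le: "norm (sym_grad U \<xi> $ i $ j) \<le> sqrt (lap \<xi>) * ((norm (U \<xi> $ i) + norm (U \<xi> $ j)) / 2)"
proof -
  have "norm (sym_grad U \<xi> $ i $ j) \<le> (norm (deriv_symbol i \<xi> * U \<xi> $ j) + norm (deriv_symbol j \<xi> * U \<xi> $ i)) / 2"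
    unfolding sym_grad_nth norm_divide by (simp add: norm_triangle_ineq)
  also have "\<dots> \<le> (sqrt (lap \<xi>) * norm (U \<xi> $ j) + sqrt (lap \<xi>) * norm (U \<xi> $ i)) / 2"
    unfolding norm_mult by (intro divide_right_mono add_mono mult_right_mono norm_deriv_symbol_le) auto
  finally show ?thesis by (simp add: algebra_simps)
qed

lemma norm_component_le_sum: "norm (U $ i) \<le> (\<Sum>k\<in>UNIV. norm (U $ k))" for U :: "complex^3"
  by (rule member_le_sum) auto

lemma norm_helmholtz_mdiv_le:
  "norm (helmholtz (mdiv G) \<xi> $ i) \<le> 2 * sqrt (lap \<xi>) * (\<Sum>k\<in>UNIV. \<Sum>l\<in>UNIV. norm (G \<xi> $ k $ l))"
proof -
  have "norm (helmholtz (mdiv G) \<xi> $ i) \<le> 2 * (\<Sum>l\<in>UNIV. sqrt (lap \<xi>) * (\<Sum>k\<in>UNIV. norm (G \<xi> $ k $ l)))"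
    by (rule order_trans[OF norm_helmholtz_le]) (intro mult_left_mono sum_mono norm_mdiv_le, simp)
  also have "(\<Sum>l\<in>UNIV. sqrt (lap \<xi>) * (\<Sum>k\<in>UNIV. norm (G \<xi> $ k $ l))) = sqrt (lap \<xi>) * (\<Sum>k\<in>UNIV. \<Sum>l\<in>UNIV. norm (G \<xi> $ k $ l))"
    unfolding sum_distrib_left[symmetric] by (subst sum.swap) (rule refl)
  finally show ?thesis by simp
qed

text \<open>The divergence and the symmetric gradient contribute one factor
  \<open>sqrt (lap \<xi>)\<close> each, which the inverse Laplacian cancels. The multiplier
  therefore has order zero and acts on L2.\<close>

lemma norm_st_symbol_le:
  "norm (st_symbol G \<xi> $ i $ j) \<le> 4 * (\<Sum>k\<in>UNIV. \<Sum>l\<in>UNIV. norm (G \<xi> $ k $ l))"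
proof (cases "\<xi> = 0")
  case True
  \<comment> \<open>Division by \<open>lap 0 = 0\<close> yields 0, so the symbol vanishes at the
    origin.\<close>
  then show ?thesis by (simp add: st_symbol_def lap_def sum_nonneg)
next
  case False
  let ?S = "\<Sum>k\<in>UNIV. \<Sum>l\<in>UNIV. norm (G \<xi> $ k $ l)"
  let ?V = "helmholtz (mdiv G)"
  have "norm (st_symbol G \<xi> $ i $ j) = 2 / lap \<xi> * norm (sym_grad ?V \<xi> $ i $ j)"
    by (simp add: st_symbol_def)
  also have "\<dots> \<le> 2 / lap \<xi> * (sqrt (lap \<xi>) * ((norm (?V \<xi> $ i) + norm (?V \<xi> $ j)) / 2))"
    by (intro mult_left_mono norm_sym_grad_le) simp
  also have "\<dots> \<le> 2 / lap \<xi> * (sqrt (lap \<xi>) * ((2 * sqrt (lap \<xi>) * ?S + 2 * sqrt (lap \<xi>) * ?S) / 2))"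
    by (intro mult_left_mono divide_right_mono add_mono norm_helmholtz_mdiv_le) auto
  also have "\<dots> = 4 / lap \<xi> * (sqrt (lap \<xi>) * sqrt (lap \<xi>)) * ?S"
  proof -
    have "2 / l * (r * ((2 * r * S + 2 * r * S) / 2)) = 4 / l * (r * r) * S" for l r S :: real
      by (simp add: algebra_simps)
    then show ?thesis .
  qed
  also have "sqrt (lap \<xi>) * sqrt (lap \<xi>) = lap \<xi>" by simp
  also have "4 / lap \<xi> * lap \<xi> * ?S = 4 * ?S" using lap_pos[OF False] by simp
  finally show ?thesis .
qed

section \<open>Hermitian symmetry and measurability of symbols\<close>

lemma hermitian_mult: "hermitian f \<Longrightarrow> hermitian g \<Longrightarrow> hermitian (\<lambda>\<xi>. f \<xi> * g \<xi>)"
  unfolding hermitian_def by (auto elim: eventually_elim2)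

lemma hermitian_add: "hermitian f \<Longrightarrow> hermitian g \<Longrightarrow> hermitian (\<lambda>\<xi>. f \<xi> + g \<xi>)"
  unfolding hermitian_def by (auto elim: eventually_elim2)

lemma hermitian_zero: "hermitian (\<lambda>\<xi>. 0)"
  by (simp add: hermitian_def)

lemma hermitian_sum: "(\<And>i. i \<in> I \<Longrightarrow> hermitian (f i)) \<Longrightarrow> hermitian (\<lambda>\<xi>. \<Sum>i\<in>I. f i \<xi>)"
  by (induction I rule: infinite_finite_induct) (auto intro: hermitian_add hermitian_zero)

lemma hermitian_deriv_symbol: "hermitian (deriv_symbol j)"
  unfolding hermitian_def by (simp add: deriv_symbol_minus cnj_deriv_symbol)

lemma hermitian_even: "(\<And>\<xi>. m (- \<xi>) = m \<xi>) \<Longrightarrow> hermitian (\<lambda>\<xi>. complex_of_real (m \<xi>))"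
  unfolding hermitian_def by simp

lemma hermitian_scaleR_even: "(\<And>\<xi>. m (- \<xi>) = m \<xi>) \<Longrightarrow> hermitian f \<Longrightarrow> hermitian (\<lambda>\<xi>. m \<xi> *\<^sub>R f \<xi>)"
  unfolding scaleR_conv_of_real by (intro hermitian_mult hermitian_even)

lemma hermitian_mdiv:
  "(\<And>i. hermitian (\<lambda>\<xi>. G \<xi> $ i $ j)) \<Longrightarrow> hermitian (\<lambda>\<xi>. mdiv G \<xi> $ j)"
  unfolding mdiv_nth by (intro hermitian_sum hermitian_mult hermitian_deriv_symbol)

lemma hermitian_helmholtz:
  "(\<And>j. hermitian (\<lambda>\<xi>. U \<xi> $ j)) \<Longrightarrow> hermitian (\<lambda>\<xi>. helmholtz U \<xi> $ i)"
  unfolding helmholtz_def vec_lambda_beta by (intro hermitian_sum hermitian_mult hermitian_even) auto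

lemma hermitian_sym_grad:
  assumes "\<And>j. hermitian (\<lambda>\<xi>. U \<xi> $ j)" shows "hermitian (\<lambda>\<xi>. sym_grad U \<xi> $ i $ j)"
proof -
  have "hermitian (\<lambda>\<xi>. complex_of_real (1/2) * (deriv_symbol i \<xi> * U \<xi> $ j + deriv_symbol j \<xi> * U \<xi> $ i))"
    by (intro hermitian_mult hermitian_add hermitian_deriv_symbol assms hermitian_even) auto
  then show ?thesis unfolding sym_grad_nth by simp
qed

lemma mdiv_borel [measurable (raw)]:
  "(\<And>i. (\<lambda>\<xi>. G \<xi> $ i $ j) \<in> borel_measurable borel) \<Longrightarrow> (\<lambda>\<xi>. mdiv G \<xi> $ j) \<in> borel_measurable borel"
  unfolding mdiv_nth by measurable

lemma helmholtz_borel: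
  "(\<And>i. (\<lambda>\<xi>. U \<xi> $ i) \<in> borel_measurable borel) \<Longrightarrow> (\<lambda>\<xi>. helmholtz U \<xi> $ i) \<in> borel_measurable borel"
  unfolding helmholtz_def vec_lambda_beta by measurable

lemma sym_grad_borel:
  assumes [measurable]: "\<And>i. (\<lambda>\<xi>. U \<xi> $ i) \<in> borel_measurable borel"
  shows "(\<lambda>\<xi>. sym_grad U \<xi> $ i $ j) \<in> borel_measurable borel"
  unfolding sym_grad_nth by measurable

lemma st_symbol_borel:
  "(\<And>i j. (\<lambda>\<xi>. G \<xi> $ i $ j) \<in> borel_measurable borel) \<Longrightarrow> (\<lambda>\<xi>. st_symbol G \<xi> $ i $ j) \<in> borel_measurable borel"
  unfolding st_symbol_def vector_scaleR_component
  by (intro borel_measurable_scaleR sym_grad_borel helmholtz_borel mdiv_borel) auto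

lemma hermitian_st_symbol:
  "(\<And>i j. hermitian (\<lambda>\<xi>. G \<xi> $ i $ j)) \<Longrightarrow> hermitian (\<lambda>\<xi>. st_symbol G \<xi> $ i $ j)"
  unfolding st_symbol_def vector_scaleR_component
  by (intro hermitian_scaleR_even hermitian_sym_grad hermitian_helmholtz hermitian_mdiv) auto

section \<open>Fields with values in vectors and matrices\<close>

lemma l2_sq_eq_sqint: "l2_sq f = sqint lborel (\<lambda>x. complex_of_real (f x))"
  by (simp add: l2_sq_def sqint_def)

lemma L2_iff: "f \<in> L2 \<longleftrightarrow> f \<in> borel_measurable borel \<and> sqint lborel (\<lambda>x. complex_of_real (f x)) < \<infinity>"
  by (simp add: L2_def l2_sq_eq_sqint)

lemma l2_sq_ft: assumes "has_ft f g" shows "l2_sq f = sqint lborel g"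
proof -
  have c: "cft (\<lambda>x. complex_of_real (f x)) g" using assms has_ft_cft by blast
  show ?thesis
  proof (cases "sqint lborel g < \<infinity>")
    case True
    then show ?thesis using cft_sqint_inverse[OF c] by (simp add: l2_sq_eq_sqint)
  next
    case False
    then have "\<not> sqint lborel (\<lambda>x. complex_of_real (f x)) < \<infinity>" using cft_sqint[OF c] by auto
    then show ?thesis using False by (simp add: l2_sq_eq_sqint top.not_eq_extremum[symmetric])
  qed
qed

lemma L2_ft_iff: assumes "has_ft f g" shows "f \<in> L2 \<longleftrightarrow> sqint lborel g < \<infinity>"
  using l2_sq_ft[OF assms] has_ft_measurable[OF assms] by (simp add: L2_def)

lemma L2_has_ft: assumes "f \<in> L2" obtains g where "has_ft f g" "sqint lborel g < \<infinity>"
proof (rule cft_L2_exists[of "\<lambda>x. complex_of_real (f x)"])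
  have [measurable]: "f \<in> borel_measurable borel" using assms L2_iff by blast
  show "(\<lambda>x. complex_of_real (f x)) \<in> borel_measurable borel" by measurable
  show "sqint lborel (\<lambda>x. complex_of_real (f x)) < \<infinity>" using assms L2_iff by blast
qed (use that has_ft_cft in blast)

lemma real_L2_exists:
  assumes "g \<in> borel_measurable borel" "hermitian g" "sqint lborel g < \<infinity>" shows "\<exists>f. has_ft f g"
  using cft_L2_inverse_exists[OF assms(1,3)] has_ft_of_hermitian[OF _ assms(2)] by metis

lemma vhas_ft_exists: "(\<And>j. \<exists>f. has_ft f (\<lambda>\<xi>. U \<xi> $ j)) \<Longrightarrow> \<exists>u. vhas_ft u U"
proof -
  assume "\<And>j. \<exists>f. has_ft f (\<lambda>\<xi>. U \<xi> $ j)"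
  then obtain f where "\<And>j. has_ft (f j) (\<lambda>\<xi>. U \<xi> $ j)" by metis
  then show ?thesis unfolding vhas_ft_def by (intro exI[of _ "\<lambda>x. \<chi> j. f j x"]) simp
qed

lemma mhas_ft_exists: "(\<And>i j. \<exists>f. has_ft f (\<lambda>\<xi>. G \<xi> $ i $ j)) \<Longrightarrow> \<exists>M. mhas_ft M G"
proof -
  assume "\<And>i j. \<exists>f. has_ft f (\<lambda>\<xi>. G \<xi> $ i $ j)"
  then obtain f where "\<And>i j. has_ft (f i j) (\<lambda>\<xi>. G \<xi> $ i $ j)" by metis
  then show ?thesis unfolding mhas_ft_def by (intro exI[of _ "\<lambda>x. \<chi> i j. f i j x"]) simp
qed

lemma AE_all3: "(\<And>j::3. AE x in M. P j x) \<Longrightarrow> AE x in M. \<forall>j. P j x"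
  by (subst AE_all_countable) blast

lemma vft_AE: assumes "vhas_ft u U" shows "AE \<xi> in lborel. vft u \<xi> = U \<xi>"
proof -
  have "AE \<xi> in lborel. \<forall>j. vft u \<xi> $ j = U \<xi> $ j"
    using assms ft_AE_eq unfolding vhas_ft_def vft_def vec_lambda_beta by (intro AE_all3) blast
  then show ?thesis by (simp add: vec_eq_iff)
qed

lemma mft_AE: assumes "mhas_ft M G" shows "AE \<xi> in lborel. mft M \<xi> = G \<xi>"
proof -
  have "AE \<xi> in lborel. \<forall>i j. mft M \<xi> $ i $ j = G \<xi> $ i $ j"
    using assms ft_AE_eq unfolding mhas_ft_def mft_def vec_lambda_beta by (intro AE_all3) blast
  then show ?thesis by (simp add: vec_eq_iff)
qed

lemma vhas_ft_vft: "vhas_ft u U \<Longrightarrow> vhas_ft u (vft u)"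
  unfolding vhas_ft_def vft_def vec_lambda_beta using has_ft_ft by blast

lemma mhas_ft_mft: "mhas_ft M G \<Longrightarrow> mhas_ft M (mft M)"
  unfolding mhas_ft_def mft_def vec_lambda_beta using has_ft_ft by blast

lemma vhas_ft_measurable: "vhas_ft u U \<Longrightarrow> (\<lambda>\<xi>. U \<xi> $ j) \<in> borel_measurable borel"
  unfolding vhas_ft_def using has_ft_measurable(2) by blast

lemma mhas_ft_measurable: "mhas_ft M G \<Longrightarrow> (\<lambda>\<xi>. G \<xi> $ i $ j) \<in> borel_measurable borel"
  unfolding mhas_ft_def using has_ft_measurable(2) by blast

lemma vhas_ft_cong_AE:
  assumes "vhas_ft u U" "AE \<xi> in lborel. U \<xi> = V \<xi>" "\<And>j. (\<lambda>\<xi>. V \<xi> $ j) \<in> borel_measurable borel"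
  shows "vhas_ft u V"
  unfolding vhas_ft_def
proof
  fix j
  show "has_ft (\<lambda>x. u x $ j) (\<lambda>\<xi>. V \<xi> $ j)"
    by (rule has_ft_cong_AE[of _ "\<lambda>\<xi>. U \<xi> $ j"]) (use assms in \<open>auto simp: vhas_ft_def elim!: eventually_mono\<close>)
qed

lemma mhas_ft_cong_AE:
  assumes "mhas_ft M G" "AE \<xi> in lborel. G \<xi> = H \<xi>" "\<And>i j. (\<lambda>\<xi>. H \<xi> $ i $ j) \<in> borel_measurable borel"
  shows "mhas_ft M H"
  unfolding mhas_ft_def
proof (intro allI)
  fix i j
  show "has_ft (\<lambda>x. M x $ i $ j) (\<lambda>\<xi>. H \<xi> $ i $ j)"
    by (rule has_ft_cong_AE[of _ "\<lambda>\<xi>. G \<xi> $ i $ j"]) (use assms in \<open>auto simp: mhas_ft_def elim!: eventually_mono\<close>)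
qed

lemma vhas_ft_diff: "vhas_ft u U \<Longrightarrow> vhas_ft v V \<Longrightarrow> vhas_ft (\<lambda>x. u x - v x) (\<lambda>\<xi>. U \<xi> - V \<xi>)"
  unfolding vhas_ft_def using has_ft_diff by fastforce

lemma mhas_ft_diff: "mhas_ft M G \<Longrightarrow> mhas_ft N H \<Longrightarrow> mhas_ft (\<lambda>x. M x - N x) (\<lambda>\<xi>. G \<xi> - H \<xi>)"
  unfolding mhas_ft_def using has_ft_diff by fastforce

lemma symmetric_valued_of_ft:
  assumes "mhas_ft M G" "AE \<xi> in lborel. transpose (G \<xi>) = G \<xi>" shows "symmetric_valued M"
proof -
  have "AE x in lborel. \<forall>i j. M x $ j $ i = M x $ i $ j"
  proof (intro AE_all3)
    fix i j
    have "has_ft (\<lambda>x. M x $ j $ i) (\<lambda>\<xi>. G \<xi> $ i $ j)"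
      by (rule has_ft_cong_AE[of _ "\<lambda>\<xi>. G \<xi> $ j $ i"])
        (use assms mhas_ft_measurable[OF assms(1)] in \<open>auto simp: mhas_ft_def transpose_def vec_eq_iff elim!: eventually_mono\<close>)
    moreover have "has_ft (\<lambda>x. M x $ i $ j) (\<lambda>\<xi>. G \<xi> $ i $ j)" using assms(1) mhas_ft_def by blast
    ultimately show "AE x in lborel. M x $ j $ i = M x $ i $ j" by (rule has_ft_unique_left)
  qed
  then show ?thesis unfolding symmetric_valued_def by (simp add: transpose_def vec_eq_iff)
qed

lemma ft_of_symmetric_valued:
  assumes "mhas_ft M G" "symmetric_valued M" shows "AE \<xi> in lborel. \<forall>i j. G \<xi> $ i $ j = G \<xi> $ j $ i"
proof (intro AE_all3)
  fix i j
  have 1: "has_ft (\<lambda>x. M x $ i $ j) (\<lambda>\<xi>. G \<xi> $ i $ j)" "has_ft (\<lambda>x. M x $ j $ i) (\<lambda>\<xi>. G \<xi> $ j $ i)"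
    using assms(1) mhas_ft_def by blast+
  have "has_ft (\<lambda>x. M x $ i $ j) (\<lambda>\<xi>. G \<xi> $ j $ i)"
    by (rule has_ft_cong_AE_left[OF 1(2)])
      (use assms(2) has_ft_measurable(1)[OF 1(1)] in \<open>auto simp: symmetric_valued_def transpose_def vec_eq_iff elim!: eventually_mono\<close>)
  then show "AE \<xi> in lborel. G \<xi> $ i $ j = G \<xi> $ j $ i" using has_ft_unique[OF 1(1)] by blast
qed

text \<open>The common frame of the norm comparisons: a pointwise inequality between weighted
  squares, known almost everywhere, is integrated to one between norms.\<close>

lemma nn_integral_weight_bound:
  fixes f :: "real^3 \<Rightarrow> real" and g :: "'i \<Rightarrow> real^3 \<Rightarrow> real"
  assumes "finite I" "AE \<xi> in lborel. f \<xi> \<le> C * (\<Sum>i\<in>I. g i \<xi>)" "C \<ge> 0"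
    and "\<And>i \<xi>. i \<in> I \<Longrightarrow> g i \<xi> \<ge> 0" and [measurable]: "\<And>i. i \<in> I \<Longrightarrow> g i \<in> borel_measurable borel"
  shows "(\<integral>\<^sup>+\<xi>. ennreal (f \<xi>) \<partial>lborel) \<le> ennreal C * (\<Sum>i\<in>I. \<integral>\<^sup>+\<xi>. ennreal (g i \<xi>) \<partial>lborel)"
proof -
  have "(\<integral>\<^sup>+\<xi>. ennreal (f \<xi>) \<partial>lborel) \<le> (\<integral>\<^sup>+\<xi>. ennreal C * (\<Sum>i\<in>I. ennreal (g i \<xi>)) \<partial>lborel)"
  proof (rule nn_integral_mono_AE)
    show "AE \<xi> in lborel. ennreal (f \<xi>) \<le> ennreal C * (\<Sum>i\<in>I. ennreal (g i \<xi>))"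
      using assms(2)
    proof eventually_elim
      case (elim \<xi>)
      then have "ennreal (f \<xi>) \<le> ennreal (C * (\<Sum>i\<in>I. g i \<xi>))" by (rule ennreal_leI)
      then show ?case using assms(3,4) by (simp add: ennreal_mult' sum_ennreal)
    qed
  qed
  also have "\<dots> = ennreal C * (\<Sum>i\<in>I. \<integral>\<^sup>+\<xi>. ennreal (g i \<xi>) \<partial>lborel)"
    by (subst nn_integral_cmult) (auto simp: nn_integral_sum)
  finally show ?thesis .
qed

lemma sum_norm_square_le:
  fixes G :: "complex^3^3"
  shows "(\<Sum>k\<in>UNIV. \<Sum>l\<in>UNIV. norm (G $ k $ l))\<^sup>2 \<le> 9 * (\<Sum>p\<in>UNIV. (norm (G $ fst p $ snd p))\<^sup>2)"
proof -
  have "(\<Sum>k\<in>UNIV. \<Sum>l\<in>UNIV. norm (G $ k $ l)) = (\<Sum>p\<in>UNIV. norm (G $ fst p $ snd p))"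
    by (simp add: sum.cartesian_product UNIV_Times_UNIV[symmetric] case_prod_beta del: UNIV_Times_UNIV)
  moreover have "(\<Sum>p\<in>(UNIV::(3\<times>3) set). norm (G $ fst p $ snd p))\<^sup>2 \<le> (\<Sum>p\<in>UNIV. (norm (G $ fst p $ snd p))\<^sup>2) * card (UNIV :: (3\<times>3) set)"
    by (rule sum_squared_le_sum_of_squares)
  ultimately show ?thesis by (simp add: mult.commute)
qed

text \<open>144 = 4^2 * 9, from the pointwise bound of the symbol and Cauchy-Schwarz over the nine
  entries.\<close>

lemma sqint_st_symbol:
  assumes "\<And>i j. (\<lambda>\<xi>. G \<xi> $ i $ j) \<in> borel_measurable borel"
  shows "sqint lborel (\<lambda>\<xi>. st_symbol G \<xi> $ i $ j) \<le> 144 * (\<Sum>p\<in>UNIV. sqint lborel (\<lambda>\<xi>. G \<xi> $ fst p $ snd p))"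
proof -
  have "(\<integral>\<^sup>+\<xi>. ennreal ((norm (st_symbol G \<xi> $ i $ j))\<^sup>2) \<partial>lborel) \<le>
    ennreal 144 * (\<Sum>p\<in>UNIV. \<integral>\<^sup>+\<xi>. ennreal ((norm (G \<xi> $ fst p $ snd p))\<^sup>2) \<partial>lborel)"
  proof (rule nn_integral_weight_bound)
    show "AE \<xi> in lborel. (norm (st_symbol G \<xi> $ i $ j))\<^sup>2 \<le> 144 * (\<Sum>p\<in>UNIV. (norm (G \<xi> $ fst p $ snd p))\<^sup>2)"
    proof (intro AE_I2)
      fix \<xi>
      have "(norm (st_symbol G \<xi> $ i $ j))\<^sup>2 \<le> (4 * (\<Sum>k\<in>UNIV. \<Sum>l\<in>UNIV. norm (G \<xi> $ k $ l)))\<^sup>2"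
        by (intro power_mono norm_st_symbol_le) simp
      also have "\<dots> = 16 * (\<Sum>k\<in>UNIV. \<Sum>l\<in>UNIV. norm (G \<xi> $ k $ l))\<^sup>2" by (simp add: power_mult_distrib)
      also have "\<dots> \<le> 144 * (\<Sum>p\<in>UNIV. (norm (G \<xi> $ fst p $ snd p))\<^sup>2)" using sum_norm_square_le[of "G \<xi>"] by simp
      finally show "(norm (st_symbol G \<xi> $ i $ j))\<^sup>2 \<le> 144 * (\<Sum>p\<in>UNIV. (norm (G \<xi> $ fst p $ snd p))\<^sup>2)" .
    qed
  qed (use assms in auto)
  then show ?thesis by (simp add: sqint_def)
qed

section \<open>The orthogonal projection onto strain matrices\<close>

lemma integral_inner_ft:
  assumes QG: "mhas_ft Q G" and RH: "mhas_ft R H"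
    and fin: "\<And>i j. (\<lambda>x. Q x $ i $ j) \<in> L2" "\<And>i j. (\<lambda>x. R x $ i $ j) \<in> L2"
  shows "complex_of_real (LINT x|lborel. Q x \<bullet> R x) = (LINT \<xi>|lborel. (\<Sum>i\<in>UNIV. \<Sum>j\<in>UNIV. G \<xi> $ i $ j * H (- \<xi>) $ i $ j))"
proof -
  have c: "cft (\<lambda>x. complex_of_real (Q x $ i $ j)) (\<lambda>\<xi>. G \<xi> $ i $ j)" "cft (\<lambda>x. complex_of_real (R x $ i $ j)) (\<lambda>\<xi>. H \<xi> $ i $ j)" for i j
    using QG RH unfolding mhas_ft_def has_ft_cft by blast+
  have f: "sqint lborel (\<lambda>x. complex_of_real (Q x $ i $ j)) < \<infinity>" "sqint lborel (\<lambda>x. complex_of_real (R x $ i $ j)) < \<infinity>" for i j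
    using fin(1)[of i j] fin(2)[of i j] unfolding L2_iff by auto
  note [measurable] = cft_measurable[OF c(1)] cft_measurable[OF c(2)]
  have h: "sqint lborel (\<lambda>\<xi>. H (- \<xi>) $ i $ j) < \<infinity>" for i j
    using cft_sqint_finite[OF c(2) f(2), of i j] sqint_reflect[of "\<lambda>\<xi>. H \<xi> $ i $ j"] by simp
  have [measurable]: "(\<lambda>\<xi>. H (- \<xi>) $ i $ j) \<in> borel_measurable borel" for i j
    by (rule measurable_compose[of uminus _ _ "\<lambda>\<xi>. H \<xi> $ i $ j"]) measurable
  have i1: "integrable lborel (\<lambda>x. complex_of_real (Q x $ i $ j) * complex_of_real (R x $ i $ j))" for i j
    by (intro integrable_mult_sqint f) measurable
  have i2: "integrable lborel (\<lambda>\<xi>. G \<xi> $ i $ j * H (- \<xi>) $ i $ j)" for i j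
    by (intro integrable_mult_sqint cft_sqint_finite[OF c(1) f(1)] h) measurable
  have "complex_of_real (LINT x|lborel. Q x \<bullet> R x) = (LINT x|lborel. (\<Sum>i\<in>UNIV. \<Sum>j\<in>UNIV. complex_of_real (Q x $ i $ j) * complex_of_real (R x $ i $ j)))"
    unfolding inner_vec_def by (subst integral_complex_of_real[symmetric]) simp
  also have "\<dots> = (\<Sum>i\<in>UNIV. \<Sum>j\<in>UNIV. LINT x|lborel. complex_of_real (Q x $ i $ j) * complex_of_real (R x $ i $ j))"
    by (subst Bochner_Integration.integral_sum, intro Bochner_Integration.integrable_sum i1)
      (intro sum.cong refl Bochner_Integration.integral_sum i1)
  also have "\<dots> = (\<Sum>i\<in>UNIV. \<Sum>j\<in>UNIV. LINT \<xi>|lborel. G \<xi> $ i $ j * H (- \<xi>) $ i $ j)"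
    by (intro sum.cong refl parseval[OF c(1) c(2) f(1) f(2)])
  also have "\<dots> = (LINT \<xi>|lborel. (\<Sum>i\<in>UNIV. \<Sum>j\<in>UNIV. G \<xi> $ i $ j * H (- \<xi>) $ i $ j))"
    by (subst Bochner_Integration.integral_sum, intro Bochner_Integration.integrable_sum i2)
      (intro sum.cong refl Bochner_Integration.integral_sum[symmetric] i2)
  finally show ?thesis .
qed

text \<open>Pairing a symmetric matrix with a symmetric gradient is, up to a factor, pairing its
  divergence with the field. By \<open>mdiv_st_symbol\<close> the remainder
  \<open>G - st_symbol G\<close> has divergence parallel to the frequency, and this annihilates
  divergence free fields. The argument \<open>- \<xi>\<close> reflects the bilinear Parseval
  formula.\<close>

lemma st_symbol_orthogonal:
  assumes nz: "\<xi> \<noteq> 0" and sym: "\<And>i j. G \<xi> $ i $ j = G \<xi> $ j $ i" and div: "vdiv W (- \<xi>) = 0"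
  shows "(\<Sum>i\<in>UNIV. \<Sum>j\<in>UNIV. (G \<xi> - st_symbol G \<xi>) $ i $ j * sym_grad (laplace_pow (- 1/2) W) (- \<xi>) $ i $ j) = 0"
proof -
  define S where "S \<eta> = G \<eta> - st_symbol G \<eta>" for \<eta>
  define Y where "Y = W (- \<xi>)"
  define c where "c = 1 / sqrt (lap \<xi>)"
  have R: "sym_grad (laplace_pow (- 1/2) W) (- \<xi>) $ i $ j = - complex_of_real (c / 2) * (deriv_symbol i \<xi> * Y $ j + deriv_symbol j \<xi> * Y $ i)" for i j
  proof -
    have "sym_grad (laplace_pow (- 1/2) W) (- \<xi>) $ i $ j = c *\<^sub>R sym_grad W (- \<xi>) $ i $ j"
      unfolding sym_grad_minus_half vector_scaleR_component c_def by simp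
    then show ?thesis
      unfolding sym_grad_nth by (simp add: deriv_symbol_minus Y_def scaleR_conv_of_real field_simps)
  qed
  have dY: "(\<Sum>j\<in>UNIV. deriv_symbol j \<xi> * Y $ j) = 0"
    using div unfolding vdiv_def Y_def by (simp add: deriv_symbol_minus sum_negf)
  have mS: "mdiv S \<xi> $ j = - deriv_symbol j \<xi> * vdiv (mdiv G) \<xi> / complex_of_real (lap \<xi>)" for j
  proof -
    have "mdiv S \<xi> $ j = mdiv G \<xi> $ j - mdiv (st_symbol G) \<xi> $ j"
      unfolding mdiv_nth S_def by (simp add: sum_subtractf right_diff_distrib)
    then show ?thesis unfolding mdiv_st_symbol[OF nz] helmholtz_nth[OF nz] by simp
  qed
  have z: "(\<Sum>i\<in>UNIV. \<Sum>j\<in>UNIV. S \<xi> $ i $ j * (deriv_symbol i \<xi> * Y $ j)) = 0"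
  proof -
    have "(\<Sum>i\<in>UNIV. \<Sum>j\<in>UNIV. S \<xi> $ i $ j * (deriv_symbol i \<xi> * Y $ j)) = (\<Sum>j\<in>UNIV. mdiv S \<xi> $ j * Y $ j)"
      unfolding mdiv_nth by (subst sum.swap) (simp add: sum_distrib_left sum_distrib_right mult_ac)
    also have "\<dots> = (\<Sum>j\<in>UNIV. deriv_symbol j \<xi> * Y $ j) * (- vdiv (mdiv G) \<xi> / complex_of_real (lap \<xi>))"
      unfolding mS by (simp add: sum_distrib_left sum_distrib_right sum_divide_distrib sum_negf mult_ac)
    finally show ?thesis using dY by simp
  qed
  have symS: "S \<xi> $ i $ j = S \<xi> $ j $ i" for i j unfolding S_def using sym st_symbol_sym by simp
  have z': "(\<Sum>i\<in>UNIV. \<Sum>j\<in>UNIV. S \<xi> $ i $ j * (deriv_symbol j \<xi> * Y $ i)) = 0"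
    by (subst sum.swap) (subst symS, rule z)
  have "(\<Sum>i\<in>UNIV. \<Sum>j\<in>UNIV. S \<xi> $ i $ j * (- complex_of_real (c / 2) * (deriv_symbol i \<xi> * Y $ j + deriv_symbol j \<xi> * Y $ i)))
    = - complex_of_real (c / 2) * ((\<Sum>i\<in>UNIV. \<Sum>j\<in>UNIV. S \<xi> $ i $ j * (deriv_symbol i \<xi> * Y $ j)) + (\<Sum>i\<in>UNIV. \<Sum>j\<in>UNIV. S \<xi> $ i $ j * (deriv_symbol j \<xi> * Y $ i)))"
    by (simp add: sum_distrib_left sum.distrib[symmetric] algebra_simps)
  then show ?thesis unfolding R using z z' by (simp add: S_def)
qed

lemma L2_diff: assumes "f \<in> L2" "g \<in> L2" shows "(\<lambda>x. f x - g x) \<in> L2"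
  using assms sqint_add_finite(2)[of "\<lambda>x. complex_of_real (f x)" lborel "\<lambda>x. complex_of_real (g x)"]
  unfolding L2_iff by auto

text \<open>Two candidates for the projection differ by an element of the space, which is what
  uniqueness of the projection requires.\<close>

lemma L2_st_diff:
  assumes "N \<in> L2_st" "N' \<in> L2_st" shows "(\<lambda>x. N x - N' x) \<in> L2_st"
proof -
  obtain w where w: "\<And>j. (\<lambda>x. w x $ j) \<in> L2" "AE \<xi> in lborel. vdiv (laplace_pow (- 1/2) (vft w)) \<xi> = 0"
    "mhas_ft N (sym_grad (laplace_pow (- 1/2) (vft w)))" using assms(1) unfolding L2_st_def by blast
  obtain w' where w': "\<And>j. (\<lambda>x. w' x $ j) \<in> L2" "AE \<xi> in lborel. vdiv (laplace_pow (- 1/2) (vft w')) \<xi> = 0"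
    "mhas_ft N' (sym_grad (laplace_pow (- 1/2) (vft w')))" using assms(2) unfolding L2_st_def by blast
  have v: "vhas_ft w (vft w)" "vhas_ft w' (vft w')"
    unfolding vhas_ft_def vft_def vec_lambda_beta using L2_has_ft[OF w(1)] L2_has_ft[OF w'(1)] has_ft_ft by meson+
  note d = vhas_ft_diff[OF v]
  note e = vft_AE[OF d]
  have m: "(\<lambda>\<xi>. sym_grad (laplace_pow (- 1/2) (vft (\<lambda>x. w x - w' x))) \<xi> $ i $ j) \<in> borel_measurable borel" for i j
    unfolding sym_grad_minus_half vector_scaleR_component
    using vhas_ft_measurable[OF vhas_ft_vft[OF d]] by (intro borel_measurable_scaleR sym_grad_borel) auto
  have s1: "symmetric_valued (\<lambda>x. N x - N' x)"
  proof -
    have "AE x in lborel. transpose (N x) = N x" "AE x in lborel. transpose (N' x) = N' x"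
      using assms unfolding L2_st_def L2_sym_def symmetric_valued_def by auto
    then have "AE x in lborel. transpose (N x - N' x) = N x - N' x"
      by eventually_elim (simp add: transpose_def vec_eq_iff)
    then show ?thesis unfolding symmetric_valued_def .
  qed
  have s2: "(\<lambda>x. (N x - N' x) $ i $ j) \<in> L2" for i j
    using assms L2_diff unfolding L2_st_def L2_sym_def by simp
  have s3: "(\<lambda>x. (w x - w' x) $ j) \<in> L2" for j using L2_diff[OF w(1) w'(1)] by simp
  have s4: "AE \<xi> in lborel. vdiv (laplace_pow (- 1/2) (vft (\<lambda>x. w x - w' x))) \<xi> = 0"
    using e w(2) w'(2)
  proof eventually_elim
    case (elim \<xi>)
    have "vdiv (laplace_pow (- 1/2) (vft (\<lambda>x. w x - w' x))) \<xi> = vdiv (laplace_pow (- 1/2) (vft w)) \<xi> - vdiv (laplace_pow (- 1/2) (vft w')) \<xi>"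
      unfolding vdiv_laplace_pow
      unfolding vdiv_def elim(1) by (simp add: right_diff_distrib sum_subtractf scaleR_diff_right)
    then show ?case using elim by simp
  qed
  have s5: "mhas_ft (\<lambda>x. N x - N' x) (sym_grad (laplace_pow (- 1/2) (vft (\<lambda>x. w x - w' x))))"
  proof (rule mhas_ft_cong_AE[OF mhas_ft_diff[OF w(3) w'(3)] _ m])
    show "AE \<xi> in lborel. sym_grad (laplace_pow (- 1/2) (vft w)) \<xi> - sym_grad (laplace_pow (- 1/2) (vft w')) \<xi> =
       sym_grad (laplace_pow (- 1/2) (vft (\<lambda>x. w x - w' x))) \<xi>"
      using e
    proof eventually_elim
      case (elim \<xi>)
      show ?case unfolding sym_grad_laplace_pow
        by (simp add: vec_eq_iff sym_grad_nth elim scaleR_diff_right[symmetric] algebra_simps diff_divide_distrib[symmetric] flip: scaleR_diff_right)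
    qed
  qed
  show ?thesis
    unfolding L2_st_def L2_sym_def
    by (intro CollectI conjI exI[of _ "\<lambda>x. w x - w' x"] allI s1 s2 s3 s4 s5)
qed

lemma L2_inner_integrable:
  assumes "\<And>i j. (\<lambda>x. Q x $ i $ j) \<in> L2" "\<And>i j. (\<lambda>x. R x $ i $ j) \<in> L2"
  shows "integrable lborel (\<lambda>x. (Q x :: real^3^3) \<bullet> R x)"
proof -
  have "integrable lborel (\<lambda>x. Q x $ i $ j * R x $ i $ j)" for i j
  proof -
    have q: "(\<lambda>x. Q x $ i $ j) \<in> borel_measurable borel" "sqint lborel (\<lambda>x. complex_of_real (Q x $ i $ j)) < \<infinity>"
      and r: "(\<lambda>x. R x $ i $ j) \<in> borel_measurable borel" "sqint lborel (\<lambda>x. complex_of_real (R x $ i $ j)) < \<infinity>"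
      using assms(1)[of i j] assms(2)[of i j] unfolding L2_iff by auto
    note [measurable] = q(1) r(1)
    have "integrable lborel (\<lambda>x. complex_of_real (Q x $ i $ j) * complex_of_real (R x $ i $ j))"
      by (intro integrable_mult_sqint q(2) r(2)) measurable
    then have "integrable lborel (\<lambda>x. complex_of_real (Q x $ i $ j * R x $ i $ j))" by simp
    then show ?thesis by (simp only: complex_of_real_integrable_eq)
  qed
  then show ?thesis unfolding inner_vec_def by (intro Bochner_Integration.integrable_sum) simp
qed

text \<open>\<open>P_st Q\<close> is an unspecified choice. A field \<open>N\<close> with the
  expected symbol is shown to meet the defining conditions, so a choice exists. The difference
  \<open>D\<close> of the chosen field and \<open>N\<close> lies in the space and is orthogonal to
  it, in particular to itself, and hence vanishes almost everywhere.\<close>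

lemma P_st_ft:
  assumes Q: "Q \<in> L2_sym" and QG: "mhas_ft Q G"
  shows "mhas_ft (P_st Q) (st_symbol G)"
proof -
  have QL: "(\<lambda>x. Q x $ i $ j) \<in> L2" for i j using Q unfolding L2_sym_def by blast
  have hf: "has_ft (\<lambda>x. Q x $ i $ j) (\<lambda>\<xi>. G \<xi> $ i $ j)" for i j using QG mhas_ft_def by blast
  have Gm: "(\<lambda>\<xi>. G \<xi> $ i $ j) \<in> borel_measurable borel" for i j using mhas_ft_measurable[OF QG] .
  have Gh: "hermitian (\<lambda>\<xi>. G \<xi> $ i $ j)" for i j using has_ft_hermitian[OF hf] .
  have Gf: "sqint lborel (\<lambda>\<xi>. G \<xi> $ i $ j) < \<infinity>" for i j using QL L2_ft_iff[OF hf] by blast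
  have Gs: "AE \<xi> in lborel. \<forall>i j. G \<xi> $ i $ j = G \<xi> $ j $ i"
    using ft_of_symmetric_valued[OF QG] Q unfolding L2_sym_def by blast
  have Sf: "(\<Sum>p\<in>UNIV. sqint lborel (\<lambda>\<xi>. G \<xi> $ fst p $ snd p)) < \<top>" using Gf by (simp add: less_top[symmetric])
  have Pf: "sqint lborel (\<lambda>\<xi>. st_symbol G \<xi> $ i $ j) < \<infinity>" for i j
    by (rule order.strict_trans1[OF sqint_st_symbol[OF Gm]]) (use Sf in \<open>simp add: ennreal_mult_less_top\<close>)
  \<comment> \<open>The generating field -2 (-Delta)^(-1/2) \<open>P_df\<close> div Q. Membership in
    \<open>L2_st\<close> contributes the other half power, which restores the factor -2 /
    \<open>lap \<xi>\<close> of \<open>st_symbol\<close>.\<close>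
  define W where "W \<xi> = (- 2 / sqrt (lap \<xi>)) *\<^sub>R helmholtz (mdiv G) \<xi>" for \<xi>
  have Wm: "(\<lambda>\<xi>. W \<xi> $ j) \<in> borel_measurable borel" for j
    unfolding W_def vector_scaleR_component by (intro borel_measurable_scaleR helmholtz_borel mdiv_borel Gm) measurable
  have Wh: "hermitian (\<lambda>\<xi>. W \<xi> $ j)" for j
    unfolding W_def vector_scaleR_component by (intro hermitian_scaleR_even hermitian_helmholtz hermitian_mdiv Gh) simp
  have Wf: "sqint lborel (\<lambda>\<xi>. W \<xi> $ j) < \<infinity>" for j
  proof -
    have "(\<integral>\<^sup>+\<xi>. ennreal ((norm (W \<xi> $ j))\<^sup>2) \<partial>lborel) \<le> ennreal 144 * (\<Sum>p\<in>UNIV. \<integral>\<^sup>+\<xi>. ennreal ((norm (G \<xi> $ fst p $ snd p))\<^sup>2) \<partial>lborel)"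
    proof (rule nn_integral_weight_bound)
      show "AE \<xi> in lborel. (norm (W \<xi> $ j))\<^sup>2 \<le> 144 * (\<Sum>p\<in>UNIV. (norm (G \<xi> $ fst p $ snd p))\<^sup>2)"
        using AE_nonzero
      proof eventually_elim
        case (elim \<xi>)
        let ?S = "\<Sum>k\<in>UNIV. \<Sum>l\<in>UNIV. norm (G \<xi> $ k $ l)"
        have "norm (W \<xi> $ j) = 2 / sqrt (lap \<xi>) * norm (helmholtz (mdiv G) \<xi> $ j)"
          unfolding W_def by simp
        also have "\<dots> \<le> 2 / sqrt (lap \<xi>) * (2 * sqrt (lap \<xi>) * ?S)"
          by (intro mult_left_mono norm_helmholtz_mdiv_le) simp
        also have "\<dots> = 4 * ?S" using lap_pos[OF elim] by simp
        finally have "(norm (W \<xi> $ j))\<^sup>2 \<le> (4 * ?S)\<^sup>2" by (intro power_mono) auto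
        also have "\<dots> = 16 * ?S\<^sup>2" by (simp add: power_mult_distrib)
        also have "\<dots> \<le> 144 * (\<Sum>p\<in>UNIV. (norm (G \<xi> $ fst p $ snd p))\<^sup>2)" using sum_norm_square_le[of "G \<xi>"] by simp
        finally show ?case .
      qed
    qed (use Gm in auto)
    also have "\<dots> < \<infinity>" using Sf by (simp add: ennreal_mult_less_top sqint_def)
    finally show ?thesis unfolding sqint_def .
  qed
  obtain w where w: "vhas_ft w W" using vhas_ft_exists[OF real_L2_exists[OF Wm Wh Wf]] by blast
  have wL: "(\<lambda>x. w x $ j) \<in> L2" for j using L2_ft_iff Wf w unfolding vhas_ft_def by blast
  have wd: "AE \<xi> in lborel. vdiv (laplace_pow (- 1/2) (vft w)) \<xi> = 0"
    using vft_AE[OF w] AE_nonzero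
  proof eventually_elim
    case (elim \<xi>)
    have "vdiv (vft w) \<xi> = vdiv W \<xi>" unfolding vdiv_def elim(1) ..
    also have "\<dots> = (- 2 / sqrt (lap \<xi>)) *\<^sub>R vdiv (helmholtz (mdiv G)) \<xi>" unfolding W_def[abs_def] by (rule vdiv_scale)
    also have "\<dots> = 0" using vdiv_helmholtz[OF elim(2)] by simp
    finally show ?case unfolding vdiv_laplace_pow by simp
  qed
  obtain N where N: "mhas_ft N (st_symbol G)"
    using mhas_ft_exists[OF real_L2_exists[OF st_symbol_borel[OF Gm] hermitian_st_symbol[OF Gh] Pf]] by blast
  have NL: "(\<lambda>x. N x $ i $ j) \<in> L2" for i j using L2_ft_iff Pf N unfolding mhas_ft_def by blast
  have Nst: "N \<in> L2_st"
    unfolding L2_st_def L2_sym_def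
  proof (intro CollectI conjI exI[of _ w])
    show "symmetric_valued N"
      by (rule symmetric_valued_of_ft[OF N]) (simp add: transpose_def vec_eq_iff st_symbol_sym)
    show "mhas_ft N (sym_grad (laplace_pow (- 1/2) (vft w)))"
    proof (rule mhas_ft_cong_AE[OF N])
      show "AE \<xi> in lborel. st_symbol G \<xi> = sym_grad (laplace_pow (- 1/2) (vft w)) \<xi>"
        using vft_AE[OF w] AE_nonzero
      proof eventually_elim
        case (elim \<xi>)
        have "sym_grad (laplace_pow (- 1/2) (vft w)) \<xi> = (1 / sqrt (lap \<xi>)) *\<^sub>R sym_grad W \<xi>"
          unfolding sym_grad_minus_half unfolding sym_grad_def elim(1) ..
        also have "sym_grad W \<xi> = (- 2 / sqrt (lap \<xi>)) *\<^sub>R sym_grad (helmholtz (mdiv G)) \<xi>"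
          unfolding W_def[abs_def] by (rule sym_grad_scale)
        finally show ?case unfolding st_symbol_def using lap_pos[OF elim(2)] by simp
      qed
      show "(\<lambda>\<xi>. sym_grad (laplace_pow (- 1/2) (vft w)) \<xi> $ i $ j) \<in> borel_measurable borel" for i j
        unfolding sym_grad_minus_half vector_scaleR_component
        using vhas_ft_measurable[OF vhas_ft_vft[OF w]] by (intro borel_measurable_scaleR sym_grad_borel) auto
    qed
  qed (use NL wL wd in auto)
  have orth: "(LINT x|lborel. (Q x - N x) \<bullet> R x) = 0" if R: "R \<in> L2_st" for R
  proof -
    obtain v where v: "AE \<xi> in lborel. vdiv (laplace_pow (- 1/2) (vft v)) \<xi> = 0"
      "mhas_ft R (sym_grad (laplace_pow (- 1/2) (vft v)))" using R unfolding L2_st_def by blast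
    have RL: "(\<lambda>x. R x $ i $ j) \<in> L2" for i j using R unfolding L2_st_def L2_sym_def by blast
    have QNL: "(\<lambda>x. (Q x - N x) $ i $ j) \<in> L2" for i j using L2_diff[OF QL NL] by simp
    have "complex_of_real (LINT x|lborel. (Q x - N x) \<bullet> R x) =
      (LINT \<xi>|lborel. (\<Sum>i\<in>UNIV. \<Sum>j\<in>UNIV. (G \<xi> - st_symbol G \<xi>) $ i $ j * sym_grad (laplace_pow (- 1/2) (vft v)) (- \<xi>) $ i $ j))"
      by (rule integral_inner_ft[OF mhas_ft_diff[OF QG N] v(2) QNL RL])
    also have "\<dots> = 0"
    proof (rule integral_eq_zero_AE)
      show "AE \<xi> in lborel. (\<Sum>i\<in>UNIV. \<Sum>j\<in>UNIV. (G \<xi> - st_symbol G \<xi>) $ i $ j * sym_grad (laplace_pow (- 1/2) (vft v)) (- \<xi>) $ i $ j) = 0"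
        using AE_nonzero Gs AE_reflect[OF v(1)]
      proof eventually_elim
        case (elim \<xi>)
        have "vdiv (vft v) (- \<xi>) = 0" using elim(1,3) unfolding vdiv_laplace_pow by simp
        then show ?case using elim by (intro st_symbol_orthogonal) auto
      qed
    qed
    finally show ?thesis by simp
  qed
  have ex: "P_st Q \<in> L2_st \<and> (\<forall>R\<in>L2_st. (LINT x|lborel. (Q x - P_st Q x) \<bullet> R x) = 0)"
    unfolding P_st_def by (rule someI[of "\<lambda>N. N \<in> L2_st \<and> (\<forall>R\<in>L2_st. (LINT x|lborel. (Q x - N x) \<bullet> R x) = 0)" N])
      (use Nst orth in blast)
  define D where "D x = P_st Q x - N x" for x
  have D: "D \<in> L2_st" unfolding D_def using ex Nst L2_st_diff by blast
  have DL: "(\<lambda>x. D x $ i $ j) \<in> L2" for i j using D unfolding L2_st_def L2_sym_def by blast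
  have PL: "(\<lambda>x. P_st Q x $ i $ j) \<in> L2" for i j using ex unfolding L2_st_def L2_sym_def by blast
  have "(LINT x|lborel. D x \<bullet> D x) = (LINT x|lborel. (Q x - N x) \<bullet> D x - (Q x - P_st Q x) \<bullet> D x)"
    by (intro Bochner_Integration.integral_cong refl) (simp add: D_def inner_diff_left)
  also have "\<dots> = (LINT x|lborel. (Q x - N x) \<bullet> D x) - (LINT x|lborel. (Q x - P_st Q x) \<bullet> D x)"
    by (intro Bochner_Integration.integral_diff L2_inner_integrable DL) (simp_all add: L2_diff QL NL PL)
  also have "\<dots> = 0" using orth[OF D] ex D by simp
  finally have "(LINT x|lborel. D x \<bullet> D x) = 0" .
  then have "AE x in lborel. D x \<bullet> D x = 0"
    by (subst (asm) integral_nonneg_eq_0_iff_AE[OF L2_inner_integrable[OF DL DL]]) auto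
  then have PN: "AE x in lborel. N x = P_st Q x" by (auto simp: D_def elim!: eventually_mono)
  show ?thesis
    unfolding mhas_ft_def
  proof (intro allI)
    fix i j
    show "has_ft (\<lambda>x. P_st Q x $ i $ j) (\<lambda>\<xi>. st_symbol G \<xi> $ i $ j)"
      by (rule has_ft_cong_AE_left[of "\<lambda>x. N x $ i $ j"])
        (use N PN PL L2_iff in \<open>auto simp: mhas_ft_def elim!: eventually_mono\<close>)
  qed
qed

section \<open>Velocity and matrix potential\<close>

lemma h1_sq_sum:
  assumes [measurable]: "g \<in> borel_measurable borel"
  shows "h1_sq g = sqint lborel g + (\<integral>\<^sup>+\<xi>. ennreal (lap \<xi> * (norm (g \<xi>))\<^sup>2) \<partial>lborel)"
proof -
  have "h1_sq g = (\<integral>\<^sup>+\<xi>. ennreal ((norm (g \<xi>))\<^sup>2) + ennreal (lap \<xi> * (norm (g \<xi>))\<^sup>2) \<partial>lborel)"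
    unfolding h1_sq_def lap_def by (intro nn_integral_cong) (simp add: distrib_right flip: ennreal_plus)
  then show ?thesis unfolding sqint_def by (simp add: nn_integral_add)
qed

lemma lap_powr_1: "lap \<xi> powr 1 = lap \<xi>"
  by simp

lemma lap_powr_2: "lap \<xi> powr 2 = (lap \<xi>)\<^sup>2"
  by (cases "lap \<xi> = 0") (simp_all add: powr_numeral less_le)

lemma hdot_sq_lap: "has_ft f g \<Longrightarrow> hdot_sq s f = (\<integral>\<^sup>+\<xi>. ennreal (lap \<xi> powr s * (norm (g \<xi>))\<^sup>2) \<partial>lborel)"
  unfolding lap_def by (rule hdot_sq_eq)

lemma vh1_sq_ft:
  assumes "vhas_ft u U" shows "vh1_sq u = (\<Sum>j\<in>UNIV. h1_sq (\<lambda>\<xi>. U \<xi> $ j))"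
  unfolding vh1_sq_def
proof (rule sum.cong[OF refl])
  fix j
  have f: "has_ft (\<lambda>x. u x $ j) (\<lambda>\<xi>. U \<xi> $ j)" using assms vhas_ft_def by blast
  show "l2_sq (\<lambda>x. u x $ j) + hdot_sq 1 (\<lambda>x. u x $ j) = h1_sq (\<lambda>\<xi>. U \<xi> $ j)"
    unfolding h1_sq_sum[OF has_ft_measurable(2)[OF f]] l2_sq_ft[OF f] hdot_sq_lap[OF f] by simp
qed

lemma mhdot_sq_ft:
  assumes "mhas_ft M G"
  shows "mhdot_sq s M = (\<Sum>p\<in>UNIV. \<integral>\<^sup>+\<xi>. ennreal (lap \<xi> powr s * (norm (G \<xi> $ fst p $ snd p))\<^sup>2) \<partial>lborel)"
proof -
  have "mhdot_sq s M = (\<Sum>i\<in>UNIV. \<Sum>j\<in>UNIV. \<integral>\<^sup>+\<xi>. ennreal (lap \<xi> powr s * (norm (G \<xi> $ i $ j))\<^sup>2) \<partial>lborel)"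
    unfolding mhdot_sq_def
    by (intro sum.cong refl hdot_sq_lap) (use assms mhas_ft_def in blast)
  then show ?thesis
    by (simp add: sum.cartesian_product UNIV_Times_UNIV[symmetric] case_prod_beta del: UNIV_Times_UNIV)
qed

text \<open>A divergence costs one factor \<open>lap \<xi>\<close> in the square, and (1 + lap) lap
  = lap + lap^2 is the sum of the weights of orders 1 and 2. The constant is 9 for Cauchy-Schwarz
  times 3 components. Arbitrary transforms \<open>G\<close> and \<open>U\<close> are allowed so that
  differences between two times are covered.\<close>

lemma velocity_bound:
  assumes G: "mhas_ft M G" and U: "vhas_ft u U" and eq: "AE \<xi> in lborel. U \<xi> = - mdiv G \<xi>"
  shows "vh1_sq u \<le> 27 * (mhdot_sq 1 M + mhdot_sq 2 M)"
proof -
  note [measurable] = mhas_ft_measurable[OF G]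
  have "h1_sq (\<lambda>\<xi>. U \<xi> $ j) \<le> 9 * (mhdot_sq 1 M + mhdot_sq 2 M)" for j
  proof -
    have "h1_sq (\<lambda>\<xi>. U \<xi> $ j) \<le> ennreal 9 * (\<Sum>p\<in>UNIV. \<integral>\<^sup>+\<xi>. ennreal (lap \<xi> powr 1 * (norm (G \<xi> $ fst p $ snd p))\<^sup>2 + lap \<xi> powr 2 * (norm (G \<xi> $ fst p $ snd p))\<^sup>2) \<partial>lborel)"
      unfolding h1_sq_def lap_def[symmetric]
    proof (rule nn_integral_weight_bound)
      show "AE \<xi> in lborel. (1 + lap \<xi>) * (norm (U \<xi> $ j))\<^sup>2 \<le> 9 * (\<Sum>p\<in>UNIV. lap \<xi> powr 1 * (norm (G \<xi> $ fst p $ snd p))\<^sup>2 + lap \<xi> powr 2 * (norm (G \<xi> $ fst p $ snd p))\<^sup>2)"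
        using eq
      proof eventually_elim
        case (elim \<xi>)
        let ?S = "\<Sum>k\<in>UNIV. \<Sum>l\<in>UNIV. norm (G \<xi> $ k $ l)"
        let ?T = "\<Sum>p\<in>UNIV. (norm (G \<xi> $ fst p $ snd p))\<^sup>2"
        have "norm (U \<xi> $ j) \<le> sqrt (lap \<xi>) * (\<Sum>i\<in>UNIV. norm (G \<xi> $ i $ j))"
          using norm_mdiv_le[of G \<xi> j] by (simp add: elim)
        also have "\<dots> \<le> sqrt (lap \<xi>) * ?S"
          by (intro mult_left_mono sum_mono norm_component_le_sum) simp
        finally have "(norm (U \<xi> $ j))\<^sup>2 \<le> (sqrt (lap \<xi>) * ?S)\<^sup>2" by (intro power_mono) auto
        also have "\<dots> = lap \<xi> * ?S\<^sup>2" by (simp add: power_mult_distrib)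
        also have "\<dots> \<le> lap \<xi> * (9 * ?T)" by (intro mult_left_mono sum_norm_square_le) simp
        finally have "(1 + lap \<xi>) * (norm (U \<xi> $ j))\<^sup>2 \<le> (1 + lap \<xi>) * (lap \<xi> * (9 * ?T))"
          by (intro mult_left_mono) auto
        also have "\<dots> = 9 * (\<Sum>p\<in>UNIV. lap \<xi> powr 1 * (norm (G \<xi> $ fst p $ snd p))\<^sup>2 + lap \<xi> powr 2 * (norm (G \<xi> $ fst p $ snd p))\<^sup>2)"
          unfolding lap_powr_1 lap_powr_2
          by (simp add: sum.distrib sum_distrib_left[symmetric] power2_eq_square algebra_simps)
        finally show ?case .
      qed
    qed auto
    also have "(\<Sum>p\<in>UNIV. \<integral>\<^sup>+\<xi>. ennreal (lap \<xi> powr 1 * (norm (G \<xi> $ fst p $ snd p))\<^sup>2 + lap \<xi> powr 2 * (norm (G \<xi> $ fst p $ snd p))\<^sup>2) \<partial>lborel)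
       = mhdot_sq 1 M + mhdot_sq 2 M"
      unfolding mhdot_sq_ft[OF G] sum.distrib[symmetric]
      by (intro sum.cong refl) (subst nn_integral_add[symmetric], auto simp flip: ennreal_plus)
    finally show ?thesis by simp
  qed
  then have "vh1_sq u \<le> (\<Sum>j\<in>(UNIV::3 set). 9 * (mhdot_sq 1 M + mhdot_sq 2 M))"
    unfolding vh1_sq_ft[OF U] by (intro sum_mono)
  also have "\<dots> = 27 * (mhdot_sq 1 M + mhdot_sq 2 M)" by (simp flip: mult.assoc)
  finally show ?thesis .
qed

lemma norm_potential_le:
  assumes "\<xi> \<noteq> 0"
  shows "norm ((2 *\<^sub>R sym_grad (laplace_pow (- 1) U) \<xi>) $ i $ j) \<le> (norm (U \<xi> $ i) + norm (U \<xi> $ j)) / sqrt (lap \<xi>)"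
proof -
  have "norm ((2 *\<^sub>R sym_grad (laplace_pow (- 1) U) \<xi>) $ i $ j) = 2 / lap \<xi> * norm (sym_grad U \<xi> $ i $ j)"
    unfolding sym_grad_minus_one by simp
  also have "\<dots> \<le> 2 / lap \<xi> * (sqrt (lap \<xi>) * ((norm (U \<xi> $ i) + norm (U \<xi> $ j)) / 2))"
    by (intro mult_left_mono norm_sym_grad_le) simp
  also have "\<dots> = (norm (U \<xi> $ i) + norm (U \<xi> $ j)) * (sqrt (lap \<xi>) / lap \<xi>)" by (simp add: algebra_simps)
  also have "sqrt (lap \<xi>) / lap \<xi> = 1 / sqrt (lap \<xi>)" using lap_pos[OF assms] by (simp add: real_div_sqrt field_simps)
  finally show ?thesis by simp
qed

lemma potential_square_le:
  assumes "\<xi> \<noteq> 0"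
  shows "lap \<xi> * (norm ((2 *\<^sub>R sym_grad (laplace_pow (- 1) U) \<xi>) $ i $ j))\<^sup>2 \<le> 4 * (\<Sum>k\<in>UNIV. (norm (U \<xi> $ k))\<^sup>2)"
proof -
  let ?T = "\<Sum>k\<in>UNIV. (norm (U \<xi> $ k))\<^sup>2"
  have "(norm ((2 *\<^sub>R sym_grad (laplace_pow (- 1) U) \<xi>) $ i $ j))\<^sup>2 \<le> ((norm (U \<xi> $ i) + norm (U \<xi> $ j)) / sqrt (lap \<xi>))\<^sup>2"
    by (intro power_mono norm_potential_le assms) simp
  also have "\<dots> = (norm (U \<xi> $ i) + norm (U \<xi> $ j))\<^sup>2 / lap \<xi>" by (simp add: power_divide)
  finally have "lap \<xi> * (norm ((2 *\<^sub>R sym_grad (laplace_pow (- 1) U) \<xi>) $ i $ j))\<^sup>2 \<le> (norm (U \<xi> $ i) + norm (U \<xi> $ j))\<^sup>2"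
    using lap_pos[OF assms] by (simp add: field_simps)
  also have "\<dots> \<le> 2 * (norm (U \<xi> $ i))\<^sup>2 + 2 * (norm (U \<xi> $ j))\<^sup>2" by (rule sum_sq_le)
  also have "\<dots> \<le> 2 * ?T + 2 * ?T" by (intro add_mono mult_left_mono member_le_sum) auto
  finally show ?thesis by simp
qed

text \<open>The potential gains one order, so \<open>lap\<close> times its square is bounded by the
  square of the velocity; both lap and lap^2 are at most (1 + lap) lap. The constant is 4 for each
  of the 9 entries.\<close>

lemma potential_bound:
  assumes G: "mhas_ft M G" and U: "vhas_ft u U"
    and eq: "AE \<xi> in lborel. G \<xi> = 2 *\<^sub>R sym_grad (laplace_pow (- 1) U) \<xi>" and s: "s = 1 \<or> s = 2"
  shows "mhdot_sq s M \<le> 36 * vh1_sq u"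
proof -
  note [measurable] = vhas_ft_measurable[OF U]
  have "(\<integral>\<^sup>+\<xi>. ennreal (lap \<xi> powr s * (norm (G \<xi> $ fst p $ snd p))\<^sup>2) \<partial>lborel) \<le> ennreal 4 * (\<Sum>k\<in>UNIV. \<integral>\<^sup>+\<xi>. ennreal ((1 + lap \<xi>) * (norm (U \<xi> $ k))\<^sup>2) \<partial>lborel)" for p
  proof (rule nn_integral_weight_bound)
    show "AE \<xi> in lborel. lap \<xi> powr s * (norm (G \<xi> $ fst p $ snd p))\<^sup>2 \<le> 4 * (\<Sum>k\<in>UNIV. (1 + lap \<xi>) * (norm (U \<xi> $ k))\<^sup>2)"
      using eq AE_nonzero
    proof eventually_elim
      case (elim \<xi>)
      let ?T = "\<Sum>k\<in>UNIV. (norm (U \<xi> $ k))\<^sup>2"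
      have b: "lap \<xi> * (norm (G \<xi> $ fst p $ snd p))\<^sup>2 \<le> 4 * ?T"
        unfolding elim(1) by (rule potential_square_le[OF elim(2)])
      have "lap \<xi> powr s * (norm (G \<xi> $ fst p $ snd p))\<^sup>2 \<le> (1 + lap \<xi>) * (lap \<xi> * (norm (G \<xi> $ fst p $ snd p))\<^sup>2)"
        using s by (auto simp: lap_powr_2 power2_eq_square algebra_simps)
      also have "\<dots> \<le> (1 + lap \<xi>) * (4 * ?T)" by (intro mult_left_mono b) simp
      also have "\<dots> = 4 * (\<Sum>k\<in>UNIV. (1 + lap \<xi>) * (norm (U \<xi> $ k))\<^sup>2)" by (simp add: sum_distrib_left mult_ac)
      finally show ?case .
    qed
  qed auto
  then have "mhdot_sq s M \<le> (\<Sum>p\<in>(UNIV::(3\<times>3) set). 4 * vh1_sq u)"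
    unfolding mhdot_sq_ft[OF G] vh1_sq_ft[OF U] h1_sq_def lap_def[symmetric] by (intro sum_mono) simp
  also have "\<dots> = 36 * vh1_sq u" by (simp flip: mult.assoc)
  finally show ?thesis .
qed

text \<open>\<open>M\<close> arises from \<open>w\<close> by a multiplier of order zero, which
  passes on the norm. Its divergence is -1/2 (-Delta)^(1/2) w, divergence free along with
  \<open>w\<close>.\<close>

lemma Hdot_st_1_D:
  assumes "M \<in> Hdot_st 1"
  shows "mhas_ft M (mft M)" "mhdot_sq 1 M < \<infinity>" "AE \<xi> in lborel. vdiv (mdiv (mft M)) \<xi> = 0"
proof -
  obtain w where w: "\<And>j. (\<lambda>x. w x $ j) \<in> Hdot 1" "AE \<xi> in lborel. vdiv (vft w) \<xi> = 0"
    "mhas_ft M (sym_grad (laplace_pow (- 1/2) (vft w)))" using assms unfolding Hdot_st_def by blast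
  show ft: "mhas_ft M (mft M)" using mhas_ft_mft[OF w(3)] .
  note eq = mft_AE[OF w(3)]
  have vw: "vhas_ft w (vft w)"
    unfolding vhas_ft_def vft_def vec_lambda_beta using Hdot_1_D[OF w(1)] has_ft_ft by meson
  have wfin: "hdot_sq 1 (\<lambda>x. w x $ j) < \<infinity>" for j using Hdot_1_D[OF w(1)] by blast
  note [measurable] = vhas_ft_measurable[OF vw]
  show "mhdot_sq 1 M < \<infinity>"
  proof -
    have "(\<integral>\<^sup>+\<xi>. ennreal (lap \<xi> powr 1 * (norm (mft M \<xi> $ fst p $ snd p))\<^sup>2) \<partial>lborel) \<le> ennreal 1 * (\<Sum>k\<in>UNIV. \<integral>\<^sup>+\<xi>. ennreal (lap \<xi> powr 1 * (norm (vft w \<xi> $ k))\<^sup>2) \<partial>lborel)" for p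
    proof (rule nn_integral_weight_bound)
      show "AE \<xi> in lborel. lap \<xi> powr 1 * (norm (mft M \<xi> $ fst p $ snd p))\<^sup>2 \<le> 1 * (\<Sum>k\<in>UNIV. lap \<xi> powr 1 * (norm (vft w \<xi> $ k))\<^sup>2)"
        using eq AE_nonzero
      proof eventually_elim
        case (elim \<xi>)
        obtain i j where p: "p = (i, j)" by (cases p)
        let ?W = "vft w \<xi>"
        have "norm (mft M \<xi> $ i $ j) = 1 / sqrt (lap \<xi>) * norm (sym_grad (vft w) \<xi> $ i $ j)"
          unfolding elim(1) sym_grad_minus_half by simp
        also have "\<dots> \<le> 1 / sqrt (lap \<xi>) * (sqrt (lap \<xi>) * ((norm (?W $ i) + norm (?W $ j)) / 2))"
          by (intro mult_left_mono norm_sym_grad_le) simp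
        also have "\<dots> = (norm (?W $ i) + norm (?W $ j)) / 2" using lap_pos[OF elim(2)] by simp
        finally have "(norm (mft M \<xi> $ i $ j))\<^sup>2 \<le> ((norm (?W $ i) + norm (?W $ j)) / 2)\<^sup>2" by (intro power_mono) auto
        also have "\<dots> \<le> (2 * (norm (?W $ i))\<^sup>2 + 2 * (norm (?W $ j))\<^sup>2) / 4"
          using sum_sq_le[of "norm (?W $ i)" "norm (?W $ j)"] by (simp add: power_divide)
        also have "\<dots> \<le> (2 * (\<Sum>k\<in>UNIV. (norm (?W $ k))\<^sup>2) + 2 * (\<Sum>k\<in>UNIV. (norm (?W $ k))\<^sup>2)) / 4"
          by (intro divide_right_mono add_mono mult_left_mono member_le_sum) auto
        finally have "(norm (mft M \<xi> $ i $ j))\<^sup>2 \<le> (\<Sum>k\<in>UNIV. (norm (?W $ k))\<^sup>2)" by simp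
        then show ?case unfolding p by (simp add: sum_distrib_left[symmetric] mult_left_mono)
      qed
    qed auto
    note bound = this
    have "(\<integral>\<^sup>+\<xi>. ennreal (lap \<xi> powr 1 * (norm (mft M \<xi> $ fst p $ snd p))\<^sup>2) \<partial>lborel) \<le> (\<Sum>k\<in>UNIV. hdot_sq 1 (\<lambda>x. w x $ k))" for p
    proof -
      have "hdot_sq 1 (\<lambda>x. w x $ k) = (\<integral>\<^sup>+\<xi>. ennreal (lap \<xi> powr 1 * (norm (vft w \<xi> $ k))\<^sup>2) \<partial>lborel)" for k
        by (rule hdot_sq_lap) (use vw vhas_ft_def in blast)
      then show ?thesis using bound[of p] by simp
    qed
    then have "mhdot_sq 1 M \<le> (\<Sum>p\<in>(UNIV::(3\<times>3) set). \<Sum>k\<in>UNIV. hdot_sq 1 (\<lambda>x. w x $ k))"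
      unfolding mhdot_sq_ft[OF ft] by (intro sum_mono)
    also have "\<dots> < \<infinity>" using wfin by (simp add: less_top[symmetric] ennreal_mult_eq_top_iff)
    finally show ?thesis .
  qed
  show "AE \<xi> in lborel. vdiv (mdiv (mft M)) \<xi> = 0"
    using eq w(2)
  proof eventually_elim
    case (elim \<xi>)
    have m: "mdiv (mft M) \<xi> $ j = - (complex_of_real (sqrt (lap \<xi>) / 2) * vft w \<xi> $ j)" for j
    proof -
      have "mdiv (mft M) \<xi> $ j = mdiv (\<lambda>\<xi>. (1 / sqrt (lap \<xi>)) *\<^sub>R sym_grad (vft w) \<xi>) \<xi> $ j"
        unfolding mdiv_nth elim(1) sym_grad_minus_half ..
      also have "\<dots> = (1 / sqrt (lap \<xi>)) *\<^sub>R mdiv (sym_grad (vft w)) \<xi> $ j" unfolding mdiv_scale by simp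
      also have "\<dots> = - (complex_of_real (1 / sqrt (lap \<xi>) * lap \<xi> / 2) * vft w \<xi> $ j)"
        unfolding mdiv_sym_grad elim(2) by (simp add: scaleR_conv_of_real)
      also have "1 / sqrt (lap \<xi>) * lap \<xi> / 2 = sqrt (lap \<xi>) / 2" by (simp add: real_div_sqrt)
      finally show ?thesis .
    qed
    have "vdiv (mdiv (mft M)) \<xi> = - (complex_of_real (sqrt (lap \<xi>) / 2) * vdiv (vft w) \<xi>)"
      unfolding vdiv_def m by (simp add: sum_distrib_left sum_negf mult_ac)
    then show ?case using elim(2) by simp
  qed
qed

lemma h1_sq_sqint_le: "sqint lborel g \<le> h1_sq g"
  unfolding sqint_def h1_sq_def by (intro nn_integral_mono ennreal_leI) (simp add: distrib_right)

lemma h1_sq_le_vh1_sq: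
  assumes "vhas_ft u U" shows "h1_sq (\<lambda>\<xi>. U \<xi> $ j) \<le> vh1_sq u"
  unfolding vh1_sq_ft[OF assms] by (rule member_le_sum) auto

section \<open>From potential to velocity and back\<close>

lemma velocity_exists:
  assumes "M \<in> Hdot12_st" shows "\<exists>u. is_velocity_of u M"
proof -
  have M: "M \<in> Hdot_st 1" "mhdot_sq 2 M < \<infinity>" using assms unfolding Hdot12_st_def by auto
  note ft = Hdot_st_1_D(1)[OF M(1)]
  note [measurable] = mhas_ft_measurable[OF ft]
  have "\<exists>f. has_ft f (\<lambda>\<xi>. (- mdiv (mft M) \<xi>) $ j)" for j
  proof (rule real_L2_exists)
    show "(\<lambda>\<xi>. (- mdiv (mft M) \<xi>) $ j) \<in> borel_measurable borel" unfolding vector_uminus_component by measurable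
    have "hermitian (\<lambda>\<xi>. complex_of_real (-1) * mdiv (mft M) \<xi> $ j)"
      using ft unfolding mhas_ft_def by (intro hermitian_mult hermitian_even hermitian_mdiv has_ft_hermitian) auto
    then show "hermitian (\<lambda>\<xi>. (- mdiv (mft M) \<xi>) $ j)" by simp
    have "(\<integral>\<^sup>+\<xi>. ennreal ((norm ((- mdiv (mft M) \<xi>) $ j))\<^sup>2) \<partial>lborel) \<le> ennreal 9 * (\<Sum>p\<in>UNIV. \<integral>\<^sup>+\<xi>. ennreal (lap \<xi> powr 1 * (norm (mft M \<xi> $ fst p $ snd p))\<^sup>2) \<partial>lborel)"
    proof (rule nn_integral_weight_bound)
      show "AE \<xi> in lborel. (norm ((- mdiv (mft M) \<xi>) $ j))\<^sup>2 \<le> 9 * (\<Sum>p\<in>UNIV. lap \<xi> powr 1 * (norm (mft M \<xi> $ fst p $ snd p))\<^sup>2)"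
      proof (intro AE_I2)
        fix \<xi>
        let ?G = "mft M"
        have "norm ((- mdiv ?G \<xi>) $ j) \<le> sqrt (lap \<xi>) * (\<Sum>i\<in>UNIV. norm (?G \<xi> $ i $ j))"
          using norm_mdiv_le[of ?G \<xi> j] by simp
        also have "\<dots> \<le> sqrt (lap \<xi>) * (\<Sum>k\<in>UNIV. \<Sum>l\<in>UNIV. norm (?G \<xi> $ k $ l))"
          by (intro mult_left_mono sum_mono norm_component_le_sum) simp
        finally have "(norm ((- mdiv ?G \<xi>) $ j))\<^sup>2 \<le> (sqrt (lap \<xi>) * (\<Sum>k\<in>UNIV. \<Sum>l\<in>UNIV. norm (?G \<xi> $ k $ l)))\<^sup>2" by (intro power_mono) auto
        also have "\<dots> = lap \<xi> * (\<Sum>k\<in>UNIV. \<Sum>l\<in>UNIV. norm (?G \<xi> $ k $ l))\<^sup>2" by (simp add: power_mult_distrib)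
        also have "\<dots> \<le> lap \<xi> * (9 * (\<Sum>p\<in>UNIV. (norm (?G \<xi> $ fst p $ snd p))\<^sup>2))"
          by (intro mult_left_mono sum_norm_square_le) simp
        finally show "(norm ((- mdiv (mft M) \<xi>) $ j))\<^sup>2 \<le> 9 * (\<Sum>p\<in>UNIV. lap \<xi> powr 1 * (norm (mft M \<xi> $ fst p $ snd p))\<^sup>2)"
          by (simp add: sum_distrib_left mult_ac)
      qed
    qed auto
    also have "\<dots> < \<infinity>"
      using Hdot_st_1_D(2)[OF M(1)] unfolding mhdot_sq_ft[OF ft, symmetric] by (simp add: ennreal_mult_less_top)
    finally show "sqint lborel (\<lambda>\<xi>. (- mdiv (mft M) \<xi>) $ j) < \<infinity>" unfolding sqint_def .
  qed
  then obtain u where "vhas_ft u (\<lambda>\<xi>. - mdiv (mft M) \<xi>)" using vhas_ft_exists[of "\<lambda>\<xi>. - mdiv (mft M) \<xi>"] by blast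
  then show ?thesis unfolding is_velocity_of_def using ft by blast
qed

lemma velocity_in_H1_df:
  assumes "M \<in> Hdot12_st" "is_velocity_of u M" shows "u \<in> H1_df"
proof -
  have M: "M \<in> Hdot_st 1" "mhdot_sq 2 M < \<infinity>" using assms(1) unfolding Hdot12_st_def by auto
  note ft = Hdot_st_1_D(1)[OF M(1)]
  have u: "vhas_ft u (\<lambda>\<xi>. - mdiv (mft M) \<xi>)" using assms(2) unfolding is_velocity_of_def by blast
  have fin: "vh1_sq u < \<infinity>"
  proof -
    have "vh1_sq u \<le> 27 * (mhdot_sq 1 M + mhdot_sq 2 M)" by (rule velocity_bound[OF ft u]) simp
    also have "\<dots> < \<infinity>" using M(2) Hdot_st_1_D(2)[OF M(1)] by (simp add: ennreal_mult_less_top)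
    finally show ?thesis .
  qed
  have "(\<lambda>x. u x $ j) \<in> L2" for j
  proof -
    have "has_ft (\<lambda>x. u x $ j) (\<lambda>\<xi>. (- mdiv (mft M) \<xi>) $ j)" using u unfolding vhas_ft_def by blast
    moreover have "sqint lborel (\<lambda>\<xi>. (- mdiv (mft M) \<xi>) $ j) < \<infinity>"
      using h1_sq_sqint_le h1_sq_le_vh1_sq[OF u] fin by (meson order.strict_trans1)
    ultimately show ?thesis using L2_ft_iff by blast
  qed
  moreover have "AE \<xi> in lborel. vdiv (vft u) \<xi> = 0"
    using vft_AE[OF u] Hdot_st_1_D(3)[OF M(1)]
  proof eventually_elim
    case (elim \<xi>)
    have "vdiv (vft u) \<xi> = - vdiv (mdiv (mft M)) \<xi>" unfolding vdiv_def elim(1) by (simp add: sum_negf)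
    then show ?case using elim(2) by simp
  qed
  ultimately show ?thesis unfolding H1_df_def using fin by blast
qed

lemma H1_df_D:
  assumes "u \<in> H1_df"
  shows "vhas_ft u (vft u)" "vh1_sq u < \<infinity>" "AE \<xi> in lborel. vdiv (vft u) \<xi> = 0"
    "sqint lborel (\<lambda>\<xi>. vft u \<xi> $ j) < \<infinity>" "(\<lambda>x. u x $ j) \<in> L2"
proof -
  have L: "(\<lambda>x. u x $ j) \<in> L2" for j using assms H1_df_def by blast
  show v: "vhas_ft u (vft u)"
    unfolding vhas_ft_def vft_def vec_lambda_beta using L2_has_ft[OF L] has_ft_ft by meson
  show "vh1_sq u < \<infinity>" "AE \<xi> in lborel. vdiv (vft u) \<xi> = 0" using assms H1_df_def by blast+
  show "(\<lambda>x. u x $ j) \<in> L2" by (rule L)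
  show "sqint lborel (\<lambda>\<xi>. vft u \<xi> $ j) < \<infinity>" using v L L2_ft_iff unfolding vhas_ft_def by blast
qed

lemma potential_exists:
  assumes "u \<in> H1_df" shows "\<exists>M. is_potential_of M u"
proof -
  note u = H1_df_D[OF assms]
  note [measurable] = vhas_ft_measurable[OF u(1)]
  have ft: "has_ft (\<lambda>x. u x $ j) (\<lambda>\<xi>. vft u \<xi> $ j)" for j using u(1) vhas_ft_def by blast
  let ?G = "\<lambda>\<xi>. 2 *\<^sub>R sym_grad (laplace_pow (- 1) (vft u)) \<xi>"
  have "\<exists>f. has_ft f (\<lambda>\<xi>. ?G \<xi> $ i $ j)" for i j
  proof -
    \<comment> \<open>Moduli are added, so that no cancellation between the two components can spoil
      the majorant.\<close>
    let ?H = "\<lambda>\<xi>. complex_of_real (norm (vft u \<xi> $ i)) + complex_of_real (norm (vft u \<xi> $ j))"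
    have "\<exists>f. cft f (\<lambda>\<xi>. ?G \<xi> $ i $ j)"
    proof (rule cft_order_minus_one_exists)
      show "?H \<in> borel_measurable borel" by measurable
      show "sqint lborel ?H < \<infinity>"
        by (rule sqint_add_finite(1)) (use u(4) in \<open>auto simp: sqint_def\<close>)
      show "(\<lambda>\<xi>. ?G \<xi> $ i $ j) \<in> borel_measurable borel"
        unfolding sym_grad_minus_one vector_scaleR_component by (intro borel_measurable_scaleR sym_grad_borel) auto
      show "AE \<xi> in lborel. norm (?G \<xi> $ i $ j) \<le> (1 / (2 * pi)) * norm (?H \<xi>) / norm \<xi>"
        using AE_nonzero
      proof eventually_elim
        case (elim \<xi>)
        have "norm (?H \<xi>) = norm (vft u \<xi> $ i) + norm (vft u \<xi> $ j)"
          by (simp flip: of_real_add)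
        then show ?case using norm_potential_le[OF elim, of "vft u" i j] unfolding sqrt_lap by simp
      qed
    qed
    moreover have "hermitian (\<lambda>\<xi>. ?G \<xi> $ i $ j)"
      unfolding sym_grad_minus_one vector_scaleR_component
      by (intro hermitian_scaleR_even hermitian_sym_grad has_ft_hermitian[OF ft]) auto
    ultimately show ?thesis using has_ft_of_hermitian by blast
  qed
  then obtain M where "mhas_ft M ?G" using mhas_ft_exists[of ?G] by blast
  then show ?thesis unfolding is_potential_of_def using u(1) by blast
qed

lemma potential_in_Hdot12_st:
  assumes "u \<in> H1_df" "is_potential_of M u" shows "M \<in> Hdot12_st"
proof -
  note u = H1_df_D[OF assms(1)]
  note [measurable] = vhas_ft_measurable[OF u(1)]
  have ft: "has_ft (\<lambda>x. u x $ j) (\<lambda>\<xi>. vft u \<xi> $ j)" for j using u(1) vhas_ft_def by blast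
  have M: "mhas_ft M (\<lambda>\<xi>. 2 *\<^sub>R sym_grad (laplace_pow (- 1) (vft u)) \<xi>)" using assms(2) unfolding is_potential_of_def by blast
  have "mhdot_sq 2 M \<le> 36 * vh1_sq u" by (rule potential_bound[OF M u(1)]) auto
  also have "\<dots> < \<infinity>" using u(2) by (simp add: ennreal_mult_less_top)
  finally have fin2: "mhdot_sq 2 M < \<infinity>" .
  have sym: "symmetric_valued M"
    by (rule symmetric_valued_of_ft[OF M]) (simp add: transpose_def vec_eq_iff sym_grad_nth add.commute)
  \<comment> \<open>The generator required by \<open>Hdot_st\<close>: w = 2 (-Delta)^(-1/2) u. It
    has order -1 in \<open>u\<close>, so its existence rests on integrability near the origin, while
    its homogeneous norm of order 1 is an L2 norm of \<open>u\<close>.\<close>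
  define W where "W \<xi> = (2 / sqrt (lap \<xi>)) *\<^sub>R vft u \<xi>" for \<xi>
  have Wm[measurable]: "(\<lambda>\<xi>. W \<xi> $ j) \<in> borel_measurable borel" for j
    unfolding W_def vector_scaleR_component by measurable
  have "\<exists>f. has_ft f (\<lambda>\<xi>. W \<xi> $ j)" for j
  proof -
    have "\<exists>f. cft f (\<lambda>\<xi>. W \<xi> $ j)"
    proof (rule cft_order_minus_one_exists)
      show "AE \<xi> in lborel. norm (W \<xi> $ j) \<le> (1 / pi) * norm (vft u \<xi> $ j) / norm \<xi>"
        by (simp add: W_def sqrt_lap)
    qed (use u(4) in auto)
    moreover have "hermitian (\<lambda>\<xi>. W \<xi> $ j)"
      unfolding W_def vector_scaleR_component by (intro hermitian_scaleR_even has_ft_hermitian[OF ft]) simp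
    ultimately show ?thesis using has_ft_of_hermitian by blast
  qed
  then obtain w where w: "vhas_ft w W" using vhas_ft_exists[of W] by blast
  have wH: "(\<lambda>x. w x $ j) \<in> Hdot 1" for j
  proof (rule Hdot_1_I)
    show f: "has_ft (\<lambda>x. w x $ j) (\<lambda>\<xi>. W \<xi> $ j)" using w vhas_ft_def by blast
    have "hdot_sq 1 (\<lambda>x. w x $ j) = (\<integral>\<^sup>+\<xi>. ennreal (lap \<xi> powr 1 * (norm (W \<xi> $ j))\<^sup>2) \<partial>lborel)" by (rule hdot_sq_lap[OF f])
    also have "\<dots> \<le> (\<integral>\<^sup>+\<xi>. 4 * ennreal ((norm (vft u \<xi> $ j))\<^sup>2) \<partial>lborel)"
    proof (intro nn_integral_mono)
      fix \<xi>
      have "lap \<xi> powr 1 * (norm (W \<xi> $ j))\<^sup>2 \<le> 4 * (norm (vft u \<xi> $ j))\<^sup>2"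
        unfolding W_def by (cases "lap \<xi> = 0") (simp_all add: power_mult_distrib power_divide)
      then have "ennreal (lap \<xi> powr 1 * (norm (W \<xi> $ j))\<^sup>2) \<le> ennreal (4 * (norm (vft u \<xi> $ j))\<^sup>2)"
        by (rule ennreal_leI)
      also have "\<dots> = 4 * ennreal ((norm (vft u \<xi> $ j))\<^sup>2)" by (subst ennreal_mult') simp_all
      finally show "ennreal (lap \<xi> powr 1 * (norm (W \<xi> $ j))\<^sup>2) \<le> 4 * ennreal ((norm (vft u \<xi> $ j))\<^sup>2)" .
    qed
    also have "\<dots> = 4 * sqint lborel (\<lambda>\<xi>. vft u \<xi> $ j)" unfolding sqint_def by (rule nn_integral_cmult) measurable
    also have "\<dots> < \<infinity>" using u(4) by (simp add: ennreal_mult_less_top)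
    finally show "hdot_sq 1 (\<lambda>x. w x $ j) < \<infinity>" .
  qed
  have wd: "AE \<xi> in lborel. vdiv (vft w) \<xi> = 0"
    using vft_AE[OF w] u(3)
  proof eventually_elim
    case (elim \<xi>)
    have "vdiv (vft w) \<xi> = vdiv W \<xi>" unfolding vdiv_def elim(1) ..
    also have "\<dots> = (2 / sqrt (lap \<xi>)) *\<^sub>R vdiv (vft u) \<xi>" unfolding W_def[abs_def] by (rule vdiv_scale)
    finally show ?case using elim(2) by simp
  qed
  have "mhas_ft M (sym_grad (laplace_pow (- 1/2) (vft w)))"
  proof (rule mhas_ft_cong_AE[OF M])
    show "AE \<xi> in lborel. 2 *\<^sub>R sym_grad (laplace_pow (- 1) (vft u)) \<xi> = sym_grad (laplace_pow (- 1/2) (vft w)) \<xi>"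
      using vft_AE[OF w] AE_nonzero
    proof eventually_elim
      case (elim \<xi>)
      have "sym_grad (laplace_pow (- 1/2) (vft w)) \<xi> = (1 / sqrt (lap \<xi>)) *\<^sub>R sym_grad W \<xi>"
        unfolding sym_grad_minus_half unfolding sym_grad_def elim(1) ..
      also have "sym_grad W \<xi> = (2 / sqrt (lap \<xi>)) *\<^sub>R sym_grad (vft u) \<xi>"
        unfolding W_def[abs_def] by (rule sym_grad_scale)
      finally show ?case unfolding sym_grad_minus_one using lap_pos[OF elim(2)] by simp
    qed
    show "(\<lambda>\<xi>. sym_grad (laplace_pow (- 1/2) (vft w)) \<xi> $ i $ j) \<in> borel_measurable borel" for i j
      unfolding sym_grad_minus_half vector_scaleR_component
      using vhas_ft_measurable[OF vhas_ft_vft[OF w]] by (intro borel_measurable_scaleR sym_grad_borel) auto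
  qed
  then show ?thesis unfolding Hdot12_st_def Hdot_st_def using sym wH wd fin2 by blast
qed

lemma velocity_of_potential:
  assumes "u \<in> H1_df" "is_potential_of M u" shows "is_velocity_of u M"
proof -
  note u = H1_df_D[OF assms(1)]
  have M: "mhas_ft M (\<lambda>\<xi>. 2 *\<^sub>R sym_grad (laplace_pow (- 1) (vft u)) \<xi>)" using assms(2) unfolding is_potential_of_def by blast
  note [measurable] = mhas_ft_measurable[OF mhas_ft_mft[OF M]]
  have "vhas_ft u (\<lambda>\<xi>. - mdiv (mft M) \<xi>)"
  proof (rule vhas_ft_cong_AE[OF u(1)])
    show "AE \<xi> in lborel. vft u \<xi> = - mdiv (mft M) \<xi>"
      using mft_AE[OF M] AE_nonzero u(3)
    proof eventually_elim
      case (elim \<xi>)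
      have "mdiv (mft M) \<xi> = mdiv (\<lambda>\<xi>. 2 *\<^sub>R sym_grad (laplace_pow (- 1) (vft u)) \<xi>) \<xi>"
        unfolding mdiv_def elim(1) ..
      then show ?case using mdiv_potential[OF elim(2,3)] by simp
    qed
    show "(\<lambda>\<xi>. (- mdiv (mft M) \<xi>) $ j) \<in> borel_measurable borel" for j
      unfolding vector_uminus_component by measurable
  qed
  then show ?thesis unfolding is_velocity_of_def using M by blast
qed

lemma has_ft_zero: "has_ft (\<lambda>x. 0) (\<lambda>\<xi>. 0)"
  by (simp add: has_ft_def)

lemma vhas_ft_uminus: "vhas_ft u U \<Longrightarrow> vhas_ft (\<lambda>x. - u x) (\<lambda>\<xi>. - U \<xi>)"
  using has_ft_diff[OF has_ft_zero] unfolding vhas_ft_def by fastforce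

section \<open>The quadratic term\<close>

text \<open>\<open>div_fun M\<close> is a choice, fixed only almost everywhere. Its sign is opposite
  to that of \<open>u\<close>, which the tensor square does not see.\<close>

lemma div_fun_AE:
  assumes "is_velocity_of u M"
  shows "AE x in lborel. div_fun M x = - u x" "(\<lambda>x. div_fun M x $ j) \<in> borel_measurable borel"
proof -
  have "vhas_ft (\<lambda>x. - u x) (mdiv (mft M))"
    using vhas_ft_uminus[of u "\<lambda>\<xi>. - mdiv (mft M) \<xi>"] assms unfolding is_velocity_of_def by simp
  then have 1: "vhas_ft (\<lambda>x. - u x) (mdiv (mft M))" "vhas_ft (div_fun M) (mdiv (mft M))"
    unfolding div_fun_def by (auto intro: someI[of "\<lambda>v. vhas_ft v (mdiv (mft M))"])
  have "AE x in lborel. \<forall>j. div_fun M x $ j = (- u x) $ j"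
    by (rule AE_all3) (use 1 has_ft_unique_left in \<open>unfold vhas_ft_def, blast\<close>)
  then show "AE x in lborel. div_fun M x = - u x" by (simp add: vec_eq_iff)
  show "(\<lambda>x. div_fun M x $ j) \<in> borel_measurable borel"
    using 1(2) has_ft_measurable(1) unfolding vhas_ft_def by blast
qed

lemma tensor_ft:
  assumes "u \<in> H1_df"
  obtains T where "mhas_ft (tensor_sq u) T"
    "\<And>i j. sqint lborel (\<lambda>\<xi>. T \<xi> $ i $ j) \<le> product_const * (vh1_sq u * vh1_sq u)"
proof -
  note u = H1_df_D[OF assms]
  define T :: "real^3 \<Rightarrow> complex^3^3" where "T \<xi> = (\<chi> i j. fourier (\<lambda>x. complex_of_real (u x $ i) * complex_of_real (u x $ j)) \<xi>)" for \<xi>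
  have c: "cft (\<lambda>x. complex_of_real (u x $ j)) (\<lambda>\<xi>. vft u \<xi> $ j)" for j using u(1) unfolding vhas_ft_def has_ft_cft by blast
  have f: "sqint lborel (\<lambda>x. complex_of_real (u x $ j)) < \<infinity>" for j using u(5)[of j] unfolding L2_iff by blast
  have "mhas_ft (tensor_sq u) T"
    unfolding mhas_ft_def has_ft_cft
  proof (intro allI)
    fix i j
    show "cft (\<lambda>x. complex_of_real (tensor_sq u x $ i $ j)) (\<lambda>\<xi>. T \<xi> $ i $ j)"
      using product_L2(1)[OF c c f f, of i j] by (simp add: tensor_sq_def T_def)
  qed
  moreover have "sqint lborel (\<lambda>\<xi>. T \<xi> $ i $ j) \<le> product_const * (vh1_sq u * vh1_sq u)" for i j
  proof -
    have "sqint lborel (\<lambda>\<xi>. T \<xi> $ i $ j) \<le> product_const * (h1_sq (\<lambda>\<xi>. vft u \<xi> $ i) * h1_sq (\<lambda>\<xi>. vft u \<xi> $ j))"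
      using product_L2(2)[OF c c f f, of i j] by (simp add: T_def)
    also have "\<dots> \<le> product_const * (vh1_sq u * vh1_sq u)"
      by (intro mult_left_mono mult_mono h1_sq_le_vh1_sq[OF u(1)]) auto
    finally show ?thesis .
  qed
  ultimately show ?thesis using that by blast
qed

lemma P_st_div_fun:
  assumes u: "u \<in> H1_df" and v: "is_velocity_of u M" and T: "mhas_ft (tensor_sq u) T"
  shows "mhas_ft (P_st (tensor_sq (div_fun M))) (st_symbol T)"
proof (rule P_st_ft)
  note d = div_fun_AE[OF v]
  note [measurable] = d(2)
  have m: "(\<lambda>x. tensor_sq (div_fun M) x $ i $ j) \<in> borel_measurable borel" for i j
    unfolding tensor_sq_def by simp
  show ft: "mhas_ft (tensor_sq (div_fun M)) T"
    unfolding mhas_ft_def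
  proof (intro allI)
    fix i j
    show "has_ft (\<lambda>x. tensor_sq (div_fun M) x $ i $ j) (\<lambda>\<xi>. T \<xi> $ i $ j)"
      by (rule has_ft_cong_AE_left[of "\<lambda>x. tensor_sq u x $ i $ j"])
        (use T d(1) m in \<open>auto simp: mhas_ft_def tensor_sq_def elim!: eventually_mono\<close>)
  qed
  \<comment> \<open>\<open>T\<close> is an arbitrary transform; the square integrability of the
    tensor is read off from this second one, which comes with a bound.\<close>
  obtain T' where T': "mhas_ft (tensor_sq u) T'"
    "\<And>i j. sqint lborel (\<lambda>\<xi>. T' \<xi> $ i $ j) \<le> product_const * (vh1_sq u * vh1_sq u)" using tensor_ft[OF u] by blast
  have "(\<lambda>x. tensor_sq (div_fun M) x $ i $ j) \<in> L2" for i j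
  proof -
    have "has_ft (\<lambda>x. tensor_sq (div_fun M) x $ i $ j) (\<lambda>\<xi>. T' \<xi> $ i $ j)"
      by (rule has_ft_cong_AE_left[of "\<lambda>x. tensor_sq u x $ i $ j"])
        (use T' d(1) m in \<open>auto simp: mhas_ft_def tensor_sq_def elim!: eventually_mono\<close>)
    moreover have "sqint lborel (\<lambda>\<xi>. T' \<xi> $ i $ j) < \<infinity>"
      by (rule order.strict_trans1[OF T'(2)])
        (use H1_df_D(2)[OF u] product_const_finite in \<open>simp add: ennreal_mult_less_top\<close>)
    ultimately show ?thesis using L2_ft_iff by blast
  qed
  then show "tensor_sq (div_fun M) \<in> L2_sym"
    unfolding L2_sym_def symmetric_valued_def
    by (auto simp: transpose_def tensor_sq_def vec_eq_iff mult.commute)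
qed

section \<open>Continuity in time\<close>

lemma tendsto_ennreal_bound:
  fixes f g :: "'a \<Rightarrow> ennreal"
  assumes "(g \<longlongrightarrow> 0) F" "c < \<top>" "\<forall>\<^sub>F x in F. f x \<le> c * g x" shows "(f \<longlongrightarrow> 0) F"
proof (rule tendsto_sandwich[OF _ assms(3) tendsto_const])
  show "((\<lambda>x. c * g x) \<longlongrightarrow> 0) F" using ennreal_tendsto_cmult[OF assms(2,1)] by simp
qed simp

lemma eventually_in_within: "(\<And>r. r \<in> S \<Longrightarrow> P r) \<Longrightarrow> \<forall>\<^sub>F r in at t within S. P r"
  by (simp add: eventually_at_filter)

lemma velocity_continuous:
  assumes M: "M \<in> C_Hdot12_st T" and v: "\<And>t. t \<in> time_interval T \<Longrightarrow> is_velocity_of (u t) (M t)"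
  shows "u \<in> C_H1_df T"
  unfolding C_H1_df_def
proof (intro CollectI ballI conjI)
  fix t assume t: "t \<in> time_interval T"
  have M12: "M r \<in> Hdot12_st" if "r \<in> time_interval T" for r using M that unfolding C_Hdot12_st_def by blast
  show "u t \<in> H1_df" using velocity_in_H1_df M12 v t by blast
  have "((\<lambda>r. mhdot_sq 1 (\<lambda>x. M r x - M t x) + mhdot_sq 2 (\<lambda>x. M r x - M t x)) \<longlongrightarrow> 0 + 0) (at t within time_interval T)"
    using M t unfolding C_Hdot12_st_def by (intro tendsto_add) auto
  then have lim: "((\<lambda>r. mhdot_sq 1 (\<lambda>x. M r x - M t x) + mhdot_sq 2 (\<lambda>x. M r x - M t x)) \<longlongrightarrow> 0) (at t within time_interval T)" by simp
  show "((\<lambda>r. vh1_sq (\<lambda>x. u r x - u t x)) \<longlongrightarrow> 0) (at t within time_interval T)"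
  proof (rule tendsto_ennreal_bound[OF lim, of 27])
    show "\<forall>\<^sub>F r in at t within time_interval T. vh1_sq (\<lambda>x. u r x - u t x) \<le> 27 * (mhdot_sq 1 (\<lambda>x. M r x - M t x) + mhdot_sq 2 (\<lambda>x. M r x - M t x))"
    proof (rule eventually_in_within)
      fix r assume r: "r \<in> time_interval T"
      have m: "mhas_ft (M s) (mft (M s))" if "s \<in> time_interval T" for s
        using M12[OF that] Hdot_st_1_D(1) unfolding Hdot12_st_def by blast
      have w: "vhas_ft (u s) (\<lambda>\<xi>. - mdiv (mft (M s)) \<xi>)" if "s \<in> time_interval T" for s
        using v[OF that] unfolding is_velocity_of_def by blast
      show "vh1_sq (\<lambda>x. u r x - u t x) \<le> 27 * (mhdot_sq 1 (\<lambda>x. M r x - M t x) + mhdot_sq 2 (\<lambda>x. M r x - M t x))"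
        by (rule velocity_bound[OF mhas_ft_diff[OF m[OF r] m[OF t]] vhas_ft_diff[OF w[OF r] w[OF t]]])
          (simp add: mdiv_def vec_eq_iff right_diff_distrib sum_subtractf)
    qed
  qed simp
qed

lemma potential_continuous:
  assumes u: "u \<in> C_H1_df T" and p: "\<And>t. t \<in> time_interval T \<Longrightarrow> is_potential_of (M t) (u t)"
  shows "M \<in> C_Hdot12_st T"
proof -
  have uH: "u r \<in> H1_df" if "r \<in> time_interval T" for r using u that unfolding C_H1_df_def by blast
  have "((\<lambda>r. mhdot_sq s (\<lambda>x. M r x - M t x)) \<longlongrightarrow> 0) (at t within time_interval T)"
    if t: "t \<in> time_interval T" and s: "s = 1 \<or> s = 2" for t s
  proof (rule tendsto_ennreal_bound[of "\<lambda>r. vh1_sq (\<lambda>x. u r x - u t x)" _ 36])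
    show "((\<lambda>r. vh1_sq (\<lambda>x. u r x - u t x)) \<longlongrightarrow> 0) (at t within time_interval T)"
      using u t unfolding C_H1_df_def by blast
    show "\<forall>\<^sub>F r in at t within time_interval T. mhdot_sq s (\<lambda>x. M r x - M t x) \<le> 36 * vh1_sq (\<lambda>x. u r x - u t x)"
    proof (rule eventually_in_within)
      fix r assume r: "r \<in> time_interval T"
      have m: "mhas_ft (M q) (\<lambda>\<xi>. 2 *\<^sub>R sym_grad (laplace_pow (- 1) (vft (u q))) \<xi>)" if "q \<in> time_interval T" for q
        using p[OF that] unfolding is_potential_of_def by blast
      show "mhdot_sq s (\<lambda>x. M r x - M t x) \<le> 36 * vh1_sq (\<lambda>x. u r x - u t x)"
      proof (rule potential_bound[OF mhas_ft_diff[OF m[OF r] m[OF t]] vhas_ft_diff[OF H1_df_D(1)[OF uH[OF r]] H1_df_D(1)[OF uH[OF t]]] _ s], intro AE_I2)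
        fix \<xi>
        have "sym_grad (\<lambda>\<xi>. vft (u r) \<xi> - vft (u t) \<xi>) \<xi> = sym_grad (vft (u r)) \<xi> - sym_grad (vft (u t)) \<xi>"
          by (simp add: vec_eq_iff sym_grad_nth algebra_simps diff_divide_distrib add_divide_distrib)
        then show "2 *\<^sub>R sym_grad (laplace_pow (- 1) (vft (u r))) \<xi> - 2 *\<^sub>R sym_grad (laplace_pow (- 1) (vft (u t))) \<xi> =
          2 *\<^sub>R sym_grad (laplace_pow (- 1) (\<lambda>\<xi>. vft (u r) \<xi> - vft (u t) \<xi>)) \<xi>"
          unfolding sym_grad_minus_one by (simp only: scaleR_diff_right)
      qed
    qed
  qed simp
  then show ?thesis
    unfolding C_Hdot12_st_def using potential_in_Hdot12_st uH p by blast
qed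

section \<open>Equivalence of the mild formulations\<close>

lemma schwartz_deriv_symbol:
  assumes "schwartz \<phi>" shows "schwartz (\<lambda>\<xi>. deriv_symbol j \<xi> * \<phi> \<xi>)"
proof -
  have "schwartz (\<lambda>\<xi>. (2 * complex_of_real pi * \<i>) * (complex_of_real (\<xi> $ j) * \<phi> \<xi>))"
    by (intro schwartz_cmul schwartz_coord assms)
  then show ?thesis by (simp add: deriv_symbol_def mult.assoc)
qed

lemma heat_eq: "heat t G \<xi> = exp (- (lap \<xi> * t)) *\<^sub>R G \<xi>"
  by (simp add: heat_def lap_def)

lemma mft_tensor:
  assumes "u \<in> H1_df"
  shows "mhas_ft (tensor_sq u) (mft (tensor_sq u))"
    "sqint lborel (\<lambda>\<xi>. mft (tensor_sq u) \<xi> $ i $ j) \<le> product_const * (vh1_sq u * vh1_sq u)"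
proof -
  obtain T where T: "mhas_ft (tensor_sq u) T"
    "\<And>i j. sqint lborel (\<lambda>\<xi>. T \<xi> $ i $ j) \<le> product_const * (vh1_sq u * vh1_sq u)" using tensor_ft[OF assms] by blast
  show "mhas_ft (tensor_sq u) (mft (tensor_sq u))" using mhas_ft_mft[OF T(1)] .
  have "sqint lborel (\<lambda>\<xi>. mft (tensor_sq u) \<xi> $ i $ j) = sqint lborel (\<lambda>\<xi>. T \<xi> $ i $ j)"
    by (rule sqint_cong_AE) (use mft_AE[OF T(1)] in \<open>auto elim!: eventually_mono\<close>)
  then show "sqint lborel (\<lambda>\<xi>. mft (tensor_sq u) \<xi> $ i $ j) \<le> product_const * (vh1_sq u * vh1_sq u)" using T(2) by simp
qed

text \<open>The condition of \<open>has_time_integral\<close> for one test function. Isolating it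
  allows the identity to be carried from one test function to another by multipliers and by
  limits.\<close>

definition time_pairing ::
    "(real \<Rightarrow> real^3 \<Rightarrow> complex) \<Rightarrow> real \<Rightarrow> (real^3 \<Rightarrow> complex) \<Rightarrow> (real^3 \<Rightarrow> complex) \<Rightarrow> bool"
  where "time_pairing F t I \<phi> \<longleftrightarrow>
     (\<forall>\<tau>\<in>{0..t}. integrable lborel (\<lambda>\<xi>. F \<tau> \<xi> * \<phi> \<xi>)) \<and>
     integrable lborel (\<lambda>\<xi>. I \<xi> * \<phi> \<xi>) \<and>
     set_integrable lborel {0..t} (\<lambda>\<tau>. LINT \<xi>|lborel. F \<tau> \<xi> * \<phi> \<xi>) \<and>
     (LINT \<tau>:{0..t}|lborel. (LINT \<xi>|lborel. F \<tau> \<xi> * \<phi> \<xi>)) = (LINT \<xi>|lborel. I \<xi> * \<phi> \<xi>)"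

lemma has_time_integral_iff: "has_time_integral F t I \<longleftrightarrow> (\<forall>\<phi>. schwartz \<phi> \<longrightarrow> time_pairing F t I \<phi>)"
  unfolding has_time_integral_def time_pairing_def ..

text \<open>A multiplier may be shifted from the integrand to the test function, and finitely many
  such terms added. The identities hold only almost everywhere in frequency, hence the separate
  measurability assumptions.\<close>

lemma time_pairing_combination:
  assumes A: "finite A" and p: "\<And>a. a \<in> A \<Longrightarrow> time_pairing (F a) t (I a) (\<phi> a)"
    and V: "\<And>\<tau>. \<tau> \<in> {0..t} \<Longrightarrow> AE \<xi> in lborel. V \<tau> \<xi> * \<psi> \<xi> = (\<Sum>a\<in>A. F a \<tau> \<xi> * \<phi> a \<xi>)"
    and Vm: "\<And>\<tau>. \<tau> \<in> {0..t} \<Longrightarrow> (\<lambda>\<xi>. V \<tau> \<xi> * \<psi> \<xi>) \<in> borel_measurable borel"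
    and J: "AE \<xi> in lborel. J \<xi> * \<psi> \<xi> = (\<Sum>a\<in>A. I a \<xi> * \<phi> a \<xi>)"
    and Jm: "(\<lambda>\<xi>. J \<xi> * \<psi> \<xi>) \<in> borel_measurable borel"
  shows "time_pairing V t J \<psi>"
proof -
  have i1: "integrable lborel (\<lambda>\<xi>. F a \<tau> \<xi> * \<phi> a \<xi>)" if "a \<in> A" "\<tau> \<in> {0..t}" for a \<tau>
    using p[OF that(1)] that(2) unfolding time_pairing_def by blast
  have i2: "integrable lborel (\<lambda>\<xi>. I a \<xi> * \<phi> a \<xi>)"
    and i3: "integrable lborel (\<lambda>\<tau>. indicator {0..t} \<tau> *\<^sub>R (LINT \<xi>|lborel. F a \<tau> \<xi> * \<phi> a \<xi>))"
    and e: "(LINT \<tau>:{0..t}|lborel. (LINT \<xi>|lborel. F a \<tau> \<xi> * \<phi> a \<xi>)) = (LINT \<xi>|lborel. I a \<xi> * \<phi> a \<xi>)" if "a \<in> A" for a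
    using p[OF that] unfolding time_pairing_def set_integrable_def by blast+
  have s1: "integrable lborel (\<lambda>\<xi>. \<Sum>a\<in>A. F a \<tau> \<xi> * \<phi> a \<xi>)" if "\<tau> \<in> {0..t}" for \<tau>
    by (intro Bochner_Integration.integrable_sum i1 that)
  have v1: "integrable lborel (\<lambda>\<xi>. V \<tau> \<xi> * \<psi> \<xi>)" if t: "\<tau> \<in> {0..t}" for \<tau>
    by (rule integrable_cong_AE_imp[OF s1[OF t]]) (use V[OF t] Vm[OF t] in \<open>auto elim!: eventually_mono\<close>)
  have v2: "(LINT \<xi>|lborel. V \<tau> \<xi> * \<psi> \<xi>) = (\<Sum>a\<in>A. LINT \<xi>|lborel. F a \<tau> \<xi> * \<phi> a \<xi>)" if t: "\<tau> \<in> {0..t}" for \<tau>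
  proof -
    have "(LINT \<xi>|lborel. V \<tau> \<xi> * \<psi> \<xi>) = (LINT \<xi>|lborel. (\<Sum>a\<in>A. F a \<tau> \<xi> * \<phi> a \<xi>))"
      by (rule integral_cong_AE) (use V[OF t] Vm[OF t] borel_measurable_integrable[OF s1[OF t]] in auto)
    then show ?thesis using Bochner_Integration.integral_sum[of A lborel "\<lambda>a \<xi>. F a \<tau> \<xi> * \<phi> a \<xi>"] i1[OF _ t] by simp
  qed
  have v3: "indicator {0..t} \<tau> *\<^sub>R (LINT \<xi>|lborel. V \<tau> \<xi> * \<psi> \<xi>) = (\<Sum>a\<in>A. indicator {0..t} \<tau> *\<^sub>R (LINT \<xi>|lborel. F a \<tau> \<xi> * \<phi> a \<xi>))" for \<tau>
    by (cases "\<tau> \<in> {0..t}") (simp_all add: v2)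
  have j0: "integrable lborel (\<lambda>\<xi>. \<Sum>a\<in>A. I a \<xi> * \<phi> a \<xi>)" by (intro Bochner_Integration.integrable_sum i2)
  have j1: "integrable lborel (\<lambda>\<xi>. J \<xi> * \<psi> \<xi>)"
    by (rule integrable_cong_AE_imp[OF j0]) (use J Jm in \<open>auto elim!: eventually_mono\<close>)
  have j2: "(LINT \<xi>|lborel. J \<xi> * \<psi> \<xi>) = (\<Sum>a\<in>A. LINT \<xi>|lborel. I a \<xi> * \<phi> a \<xi>)"
  proof -
    have "(LINT \<xi>|lborel. J \<xi> * \<psi> \<xi>) = (LINT \<xi>|lborel. (\<Sum>a\<in>A. I a \<xi> * \<phi> a \<xi>))"
      by (rule integral_cong_AE) (use J Jm borel_measurable_integrable[OF j0] in auto)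
    then show ?thesis by (simp add: Bochner_Integration.integral_sum i2)
  qed
  have "(LINT \<tau>:{0..t}|lborel. (LINT \<xi>|lborel. V \<tau> \<xi> * \<psi> \<xi>)) = (\<Sum>a\<in>A. LINT \<tau>:{0..t}|lborel. (LINT \<xi>|lborel. F a \<tau> \<xi> * \<phi> a \<xi>))"
    unfolding set_lebesgue_integral_def v3 by (intro Bochner_Integration.integral_sum i3)
  also have "\<dots> = (LINT \<xi>|lborel. J \<xi> * \<psi> \<xi>)" unfolding j2 by (intro sum.cong refl e)
  finally show ?thesis
    unfolding time_pairing_def set_integrable_def v3
    by (intro conjI ballI v1 j1 Bochner_Integration.integrable_sum i3)
qed

text \<open>Dominated convergence twice: in frequency for each fixed time, with majorant the modulus
  of \<open>F \<tau>\<close> times \<open>\<psi>\<close>, and then in time with the constant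
  \<open>K\<close>, which therefore has to be uniform over the interval.\<close>

lemma time_pairing_limit:
  assumes p: "\<And>n::nat. time_pairing F t I (\<phi> n)"
    and lim: "AE \<xi> in lborel. (\<lambda>n. \<phi> n \<xi>) \<longlonglongrightarrow> \<psi> \<xi>"
    and le: "\<And>n \<xi>. norm (\<phi> n \<xi>) \<le> norm (\<psi> \<xi>)"
    and F: "\<And>\<tau>. \<tau> \<in> {0..t} \<Longrightarrow> integrable lborel (\<lambda>\<xi>. F \<tau> \<xi> * \<psi> \<xi>)"
    and K: "\<And>\<tau>. \<tau> \<in> {0..t} \<Longrightarrow> (LINT \<xi>|lborel. norm (F \<tau> \<xi> * \<psi> \<xi>)) \<le> K"
    and I: "integrable lborel (\<lambda>\<xi>. I \<xi> * \<psi> \<xi>)"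
  shows "time_pairing F t I \<psi>"
proof -
  have i1: "integrable lborel (\<lambda>\<xi>. F \<tau> \<xi> * \<phi> n \<xi>)" if "\<tau> \<in> {0..t}" for n \<tau>
    using p that unfolding time_pairing_def by blast
  have i2: "integrable lborel (\<lambda>\<xi>. I \<xi> * \<phi> n \<xi>)"
    and i3: "integrable lborel (\<lambda>\<tau>. indicator {0..t} \<tau> *\<^sub>R (LINT \<xi>|lborel. F \<tau> \<xi> * \<phi> n \<xi>))"
    and e: "(LINT \<tau>:{0..t}|lborel. (LINT \<xi>|lborel. F \<tau> \<xi> * \<phi> n \<xi>)) = (LINT \<xi>|lborel. I \<xi> * \<phi> n \<xi>)" for n
    using p unfolding time_pairing_def set_integrable_def by blast+
  have conv: "(\<lambda>n. LINT \<xi>|lborel. G \<xi> * \<phi> n \<xi>) \<longlonglongrightarrow> (LINT \<xi>|lborel. G \<xi> * \<psi> \<xi>)"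
    if "integrable lborel (\<lambda>\<xi>. G \<xi> * \<psi> \<xi>)" "\<And>n. integrable lborel (\<lambda>\<xi>. G \<xi> * \<phi> n \<xi>)" for G
  proof (rule integral_dominated_convergence[where w="\<lambda>\<xi>. norm (G \<xi> * \<psi> \<xi>)"])
    show "AE \<xi> in lborel. (\<lambda>n. G \<xi> * \<phi> n \<xi>) \<longlonglongrightarrow> G \<xi> * \<psi> \<xi>"
      using lim by eventually_elim (intro tendsto_intros)
    show "AE \<xi> in lborel. norm (G \<xi> * \<phi> n \<xi>) \<le> norm (G \<xi> * \<psi> \<xi>)" for n
      by (intro AE_I2) (simp add: norm_mult mult_left_mono le)
  qed (use that in \<open>auto intro: borel_measurable_integrable\<close>)
  have bd: "norm (LINT \<xi>|lborel. F \<tau> \<xi> * \<phi> n \<xi>) \<le> K" if t: "\<tau> \<in> {0..t}" for \<tau> n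
  proof -
    have "norm (LINT \<xi>|lborel. F \<tau> \<xi> * \<phi> n \<xi>) \<le> (LINT \<xi>|lborel. norm (F \<tau> \<xi> * \<psi> \<xi>))"
      by (rule Bochner_Integration.integral_norm_bound_integral[OF i1[OF t] integrable_norm[OF F[OF t]]])
        (use le in \<open>auto simp: norm_mult intro: mult_left_mono\<close>)
    also have "\<dots> \<le> K" by (rule K[OF t])
    finally show ?thesis .
  qed
  let ?f = "\<lambda>n \<tau>. indicator {0..t} \<tau> *\<^sub>R (LINT \<xi>|lborel. F \<tau> \<xi> * \<phi> n \<xi>)"
  let ?g = "\<lambda>\<tau>. indicator {0..t} \<tau> *\<^sub>R (LINT \<xi>|lborel. F \<tau> \<xi> * \<psi> \<xi>)"
  have pw: "(\<lambda>n. ?f n \<tau>) \<longlonglongrightarrow> ?g \<tau>" for \<tau>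
  proof (cases "\<tau> \<in> {0..t}")
    case True
    then show ?thesis using conv[OF F[OF True] i1[OF True]] by simp
  qed simp
  have fm: "?f n \<in> borel_measurable lborel" for n using borel_measurable_integrable[OF i3] .
  \<comment> \<open>Measurability in time is inherited from the approximating pairings, as nothing
    is assumed about \<open>F\<close> jointly in time and frequency.\<close>
  have gm: "?g \<in> borel_measurable lborel" by (rule borel_measurable_LIMSEQ_metric[OF fm pw])
  have w: "integrable lborel (\<lambda>\<tau>. indicator {0..t} \<tau> *\<^sub>R K)" 
    using emeasure_bounded_finite[of "{0..t}"] by (intro integrable_scaleR_left integrable_real_indicator) auto
  have bf: "AE \<tau> in lborel. norm (?f n \<tau>) \<le> indicator {0..t} \<tau> *\<^sub>R K" for n
    using bd by (auto simp: indicator_def)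
  have ae: "AE \<tau> in lborel. (\<lambda>n. ?f n \<tau>) \<longlonglongrightarrow> ?g \<tau>" by (intro AE_I2 pw)
  note lt = integral_dominated_convergence[OF gm fm w ae bf]
    and gi = integrable_dominated_convergence[OF gm fm w ae bf]
  have "(LINT \<tau>|lborel. ?g \<tau>) = (LINT \<xi>|lborel. I \<xi> * \<psi> \<xi>)"
    using LIMSEQ_unique[OF lt] conv[OF I i2] e unfolding set_lebesgue_integral_def by simp
  then show ?thesis unfolding time_pairing_def set_integrable_def set_lebesgue_integral_def using F I gi by blast
qed

lemma time_interval_subset:
  assumes "ereal t < T" "s \<in> {0..t}" shows "s \<in> time_interval T"
proof -
  have "ereal s \<le> ereal t" using assms(2) by simp
  then have "ereal s < T" using assms(1) by (rule order.strict_trans1)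
  then show ?thesis using assms(2) unfolding time_interval_def by simp
qed

lemma has_time_integral_measurable: "has_time_integral F t I \<Longrightarrow> I \<in> borel_measurable borel"
  unfolding has_time_integral_def by (rule measurable_schwartz_integrable) blast

section \<open>From the matrix equation to the velocity equation\<close>

lemma mild_NS_of_mild_potential:
  assumes M: "mild_potential T M" and v: "\<And>t. t \<in> time_interval T \<Longrightarrow> is_velocity_of (u t) (M t)"
  shows "mild_NS T u"
proof -
  have MC: "M \<in> C_Hdot12_st T" using M mild_potential_def by blast
  have uC: "u \<in> C_H1_df T" by (rule velocity_continuous[OF MC v])
  have uH: "u r \<in> H1_df" if "r \<in> time_interval T" for r using uC that unfolding C_H1_df_def by blast
  have "\<exists>I' :: real^3 \<Rightarrow> complex^3. (\<forall>j. has_time_integral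
           (\<lambda>\<tau> \<xi>. heat (t - \<tau>) (helmholtz (mdiv (mft (tensor_sq (u \<tau>))))) \<xi> $ j) t (\<lambda>\<xi>. I' \<xi> $ j)) \<and>
        vhas_ft (u t) (\<lambda>\<xi>. heat t (vft (u 0)) \<xi> - I' \<xi>)" if t: "0 < t" "ereal t < T" for t
  proof -
    have ti: "s \<in> time_interval T" if "s \<in> {0..t}" for s using time_interval_subset[OF t(2) that] .
    obtain I :: "real^3 \<Rightarrow> complex^3^3" where I: "\<And>i j. has_time_integral
           (\<lambda>\<tau> \<xi>. heat (t - \<tau>) (mft (P_st (tensor_sq (div_fun (M \<tau>))))) \<xi> $ i $ j) t
           (\<lambda>\<xi>. I \<xi> $ i $ j)" "mhas_ft (M t) (\<lambda>\<xi>. heat t (mft (M 0)) \<xi> + I \<xi>)"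
      using M t unfolding mild_potential_def by blast
    have Im[measurable]: "(\<lambda>\<xi>. I \<xi> $ i $ j) \<in> borel_measurable borel" for i j
      using has_time_integral_measurable[OF I(1)] .
    \<comment> \<open>The witness for the velocity equation is \<open>mdiv I\<close>. The minus sign
      in u = - div M accounts for + \<open>I\<close> in one equation and - \<open>mdiv I\<close> in
      the other.\<close>
    have "has_time_integral (\<lambda>\<tau> \<xi>. heat (t - \<tau>) (helmholtz (mdiv (mft (tensor_sq (u \<tau>))))) \<xi> $ j) t (\<lambda>\<xi>. mdiv I \<xi> $ j)" for j
      unfolding has_time_integral_iff
    proof (intro allI impI)
      fix \<phi> :: "real^3 \<Rightarrow> complex" assume \<phi>: "schwartz \<phi>"
      note [measurable] = schwartz_measurable[OF \<phi>]
      show "time_pairing (\<lambda>\<tau> \<xi>. heat (t - \<tau>) (helmholtz (mdiv (mft (tensor_sq (u \<tau>))))) \<xi> $ j) t (\<lambda>\<xi>. mdiv I \<xi> $ j) \<phi>"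
      proof (rule time_pairing_combination[where A=UNIV and \<phi>="\<lambda>i \<xi>. deriv_symbol i \<xi> * \<phi> \<xi>"
            and F="\<lambda>i \<tau> \<xi>. heat (t - \<tau>) (mft (P_st (tensor_sq (div_fun (M \<tau>))))) \<xi> $ i $ j" and I="\<lambda>i \<xi>. I \<xi> $ i $ j"])
        show "time_pairing (\<lambda>\<tau> \<xi>. heat (t - \<tau>) (mft (P_st (tensor_sq (div_fun (M \<tau>))))) \<xi> $ i $ j) t (\<lambda>\<xi>. I \<xi> $ i $ j)
            (\<lambda>\<xi>. deriv_symbol i \<xi> * \<phi> \<xi>)" for i
          using I(1) schwartz_deriv_symbol[OF \<phi>] unfolding has_time_integral_iff by blast
        show "AE \<xi> in lborel. mdiv I \<xi> $ j * \<phi> \<xi> = (\<Sum>i\<in>UNIV. I \<xi> $ i $ j * (deriv_symbol i \<xi> * \<phi> \<xi>))"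
          unfolding mdiv_nth by (simp add: sum_distrib_left mult_ac)
        show "(\<lambda>\<xi>. mdiv I \<xi> $ j * \<phi> \<xi>) \<in> borel_measurable borel" by measurable
        fix \<tau> assume \<tau>: "\<tau> \<in> {0..t}"
        let ?T = "mft (tensor_sq (u \<tau>))"
        note uT = mft_tensor(1)[OF uH[OF ti[OF \<tau>]]]
        note [measurable] = mhas_ft_measurable[OF uT]
        show "(\<lambda>\<xi>. heat (t - \<tau>) (helmholtz (mdiv ?T)) \<xi> $ j * \<phi> \<xi>) \<in> borel_measurable borel"
          unfolding heat_eq vector_scaleR_component
          by (intro borel_measurable_times borel_measurable_scaleR helmholtz_borel mdiv_borel) measurable
        show "AE \<xi> in lborel. heat (t - \<tau>) (helmholtz (mdiv ?T)) \<xi> $ j * \<phi> \<xi> =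
            (\<Sum>i\<in>UNIV. heat (t - \<tau>) (mft (P_st (tensor_sq (div_fun (M \<tau>))))) \<xi> $ i $ j * (deriv_symbol i \<xi> * \<phi> \<xi>))"
          using mft_AE[OF P_st_div_fun[OF uH[OF ti[OF \<tau>]] v[OF ti[OF \<tau>]] uT]] AE_nonzero
        proof eventually_elim
          case (elim \<xi>)
          show ?case
            unfolding heat_eq elim(1) vector_scaleR_component mdiv_st_symbol[OF elim(2), symmetric]
            unfolding mdiv_nth by (simp add: scaleR_conv_of_real sum_distrib_left sum_distrib_right mult_ac)
        qed
      qed simp
    qed
    moreover have "vhas_ft (u t) (\<lambda>\<xi>. heat t (vft (u 0)) \<xi> - mdiv I \<xi>)"
    proof -
      have t0: "0 \<in> time_interval T" "t \<in> time_interval T" using ti[of 0] ti[of t] t(1) by auto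
      have u: "vhas_ft (u s) (\<lambda>\<xi>. - mdiv (mft (M s)) \<xi>)" if "s \<in> time_interval T" for s
        using v[OF that] unfolding is_velocity_of_def by blast
      note [measurable] = vhas_ft_measurable[OF vhas_ft_vft[OF u[OF t0(1)]]]
      show ?thesis
      proof (rule vhas_ft_cong_AE[OF u[OF t0(2)]])
        show "AE \<xi> in lborel. - mdiv (mft (M t)) \<xi> = heat t (vft (u 0)) \<xi> - mdiv I \<xi>"
          using mft_AE[OF I(2)] vft_AE[OF u[OF t0(1)]]
        proof eventually_elim
          case (elim \<xi>)
          show ?case
            unfolding heat_eq elim(2) unfolding mdiv_def elim(1) heat_eq
            by (simp add: vec_eq_iff distrib_left sum.distrib scaleR_sum_right)
        qed
        show "(\<lambda>\<xi>. (heat t (vft (u 0)) \<xi> - mdiv I \<xi>) $ j) \<in> borel_measurable borel" for j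
          unfolding heat_eq vector_minus_component vector_scaleR_component by measurable
      qed
    qed
    ultimately show ?thesis by blast
  qed
  then show ?thesis unfolding mild_NS_def using uC by blast
qed

section \<open>Boundedness on compact time intervals\<close>

lemma h1_sq_add_le:
  assumes [measurable]: "f \<in> borel_measurable borel" "g \<in> borel_measurable borel"
  shows "h1_sq (\<lambda>\<xi>. f \<xi> + g \<xi>) \<le> 2 * h1_sq f + 2 * h1_sq g"
proof -
  let ?M = "density lborel (\<lambda>\<xi>::real^3. ennreal (1 + lap \<xi>))"
  have e: "h1_sq h = sqint ?M h" if [measurable]: "h \<in> borel_measurable borel" for h
    unfolding h1_sq_def sqint_def lap_def[symmetric]
    by (subst nn_integral_density) (auto simp: ennreal_mult)
  have "sqint ?M (\<lambda>\<xi>. f \<xi> + g \<xi>) \<le> 2 * sqint ?M f + 2 * sqint ?M g" by (rule sqint_add_le) auto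
  then show ?thesis by (simp add: e)
qed

lemma vh1_sq_triangle:
  assumes "vhas_ft u U" "vhas_ft v V"
  shows "vh1_sq u \<le> 2 * vh1_sq (\<lambda>x. u x - v x) + 2 * vh1_sq v"
proof -
  note [measurable] = vhas_ft_measurable[OF assms(1)] vhas_ft_measurable[OF assms(2)]
  have "vh1_sq u \<le> (\<Sum>j\<in>UNIV. 2 * h1_sq (\<lambda>\<xi>. (U \<xi> - V \<xi>) $ j) + 2 * h1_sq (\<lambda>\<xi>. V \<xi> $ j))"
    unfolding vh1_sq_ft[OF assms(1)]
  proof (rule sum_mono)
    fix j
    have "h1_sq (\<lambda>\<xi>. (U \<xi> - V \<xi>) $ j + V \<xi> $ j) \<le> 2 * h1_sq (\<lambda>\<xi>. (U \<xi> - V \<xi>) $ j) + 2 * h1_sq (\<lambda>\<xi>. V \<xi> $ j)"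
      by (rule h1_sq_add_le) auto
    then show "h1_sq (\<lambda>\<xi>. U \<xi> $ j) \<le> 2 * h1_sq (\<lambda>\<xi>. (U \<xi> - V \<xi>) $ j) + 2 * h1_sq (\<lambda>\<xi>. V \<xi> $ j)" by simp
  qed
  then show ?thesis
    unfolding vh1_sq_ft[OF vhas_ft_diff[OF assms]] vh1_sq_ft[OF assms(2)] by (simp add: sum.distrib sum_distrib_left)
qed

text \<open>Continuity is stated through norms of differences, so it yields a bound near each time;
  a finite subcover of the compact interval makes it uniform.\<close>

lemma C_H1_df_bounded:
  assumes u: "u \<in> C_H1_df T" and t: "ereal t < T"
  obtains B where "B < \<top>" "\<And>s. s \<in> {0..t} \<Longrightarrow> vh1_sq (u s) \<le> B"
proof -
  have ti: "s \<in> time_interval T" if "s \<in> {0..t}" for s using time_interval_subset[OF t that] .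
  have uH: "u r \<in> H1_df" if "r \<in> {0..t}" for r using u ti[OF that] unfolding C_H1_df_def by blast
  have "\<exists>d>0. \<forall>r\<in>{0..t}. dist r s < d \<longrightarrow> vh1_sq (u r) \<le> 2 * 1 + 2 * vh1_sq (u s)" if s: "s \<in> {0..t}" for s
  proof -
    have "((\<lambda>r. vh1_sq (\<lambda>x. u r x - u s x)) \<longlongrightarrow> 0) (at s within time_interval T)"
      using u ti[OF s] unfolding C_H1_df_def by blast
    then have "\<forall>\<^sub>F r in at s within time_interval T. vh1_sq (\<lambda>x. u r x - u s x) < 1"
      by (rule order_tendstoD) simp
    then obtain d where d: "d > 0" "\<And>r. r \<in> time_interval T \<Longrightarrow> r \<noteq> s \<Longrightarrow> dist r s < d \<Longrightarrow> vh1_sq (\<lambda>x. u r x - u s x) < 1"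
      unfolding eventually_at by blast
    have "vh1_sq (u r) \<le> 2 * 1 + 2 * vh1_sq (u s)" if r: "r \<in> {0..t}" "dist r s < d" for r
    \<comment> \<open>The filter \<open>at s within time_interval T\<close> gives no information at
      \<open>s\<close> itself.\<close>
    proof (cases "r = s")
      case True
      have "1 * vh1_sq (u s) \<le> 2 * vh1_sq (u s)" by (intro mult_right_mono) auto
      then show ?thesis using True by (simp add: add_increasing)
    next
      case False
      have "vh1_sq (u r) \<le> 2 * vh1_sq (\<lambda>x. u r x - u s x) + 2 * vh1_sq (u s)"
        by (rule vh1_sq_triangle[OF H1_df_D(1)[OF uH[OF r(1)]] H1_df_D(1)[OF uH[OF s]]])
      also have "\<dots> \<le> 2 * 1 + 2 * vh1_sq (u s)"
        using d(2)[OF ti[OF r(1)] False r(2)] by (intro add_mono mult_left_mono) auto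
      finally show ?thesis .
    qed
    then show ?thesis using d(1) by blast
  qed
  then obtain d where d: "\<And>s. s \<in> {0..t} \<Longrightarrow> d s > 0"
    "\<And>s r. s \<in> {0..t} \<Longrightarrow> r \<in> {0..t} \<Longrightarrow> dist r s < d s \<Longrightarrow> vh1_sq (u r) \<le> 2 * 1 + 2 * vh1_sq (u s)" by metis
  obtain C where C: "C \<subseteq> {0..t}" "finite C" "{0..t} \<subseteq> (\<Union>s\<in>C. ball s (d s))"
  proof (rule compactE_image[of "{0..t}" "{0..t}" "\<lambda>s. ball s (d s)"])
    show "{0..t} \<subseteq> (\<Union>s\<in>{0..t}. ball s (d s))" using d(1) by (intro subsetI UN_I) auto
  qed auto
  let ?B = "\<Sum>s\<in>C. 2 * 1 + 2 * vh1_sq (u s)"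
  show ?thesis
  proof (rule that[of ?B])
    show "?B < \<top>" using C H1_df_D(2)[OF uH] by (auto simp: less_top[symmetric] ennreal_mult_eq_top_iff ennreal_add_eq_top subset_iff)
    fix r assume r: "r \<in> {0..t}"
    then obtain s where s: "s \<in> C" "r \<in> ball s (d s)" using C(3) by blast
    have "vh1_sq (u r) \<le> 2 * 1 + 2 * vh1_sq (u s)"
      using d(2)[of s r] s C(1) r by (auto simp: dist_commute)
    also have "\<dots> \<le> ?B" using s(1) C(2) by (intro member_le_sum) auto
    finally show "vh1_sq (u r) \<le> ?B" .
  qed
qed

text \<open>With \<open>q = |\<xi>|\<^sup>2 exp (- |\<xi>|\<^sup>2)\<close> the function \<open>(1 - (1 - q)\<^sup>n) \<phi>\<close> is \<open>|\<xi>|\<^sup>2\<close> times a Schwartz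
  function, by the finite geometric series, and it increases to \<open>\<phi>\<close> away from the origin. This gives
  access to test functions divided by \<open>|\<xi>|\<^sup>2\<close>.\<close>

definition gauss_bump :: "real^3 \<Rightarrow> real"
  where "gauss_bump \<xi> = (norm \<xi>)\<^sup>2 * exp (- (norm \<xi>)\<^sup>2)"

lemma gauss_bump_bounds: "0 \<le> gauss_bump \<xi>" "gauss_bump \<xi> \<le> 1" "\<xi> \<noteq> 0 \<Longrightarrow> 0 < gauss_bump \<xi>"
proof -
  have "(norm \<xi>)\<^sup>2 \<le> exp ((norm \<xi>)\<^sup>2)" using exp_ge_add_one_self[of "(norm \<xi>)\<^sup>2"] by linarith
  then show "gauss_bump \<xi> \<le> 1" unfolding gauss_bump_def by (simp add: exp_minus field_simps)
qed (auto simp: gauss_bump_def)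

lemma schwartz_gauss_bump: "schwartz (\<lambda>\<xi>. complex_of_real (gauss_bump \<xi>))"
proof -
  have "schwartz (\<lambda>\<xi>. \<Sum>k\<in>UNIV. complex_of_real (\<xi> $ k) * (complex_of_real (\<xi> $ k) * complex_of_real (exp (- (norm \<xi>)\<^sup>2))))"
    by (intro schwartz_sum schwartz_coord schwartz_gauss)
  moreover have "(\<Sum>k\<in>UNIV. complex_of_real (\<xi> $ k) * (complex_of_real (\<xi> $ k) * complex_of_real (exp (- (norm \<xi>)\<^sup>2)))) = complex_of_real (gauss_bump \<xi>)" for \<xi> :: "real^3"
  proof -
    have "(\<Sum>k\<in>UNIV. complex_of_real (\<xi> $ k) * (complex_of_real (\<xi> $ k) * complex_of_real (exp (- (norm \<xi>)\<^sup>2))))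
      = complex_of_real ((\<Sum>k\<in>UNIV. (\<xi> $ k)\<^sup>2) * exp (- (norm \<xi>)\<^sup>2))"
      unfolding of_real_mult of_real_sum sum_distrib_right by (simp add: power2_eq_square mult.assoc)
    then show ?thesis unfolding gauss_bump_def norm2_cart .
  qed
  ultimately show ?thesis by simp
qed

lemma schwartz_geometric:
  assumes "schwartz \<phi>"
  obtains \<psi> where "\<And>n. schwartz (\<psi> n)"
    "\<And>n \<xi>. complex_of_real ((norm \<xi>)\<^sup>2) * \<psi> n \<xi> = complex_of_real (1 - (1 - gauss_bump \<xi>) ^ n) * \<phi> \<xi>"
proof -
  let ?q = "\<lambda>\<xi>. complex_of_real (gauss_bump \<xi>)"
  let ?e = "\<lambda>\<xi>::real^3. complex_of_real (exp (- (norm \<xi>)\<^sup>2))"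
  define \<psi> where "\<psi> n \<xi> = (\<Sum>k<n. (1 - ?q \<xi>) ^ k * (?e \<xi> * \<phi> \<xi>))" for n :: nat and \<xi>
  have s: "schwartz (\<lambda>\<xi>. (1 - ?q \<xi>) ^ k * (?e \<xi> * \<phi> \<xi>))" for k
  proof (induction k)
    case 0
    show ?case using schwartz_mult[OF schwartz_gauss assms] by simp
  next
    case (Suc k)
    have "schwartz (\<lambda>\<xi>. (1 - ?q \<xi>) ^ k * (?e \<xi> * \<phi> \<xi>) - ?q \<xi> * ((1 - ?q \<xi>) ^ k * (?e \<xi> * \<phi> \<xi>)))"
      by (intro schwartz_diff schwartz_mult schwartz_gauss_bump Suc)
    then show ?case by (simp add: algebra_simps)
  qed
  show ?thesis
  proof (rule that[of \<psi>])
    show "schwartz (\<psi> n)" for n unfolding \<psi>_def[abs_def] by (intro schwartz_sum s)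
    fix n \<xi>
    have "complex_of_real ((norm \<xi>)\<^sup>2) * \<psi> n \<xi> = (complex_of_real ((norm \<xi>)\<^sup>2) * ?e \<xi>) * (\<Sum>k<n. (1 - ?q \<xi>) ^ k) * \<phi> \<xi>"
      unfolding \<psi>_def by (simp add: sum_distrib_left sum_distrib_right mult_ac)
    also have "complex_of_real ((norm \<xi>)\<^sup>2) * ?e \<xi> = ?q \<xi>" by (simp add: gauss_bump_def)
    also have "?q \<xi> * (\<Sum>k<n. (1 - ?q \<xi>) ^ k) = 1 - (1 - ?q \<xi>) ^ n"
      using one_diff_power_eq[of "1 - ?q \<xi>" n] by simp
    finally show "complex_of_real ((norm \<xi>)\<^sup>2) * \<psi> n \<xi> = complex_of_real (1 - (1 - gauss_bump \<xi>) ^ n) * \<phi> \<xi>" by simp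
  qed
qed

section \<open>From the velocity equation to the matrix equation\<close>

lemma lap_mult_sym_grad:
  assumes "\<xi> \<noteq> 0"
  shows "complex_of_real (lap \<xi>) * ((- 2 / lap \<xi>) *\<^sub>R sym_grad V \<xi>) $ i $ j = - (deriv_symbol i \<xi> * V \<xi> $ j + deriv_symbol j \<xi> * V \<xi> $ i)"
  using lap_pos[OF assms] unfolding vector_scaleR_component sym_grad_nth
  by (simp add: scaleR_conv_of_real field_simps)

lemma mild_potential_of_mild_NS:
  assumes u: "mild_NS T u" and p: "\<And>t. t \<in> time_interval T \<Longrightarrow> is_potential_of (M t) (u t)"
  shows "mild_potential T M"
proof -
  have uC: "u \<in> C_H1_df T" using u mild_NS_def by blast
  have uH: "u r \<in> H1_df" if "r \<in> time_interval T" for r using uC that unfolding C_H1_df_def by blast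
  have MC: "M \<in> C_Hdot12_st T" by (rule potential_continuous[OF uC p])
  have v: "is_velocity_of (u r) (M r)" if "r \<in> time_interval T" for r
    using velocity_of_potential[OF uH[OF that] p[OF that]] .
  have "\<exists>I :: real^3 \<Rightarrow> complex^3^3. (\<forall>i j. has_time_integral
           (\<lambda>\<tau> \<xi>. heat (t - \<tau>) (mft (P_st (tensor_sq (div_fun (M \<tau>))))) \<xi> $ i $ j) t
           (\<lambda>\<xi>. I \<xi> $ i $ j)) \<and>
        mhas_ft (M t) (\<lambda>\<xi>. heat t (mft (M 0)) \<xi> + I \<xi>)" if t: "0 < t" "ereal t < T" for t
  proof -
    have ti: "s \<in> time_interval T" if "s \<in> {0..t}" for s using time_interval_subset[OF t(2) that] .
    have t0: "0 \<in> time_interval T" "t \<in> time_interval T" using ti[of 0] ti[of t] t(1) by auto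
    obtain J :: "real^3 \<Rightarrow> complex^3" where J: "\<And>j. has_time_integral
           (\<lambda>\<tau> \<xi>. heat (t - \<tau>) (helmholtz (mdiv (mft (tensor_sq (u \<tau>))))) \<xi> $ j) t (\<lambda>\<xi>. J \<xi> $ j)"
        "vhas_ft (u t) (\<lambda>\<xi>. heat t (vft (u 0)) \<xi> - J \<xi>)"
      using u t unfolding mild_NS_def by blast
    have Jm[measurable]: "(\<lambda>\<xi>. J \<xi> $ j) \<in> borel_measurable borel" for j
      using has_time_integral_measurable[OF J(1)] .
    \<comment> \<open>The potential operator applied to - \<open>J\<close>. So far this is only a
      measurable function; its singularity at the origin leaves open whether it can be paired with
      Schwartz functions.\<close>
    define I where "I \<xi> = (- 2 / lap \<xi>) *\<^sub>R sym_grad J \<xi>" for \<xi>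
    have Im[measurable]: "(\<lambda>\<xi>. I \<xi> $ i $ j) \<in> borel_measurable borel" for i j
      unfolding I_def vector_scaleR_component by (intro borel_measurable_scaleR sym_grad_borel) auto
    have MG: "mhas_ft (M s) (\<lambda>\<xi>. 2 *\<^sub>R sym_grad (laplace_pow (- 1) (vft (u s))) \<xi>)" if "s \<in> time_interval T" for s
      using p[OF that] unfolding is_potential_of_def by blast
    note MF = mhas_ft_mft[OF MG]
    note [measurable] = mhas_ft_measurable[OF MF[OF t0(1)]] mhas_ft_measurable[OF MF[OF t0(2)]]
    \<comment> \<open>Applying the potential operator to the velocity equation pointwise in
      frequency. This gives the matrix equation and later also the integrability of
      \<open>I\<close>.\<close>
    have IG: "AE \<xi> in lborel. mft (M t) \<xi> = heat t (mft (M 0)) \<xi> + I \<xi>"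
      using mft_AE[OF MG[OF t0(1)]] mft_AE[OF MG[OF t0(2)]] vft_AE[OF J(2)]
    proof eventually_elim
      case (elim \<xi>)
      have "sym_grad (vft (u t)) \<xi> = exp (- (lap \<xi> * t)) *\<^sub>R sym_grad (vft (u 0)) \<xi> - sym_grad J \<xi>"
        by (simp only: vec_eq_iff sym_grad_nth vector_scaleR_component vector_minus_component elim(3) heat_eq)
          (simp add: scaleR_conv_of_real algebra_simps diff_divide_distrib add_divide_distrib)
      then show ?case
        unfolding elim(1,2) heat_eq I_def sym_grad_minus_one by (simp add: scaleR_diff_right mult_ac)
    qed
    obtain B where B: "B < \<top>" "\<And>s. s \<in> {0..t} \<Longrightarrow> vh1_sq (u s) \<le> B" using C_H1_df_bounded[OF uC t(2)] by blast
    \<comment> \<open>The bound of \<open>sqint_st_symbol\<close>, with each of the nine entries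
      estimated by the product inequality and the uniform bound \<open>B\<close>.\<close>
    define Q where "Q = 144 * (9 * (product_const * (B * B)))"
    have Q: "Q < \<top>" unfolding Q_def using B(1) product_const_finite by (simp add: ennreal_mult_less_top)
    have "has_time_integral (\<lambda>\<tau> \<xi>. heat (t - \<tau>) (mft (P_st (tensor_sq (div_fun (M \<tau>))))) \<xi> $ i $ j) t (\<lambda>\<xi>. I \<xi> $ i $ j)" for i j
      unfolding has_time_integral_iff
    proof (intro allI impI)
      let ?F = "\<lambda>\<tau> \<xi>. heat (t - \<tau>) (mft (P_st (tensor_sq (div_fun (M \<tau>))))) \<xi> $ i $ j"
      let ?V = "\<lambda>\<tau>. helmholtz (mdiv (mft (tensor_sq (u \<tau>))))"
      fix \<phi> :: "real^3 \<Rightarrow> complex" assume \<phi>: "schwartz \<phi>"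
      note [measurable] = schwartz_measurable[OF \<phi>]
      obtain \<psi> where \<psi>: "\<And>n. schwartz (\<psi> n)"
        "\<And>n \<xi>. complex_of_real ((norm \<xi>)\<^sup>2) * \<psi> n \<xi> = complex_of_real (1 - (1 - gauss_bump \<xi>) ^ n) * \<phi> \<xi>"
        using schwartz_geometric[OF \<phi>] by blast
      define \<phi>n where "\<phi>n n \<xi> = complex_of_real (1 - (1 - gauss_bump \<xi>) ^ n) * \<phi> \<xi>" for n \<xi>
      \<comment> \<open>Converts |xi|^2 into \<open>lap\<close>. The sign anticipates the one in
        \<open>lap_mult_sym_grad\<close>.\<close>
      define c where "c = - 1 / complex_of_real (4 * pi\<^sup>2)"
      have \<phi>n: "\<phi>n n \<xi> = - (complex_of_real (lap \<xi>) * (c * \<psi> n \<xi>))" for n \<xi>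
        unfolding \<phi>n_def \<psi>(2)[symmetric] by (simp add: lap_def c_def)
      have \<phi>n_meas[measurable]: "\<phi>n n \<in> borel_measurable borel" for n
        unfolding \<phi>n using schwartz_measurable[OF \<psi>(1)] by measurable
      have Pf: "mhas_ft (P_st (tensor_sq (div_fun (M \<tau>)))) (st_symbol (mft (tensor_sq (u \<tau>))))" if "\<tau> \<in> {0..t}" for \<tau>
        using P_st_div_fun[OF uH v mft_tensor(1)[OF uH]] ti[OF that] by blast
      have Fm: "?F \<tau> \<in> borel_measurable borel" if "\<tau> \<in> {0..t}" for \<tau>
        using mhas_ft_measurable[OF mhas_ft_mft[OF Pf[OF that]]] unfolding heat_eq vector_scaleR_component by measurable
      have pair: "time_pairing ?F t (\<lambda>\<xi>. I \<xi> $ i $ j) (\<phi>n n)" for n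
      \<comment> \<open>The index ranges over \<open>bool\<close>, one value for each of the two
        terms of the symmetric gradient. The factor \<open>lap\<close> contained in
        \<open>\<phi>n\<close> cancels the inverse Laplacian, and the remaining symbols go to
        Schwartz functions, for which the velocity equation is available.\<close>
      proof (rule time_pairing_combination[where A=UNIV
            and F="\<lambda>b \<tau> \<xi>. heat (t - \<tau>) (?V \<tau>) \<xi> $ (if b then j else i)" and I="\<lambda>b \<xi>. J \<xi> $ (if b then j else i)"
            and \<phi>="\<lambda>b \<xi>. deriv_symbol (if b then i else j) \<xi> * (c * \<psi> n \<xi>)"])
        show "time_pairing (\<lambda>\<tau> \<xi>. heat (t - \<tau>) (?V \<tau>) \<xi> $ (if b then j else i)) t (\<lambda>\<xi>. J \<xi> $ (if b then j else i))
            (\<lambda>\<xi>. deriv_symbol (if b then i else j) \<xi> * (c * \<psi> n \<xi>))" for b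
          using J(1) schwartz_deriv_symbol[OF schwartz_cmul[OF \<psi>(1)]] unfolding has_time_integral_iff by blast
        show "AE \<xi> in lborel. I \<xi> $ i $ j * \<phi>n n \<xi> = (\<Sum>b\<in>UNIV. J \<xi> $ (if b then j else i) * (deriv_symbol (if b then i else j) \<xi> * (c * \<psi> n \<xi>)))"
          using AE_nonzero
        proof eventually_elim
          case (elim \<xi>)
          have "I \<xi> $ i $ j * \<phi>n n \<xi> = - (complex_of_real (lap \<xi>) * I \<xi> $ i $ j) * (c * \<psi> n \<xi>)" unfolding \<phi>n by simp
          then show ?case unfolding I_def lap_mult_sym_grad[OF elim] by (simp add: UNIV_bool algebra_simps)
        qed
        show "(\<lambda>\<xi>. I \<xi> $ i $ j * \<phi>n n \<xi>) \<in> borel_measurable borel" by measurable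
        fix \<tau> assume \<tau>: "\<tau> \<in> {0..t}"
        note [measurable] = Fm[OF \<tau>]
        show "(\<lambda>\<xi>. ?F \<tau> \<xi> * \<phi>n n \<xi>) \<in> borel_measurable borel" by measurable
        show "AE \<xi> in lborel. ?F \<tau> \<xi> * \<phi>n n \<xi> =
           (\<Sum>b\<in>UNIV. heat (t - \<tau>) (?V \<tau>) \<xi> $ (if b then j else i) * (deriv_symbol (if b then i else j) \<xi> * (c * \<psi> n \<xi>)))"
          using mft_AE[OF Pf[OF \<tau>]] AE_nonzero
        proof eventually_elim
          case (elim \<xi>)
          let ?x = "complex_of_real (exp (- (lap \<xi> * (t - \<tau>))))"
          have "?F \<tau> \<xi> * \<phi>n n \<xi> = - (complex_of_real (lap \<xi>) * st_symbol (mft (tensor_sq (u \<tau>))) \<xi> $ i $ j) * (?x * (c * \<psi> n \<xi>))"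
            unfolding \<phi>n heat_eq vector_scaleR_component elim(1) unfolding scaleR_conv_of_real by simp
          also have "\<dots> = (deriv_symbol i \<xi> * ?V \<tau> \<xi> $ j + deriv_symbol j \<xi> * ?V \<tau> \<xi> $ i) * (?x * (c * \<psi> n \<xi>))"
            unfolding st_symbol_def lap_mult_sym_grad[OF elim(2)] by simp
          also have "\<dots> = (\<Sum>b\<in>UNIV. heat (t - \<tau>) (?V \<tau>) \<xi> $ (if b then j else i) * (deriv_symbol (if b then i else j) \<xi> * (c * \<psi> n \<xi>)))"
            unfolding heat_eq vector_scaleR_component unfolding scaleR_conv_of_real by (simp add: UNIV_bool algebra_simps)
          finally show ?case .
        qed
      qed simp
      \<comment> \<open>Uniform in time: the heat factor is at most 1 because \<open>\<tau>\<close>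
        does not exceed \<open>t\<close>, and the projection and the product are controlled by
        \<open>B\<close>.\<close>
      have Fb: "sqint lborel (?F \<tau>) \<le> Q" if \<tau>: "\<tau> \<in> {0..t}" for \<tau>
      proof -
        let ?T = "mft (tensor_sq (u \<tau>))"
        note uT = mft_tensor[OF uH[OF ti[OF \<tau>]]]
        have "sqint lborel (?F \<tau>) \<le> sqint lborel (\<lambda>\<xi>. st_symbol ?T \<xi> $ i $ j)"
          unfolding sqint_def
        proof (rule nn_integral_mono_AE)
          show "AE \<xi> in lborel. ennreal ((norm (?F \<tau> \<xi>))\<^sup>2) \<le> ennreal ((norm (st_symbol ?T \<xi> $ i $ j))\<^sup>2)"
            using mft_AE[OF Pf[OF \<tau>]]
          proof eventually_elim
            case (elim \<xi>)
            have "norm (?F \<tau> \<xi>) = exp (- (lap \<xi> * (t - \<tau>))) * norm (st_symbol ?T \<xi> $ i $ j)"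
              unfolding heat_eq elim vector_scaleR_component by simp
            also have "\<dots> \<le> 1 * norm (st_symbol ?T \<xi> $ i $ j)" using \<tau> by (intro mult_right_mono) auto
            finally show ?case by (intro ennreal_leI power_mono) auto
          qed
        qed
        also have "\<dots> \<le> 144 * (\<Sum>p\<in>UNIV. sqint lborel (\<lambda>\<xi>. ?T \<xi> $ fst p $ snd p))"
          by (rule sqint_st_symbol) (rule mhas_ft_measurable[OF uT(1)])
        also have "\<dots> \<le> 144 * (\<Sum>p\<in>(UNIV :: (3\<times>3) set). product_const * (B * B))"
          by (intro mult_left_mono sum_mono order_trans[OF uT(2)] mult_mono B(2)[OF \<tau>]) auto
        also have "\<dots> = Q" unfolding Q_def by simp
        finally show ?thesis .
      qed
      have sf: "sqint lborel \<phi> < \<infinity>" by (rule schwartz_sqint[OF \<phi>])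
      have Fi: "integrable lborel (\<lambda>\<xi>. ?F \<tau> \<xi> * \<phi> \<xi>)" if \<tau>: "\<tau> \<in> {0..t}" for \<tau>
        by (rule integrable_mult_sqint(1)) (use Fm[OF \<tau>] Fb[OF \<tau>] Q sf in \<open>auto intro: order.strict_trans1\<close>)
      show "time_pairing ?F t (\<lambda>\<xi>. I \<xi> $ i $ j) \<phi>"
      proof (rule time_pairing_limit[OF pair _ _ Fi])
        show "AE \<xi> in lborel. (\<lambda>n. \<phi>n n \<xi>) \<longlonglongrightarrow> \<phi> \<xi>"
          using AE_nonzero
        proof eventually_elim
          case (elim \<xi>)
          have "(\<lambda>n. (1 - gauss_bump \<xi>) ^ n) \<longlonglongrightarrow> 0"
            using gauss_bump_bounds(1,2)[of \<xi>] gauss_bump_bounds(3)[OF elim] by (intro LIMSEQ_realpow_zero) simp_all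
          then have "(\<lambda>n. complex_of_real (1 - (1 - gauss_bump \<xi>) ^ n) * \<phi> \<xi>) \<longlonglongrightarrow> complex_of_real (1 - 0) * \<phi> \<xi>"
            by (intro tendsto_mult tendsto_of_real tendsto_diff tendsto_const)
          then show ?case unfolding \<phi>n_def by simp
        qed
        show "norm (\<phi>n n \<xi>) \<le> norm (\<phi> \<xi>)" for n \<xi>
        proof -
          have "0 \<le> (1 - gauss_bump \<xi>) ^ n" "(1 - gauss_bump \<xi>) ^ n \<le> 1"
            using gauss_bump_bounds[of \<xi>] by (auto intro: power_le_one)
          then have "\<bar>1 - (1 - gauss_bump \<xi>) ^ n\<bar> \<le> 1" by simp
          then show ?thesis unfolding \<phi>n_def norm_mult norm_of_real by (simp add: mult_left_le_one_le)
        qed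
        \<comment> \<open>The constant is Cauchy-Schwarz with the uniform bound \<open>Q\<close>;
          the real value is legitimate since the product is finite.\<close>
        show "(LINT \<xi>|lborel. norm (?F \<tau> \<xi> * \<phi> \<xi>)) \<le> sqrt (enn2real (Q * sqint lborel \<phi>))" if \<tau>: "\<tau> \<in> {0..t}" for \<tau>
        proof -
          let ?L = "LINT \<xi>|lborel. norm (?F \<tau> \<xi> * \<phi> \<xi>)"
          have fin: "Q * sqint lborel \<phi> < \<top>" using Q sf by (simp add: ennreal_mult_less_top)
          have "ennreal ?L = (\<integral>\<^sup>+\<xi>. ennreal (norm (?F \<tau> \<xi>) * norm (\<phi> \<xi>)) \<partial>lborel)"
            using nn_integral_eq_integral[OF integrable_norm[OF Fi[OF \<tau>]]] by (simp add: norm_mult)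
          then have "(ennreal ?L)\<^sup>2 \<le> sqint lborel (?F \<tau>) * sqint lborel \<phi>"
            using nn_integral_mult_sqint[of "?F \<tau>" lborel \<phi>] Fm[OF \<tau>] by simp
          also have "\<dots> \<le> Q * sqint lborel \<phi>" by (intro mult_right_mono Fb[OF \<tau>]) simp
          also have "\<dots> = ennreal (enn2real (Q * sqint lborel \<phi>))" using fin by simp
          finally have "ennreal (?L\<^sup>2) \<le> ennreal (enn2real (Q * sqint lborel \<phi>))" by (simp add: ennreal_power)
          then have "?L\<^sup>2 \<le> enn2real (Q * sqint lborel \<phi>)" by (subst (asm) ennreal_le_iff) auto
          then show ?thesis by (rule real_le_rsqrt)
        qed
        \<comment> \<open>No size estimate of \<open>J\<close> is used: by the equation,
          \<open>I\<close> is the transform of \<open>M t\<close> minus the damped transform of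
          \<open>M 0\<close>, and both can be paired with \<open>\<phi>\<close>.\<close>
        show "integrable lborel (\<lambda>\<xi>. I \<xi> $ i $ j * \<phi> \<xi>)"
        proof -
          have g: "integrable lborel (\<lambda>\<xi>. mft (M s) \<xi> $ i $ j * \<phi> \<xi>)" if "s \<in> time_interval T" for s
            using MF[OF that] \<phi> unfolding mhas_ft_def has_ft_def by blast
          have h: "integrable lborel (\<lambda>\<xi>. heat t (mft (M 0)) \<xi> $ i $ j * \<phi> \<xi>)"
          proof (rule Bochner_Integration.integrable_bound[OF g[OF t0(1)]])
            show "(\<lambda>\<xi>. heat t (mft (M 0)) \<xi> $ i $ j * \<phi> \<xi>) \<in> borel_measurable lborel"
              unfolding heat_eq vector_scaleR_component by measurable
            show "AE \<xi> in lborel. norm (heat t (mft (M 0)) \<xi> $ i $ j * \<phi> \<xi>) \<le> norm (mft (M 0) \<xi> $ i $ j * \<phi> \<xi>)"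
              unfolding heat_eq vector_scaleR_component using t(1)
              by (intro AE_I2) (simp add: norm_mult mult_left_le_one_le)
          qed
          show ?thesis
          proof (rule integrable_cong_AE_imp[OF Bochner_Integration.integrable_diff[OF g[OF t0(2)] h]])
            show "AE \<xi> in lborel. mft (M t) \<xi> $ i $ j * \<phi> \<xi> - heat t (mft (M 0)) \<xi> $ i $ j * \<phi> \<xi> = I \<xi> $ i $ j * \<phi> \<xi>"
              using IG by eventually_elim (simp add: algebra_simps)
          qed measurable
        qed
      qed
    qed
    moreover have "mhas_ft (M t) (\<lambda>\<xi>. heat t (mft (M 0)) \<xi> + I \<xi>)"
    proof (rule mhas_ft_cong_AE[OF MF[OF t0(2)] IG])
      show "(\<lambda>\<xi>. (heat t (mft (M 0)) \<xi> + I \<xi>) $ i $ j) \<in> borel_measurable borel" for i j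
        unfolding heat_eq vector_add_component vector_scaleR_component by measurable
    qed
    ultimately show ?thesis by blast
  qed
  then show ?thesis unfolding mild_potential_def using MC by blast
qed

text \<open>A corresponding field is determined at each time only up to a null set. Each direction
  therefore asserts that a partner exists and that every partner is a solution, next to the
  equivalence for given pairs.\<close>

theorem proposition4p5:
  fixes T :: ereal
  assumes "0 < T"
  shows
    "(\<forall>(u :: real \<Rightarrow> real^3 \<Rightarrow> real^3) (M :: real \<Rightarrow> real^3 \<Rightarrow> real^3^3).
        (\<forall>t\<in>time_interval T. is_velocity_of (u t) (M t) \<and> is_potential_of (M t) (u t)) \<longrightarrow>
        (mild_potential T M \<longleftrightarrow> mild_NS T u)) \<and>
     (\<forall>M :: real \<Rightarrow> real^3 \<Rightarrow> real^3^3. mild_potential T M \<longrightarrow>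
        (\<exists>u. \<forall>t\<in>time_interval T. is_velocity_of (u t) (M t)) \<and>
        (\<forall>u. (\<forall>t\<in>time_interval T. is_velocity_of (u t) (M t)) \<longrightarrow> mild_NS T u)) \<and>
     (\<forall>u :: real \<Rightarrow> real^3 \<Rightarrow> real^3. mild_NS T u \<longrightarrow>
        (\<exists>M. \<forall>t\<in>time_interval T. is_potential_of (M t) (u t)) \<and>
        (\<forall>M. (\<forall>t\<in>time_interval T. is_potential_of (M t) (u t)) \<longrightarrow> mild_potential T M))"
proof (intro conjI allI impI)
  fix u :: "real \<Rightarrow> real^3 \<Rightarrow> real^3" and M :: "real \<Rightarrow> real^3 \<Rightarrow> real^3^3"
  assume "\<forall>t\<in>time_interval T. is_velocity_of (u t) (M t) \<and> is_potential_of (M t) (u t)"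
  then show "mild_potential T M \<longleftrightarrow> mild_NS T u"
    using mild_NS_of_mild_potential mild_potential_of_mild_NS by blast
next
  fix M :: "real \<Rightarrow> real^3 \<Rightarrow> real^3^3" assume "mild_potential T M"
  then have "\<forall>t\<in>time_interval T. \<exists>u. is_velocity_of u (M t)"
    using velocity_exists unfolding mild_potential_def C_Hdot12_st_def by blast
  \<comment> \<open>The velocities are chosen time by time; continuity in time comes afterwards from
    the norm comparison, whatever the choice.\<close>
  then show "\<exists>u. \<forall>t\<in>time_interval T. is_velocity_of (u t) (M t)" by (rule bchoice)
next
  fix u :: "real \<Rightarrow> real^3 \<Rightarrow> real^3" assume "mild_NS T u"
  then have "\<forall>t\<in>time_interval T. \<exists>M. is_potential_of M (u t)"
    using potential_exists unfolding mild_NS_def C_H1_df_def by blast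
  then show "\<exists>M. \<forall>t\<in>time_interval T. is_potential_of (M t) (u t)" by (rule bchoice)
qed (use mild_NS_of_mild_potential mild_potential_of_mild_NS in blast)+

end
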